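(* Let $l=2h+1\geq3$ be an odd number and $q$ a primitive $l$-th root of unity. The (projective) $\mathrm{SL}(2,\mathbb{Z})$-representation on the center $Z$ of $U_qsl(2)$ decomposes as $$Z=\mathcal{P}_{h+1}\oplus \mathbb{C}^2\otimes\mathcal{V}_h,$$ where $\mathcal{P}_{h+1}$ is an $(h+1)$-dimensional representation, $\mathbb{C}^2$ is the standard representation of $\mathrm{SL}(2,\mathbb{Z})$, and $\mathcal{V}_h$ is an $h$-dimensional representation on which the matrices of $S_{LM}$ and $T_{LM}$ are (up to scalars) the same as those obtained from the Reshetikhin–Turaev TQFT, namely $S_{semi}=([jr])_{1\le j,r\le h}$ and $T_{semi}=\mathrm{diag}\big((-1)^{r+1}q^{\frac12(r^2-1)}\big)_{1\le r\le h}$.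
   Context: Put $[n]=\frac{q^n-q^{-n}}{q-q^{-1}}$; $q^{1/2}$ is the square root of $q$ with $(q^{1/2})^l=-1$, so $(-1)^{r+1}q^{\frac12(r^2-1)}=q^{\frac12(r+1)(2h+r)}$. $H=U_qsl(2)$ is the $l^3$-dimensional complex Hopf algebra generated by $E,F,K$ with $E^l=F^l=0$, $K^l=1$, $KE=q^2EK$, $KF=q^{-2}FK$, $[E,F]=\frac{K-K^{-1}}{q-q^{-1}}$, $\Delta(E)=1\otimes E+E\otimes K$, $\Delta(F)=K^{-1}\otimes F+F\otimes 1$, $\Delta(K)=K\otimes K$, $\epsilon(E)=\epsilon(F)=0$, $\epsilon(K)=1$, $S(E)=-EK^{-1}$, $S(F)=-KF$, $S(K)=K^{-1}$. It is a factorizable ribbon Hopf algebra with $R=\frac{1}{l}\sum_{0\leq m,i,j\leq l-1}\frac{(q-q^{-1})^m}{[m]!}q^{\frac{m(m-1)}{2}+2m(i-j)-2ij}E^mK^i\otimes F^mK^j$ and ribbon element $\theta$ (convention: $\theta$ central, $\Delta(\theta)=(R_{21}R)^{-1}(\theta\otimes\theta)$, $\epsilon(\theta)=1$, $S(\theta)=\theta$). Its integral is $\Lambda=\zeta F^{l-1}E^{l-1}\sum_{j=0}^{l-1}K^j$ with $\zeta=\frac{\sqrt l}{([l-1]!)^2}$. Let $\mathrm{qCh}(H)=\{\beta\in H^*:\beta(xy)=\beta(S^2(y)x)\}$. The Drinfeld map $\chi(\beta)=(\beta\otimes\mathrm{id})(R_{21}R)$ is an isomorphism $\mathrm{qCh}(H)\to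 Z$; the Radford map is $\phi(\beta)=(\beta\otimes\mathrm{id})\Delta(\Lambda)$. The projective representation of $\mathrm{SL}(2,\mathbb{Z})$ on $Z$ is $s=\begin{pmatrix}0&-1\\1&0\end{pmatrix}\mapsto S_{LM}$, $t=\begin{pmatrix}1&1\\0&1\end{pmatrix}\mapsto T_{LM}$, with $S_{LM}(a)=\phi(\chi^{-1}(a))$ and $T_{LM}(a)=\kappa\,S_{LM}^{-1}(\theta^{-1}S_{LM}(a))$, $\kappa$ a nonzero constant. For $1\le r\le l$, $V_r$ is the $r$-dimensional irreducible module with basis $v_0,\dots,v_{r-1}$, $Kv_n=q^{r-1-2n}v_n$, $Ev_n=[n][r-n]v_{n-1}$, $Fv_n=v_{n+1}$ (with $v_{-1}=v_r=0$), and $\mathrm{qCh}_{V}=\mathrm{Tr}_{V}(K^{-1}\,\cdot\,)$. The subspace $\mathcal{P}_{h+1}\subset Z$ is the intersection of $\mathrm{span}\{\chi(\mathrm{qCh}_{V_r})\}_{r=1}^{l}$ and $\mathrm{span}\{\phi(\mathrm{qCh}_{V_r})\}_{r=1}^{l}$. The decomposition is into invariant subspaces and identifications are of projective representations. *)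

theory Defs
  imports Complex_Main "Jordan_Normal_Form.Matrix" "Jordan_Normal_Form.Determinant"
begin

section \<open>Complex vector spaces and unital algebras\<close>

class complex_vector = ab_group_add +
  fixes scaleC :: "complex \<Rightarrow> 'a \<Rightarrow> 'a" (infixr \<open>*\<^sub>C\<close> 75)
  assumes scaleC_add_right: "c *\<^sub>C (x + y) = c *\<^sub>C x + c *\<^sub>C y"
    and scaleC_add_left: "(c + d) *\<^sub>C x = c *\<^sub>C x + d *\<^sub>C x"
    and scaleC_scaleC: "c *\<^sub>C d *\<^sub>C x = (c * d) *\<^sub>C x"
    and scaleC_one: "1 *\<^sub>C x = x"

class complex_algebra_1 = complex_vector + ring_1 +
  assumes mult_scaleC_left: "(c *\<^sub>C x) * y = c *\<^sub>C (x * y)"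
    and mult_scaleC_right: "x * (c *\<^sub>C y) = c *\<^sub>C (x * y)"

instantiation complex :: complex_algebra_1
begin

definition scaleC_complex_def [simp]: "scaleC c (x :: complex) = c * x"

instance
  by standard (simp_all add: algebra_simps)

end

global_interpretation complex_vector:
  vector_space "scaleC :: complex \<Rightarrow> 'a \<Rightarrow> 'a :: complex_vector"
  by unfold_locales
    (simp_all add: scaleC_add_right scaleC_add_left scaleC_scaleC scaleC_one)

global_interpretation complex_vector: vector_space_pair
  "scaleC :: complex \<Rightarrow> 'a \<Rightarrow> 'a :: complex_vector"
  "scaleC :: complex \<Rightarrow> 'b \<Rightarrow> 'b :: complex_vector"
  by unfold_locales

abbreviation clinear :: "('a::complex_vector \<Rightarrow> 'b::complex_vector) \<Rightarrow> bool"
  where "clinear \<equiv> Vector_Spaces.linear scaleC scaleC"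

lemma clinear_iff:
  fixes f :: "'a::complex_vector \<Rightarrow> 'b::complex_vector"
  shows "clinear f \<longleftrightarrow> (\<forall>x y. f (x + y) = f x + f y) \<and> (\<forall>c x. f (c *\<^sub>C x) = c *\<^sub>C f x)"
  by (simp add: Vector_Spaces.linear_iff complex_vector.vector_space_axioms)

lemma clinearI:
  fixes f :: "'a::complex_vector \<Rightarrow> 'b::complex_vector"
  shows "(\<And>x y. f (x + y) = f x + f y) \<Longrightarrow> (\<And>c x. f (c *\<^sub>C x) = c *\<^sub>C f x) \<Longrightarrow> clinear f"
  by (simp add: clinear_iff)

lemma separating_functional:
  fixes x :: "'a::complex_vector"
  assumes "x \<noteq> 0"
  obtains \<phi> :: "'a \<Rightarrow> complex" where "clinear \<phi>" "\<phi> x = 1"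
proof -
  have "\<not> complex_vector.dependent {x}"
    using assms complex_vector.dependent_single by blast
  from complex_vector.linear_independent_extend[OF this, of "\<lambda>_. 1 :: complex"]
  show thesis using that by auto
qed

definition calgebra_hom :: "('a::complex_algebra_1 \<Rightarrow> 'b::complex_algebra_1) \<Rightarrow> bool"
  where "calgebra_hom f \<longleftrightarrow> clinear f \<and> f 1 = 1 \<and> (\<forall>x y. f (x * y) = f x * f y)"

definition subalgebra :: "'a::complex_algebra_1 set \<Rightarrow> bool"
  where "subalgebra A \<longleftrightarrow>
    complex_vector.subspace A \<and> 1 \<in> A \<and> (\<forall>x\<in>A. \<forall>y\<in>A. x * y \<in> A)"

text \<open>The inverse of a unit of a ring; unspecified on non-units.\<close>

definition ring_inv :: "'a::ring_1 \<Rightarrow> 'a"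
  where "ring_inv x = (THE y. x * y = 1 \<and> y * x = 1)"

definition center :: "'a::ring_1 set"
  where "center = {z. \<forall>x. z * x = x * z}"


section \<open>Tensor products\<close>

definition cbilinear ::
    "('a::complex_vector \<Rightarrow> 'b::complex_vector \<Rightarrow> 'c::complex_vector) \<Rightarrow> bool"
  where "cbilinear f \<longleftrightarrow> (\<forall>a. clinear (f a)) \<and> (\<forall>b. clinear (\<lambda>a. f a b))"

text \<open>
  An element \<open>\<Sum> a\<^sub>i \<otimes> b\<^sub>i\<close> of the tensor product is represented by the functional
  \<open>f \<mapsto> \<Sum> f a\<^sub>i b\<^sub>i\<close> on bilinear forms. As bilinear forms separate the elements of a
  tensor product of vector spaces, this is the usual tensor product; its universal property
  is proved below (\<open>tensor_universal\<close>).
\<close>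

definition tensor_functional ::
    "('a::complex_vector \<times> 'b::complex_vector) list \<Rightarrow> ('a \<Rightarrow> 'b \<Rightarrow> complex) \<Rightarrow> complex"
  where "tensor_functional xs =
    (\<lambda>f. if cbilinear f then \<Sum>(a, b)\<leftarrow>xs. f a b else 0)"

typedef (overloaded) ('a::complex_vector, 'b::complex_vector) tensor =
  "range (tensor_functional :: ('a \<times> 'b) list \<Rightarrow> _)"
  by blast

setup_lifting type_definition_tensor

lift_definition pure_tensor :: "'a::complex_vector \<Rightarrow> 'b::complex_vector \<Rightarrow> ('a, 'b) tensor"
    (infixr \<open>\<boxtimes>\<close> 72)
  is "\<lambda>a b. tensor_functional [(a, b)]"
  by blast

lemma cbilinear_simps:
  assumes "cbilinear f"
  shows "f (a + a') b = f a b + f a' b" "f a (b + b') = f a b + f a b'"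
    "f (c *\<^sub>C a) b = c *\<^sub>C f a b" "f a (c *\<^sub>C b) = c *\<^sub>C f a b"
    "f (- a) b = - f a b" "f a (- b) = - f a b" "f 0 b = 0" "f a 0 = 0"
proof -
  have l: "clinear (f a)" "clinear (\<lambda>a. f a b)" for a b
    using assms by (auto simp: cbilinear_def)
  show "f (a + a') b = f a b + f a' b" "f a (b + b') = f a b + f a b'"
    "f (c *\<^sub>C a) b = c *\<^sub>C f a b" "f a (c *\<^sub>C b) = c *\<^sub>C f a b"
    using l unfolding clinear_iff by auto
  show "f (- a) b = - f a b" "f a (- b) = - f a b" "f 0 b = 0" "f a 0 = 0"
    using complex_vector.linear_neg[OF l(1)] complex_vector.linear_neg[OF l(2)]
      complex_vector.linear_0[OF l(1)] complex_vector.linear_0[OF l(2)] by auto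
qed

lemma cbilinearI:
  assumes "\<And>a a' b. f (a + a') b = f a b + f a' b" "\<And>a b b'. f a (b + b') = f a b + f a b'"
    "\<And>c a b. f (c *\<^sub>C a) b = c *\<^sub>C f a b" "\<And>c a b. f a (c *\<^sub>C b) = c *\<^sub>C f a b"
  shows "cbilinear f"
  using assms by (auto simp: cbilinear_def clinear_iff)

instantiation tensor :: (complex_vector, complex_vector) complex_vector
begin

lift_definition zero_tensor :: "('a, 'b) tensor" is "\<lambda>_. 0"
  by (rule range_eqI[of _ _ "[]"]) (auto simp: tensor_functional_def)

lift_definition plus_tensor :: "('a, 'b) tensor \<Rightarrow> ('a, 'b) tensor \<Rightarrow> ('a, 'b) tensor"
  is "\<lambda>s t f. s f + t f"
proof -
  fix s t :: "('a \<Rightarrow> 'b \<Rightarrow> complex) \<Rightarrow> complex"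
  assume "s \<in> range tensor_functional" "t \<in> range tensor_functional"
  then obtain xs ys where "s = tensor_functional xs" "t = tensor_functional ys" by blast
  then have "(\<lambda>f. s f + t f) = tensor_functional (xs @ ys)"
    by (auto simp: tensor_functional_def)
  then show "(\<lambda>f. s f + t f) \<in> range tensor_functional" by blast
qed

lift_definition scaleC_tensor :: "complex \<Rightarrow> ('a, 'b) tensor \<Rightarrow> ('a, 'b) tensor"
  is "\<lambda>c t f. c * t f"
proof -
  fix c :: complex and t :: "('a \<Rightarrow> 'b \<Rightarrow> complex) \<Rightarrow> complex"
  assume "t \<in> range tensor_functional"
  then obtain xs where t: "t = tensor_functional xs" by blast
  have "c * (\<Sum>(a, b)\<leftarrow>xs. f a b) = (\<Sum>(a, b)\<leftarrow>map (\<lambda>(a, b). (c *\<^sub>C a, b)) xs. f a b)"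
    if "cbilinear f" for f :: "'a \<Rightarrow> 'b \<Rightarrow> complex"
    by (induction xs) (auto simp: algebra_simps cbilinear_simps[OF that])
  then have "(\<lambda>f. c * t f) = tensor_functional (map (\<lambda>(a, b). (c *\<^sub>C a, b)) xs)"
    by (auto simp: t tensor_functional_def)
  then show "(\<lambda>f. c * t f) \<in> range tensor_functional" by blast
qed

definition uminus_tensor :: "('a, 'b) tensor \<Rightarrow> ('a, 'b) tensor"
  where "uminus_tensor t = (-1) *\<^sub>C t"

definition minus_tensor :: "('a, 'b) tensor \<Rightarrow> ('a, 'b) tensor \<Rightarrow> ('a, 'b) tensor"
  where "minus_tensor s t = s + (- t)"

instance
proof
  fix a b c :: "('a, 'b) tensor" and x y :: complex
  show "a + b + c = a + (b + c)" by transfer (auto simp: algebra_simps)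
  show "a + b = b + a" by transfer (auto simp: algebra_simps)
  show "0 + a = a" by transfer auto
  show "- a + a = 0" unfolding uminus_tensor_def by transfer auto
  show "a - b = a + - b" by (rule minus_tensor_def)
  show "x *\<^sub>C (a + b) = x *\<^sub>C a + x *\<^sub>C b" by transfer (auto simp: algebra_simps)
  show "(x + y) *\<^sub>C a = x *\<^sub>C a + y *\<^sub>C a" by transfer (auto simp: algebra_simps)
  show "x *\<^sub>C y *\<^sub>C a = (x * y) *\<^sub>C a" by transfer (auto simp: algebra_simps)
  show "1 *\<^sub>C a = a" by transfer auto
qed

end

lemma cbilinear_pure_tensor: "cbilinear (\<boxtimes>)"
proof (rule cbilinearI)
  fix a a' :: 'a and b b' :: 'b and c
  show "(a + a') \<boxtimes> b = a \<boxtimes> b + a' \<boxtimes> b" "a \<boxtimes> (b + b') = a \<boxtimes> b + a \<boxtimes> b'"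
    "(c *\<^sub>C a) \<boxtimes> b = c *\<^sub>C (a \<boxtimes> b)" "a \<boxtimes> (c *\<^sub>C b) = c *\<^sub>C (a \<boxtimes> b)"
    by (transfer, auto simp: tensor_functional_def cbilinear_simps)+
qed

lemmas pure_tensor_simps = cbilinear_simps[OF cbilinear_pure_tensor]

lemma tensor_functional_Cons:
  "Abs_tensor (tensor_functional (x # xs)) =
    fst x \<boxtimes> snd x + Abs_tensor (tensor_functional xs)"
  by (rule Rep_tensor_inject[THEN iffD1])
    (auto simp: plus_tensor.rep_eq pure_tensor.rep_eq Abs_tensor_inverse tensor_functional_def
      split: prod.splits)

lemma Abs_tensor_functional:
  "Abs_tensor (tensor_functional xs) = (\<Sum>(a, b)\<leftarrow>xs. a \<boxtimes> b)"
proof (induction xs)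
  case Nil
  show ?case
    by (rule Rep_tensor_inject[THEN iffD1])
      (auto simp: zero_tensor.rep_eq Abs_tensor_inverse tensor_functional_def)
qed (auto simp: tensor_functional_Cons)

lemma tensor_sum_list:
  obtains xs where "t = (\<Sum>(a, b)\<leftarrow>xs. a \<boxtimes> b)"
  using Abs_tensor_functional Abs_tensor_cases[of t] by (metis imageE)

lemma tensor_induct [case_names zero pure add, induct type: tensor]:
  assumes "P 0" "\<And>a b. P (a \<boxtimes> b)" "\<And>s t. P s \<Longrightarrow> P t \<Longrightarrow> P (s + t)"
  shows "P t"
proof -
  obtain xs where t: "t = (\<Sum>(a, b)\<leftarrow>xs. a \<boxtimes> b)" by (rule tensor_sum_list)
  show ?thesis unfolding t by (induction xs) (auto simp: assms)
qed

lemma clinear_eq_on_pure: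
  assumes "clinear g" "clinear g'" "\<And>a b. g (a \<boxtimes> b) = g' (a \<boxtimes> b)"
  shows "g t = g' t"
proof (induction t)
  case zero
  show ?case
    using complex_vector.linear_0[OF assms(1)] complex_vector.linear_0[OF assms(2)] by simp
qed (use assms in \<open>auto simp: clinear_iff\<close>)

lemma Rep_tensor_sum_list:
  "cbilinear f \<Longrightarrow> Rep_tensor (\<Sum>(a, b)\<leftarrow>xs. a \<boxtimes> b) f = (\<Sum>(a, b)\<leftarrow>xs. f a b)"
  by (simp add: Abs_tensor_functional[symmetric] Abs_tensor_inverse tensor_functional_def)

lemma tensor_lift_well_defined:
  fixes f :: "'a::complex_vector \<Rightarrow> 'b::complex_vector \<Rightarrow> 'c::complex_vector"
  assumes f: "cbilinear f"
    and eq: "(\<Sum>(a, b)\<leftarrow>xs. a \<boxtimes> b) = (\<Sum>(a, b)\<leftarrow>ys. a \<boxtimes> b)"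
  shows "(\<Sum>(a, b)\<leftarrow>xs. f a b) = (\<Sum>(a, b)\<leftarrow>ys. f a b)"
proof (rule ccontr)
  assume "\<not> ?thesis"
  then have "(\<Sum>(a, b)\<leftarrow>xs. f a b) - (\<Sum>(a, b)\<leftarrow>ys. f a b) \<noteq> 0" by simp
  then obtain \<phi> :: "'c \<Rightarrow> complex" where \<phi>: "clinear \<phi>"
    and ne: "\<phi> ((\<Sum>(a, b)\<leftarrow>xs. f a b) - (\<Sum>(a, b)\<leftarrow>ys. f a b)) = 1"
    by (rule separating_functional)
  have bil: "cbilinear (\<lambda>a b. \<phi> (f a b))"
    using \<phi> by (intro cbilinearI) (auto simp: clinear_iff cbilinear_simps[OF f])
  have "\<phi> (\<Sum>(a, b)\<leftarrow>zs. f a b) = (\<Sum>(a, b)\<leftarrow>zs. \<phi> (f a b))" for zs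
    using \<phi> by (induction zs) (auto simp: clinear_iff complex_vector.linear_0[OF \<phi>])
  then have "\<phi> (\<Sum>(a, b)\<leftarrow>zs. f a b) = Rep_tensor (\<Sum>(a, b)\<leftarrow>zs. a \<boxtimes> b) (\<lambda>a b. \<phi> (f a b))" for zs
    using Rep_tensor_sum_list[OF bil] by simp
  then have "\<phi> (\<Sum>(a, b)\<leftarrow>xs. f a b) = \<phi> (\<Sum>(a, b)\<leftarrow>ys. f a b)"
    using eq by simp
  then show False
    using ne complex_vector.linear_diff[OF \<phi>] by simp
qed

theorem tensor_universal:
  fixes f :: "'a::complex_vector \<Rightarrow> 'b::complex_vector \<Rightarrow> 'c::complex_vector"
  assumes "cbilinear f"
  shows "\<exists>!g. clinear g \<and> (\<forall>a b. g (a \<boxtimes> b) = f a b)"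
proof (rule ex_ex1I)
  define r :: "('a, 'b) tensor \<Rightarrow> ('a \<times> 'b) list"
    where "r t = (SOME xs. t = (\<Sum>(a, b)\<leftarrow>xs. a \<boxtimes> b))" for t
  define g where "g t = (\<Sum>(a, b)\<leftarrow>r t. f a b)" for t
  have r: "(\<Sum>(a, b)\<leftarrow>r t. a \<boxtimes> b) = t" for t
    unfolding r_def by (rule someI2_ex) (use tensor_sum_list[of t] in auto)
  have g: "g (\<Sum>(a, b)\<leftarrow>xs. a \<boxtimes> b) = (\<Sum>(a, b)\<leftarrow>xs. f a b)" for xs
    unfolding g_def by (rule tensor_lift_well_defined[OF assms]) (rule r)
  have pure: "g (a \<boxtimes> b) = f a b" for a b
    using g[of "[(a, b)]"] by simp
  have add: "g (s + t) = g s + g t" for s t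
    using g[of "r s @ r t"] g[of "r s"] g[of "r t"] by (simp add: r)
  have g0: "g 0 = 0" using g[of "[]"] by simp
  have scale: "g (c *\<^sub>C t) = c *\<^sub>C g t" for c t
  proof (induction t)
    case (pure a b)
    have "g (c *\<^sub>C (a \<boxtimes> b)) = g ((c *\<^sub>C a) \<boxtimes> b)" by (simp only: pure_tensor_simps)
    then show ?case by (simp add: \<open>\<And>a b. g (a \<boxtimes> b) = f a b\<close> cbilinear_simps[OF assms])
  qed (simp_all add: g0 scaleC_add_right add)
  show "\<exists>g. clinear g \<and> (\<forall>a b. g (a \<boxtimes> b) = f a b)"
    by (rule exI[of _ g]) (simp add: clinear_iff pure add scale)
next
  fix g g' assume g: "clinear g \<and> (\<forall>a b. g (a \<boxtimes> b) = f a b)"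
    and g': "clinear g' \<and> (\<forall>a b. g' (a \<boxtimes> b) = f a b)"
  show "g = g'"
    by (rule ext, rule clinear_eq_on_pure) (simp_all add: g g')
qed

text \<open>The linear map induced by a bilinear map.\<close>

definition tensor_lift ::
    "('a::complex_vector \<Rightarrow> 'b::complex_vector \<Rightarrow> 'c::complex_vector) \<Rightarrow> ('a, 'b) tensor \<Rightarrow> 'c"
  where "tensor_lift f = (THE g. clinear g \<and> (\<forall>a b. g (a \<boxtimes> b) = f a b))"

lemma
  assumes "cbilinear f"
  shows clinear_tensor_lift: "clinear (tensor_lift f)"
    and tensor_lift_pure: "tensor_lift f (a \<boxtimes> b) = f a b"
  using theI'[OF tensor_universal[OF assms]] unfolding tensor_lift_def by blast+

lemma
  assumes "cbilinear f"
  shows tensor_lift_add: "tensor_lift f (s + t) = tensor_lift f s + tensor_lift f t"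
    and tensor_lift_scale: "tensor_lift f (c *\<^sub>C t) = c *\<^sub>C tensor_lift f t"
    and tensor_lift_0: "tensor_lift f 0 = 0"
  using clinear_tensor_lift[OF assms] complex_vector.linear_0[OF clinear_tensor_lift[OF assms]]
  unfolding clinear_iff by blast+

instantiation tensor :: (complex_algebra_1, complex_algebra_1) complex_algebra_1
begin

definition one_tensor :: "('a, 'b) tensor"
  where "one_tensor = 1 \<boxtimes> 1"

definition times_tensor :: "('a, 'b) tensor \<Rightarrow> ('a, 'b) tensor \<Rightarrow> ('a, 'b) tensor"
  where "times_tensor s t =
    tensor_lift (\<lambda>a b. tensor_lift (\<lambda>c d. (a * c) \<boxtimes> (b * d)) t) s"

lemma bilinear_times_tensor_aux:
  "cbilinear (\<lambda>c d. (a * c) \<boxtimes> (b * d) :: ('a, 'b) tensor)"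
  by (rule cbilinearI) (simp_all add: algebra_simps pure_tensor_simps mult_scaleC_right)

lemma tensor_lift_aux_pure:
  "tensor_lift (\<lambda>c d. (a * c) \<boxtimes> (b * d)) (c' \<boxtimes> d') = ((a * c') \<boxtimes> (b * d') :: ('a, 'b) tensor)"
  by (rule tensor_lift_pure[OF bilinear_times_tensor_aux])

lemma tensor_lift_times_aux:
  fixes t :: "('a, 'b) tensor"
  shows "cbilinear (\<lambda>a b. tensor_lift (\<lambda>c d. (a * c) \<boxtimes> (b * d)) t :: ('a, 'b) tensor)"
proof (induction t)
  case zero
  show ?case
    by (rule cbilinearI) (simp_all add: tensor_lift_0[OF bilinear_times_tensor_aux])
next
  case (pure c d)
  show ?case
    unfolding tensor_lift_aux_pure
    by (rule cbilinearI) (simp_all add: distrib_right pure_tensor_simps mult_scaleC_left)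
next
  case (add s t)
  show ?case
    by (rule cbilinearI)
      (simp_all add: tensor_lift_add[OF bilinear_times_tensor_aux] cbilinear_simps[OF add(1)]
        cbilinear_simps[OF add(2)] scaleC_add_right add_ac)
qed

lemma pure_tensor_times:
  fixes t :: "('a, 'b) tensor"
  shows "(a \<boxtimes> b) * t = tensor_lift (\<lambda>c d. (a * c) \<boxtimes> (b * d)) t"
  unfolding times_tensor_def by (rule tensor_lift_pure[OF tensor_lift_times_aux])

lemma times_pure_tensor: "(a \<boxtimes> b) * (c \<boxtimes> d) = ((a * c) \<boxtimes> (b * d) :: ('a, 'b) tensor)"
  unfolding pure_tensor_times by (rule tensor_lift_aux_pure)

lemma bilinear_times_tensor: "cbilinear ((*) :: ('a, 'b) tensor \<Rightarrow> _)"
proof (rule cbilinearI)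
  fix r s t :: "('a, 'b) tensor" and c
  show "(r + s) * t = r * t + s * t" "(c *\<^sub>C r) * t = c *\<^sub>C (r * t)"
    unfolding times_tensor_def
    by (simp_all add: tensor_lift_add tensor_lift_scale tensor_lift_times_aux)
  have "clinear (\<lambda>t. r * t)"
  proof (induction r)
    case zero
    show ?case
      by (rule clinearI) (simp_all add: times_tensor_def tensor_lift_0[OF tensor_lift_times_aux])
  next
    case (pure a b)
    show ?case
      unfolding pure_tensor_times by (rule clinear_tensor_lift[OF bilinear_times_tensor_aux])
  next
    case (add s t)
    have "(s + t) * u = s * u + t * u" for u
      by (simp add: times_tensor_def tensor_lift_add[OF tensor_lift_times_aux])
    with add show ?case by (auto simp: clinear_iff algebra_simps)
  qed
  then show "r * (s + t) = r * s + r * t" "r * (c *\<^sub>C s) = c *\<^sub>C (r * s)"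
    by (auto simp: clinear_iff)
qed

instance
proof
  fix r s t :: "('a, 'b) tensor" and c :: complex
  note bil = cbilinear_simps[OF bilinear_times_tensor]
  show "(c *\<^sub>C s) * t = c *\<^sub>C (s * t)" "s * (c *\<^sub>C t) = c *\<^sub>C (s * t)"
    "(r + s) * t = r * t + s * t" "r * (s + t) = r * s + r * t"
    by (simp_all only: bil)
  show "1 * t = t" "t * 1 = t"
    by (induction t) (simp_all add: bil one_tensor_def times_pure_tensor)
  show "r * s * t = r * (s * t)"
  proof (induction r)
    case (pure a b)
    show ?case
    proof (induction s)
      case (pure a' b')
      show ?case
        by (induction t) (simp_all add: bil times_pure_tensor mult.assoc)
    qed (simp_all add: bil)
  qed (simp_all add: bil)
  obtain \<phi> :: "'a \<Rightarrow> complex" where \<phi>: "clinear \<phi>" "\<phi> 1 = 1"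
    using separating_functional[of "1 :: 'a"] by auto
  obtain \<psi> :: "'b \<Rightarrow> complex" where \<psi>: "clinear \<psi>" "\<psi> 1 = 1"
    using separating_functional[of "1 :: 'b"] by auto
  have b: "cbilinear (\<lambda>a b. \<phi> a * \<psi> b)"
    using \<phi>(1) \<psi>(1) by (intro cbilinearI) (auto simp: clinear_iff algebra_simps)
  have "tensor_lift (\<lambda>a b. \<phi> a * \<psi> b) 1 = 1"
    by (simp add: one_tensor_def tensor_lift_pure[OF b] \<phi> \<psi>)
  then show "(0 :: ('a, 'b) tensor) \<noteq> 1"
    using tensor_lift_0[OF b] by force
qed

end

definition tensor_flip :: "('a::complex_vector, 'b::complex_vector) tensor \<Rightarrow> ('b, 'a) tensor"
  where "tensor_flip = tensor_lift (\<lambda>a b. b \<boxtimes> a)"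

text \<open>The map \<open>\<beta> \<otimes> id\<close>, with \<open>\<complex> \<otimes> B\<close> identified with \<open>B\<close>.\<close>

definition tensor_slice ::
    "('a::complex_vector \<Rightarrow> complex) \<Rightarrow> ('a, 'b::complex_vector) tensor \<Rightarrow> 'b"
  where "tensor_slice \<beta> = tensor_lift (\<lambda>a b. \<beta> a *\<^sub>C b)"


section \<open>Hopf algebras, quantum characters and the Lyubashenko--Majid operators\<close>

locale hopf_algebra =
  fixes \<Delta> :: "'a::complex_algebra_1 \<Rightarrow> ('a, 'a) tensor"
    and \<epsilon> :: "'a \<Rightarrow> complex"
    and S :: "'a \<Rightarrow> 'a"
  assumes comult_hom: "calgebra_hom \<Delta>"
    and counit_hom: "calgebra_hom \<epsilon>"
    and antipode_linear: "clinear S"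
    \<comment> \<open>Both sides are brought to the form \<open>x' \<otimes> (x'' \<otimes> x''')\<close>.\<close>
    and coassoc: "tensor_lift (\<lambda>a b. tensor_lift (\<lambda>a' a''. a' \<boxtimes> (a'' \<boxtimes> b)) (\<Delta> a)) (\<Delta> x) =
      tensor_lift (\<lambda>a b. a \<boxtimes> \<Delta> b) (\<Delta> x)"
    and counit_left: "tensor_lift (\<lambda>a b. \<epsilon> a *\<^sub>C b) (\<Delta> x) = x"
    and counit_right: "tensor_lift (\<lambda>a b. \<epsilon> b *\<^sub>C a) (\<Delta> x) = x"
    and antipode_left: "tensor_lift (\<lambda>a b. S a * b) (\<Delta> x) = \<epsilon> x *\<^sub>C 1"
    and antipode_right: "tensor_lift (\<lambda>a b. a * S b) (\<Delta> x) = \<epsilon> x *\<^sub>C 1"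

definition ribbon_element ::
    "('a::complex_algebra_1, 'a) tensor \<Rightarrow> ('a \<Rightarrow> ('a, 'a) tensor) \<Rightarrow> ('a \<Rightarrow> complex) \<Rightarrow>
      ('a \<Rightarrow> 'a) \<Rightarrow> 'a \<Rightarrow> bool"
  where "ribbon_element R \<Delta> \<epsilon> S \<theta> \<longleftrightarrow>
    \<theta> \<in> center \<and> \<Delta> \<theta> = ring_inv (tensor_flip R * R) * (\<theta> \<boxtimes> \<theta>) \<and> \<epsilon> \<theta> = 1 \<and> S \<theta> = \<theta>"

definition qCh :: "('a::complex_algebra_1 \<Rightarrow> 'a) \<Rightarrow> ('a \<Rightarrow> complex) set"
  where "qCh S = {\<beta>. clinear \<beta> \<and> (\<forall>x y. \<beta> (x * y) = \<beta> (S (S y) * x))}"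

definition drinfeld :: "('a::complex_algebra_1, 'a) tensor \<Rightarrow> ('a \<Rightarrow> complex) \<Rightarrow> 'a"
  where "drinfeld R \<beta> = tensor_slice \<beta> (tensor_flip R * R)"

definition radford ::
    "('a::complex_algebra_1 \<Rightarrow> ('a, 'a) tensor) \<Rightarrow> 'a \<Rightarrow> ('a \<Rightarrow> complex) \<Rightarrow> 'a"
  where "radford \<Delta> \<Lambda> \<beta> = tensor_slice \<beta> (\<Delta> \<Lambda>)"

definition S_LM ::
    "('a::complex_algebra_1, 'a) tensor \<Rightarrow> ('a \<Rightarrow> ('a, 'a) tensor) \<Rightarrow> ('a \<Rightarrow> 'a) \<Rightarrow>
      'a \<Rightarrow> 'a \<Rightarrow> 'a"
  where "S_LM R \<Delta> S \<Lambda> z = radford \<Delta> \<Lambda> (inv_into (qCh S) (drinfeld R) z)"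

definition T_LM ::
    "('a::complex_algebra_1, 'a) tensor \<Rightarrow> ('a \<Rightarrow> ('a, 'a) tensor) \<Rightarrow> ('a \<Rightarrow> 'a) \<Rightarrow>
      'a \<Rightarrow> 'a \<Rightarrow> complex \<Rightarrow> 'a \<Rightarrow> 'a"
  where "T_LM R \<Delta> S \<Lambda> \<theta> \<kappa> z =
    \<kappa> *\<^sub>C inv_into center (S_LM R \<Delta> S \<Lambda>) (ring_inv \<theta> * S_LM R \<Delta> S \<Lambda> z)"


section \<open>The restricted quantum group of sl(2) at a root of unity\<close>

definition qint :: "complex \<Rightarrow> nat \<Rightarrow> complex"
  where "qint q n = (q ^ n - inverse q ^ n) / (q - inverse q)"

definition qfact :: "complex \<Rightarrow> nat \<Rightarrow> complex"
  where "qfact q n = (\<Prod>k=1..n. qint q k)"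

text \<open>
  Throughout, \<open>K\<^sup>-\<^sup>1\<close> is written \<open>K ^ (l - 1)\<close>, since \<open>K ^ l = 1\<close>. The presentation together
  with the dimension \<open>l\<^sup>3\<close> determines the algebra up to isomorphism, and the values on the
  generators determine the Hopf structure.
\<close>

locale uqsl2 = hopf_algebra \<Delta> \<epsilon> S
  for l :: nat and q :: complex and E F K :: "'a::complex_algebra_1"
    and \<Delta> :: "'a \<Rightarrow> ('a, 'a) tensor" and \<epsilon> :: "'a \<Rightarrow> complex" and S :: "'a \<Rightarrow> 'a" +
  assumes generated: "subalgebra A \<Longrightarrow> E \<in> A \<Longrightarrow> F \<in> A \<Longrightarrow> K \<in> A \<Longrightarrow> A = UNIV"
    and dimension: "complex_vector.dim (UNIV :: 'a set) = l ^ 3"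
    and E_nilpotent: "E ^ l = 0" and F_nilpotent: "F ^ l = 0" and K_order: "K ^ l = 1"
    and K_E: "K * E = q\<^sup>2 *\<^sub>C (E * K)"
    and K_F: "K * F = inverse (q\<^sup>2) *\<^sub>C (F * K)"
    and E_F: "E * F - F * E = (1 / (q - inverse q)) *\<^sub>C (K - K ^ (l - 1))"
    and comult_E: "\<Delta> E = 1 \<boxtimes> E + E \<boxtimes> K"
    and comult_F: "\<Delta> F = K ^ (l - 1) \<boxtimes> F + F \<boxtimes> 1"
    and comult_K: "\<Delta> K = K \<boxtimes> K"
    and counit_E: "\<epsilon> E = 0" and counit_F: "\<epsilon> F = 0" and counit_K: "\<epsilon> K = 1"
    and antipode_E: "S E = - (E * K ^ (l - 1))"
    and antipode_F: "S F = - (K * F)"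
    and antipode_K: "S K = K ^ (l - 1)"

definition uqsl2_R ::
    "nat \<Rightarrow> complex \<Rightarrow> 'a::complex_algebra_1 \<Rightarrow> 'a \<Rightarrow> 'a \<Rightarrow> ('a, 'a) tensor"
  where "uqsl2_R l q E F K = (1 / of_nat l) *\<^sub>C
    (\<Sum>m<l. \<Sum>i<l. \<Sum>j<l.
      ((q - inverse q) ^ m / qfact q m *
        q powi (int (m * (m - 1) div 2) + 2 * int m * (int i - int j) - 2 * int i * int j)) *\<^sub>C
      ((E ^ m * K ^ i) \<boxtimes> (F ^ m * K ^ j)))"

definition uqsl2_integral ::
    "nat \<Rightarrow> complex \<Rightarrow> 'a::complex_algebra_1 \<Rightarrow> 'a \<Rightarrow> 'a \<Rightarrow> 'a"
  where "uqsl2_integral l q E F K =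
    (of_real (sqrt (of_nat l)) / (qfact q (l - 1))\<^sup>2) *\<^sub>C
      (F ^ (l - 1) * E ^ (l - 1) * (\<Sum>j<l. K ^ j))"

text \<open>
  Matrices of \<open>K\<close>, \<open>E\<close>, \<open>F\<close> on \<open>V\<^sub>r\<close> in the basis \<open>v\<^sub>0, \<dots>, v\<^sub>r\<^sub>-\<^sub>1\<close>; column \<open>n\<close> is the image
  of \<open>v\<^sub>n\<close>.
\<close>

definition uqsl2_irrep ::
    "complex \<Rightarrow> 'a::complex_algebra_1 \<Rightarrow> 'a \<Rightarrow> 'a \<Rightarrow> nat \<Rightarrow> ('a \<Rightarrow> complex mat) \<Rightarrow> bool"
  where "uqsl2_irrep q E F K r \<rho> \<longleftrightarrow>
    (\<forall>x. \<rho> x \<in> carrier_mat r r) \<and> \<rho> 1 = 1\<^sub>m r \<and>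
    (\<forall>x y. \<rho> (x + y) = \<rho> x + \<rho> y \<and> \<rho> (x * y) = \<rho> x * \<rho> y) \<and>
    (\<forall>c x. \<rho> (c *\<^sub>C x) = c \<cdot>\<^sub>m \<rho> x) \<and>
    \<rho> K = mat r r (\<lambda>(m, n). if m = n then q powi (int r - 1 - 2 * int n) else 0) \<and>
    \<rho> E = mat r r (\<lambda>(m, n). if Suc m = n then qint q n * qint q (r - n) else 0) \<and>
    \<rho> F = mat r r (\<lambda>(m, n). if m = Suc n then 1 else 0)"

text \<open>The quantum character \<open>x \<mapsto> Tr\<^sub>V (K\<^sup>-\<^sup>1 x)\<close>.\<close>

definition qCh_mod :: "nat \<Rightarrow> 'a::complex_algebra_1 \<Rightarrow> ('a \<Rightarrow> complex mat) \<Rightarrow> 'a \<Rightarrow> complex"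
  where "qCh_mod l K \<rho> x =
    (\<Sum>i<dim_row (\<rho> x). \<rho> (K ^ (l - 1) * x) $$ (i, i))"


section \<open>Projective representations of SL(2,Z)\<close>

definition SL2Z :: "int mat set"
  where "SL2Z = {g \<in> carrier_mat 2 2. det g = 1}"

definition s_mat :: "int mat" where "s_mat = mat_of_rows_list 2 [[0, -1], [1, 0]]"

definition t_mat :: "int mat" where "t_mat = mat_of_rows_list 2 [[1, 1], [0, 1]]"

definition projective_rep_on :: "'a::complex_vector set \<Rightarrow> (int mat \<Rightarrow> 'a \<Rightarrow> 'a) \<Rightarrow> bool"
  where "projective_rep_on W \<rho> \<longleftrightarrow>
    complex_vector.subspace W \<and>
    (\<forall>g\<in>SL2Z. bij_betw (\<rho> g) W W \<and>
      (\<forall>x\<in>W. \<forall>y\<in>W. \<rho> g (x + y) = \<rho> g x + \<rho> g y) \<and>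
      (\<forall>c. \<forall>x\<in>W. \<rho> g (c *\<^sub>C x) = c *\<^sub>C \<rho> g x)) \<and>
    (\<forall>g\<in>SL2Z. \<forall>g'\<in>SL2Z. \<exists>c. c \<noteq> 0 \<and> (\<forall>x\<in>W. \<rho> (g * g') x = c *\<^sub>C \<rho> g (\<rho> g' x)))"

definition projective_mat_rep :: "nat \<Rightarrow> (int mat \<Rightarrow> complex mat) \<Rightarrow> bool"
  where "projective_mat_rep n \<sigma> \<longleftrightarrow>
    (\<forall>g\<in>SL2Z. \<sigma> g \<in> carrier_mat n n \<and> invertible_mat (\<sigma> g)) \<and>
    (\<forall>g\<in>SL2Z. \<forall>g'\<in>SL2Z. \<exists>c. c \<noteq> 0 \<and> \<sigma> (g * g') = c \<cdot>\<^sub>m (\<sigma> g * \<sigma> g'))"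

text \<open>
  The projective representation \<open>\<rho>\<close> on \<open>W\<close> is identified with \<open>\<complex>\<^sup>2 \<otimes> \<complex>\<^sup>n\<close>, where \<open>SL(2,\<int>)\<close>
  acts on \<open>\<complex>\<^sup>2\<close> by the standard representation and on \<open>\<complex>\<^sup>n\<close> by \<open>\<sigma>\<close>: the vectors \<open>w a i\<close> are
  the images of \<open>e\<^sub>a \<otimes> f\<^sub>i\<close>.
\<close>

definition std_tensor_iso ::
    "'a::complex_vector set \<Rightarrow> (int mat \<Rightarrow> 'a \<Rightarrow> 'a) \<Rightarrow> nat \<Rightarrow> (int mat \<Rightarrow> complex mat) \<Rightarrow> bool"
  where "std_tensor_iso W \<rho> n \<sigma> \<longleftrightarrow>
    (\<exists>w :: nat \<Rightarrow> nat \<Rightarrow> 'a.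
      inj_on (\<lambda>(a, i). w a i) ({..<2} \<times> {..<n}) \<and>
      \<not> complex_vector.dependent ((\<lambda>(a, i). w a i) ` ({..<2} \<times> {..<n})) \<and>
      complex_vector.span ((\<lambda>(a, i). w a i) ` ({..<2} \<times> {..<n})) = W \<and>
      (\<forall>g\<in>SL2Z. \<exists>c. c \<noteq> 0 \<and>
        (\<forall>b<2. \<forall>j<n. \<rho> g (w b j) =
          c *\<^sub>C (\<Sum>a<2. \<Sum>i<n. (of_int (g $$ (a, b)) * \<sigma> g $$ (i, j)) *\<^sub>C w a i))))"

text \<open>
  Rows and columns are numbered from 0 here, so index \<open>i\<close> stands for \<open>r = i + 1\<close>; \<open>p\<close> is the
  chosen square root of \<open>q\<close>.
\<close>

definition S_semi :: "nat \<Rightarrow> complex \<Rightarrow> complex mat"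
  where "S_semi h q = mat h h (\<lambda>(i, j). qint q ((i + 1) * (j + 1)))"

definition T_semi :: "nat \<Rightarrow> complex \<Rightarrow> complex mat"
  where "T_semi h p =
    mat h h (\<lambda>(i, j). if i = j then (- 1) ^ ((i + 1) + 1) * p ^ ((i + 1)\<^sup>2 - 1) else 0)"

end

theory Submission
  imports Defs "HOL-Computational_Algebra.Polynomial" "HOL-Computational_Algebra.Formal_Power_Series"
begin

text \<open>
  Multiplication by the idempotents \<open>e\<^sub>k\<close> of \<open>K\<close> turns a central element into a family
  \<open>(f\<^sub>k)\<close>, \<open>k \<in> \<int>/l\<close>, of polynomials in the Casimir element modulo one polynomial of degree \<open>l\<close>; centrality bounds the jumps
  \<open>f\<^bsub>k+2\<^esub> - f\<^sub>k\<close>. Expanding these polynomials in Newton bases with nodes the Casimir eigenvalues gives closed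
  forms for the Drinfeld and Radford images of the quantum characters and of the characters built from
  a trace on \<open>H\<close>; so \<open>S\<^sub>L\<^sub>M\<close> exchanges the Chebyshev polynomials in the Casimir with the
  nilpotent elements \<open>nn r\<close>. The equation \<open>\<Delta>(\<theta>\<^sup>-\<^sup>1) = (\<theta>\<^sup>-\<^sup>1 \<otimes> \<theta>\<^sup>-\<^sup>1) R\<^sub>2\<^sub>1 R\<close> determines
  \<open>\<theta>\<^sup>-\<^sup>1\<close>, whose values and first derivatives at the Casimir eigenvalues give \<open>T\<^sub>L\<^sub>M\<close>. In suitable
  vectors indexed by \<open>\<int>/l\<close>, \<open>S\<^sub>L\<^sub>M\<close> and \<open>T\<^sub>L\<^sub>M\<close> are then the generators of the Weil
  representation of \<open>SL(2,\<int>)\<close> on functions on \<open>\<int>/l\<close>: on even functions for \<open>P\<close>, and tensored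
  with the standard representation on odd functions for the complement. The Weil representation is
  projective by Schur's lemma for the Heisenberg group.
\<close>

section \<open>Roots of unity and periodic sums\<close>

text \<open>The obstacle is that the Casimir element is not diagonalizable: \<open>PSI\<close> has a
  double root at every \<open>ch j\<close> with j nonzero modulo l. The action of the inverse ribbon
  element on the center therefore depends on first derivatives of its polynomials, which are
  truncated q-series. Keeping y in x = y + 1/y as a free variable gives a shift equation for them
  whose truncation error contains the factor 1 - (q^(k+1) y)^l. This factor vanishes when y is an
  l-th root of unity, but its derivative does not, and the derivative contributes a multiple of l
  exactly on the weights of \<open>V_r\<close>. The off-diagonal entry of t in the standard
  representation has its origin here. A projective representation is a function of the matrix g, so
  operators of different words in s and t would have to be compared. Instead every g receives some
  operator that transforms the Heisenberg operators by g; prescribing it on s and t makes the values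
  there equal to \<open>S_LM\<close> and \<open>T_LM\<close> themselves, with their scalars.\<close>

locale odd_root =
  fixes l h :: nat and q :: complex
  assumes l_eq: "l = 2 * h + 1" and l_ge: "l \<ge> 3"
    and q_pow_l: "q ^ l = 1" and q_primitive: "\<And>k. 0 < k \<Longrightarrow> k < l \<Longrightarrow> q ^ k \<noteq> 1"
begin

lemma q_nonzero [simp]: "q \<noteq> 0"
  using q_pow_l l_ge by (auto simp: zero_power)

lemma l_pos [simp]: "0 < l" "l \<noteq> 0"
  using l_ge by auto

definition qp :: "int \<Rightarrow> complex" where "qp k = q powi k"

text \<open>\<open>q\<^sup>h\<^sup>+\<^sup>1\<close> is the square root of \<open>q\<close> that is itself an \<open>l\<close>-th root of unity.\<close>

definition hp :: "int \<Rightarrow> complex" where "hp k = qp (int (h + 1) * k)"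

lemma qp_nonzero [simp]: "qp k \<noteq> 0"
  by (simp add: qp_def)

lemma qp_add: "qp (a + b) = qp a * qp b"
  by (simp add: qp_def power_int_add)

lemma qp_diff: "qp (a - b) = qp a / qp b"
  by (simp add: qp_def power_int_diff)

lemma qp_minus: "qp (- a) = inverse (qp a)"
  by (simp add: qp_def power_int_minus)

lemma qp_0 [simp]: "qp 0 = 1" and qp_1 [simp]: "qp 1 = q"
  by (simp_all add: qp_def)

lemma qp_of_nat: "qp (int n) = q ^ n"
  by (simp add: qp_def)

lemma qp_mult_nat: "qp (k * int n) = qp k ^ n"
  by (simp add: qp_def power_int_mult)

lemma qp_eq_1_iff: "qp k = 1 \<longleftrightarrow> int l dvd k"
proof
  have l1: "qp (int l * m) = 1" for m
    using q_pow_l by (simp add: qp_def power_int_mult)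
  then show "int l dvd k \<Longrightarrow> qp k = 1" by (auto simp: dvd_def)
  assume "qp k = 1"
  moreover have "qp k = qp (k mod int l)"
    using l1[of "k div int l"] qp_add[of "int l * (k div int l)" "k mod int l"] by simp
  moreover have "qp (k mod int l) = q ^ nat (k mod int l)"
    by (simp add: qp_def power_int_def)
  ultimately have "\<not> 0 < nat (k mod int l)"
    using q_primitive[of "nat (k mod int l)"] by (auto simp: nat_less_iff)
  moreover have "k mod int l \<ge> 0" by simp
  ultimately show "int l dvd k" by (simp add: dvd_eq_mod_eq_0)
qed

lemma qp_eq_iff: "qp a = qp b \<longleftrightarrow> int l dvd a - b"
  using qp_eq_1_iff[of "a - b"] by (simp add: qp_diff)

lemma qp_cong: "int l dvd a - b \<Longrightarrow> qp a = qp b"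
  by (simp add: qp_eq_iff)

lemma hp_add: "hp (a + b) = hp a * hp b"
  by (simp add: hp_def distrib_left qp_add)

lemma hp_nonzero [simp]: "hp k \<noteq> 0"
  by (simp add: hp_def)

lemma hp_0 [simp]: "hp 0 = 1"
  by (simp add: hp_def)

lemma hp_minus: "hp (- a) = inverse (hp a)"
  by (simp add: hp_def qp_minus)

text \<open>Twice h + 1 is l + 1, so \<open>hp 1\<close> is a square root of q.\<close>

lemma hp_double: "hp (2 * k) = qp k"
  unfolding hp_def
proof (rule qp_cong)
  have "int (h + 1) * (2 * k) - k = int l * k" by (simp add: l_eq algebra_simps)
  then show "int l dvd int (h + 1) * (2 * k) - k" by simp
qed

lemma hp_cong: "int l dvd a - b \<Longrightarrow> hp a = hp b"
  unfolding hp_def by (rule qp_cong) (simp flip: right_diff_distrib)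

text \<open>l is odd. This cancellation of 2 is what lets progressions of weights with step 2 reach
  every residue modulo l.\<close>

lemma coprime_l_2: "int l dvd 2 * k \<longleftrightarrow> int l dvd k"
proof -
  have "coprime (int l) 2" by (simp add: l_eq)
  then show ?thesis by (rule coprime_dvd_mult_right_iff)
qed

section \<open>Sums of periodic functions over Z/l and the discrete Fourier transform\<close>

definition Zl :: "int set" where "Zl = {0..<int l}"

lemma finite_Zl [simp]: "finite Zl" and card_Zl [simp]: "card Zl = l"
  by (simp_all add: Zl_def)

lemma sum_Zl_nat: "(\<Sum>k\<in>Zl. g k) = (\<Sum>j<l. g (int j))"
  unfolding Zl_def
  by (rule sum.reindex_bij_witness[of _ int nat]) auto

definition periodic :: "(int \<Rightarrow> 'b) \<Rightarrow> bool"
  where "periodic g \<longleftrightarrow> (\<forall>k. g (k + int l) = g k)"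

lemma periodic_mult: "periodic g \<Longrightarrow> g (k + int l * m) = g k"
proof (induction m arbitrary: k rule: int_induct[where k = 0])
  case (step1 m)
  then show ?case
    by (metis (no_types, opaque_lifting) periodic_def add.assoc distrib_left mult.right_neutral)
next
  case (step2 m)
  have "g (k + int l * (m - 1)) = g (k + int l * (m - 1) + int l)"
    using step2.prems by (simp add: periodic_def)
  also have "\<dots> = g (k + int l * m)" by (simp add: algebra_simps)
  finally show ?case using step2 by simp
qed simp

lemma periodic_cong: "periodic g \<Longrightarrow> int l dvd a - b \<Longrightarrow> g a = g b"
  using periodic_mult[of g b] by (metis add.commute diff_add_cancel dvdE)

lemma periodic_mod: "periodic g \<Longrightarrow> g (k mod int l) = g k"
  by (rule periodic_cong) (auto simp: mod_eq_dvd_iff[symmetric])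

lemma mod_Zl [simp]: "k mod int l \<in> Zl"
  by (simp add: Zl_def)

lemma Zl_eqI: "a \<in> Zl \<Longrightarrow> b \<in> Zl \<Longrightarrow> int l dvd a - b \<Longrightarrow> a = b"
  by (metis Zl_def atLeastLessThan_iff mod_eq_dvd_iff mod_pos_pos_trivial)

lemma sum_periodic_shift:
  fixes g :: "int \<Rightarrow> 'b::comm_monoid_add"
  assumes "periodic g"
  shows "(\<Sum>k\<in>Zl. g (k + a)) = (\<Sum>k\<in>Zl. g k)"
  by (rule sum.reindex_bij_witness[of _ "\<lambda>k. (k - a) mod int l" "\<lambda>k. (k + a) mod int l"])
    (auto simp: mod_simps periodic_mod[OF assms] Zl_def)

lemma sum_periodic_minus:
  fixes g :: "int \<Rightarrow> 'b::comm_monoid_add"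
  assumes "periodic g"
  shows "(\<Sum>k\<in>Zl. g (- k)) = (\<Sum>k\<in>Zl. g k)"
  by (rule sum.reindex_bij_witness[of _ "\<lambda>k. (- k) mod int l" "\<lambda>k. (- k) mod int l"])
    (auto simp: mod_simps periodic_mod[OF assms] Zl_def)

lemma sum_Zl_single:
  fixes g :: "int \<Rightarrow> 'b::comm_monoid_add"
  assumes "periodic g"
  shows "(\<Sum>k\<in>Zl. if int l dvd k - a then g k else 0) = g a"
proof -
  have "(\<Sum>k\<in>Zl. if int l dvd k - a then g k else 0) =
      (\<Sum>k\<in>Zl. if k = a mod int l then g k else 0)"
  proof (rule sum.cong)
    fix k assume k: "k \<in> Zl"
    have "int l dvd k - a \<longleftrightarrow> k mod int l = a mod int l" by (simp add: mod_eq_dvd_iff)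
    with k show "(if int l dvd k - a then g k else 0) = (if k = a mod int l then g k else 0)"
      by (auto simp: Zl_def)
  qed simp
  also have "\<dots> = g a" by (simp add: periodic_mod[OF assms])
  finally show ?thesis .
qed

lemma sum_qp: "(\<Sum>j\<in>Zl. qp (k * j)) = (if int l dvd k then of_nat l else 0)"
proof (cases "int l dvd k")
  case True
  then have "qp (k * j) = 1" for j by (simp add: qp_eq_1_iff)
  with True show ?thesis by simp
next
  case False
  then have "qp k \<noteq> 1" by (simp add: qp_eq_1_iff)
  moreover have "qp k ^ l = 1" by (simp add: qp_mult_nat[symmetric] qp_eq_1_iff)
  ultimately show ?thesis using False
    by (simp add: sum_Zl_nat qp_mult_nat geometric_sum)
qed

lemma dft_inversion:
  fixes g :: "int \<Rightarrow> complex"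
  assumes "periodic g"
  shows "(\<Sum>j\<in>Zl. qp (- (a * j)) * (\<Sum>k\<in>Zl. qp (k * j) * g k)) = of_nat l * g a"
proof -
  have "(\<Sum>j\<in>Zl. qp (- (a * j)) * (\<Sum>k\<in>Zl. qp (k * j) * g k)) =
      (\<Sum>k\<in>Zl. g k * (\<Sum>j\<in>Zl. qp ((k - a) * j)))"
    unfolding sum_distrib_left
    by (subst sum.swap) (simp add: left_diff_distrib qp_diff qp_minus field_simps)
  also have "\<dots> = (\<Sum>k\<in>Zl. if int l dvd k - a then of_nat l * g k else 0)"
    by (rule sum.cong) (auto simp: sum_qp)
  also have "\<dots> = of_nat l * g a"
    by (rule sum_Zl_single) (use assms in \<open>simp add: periodic_def\<close>)
  finally show ?thesis .
qed

definition br :: "int \<Rightarrow> complex" where "br k = qp k - qp (- k)"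

definition ch :: "int \<Rightarrow> complex" where "ch k = qp k + qp (- k)"

lemma br_eq_0_iff: "br k = 0 \<longleftrightarrow> int l dvd k"
proof -
  have "br k = 0 \<longleftrightarrow> int l dvd k - - k" unfolding qp_eq_iff[symmetric] by (simp add: br_def)
  also have "k - - k = 2 * k" by simp
  finally show ?thesis by (simp only: coprime_l_2)
qed

lemma br_0 [simp]: "br 0 = 0" and br_minus: "br (- k) = - br k"
  by (simp_all add: br_def)

lemma br_nonzero: "0 < s \<Longrightarrow> s < l \<Longrightarrow> br (int s) \<noteq> 0"
  by (auto simp: br_eq_0_iff dest: zdvd_imp_le)

lemma br_cong: "int l dvd a - b \<Longrightarrow> br a = br b"
  unfolding br_def using qp_cong[of a b] by (simp add: qp_minus)

lemma ch_minus: "ch (- k) = ch k"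
  by (simp add: ch_def)

lemma ch_cong: "int l dvd a - b \<Longrightarrow> ch a = ch b"
  unfolding ch_def using qp_cong[of a b] by (simp add: qp_minus)

lemma ch_diff: "ch (a + b) - ch (a - b) = br a * br b"
  by (simp add: ch_def br_def qp_add qp_diff qp_minus field_simps)

lemma ch_eq_iff: "ch a = ch b \<longleftrightarrow> int l dvd a - b \<or> int l dvd a + b"
proof -
  have "(qp a - qp b) * (1 - qp (- (a + b))) = ch a - ch b"
    by (simp add: ch_def qp_add qp_minus field_simps del: minus_add_distrib)
  then have "ch a = ch b \<longleftrightarrow> qp a = qp b \<or> qp (- (a + b)) = 1"
    by (metis eq_iff_diff_eq_0 mult_eq_0_iff)
  then show ?thesis by (simp only: qp_eq_iff qp_eq_1_iff dvd_minus_iff)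
qed

lemma br_1: "br 1 = q - inverse q"
  by (simp add: br_def qp_minus)

lemma br_1_nonzero [simp]: "br 1 \<noteq> 0" "q - inverse q \<noteq> 0" "q \<noteq> inverse q"
  using br_nonzero[of 1] l_ge br_1 by auto

lemma qint_br: "qint q n = br (int n) / br 1"
  by (simp add: qint_def br_def qp_minus qp_of_nat power_inverse)

section \<open>Polynomials in the Casimir eigenvalue\<close>

definition nd :: "int \<Rightarrow> complex poly" where "nd k = [:- ch k, 1:]"

text \<open>Evaluated at the Casimir element on \<open>eK k\<close>, this is (q - 1/q)^(2n) F^n E^n
  (see \<open>FE_pow_eK\<close>). Each k gives another Newton basis of the same space of
  polynomials.\<close>

definition N :: "nat \<Rightarrow> int \<Rightarrow> complex poly"
  where "N n k = (\<Prod>s<n. nd (k + 1 + 2 * int s))"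

definition PSI :: "complex poly" where "PSI = N l 0"

text \<open>The nodes j + 2, j + 4, ..., j + 2(l - 1) are all residues except j, so this is
  \<open>PSI\<close> divided by x - ch j.\<close>

definition Psi :: "int \<Rightarrow> complex poly" where "Psi j = N (l - 1) (j + 1)"

lemma nd_cong: "int l dvd a - b \<Longrightarrow> nd a = nd b"
  by (simp add: nd_def ch_cong)

lemma nd_minus: "nd (- k) = nd k"
  by (simp add: nd_def ch_minus)

lemma N_0 [simp]: "N 0 k = 1"
  by (simp add: N_def)

lemma N_Suc: "N (Suc n) k = N n k * nd (k + 1 + 2 * int n)"
  by (simp add: N_def)

lemma N_cong: "int l dvd a - b \<Longrightarrow> N n a = N n b"
  unfolding N_def by (intro prod.cong refl nd_cong) (simp add: algebra_simps)

lemma N_add: "N (a + b) k = N a k * N b (k + 2 * int a)"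
  by (induction b) (simp_all add: N_Suc mult.assoc algebra_simps)

lemma N_Suc': "N (Suc n) k = nd (k + 1) * N n (k + 2)"
  using N_add[of 1 n k] by (simp add: N_def)

text \<open>Negation reverses the progression of nodes, and \<open>ch\<close> is even.\<close>

lemma N_minus: "N n (- k) = N n (k - 2 * int n)"
  unfolding N_def
proof (rule prod.reindex_bij_witness[of _ "\<lambda>s. n - 1 - s" "\<lambda>s. n - 1 - s"])
  fix s assume "s \<in> {..<n}"
  then have "k - 2 * int n + 1 + 2 * int (n - 1 - s) = - (- k + 1 + 2 * int s)"
    by (auto simp: of_nat_diff)
  then show "nd (k - 2 * int n + 1 + 2 * int (n - 1 - s)) = nd (- k + 1 + 2 * int s)"
    by (simp only: nd_minus)
qed auto

lemma degree_nd [simp]: "degree (nd k) = 1" and nd_nonzero [simp]: "nd k \<noteq> 0"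
  by (simp_all add: nd_def)

lemma N_nonzero [simp]: "N n k \<noteq> 0"
  by (simp add: N_def)

lemma degree_N [simp]: "degree (N n k) = n"
  unfolding N_def by (simp add: degree_prod_eq_sum_degree)

lemma lead_coeff_N: "coeff (N n k) n = 1"
proof -
  have "lead_coeff (N n k) = 1" unfolding N_def by (simp add: lead_coeff_prod nd_def)
  then show ?thesis by simp
qed

text \<open>As l is odd, l nodes in steps of 2 run through all of Z/l, so the starting point is
  immaterial. Shifting it by 2 exchanges one node for a congruent one.\<close>

lemma N_full: "N l k = PSI"
proof -
  have two: "N l (k + 2) = N l k" for k
  proof -
    have "nd (k + 1) * N l (k + 2) = N l k * nd (k + 1 + 2 * int l)"
      using N_Suc[of l k] N_Suc'[of l k] by simp
    also have "nd (k + 1 + 2 * int l) = nd (k + 1)" by (rule nd_cong) simp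
    finally show ?thesis by simp
  qed
  have even: "N l (k + 2 * int n) = N l k" for k n
  proof (induction n)
    case (Suc n)
    then show ?case using two[of "k + 2 * int n"] by (simp add: algebra_simps)
  qed simp
  \<comment> \<open>A solution of k + 2n = 0 modulo l, since h + 1 is the inverse of 2.\<close>
  define n where "n = nat ((int (h + 1) * - k) mod int l)"
  have "int l dvd k + 2 * int n - 0"
  proof -
    define x where "x = int (h + 1) * - k"
    have "int n = x mod int l" by (simp add: n_def x_def)
    then have "int n = x - int l * (x div int l)" by (simp add: minus_mult_div_eq_mod)
    moreover have "k + 2 * x = int l * - k" by (simp add: x_def l_eq algebra_simps)
    ultimately have "k + 2 * int n - 0 = int l * (- k - 2 * (x div int l))"
      by (simp add: algebra_simps)
    then show ?thesis by simp
  qed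
  from N_cong[OF this, of l] show ?thesis using even[of k n] by (simp add: PSI_def)
qed

lemma PSI_nonzero [simp]: "PSI \<noteq> 0" and degree_PSI [simp]: "degree PSI = l"
  by (simp_all add: PSI_def)

lemma degree_Psi [simp]: "degree (Psi j) = l - 1" and Psi_nonzero [simp]: "Psi j \<noteq> 0"
  by (simp_all add: Psi_def)

lemma Psi_cong: "int l dvd a - b \<Longrightarrow> Psi a = Psi b"
  unfolding Psi_def by (rule N_cong) simp

lemma nd_Psi: "nd j * Psi j = PSI"
  using N_Suc'[of "l - 1" "j - 1"] N_full[of "j - 1"] by (simp add: Psi_def add.commute)

lemma Psi_minus: "Psi (- j) = Psi j"
proof -
  have "nd j * Psi (- j) = nd j * Psi j" using nd_Psi[of "- j"] nd_Psi[of j] by (simp add: nd_minus)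
  then show ?thesis by simp
qed

text \<open>The \<open>N n k\<close> are monic, so the top Newton coefficient is the coefficient of
  x^(m-1) whatever k is. The trace in \<open>cointegral_exists\<close> rests on this.\<close>

lemma newton_expansion:
  assumes "degree f < m"
  obtains a where "f = (\<Sum>n<m. smult (a n) (N n k))" "a (m - 1) = coeff f (m - 1)"
proof -
  have "\<exists>a. f = (\<Sum>n<m. smult (a n) (N n k)) \<and> a (m - 1) = coeff f (m - 1)"
    using assms
  proof (induction m arbitrary: f)
    case (Suc m)
    define g where "g = f - smult (coeff f m) (N m k)"
    show ?case
    proof (cases "m = 0")
      case True
      with Suc.prems obtain c where "f = [:c:]" using degree_eq_zeroE by blast
      then show ?thesis using True by (auto intro!: exI[of _ "\<lambda>_. c"])
    next
      case False
      have "degree g \<le> m" unfolding g_def using Suc.prems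
        by (intro degree_diff_le) (auto intro: le_trans[OF degree_smult_le])
      moreover have "coeff g m = 0" by (simp add: g_def lead_coeff_N)
      ultimately have "degree g < m" using False
        by (metis degree_0 leading_coeff_0_iff le_neq_implies_less gr0I)
      then obtain a where a: "g = (\<Sum>n<m. smult (a n) (N n k))" using Suc.IH by blast
      have "f = (\<Sum>n<Suc m. smult ((a(m := coeff f m)) n) (N n k))"
        using a by (simp add: g_def algebra_simps)
      then show ?thesis by (intro exI[of _ "a(m := coeff f m)"]) simp
    qed
  qed simp
  then show thesis using that by blast
qed

end

section \<open>Chebyshev polynomials, and comparison of polynomials along x = y + 1/y\<close>

fun chebU :: "nat \<Rightarrow> complex poly" where
  "chebU 0 = 0"
| "chebU (Suc 0) = 1"
| "chebU (Suc (Suc r)) = [:0, 1:] * chebU (Suc r) - chebU r"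

lemma degree_chebU_less: "0 < r \<Longrightarrow> degree (chebU r) < r \<and> coeff (chebU r) (r - 1) = 1"
proof (induction r rule: chebU.induct)
  case (3 r)
  have "degree ([:0, 1:] * chebU (Suc r)) \<le> Suc r" using 3(1)
    by (intro order_trans[OF degree_mult_le]) simp
  moreover have "degree (chebU r) \<le> r" using 3(2) by (cases "r = 0") auto
  ultimately have "degree (chebU (Suc (Suc r))) \<le> Suc r"
    by (auto intro: degree_diff_le)
  moreover have "coeff (chebU r) (Suc r) = 0" using \<open>degree (chebU r) \<le> r\<close> by (simp add: coeff_eq_0)
  ultimately show ?case using 3(1) by simp
qed simp_all

text \<open>The value at y + 1/y is the character of the r-dimensional irreducible
  sl(2)-module.\<close>

lemma poly_chebU:
  assumes "y \<noteq> 0"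
  shows "poly (chebU r) (y + inverse y) * (y - inverse y) = y ^ r - inverse y ^ r"
proof (induction r rule: chebU.induct)
  case (3 r)
  have "poly (chebU (Suc (Suc r))) (y + inverse y) * (y - inverse y) =
      (y + inverse y) * (poly (chebU (Suc r)) (y + inverse y) * (y - inverse y)) -
      poly (chebU r) (y + inverse y) * (y - inverse y)"
    by (simp add: algebra_simps)
  also have "\<dots> = (y + inverse y) * (y ^ Suc r - inverse y ^ Suc r) - (y ^ r - inverse y ^ r)"
    by (simp only: 3)
  also have "\<dots> = y ^ Suc (Suc r) - inverse y ^ Suc (Suc r)"
  proof -
    have "(y + z) * (y * a - z * b) - (a - b) = y * (y * a) - z * (z * b) + (y * z - 1) * (a - b)"
      for z a b by (simp add: algebra_simps)
    from this[of "inverse y"] show ?thesis using assms by simp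
  qed
  finally show ?case .
qed simp_all

text \<open>D is a unit among the power series, so A itself is divisible by X^m.\<close>

lemma fps_nth_eq_0_of_mult:
  fixes D A H :: "complex fps"
  assumes "D * A = fps_X ^ m * H" "fps_nth D 0 = 1" "r < m"
  shows "fps_nth A r = 0"
proof -
  have "A = inverse D * D * A" using assms(2) by (simp add: inverse_mult_eq_1)
  also have "\<dots> = inverse D * (D * A)" by (rule mult.assoc)
  also have "\<dots> = fps_X ^ m * (inverse D * H)" unfolding assms(1) by (rule mult.left_commute)
  finally show ?thesis using assms(3) by (simp add: fps_X_power_mult_nth)
qed

text \<open>The points \<open>y + 1/y\<close> for \<open>y = n + 2\<close> avoid all poles and roots of unity.\<close>

lemma poly_eq_by_joukowski:
  fixes f g :: "complex poly"
  assumes "\<And>y :: complex. norm y > 1 \<Longrightarrow> y \<noteq> 0 \<Longrightarrow> y - inverse y \<noteq> 0 \<Longrightarrow>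
    poly f (y + inverse y) = poly g (y + inverse y)"
  shows "f = g"
proof (rule ccontr)
  define J where "J n = complex_of_real (real n + 2) + inverse (complex_of_real (real n + 2))" for n :: nat
  assume "f \<noteq> g"
  then have fin: "finite {x. poly (f - g) x = 0}" by (intro poly_roots_finite) simp
  have "poly (f - g) (J n) = 0" for n
  proof -
    let ?y = "complex_of_real (real n + 2)"
    have n: "norm ?y > 1" by (simp only: norm_of_real)
    then have "norm (inverse ?y) < 1"
      unfolding norm_inverse inverse_less_1_iff by blast
    with n have "?y \<noteq> inverse ?y" by (metis less_asym)
    moreover have "?y \<noteq> 0" using n by (metis norm_zero not_one_less_zero)
    ultimately show ?thesis using assms[of ?y] n by (simp add: J_def)
  qed
  then have "range J \<subseteq> {x. poly (f - g) x = 0}" by auto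
  moreover have "inj J"
  proof (rule injI)
    fix m n assume "J m = J n"
    then have "complex_of_real (real m + 2 + inverse (real m + 2)) =
        complex_of_real (real n + 2 + inverse (real n + 2))"
      by (simp only: J_def of_real_add of_real_inverse)
    then have "(real m + 2) + inverse (real m + 2) = (real n + 2) + inverse (real n + 2)"
      by (simp only: of_real_eq_iff)
    then have "(real m - real n) * ((real m + 2) * (real n + 2) - 1) = 0"
      by (simp add: field_simps)
    moreover have "(real m + 2) * (real n + 2) \<ge> 2 * 2" by (intro mult_mono) auto
    ultimately show "m = n" by auto
  qed
  ultimately show False using fin by (metis finite_subset infinite_UNIV_nat finite_imageD)
qed

context odd_root
begin

section \<open>Products over the l-th roots of unity\<close>

lemma prod_roots:
  assumes "inj_on c {..<l}" "\<And>s. s < l \<Longrightarrow> c s ^ l = (1 :: complex)"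
  shows "(\<Prod>s<l. [:- c s, 1:]) = monom 1 l - 1"
proof -
  let ?p = "\<Prod>s<l. [:- c s, 1:]" and ?f = "monom 1 l - 1 :: complex poly"
  have dp: "degree ?p = l" by (simp add: degree_prod_eq_sum_degree)
  have lp: "coeff ?p l = 1"
  proof -
    have "lead_coeff ?p = 1" by (simp add: lead_coeff_prod)
    then show ?thesis using dp by simp
  qed
  have "degree ?f \<le> l" by (rule degree_diff_le) (auto simp: degree_monom_le)
  then have "degree (?p - ?f) \<le> l" using dp degree_diff_le[of ?p l ?f] by simp
  moreover have "coeff (?p - ?f) l = 0" using lp by (simp add: coeff_1)
  ultimately have deg: "degree (?p - ?f) < l \<or> ?p - ?f = 0"
    by (metis le_neq_implies_less leading_coeff_0_iff)
  have "?p - ?f = 0"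
  proof (rule ccontr)
    assume nz: "?p - ?f \<noteq> 0"
    have root: "poly (?p - ?f) (c s) = 0" if "s < l" for s
      using that assms(2)[OF that] by (auto simp: poly_prod poly_monom)
    have "card (c ` {..<l}) \<le> card {x. poly (?p - ?f) x = 0}"
      using root by (intro card_mono poly_roots_finite nz) blast
    also have "\<dots> \<le> degree (?p - ?f)" by (rule card_poly_roots_bound[OF nz])
    finally show False using deg nz assms(1) by (simp add: card_image)
  qed
  then show ?thesis by simp
qed

lemma inj_qp_even: "inj_on (\<lambda>s. qp (a + 2 * int s)) {..<l}"
proof (rule inj_onI)
  fix s t assume st: "s \<in> {..<l}" "t \<in> {..<l}" "qp (a + 2 * int s) = qp (a + 2 * int t)"
  then have "int l dvd 2 * (int s - int t)" by (simp add: qp_eq_iff algebra_simps)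
  then have "int l dvd int s - int t" by (simp only: coprime_l_2)
  with st show "s = t" using Zl_eqI[of "int s" "int t"] by (simp add: Zl_def)
qed

lemma qp_pow_l: "qp k ^ l = 1"
  by (simp add: qp_mult_nat[symmetric] qp_eq_1_iff)

text \<open>At x = y + 1/y each factor x - ch k splits as (y - q^k)(y - q^(-k)) / y, and either
  family of roots exhausts the l-th roots of unity. The square reflects that ch j is a double root
  of \<open>PSI\<close> for j nonzero modulo l.\<close>

lemma poly_PSI:
  assumes "y \<noteq> 0"
  shows "poly PSI (y + inverse y) = inverse y ^ l * (y ^ l - 1)\<^sup>2"
proof -
  have prod: "(\<Prod>s<l. y - c s) = y ^ l - 1" if "inj_on c {..<l}" "\<And>s. s < l \<Longrightarrow> c s ^ l = 1" for c
    using arg_cong[OF prod_roots[OF that], of "\<lambda>p. poly p y"] by (simp add: poly_prod poly_monom)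
  have "inj_on (\<lambda>s. qp (- (1 + 2 * int s))) {..<l}"
    using inj_qp_even[of 1] unfolding inj_on_def qp_minus by simp
  then have 2: "(\<Prod>s<l. y - qp (- (1 + 2 * int s))) = y ^ l - 1"
    by (rule prod) (simp add: qp_pow_l)
  have 1: "(\<Prod>s<l. y - qp (1 + 2 * int s)) = y ^ l - 1"
    by (rule prod[OF inj_qp_even]) (simp add: qp_pow_l)
  have "poly PSI (y + inverse y) =
      (\<Prod>s<l. inverse y * ((y - qp (1 + 2 * int s)) * (y - qp (- (1 + 2 * int s)))))"
    unfolding PSI_def N_def poly_prod
  proof (rule prod.cong)
    fix s
    show "poly (nd (0 + 1 + 2 * int s)) (y + inverse y) =
        inverse y * ((y - qp (1 + 2 * int s)) * (y - qp (- (1 + 2 * int s))))"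
      using assms unfolding nd_def ch_def qp_minus by (simp add: field_simps)
  qed simp
  also have "\<dots> = inverse y ^ l * (y ^ l - 1)\<^sup>2"
    unfolding prod.distrib 1 2 by (simp add: power2_eq_square)
  finally show ?thesis .
qed

lemma prod_one_minus_qp: "(\<Prod>s=1..l-1. 1 - qp (2 * int s)) = of_nat l"
proof -
  let ?p = "\<Prod>s=1..l-1. [:- qp (2 * int s), 1:]"
  have "{..<l} = insert 0 {1..l-1}" using l_ge by auto
  moreover have "(\<Prod>s<l. [:- qp (2 * int s), 1:]) = monom 1 l - 1"
    using prod_roots[of "\<lambda>s. qp (0 + 2 * int s)"] inj_qp_even[of 0] qp_pow_l by simp
  ultimately have "[:-1, 1:] * ?p = monom 1 l - 1" by simp
  also have "\<dots> = [:-1, 1:] * (\<Sum>i<l. monom 1 i)"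
  proof -
    have "(monom 1 l :: complex poly) - 1 = [:0, 1:] ^ l - 1"
      by (simp add: monom_altdef)
    also have "\<dots> = ([:0, 1:] - 1) * (\<Sum>i<l. [:0, 1:] ^ i)"
      by (rule power_diff_1_eq)
    also have "[:0, 1:] - 1 = [:-1, 1 :: complex:]" by (simp add: one_pCons)
    finally show ?thesis by (simp add: monom_altdef)
  qed
  finally have "?p = (\<Sum>i<l. monom 1 i)" by (simp only: mult_cancel_left) simp
  then have "poly ?p 1 = of_nat l" by (simp add: poly_sum poly_monom)
  then show ?thesis by (simp add: poly_prod)
qed

text \<open>The quantum factorial times (q - 1/q)^n; see \<open>qfact_bf\<close>.\<close>

definition bf :: "nat \<Rightarrow> complex" where "bf n = (\<Prod>s=1..n. br (int s))"

lemma bf_0 [simp]: "bf 0 = 1" and bf_Suc: "bf (Suc n) = bf n * br (int (Suc n))"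
  by (simp_all add: bf_def)

lemma bf_nonzero: "n < l \<Longrightarrow> bf n \<noteq> 0"
  unfolding bf_def using br_nonzero by auto

text \<open>Taking q^(-s) and a sign out of each factor leaves the product of the 1 - q^(2s), which
  is l. The powers of q cancel because 1 + ... + (l - 1) is a multiple of l, and the number of signs
  is even.\<close>

lemma bf_last: "bf (l - 1) = of_nat l"
proof -
  have "bf (l - 1) = (\<Prod>s=1..l-1. qp (- int s) * (- 1) * (1 - qp (2 * int s)))"
    unfolding bf_def br_def by (rule prod.cong) (simp_all add: algebra_simps flip: qp_add)
  also have "\<dots> = (\<Prod>s=1..l-1. qp (- int s)) * (- 1) ^ (l - 1) * of_nat l"
    by (simp only: prod.distrib prod_one_minus_qp) simp
  also have "(\<Prod>s=1..l-1. qp (- int s)) = 1"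
  proof -
    have "(\<Prod>s=1..n. qp (- int s)) = qp (- (int n * int (n + 1) div 2))" for n
    proof (induction n)
      case (Suc n)
      have "int (Suc n) * int (Suc n + 1) div 2 = int n * int (n + 1) div 2 + int (Suc n)"
        by (simp add: algebra_simps)
      then show ?case using Suc by (simp add: qp_diff qp_minus divide_inverse del: of_nat_Suc)
    qed simp
    moreover have "int (l - 1) * int (l - 1 + 1) div 2 = int l * int h"
      by (simp add: l_eq algebra_simps)
    ultimately show ?thesis by (metis dvd_minus_iff dvd_triv_left qp_eq_1_iff)
  qed
  also have "(- 1 :: complex) ^ (l - 1) = 1" by (simp add: l_eq)
  finally show ?thesis by simp
qed

text \<open>Reflecting s to l - s changes the sign of \<open>br\<close>, so the product is l up to
  sign. The squares suffice because \<open>ca\<close> contains only squares of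
  \<open>bf\<close>.\<close>

lemma bf_complement:
  assumes "n < l"
  shows "(bf n * bf (l - 1 - n))\<^sup>2 = (of_nat l)\<^sup>2"
proof -
  have "bf n * bf (l - 1 - n) * (-1) ^ n = of_nat l"
    using assms
  proof (induction n)
    case (Suc n)
    have "l - 1 - n = Suc (l - 1 - Suc n)" using Suc.prems by simp
    then have "bf (l - 1 - n) = bf (l - 1 - Suc n) * br (int (l - 1 - n))" by (simp only: bf_Suc)
    also have "br (int (l - 1 - n)) = br (- int (Suc n))"
      using Suc.prems by (intro br_cong) (simp add: of_nat_diff)
    finally show ?case using Suc by (simp add: bf_Suc br_minus mult_ac del: of_nat_Suc)
  qed (simp add: bf_last[unfolded One_nat_def])
  then have "(of_nat l)\<^sup>2 = (bf n * bf (l - 1 - n) * (-1) ^ n)\<^sup>2" by simp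
  also have "\<dots> = (bf n * bf (l - 1 - n))\<^sup>2"
    by (simp add: power_mult_distrib flip: power_mult)
  finally show ?thesis ..
qed

text \<open>
  The Newton coefficients of \<open>chebU r\<close> come from the generating function
  \<open>\<Sum>\<^sub>r chebU r X\<^sup>r = X / (1 - x X + X\<^sup>2)\<close>, whose Newton expansion in \<open>x\<close> is a telescoping
  series with denominators \<open>1 - ch k X + X\<^sup>2 = (1 - q\<^sup>k X) (1 - q\<^sup>-\<^sup>k X)\<close>.
\<close>

definition gb :: "nat \<Rightarrow> nat \<Rightarrow> complex"
  where "gb n a = (\<Prod>s=1..n. br (int a + int s) / br (int s))"

lemma gb_shift: "n < l \<Longrightarrow> 0 < n \<Longrightarrow> gb n a * br (int n) = gb (n - 1) (Suc a) * br (int a + 1)"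
proof (induction n)
  case (Suc n)
  show ?case
  proof (cases n)
    case 0
    then show ?thesis using br_nonzero[of 1] l_ge by (simp add: gb_def)
  next
    case (Suc m)
    have n: "br (int n) \<noteq> 0" "br (int (Suc n)) \<noteq> 0"
      using Suc.prems Suc br_nonzero[of n] br_nonzero[of "Suc n"] by simp_all
    have "gb (Suc n) a * br (int (Suc n)) = gb n a * br (int a + int (Suc n))"
      using n by (simp add: gb_def del: of_nat_Suc)
    moreover have "gb n (Suc a) = gb m (Suc a) * (br (int a + int (Suc n)) / br (int n))"
      using Suc by (simp add: gb_def algebra_simps)
    moreover have "gb n a * br (int n) = gb m (Suc a) * br (int a + 1)"
      using Suc.IH Suc.prems Suc by simp
    ultimately have "br (int n) * (gb (Suc n) a * br (int (Suc n))) =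
        br (int n) * (gb n (Suc a) * br (int a + 1))"
      using n(1) by (simp add: mult_ac del: of_nat_Suc)
    then show ?thesis using n by simp
  qed
qed simp

text \<open>For n < l the q-binomial theorem makes this the product of 1/(1 - q^(j-2s) X) over s
  \<le> n, and \<open>Fb\<close> that of 1/(1 - q^(2s-j) X). The explicit coefficients are what is
  wanted; the product form enters through the recursions \<open>Fa_step\<close> and
  \<open>Fb_step\<close>.\<close>

definition Fa :: "int \<Rightarrow> nat \<Rightarrow> complex fps"
  where "Fa j n = Abs_fps (\<lambda>a. qp (int a * (j - int n)) * gb n a)"

definition Fb :: "int \<Rightarrow> nat \<Rightarrow> complex fps"
  where "Fb j n = Abs_fps (\<lambda>a. qp (- int a * (j - int n)) * gb n a)"

lemma gb_0 [simp]: "n < l \<Longrightarrow> gb n 0 = 1"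
  unfolding gb_def using br_nonzero by (intro prod.neutral) (auto simp del: of_nat_Suc)

lemma gb_0' [simp]: "gb 0 a = 1"
  by (simp add: gb_def)

lemma gb_Suc: "n > 0 \<Longrightarrow> gb n a = gb (n - 1) a * br (int a + int n) / br (int n)"
  by (cases n) (simp_all add: gb_def)

lemma Fa_step:
  assumes "n < l" "0 < n"
  shows "(1 - fps_const (qp (j - 2 * int n)) * fps_X) * Fa j n = Fa j (n - 1)"
proof (rule fps_ext)
  fix a
  show "fps_nth ((1 - fps_const (qp (j - 2 * int n)) * fps_X) * Fa j n) a = fps_nth (Fa j (n - 1)) a"
  proof (cases a)
    case 0
    then show ?thesis using assms by (simp add: Fa_def)
  next
    case (Suc b)
    have n: "br (int n) \<noteq> 0" using assms by (intro br_nonzero)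
    have 1: "gb n a = gb (n - 1) a * br (int a + int n) / br (int n)" using assms by (simp add: gb_Suc)
    have 2: "gb n b = gb (n - 1) a * br (int a) / br (int n)"
      using gb_shift[OF assms, of b] n Suc by (simp add: field_simps)
    have 3: "br (int a + int n) - qp (- int n) * br (int a) = qp (int a) * br (int n)"
      by (simp add: br_def qp_add qp_minus qp_diff field_simps)
    have e: "qp (int a * (j - int (n - 1))) = qp (int a * (j - int n)) * qp (int a)"
      using assms by (simp add: of_nat_diff algebra_simps flip: qp_add)
    have e2: "qp (j - 2 * int n) * qp (int b * (j - int n)) = qp (int a * (j - int n)) * qp (- int n)"
      using Suc by (simp add: algebra_simps flip: qp_add)
    have "fps_nth ((1 - fps_const (qp (j - 2 * int n)) * fps_X) * Fa j n) a =
        qp (int a * (j - int n)) * gb n a - (qp (j - 2 * int n) * qp (int b * (j - int n))) * gb n b"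
      using Suc by (simp add: Fa_def algebra_simps)
    also have "\<dots> = qp (int a * (j - int n)) * (gb (n - 1) a / br (int n)) *
        (br (int a + int n) - qp (- int n) * br (int a))"
      unfolding 1 2 e2 using n by (simp add: field_simps)
    also have "\<dots> = fps_nth (Fa j (n - 1)) a"
      unfolding 3 using n e by (simp add: Fa_def)
    finally show ?thesis .
  qed
qed

lemma Fb_step:
  assumes "n < l" "0 < n"
  shows "(1 - fps_const (qp (2 * int n - j)) * fps_X) * Fb j n = Fb j (n - 1)"
proof (rule fps_ext)
  fix a
  show "fps_nth ((1 - fps_const (qp (2 * int n - j)) * fps_X) * Fb j n) a = fps_nth (Fb j (n - 1)) a"
  proof (cases a)
    case 0
    then show ?thesis using assms by (simp add: Fb_def)
  next
    case (Suc b)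
    have n: "br (int n) \<noteq> 0" using assms by (intro br_nonzero)
    have 1: "gb n a = gb (n - 1) a * br (int a + int n) / br (int n)" using assms by (simp add: gb_Suc)
    have 2: "gb n b = gb (n - 1) a * br (int a) / br (int n)"
      using gb_shift[OF assms, of b] n Suc by (simp add: field_simps)
    have 3: "br (int a + int n) - qp (int n) * br (int a) = qp (- int a) * br (int n)"
      by (simp add: br_def qp_add qp_minus qp_diff field_simps)
    have e: "qp (- int a * (j - int (n - 1))) = qp (- int a * (j - int n)) * qp (- int a)"
      using assms by (simp add: of_nat_diff algebra_simps flip: qp_add)
    have e2: "qp (2 * int n - j) * qp (- int b * (j - int n)) = qp (- int a * (j - int n)) * qp (int n)"
      using Suc by (simp add: algebra_simps flip: qp_add)
    have "fps_nth ((1 - fps_const (qp (2 * int n - j)) * fps_X) * Fb j n) a =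
        qp (- int a * (j - int n)) * gb n a - (qp (2 * int n - j) * qp (- int b * (j - int n))) * gb n b"
      using Suc by (simp add: Fb_def algebra_simps)
    also have "\<dots> = qp (- int a * (j - int n)) * (gb (n - 1) a / br (int n)) *
        (br (int a + int n) - qp (int n) * br (int a))"
      unfolding 1 2 e2 using n by (simp add: field_simps)
    also have "\<dots> = fps_nth (Fb j (n - 1)) a"
      unfolding 3 using n e by (simp add: Fb_def)
    finally show ?thesis .
  qed
qed

lemma Fa_0: "(1 - fps_const (qp j) * fps_X) * Fa j 0 = 1"
proof (rule fps_ext)
  fix a
  show "fps_nth ((1 - fps_const (qp j) * fps_X) * Fa j 0) a = fps_nth 1 a"
    by (cases a) (simp_all add: Fa_def algebra_simps qp_add)
qed

lemma Fb_0: "(1 - fps_const (qp (- j)) * fps_X) * Fb j 0 = 1"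
proof (rule fps_ext)
  fix a
  show "fps_nth ((1 - fps_const (qp (- j)) * fps_X) * Fb j 0) a = fps_nth 1 a"
    by (cases a) (simp_all add: Fb_def algebra_simps qp_add qp_diff qp_minus divide_inverse)
qed

definition Dx :: "complex \<Rightarrow> complex fps" where "Dx x = 1 - fps_const x * fps_X + fps_X\<^sup>2"

lemma Dx_ch: "Dx (ch k) = (1 - fps_const (qp k) * fps_X) * (1 - fps_const (qp (- k)) * fps_X)"
proof -
  have "fps_const (qp k) * fps_const (qp (- k)) = 1" by (simp add: qp_minus)
  then have "fps_const (qp k) * fps_X * (fps_const (qp (- k)) * fps_X) = fps_X\<^sup>2"
    by (simp add: algebra_simps power2_eq_square)
  then show ?thesis by (simp add: Dx_def ch_def algebra_simps flip: fps_const_add)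
qed

text \<open>For n < l this is X^(n+1) divided by the product of the 1 - ch (j - 2s) X + X^2 over s
  \<le> n.\<close>

definition Gx :: "int \<Rightarrow> nat \<Rightarrow> complex fps"
  where "Gx j n = fps_X ^ (n + 1) * (Fa j n * Fb j n)"

lemma Gx_0: "Dx (ch j) * Gx j 0 = fps_X"
proof -
  have "Dx (ch j) * Gx j 0 = fps_X * (((1 - fps_const (qp j) * fps_X) * Fa j 0) *
      ((1 - fps_const (qp (- j)) * fps_X) * Fb j 0))"
    unfolding Dx_ch Gx_def by (simp only: power_one_right add_0 mult_ac)
  then show ?thesis by (simp only: Fa_0 Fb_0) simp
qed

lemma Gx_step:
  assumes "n < l" "0 < n"
  shows "Dx (ch (j - 2 * int n)) * Gx j n = fps_X * Gx j (n - 1)"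
proof -
  have "Dx (ch (j - 2 * int n)) * Gx j n =
      fps_X ^ (n + 1) * (((1 - fps_const (qp (j - 2 * int n)) * fps_X) * Fa j n) *
      ((1 - fps_const (qp (2 * int n - j)) * fps_X) * Fb j n))"
    unfolding Dx_ch Gx_def by (simp only: minus_diff_eq mult_ac)
  also have "\<dots> = fps_X * Gx j (n - 1)"
    unfolding Fa_step[OF assms] Fb_step[OF assms] Gx_def using assms by simp
  finally show ?thesis .
qed

text \<open>The factor 1 - x X + X^2 differs from the newest denominator factor 1 - c X + X^2 by (x
  - c) X. The two terms that this produces from each summand cancel between neighbours.\<close>

lemma Gx_telescope:
  assumes "m < l"
  shows "Dx x * (\<Sum>n<Suc m. fps_const (poly (N n (- j - 1)) x) * Gx j n) =
    fps_X - fps_const (poly (N (Suc m) (- j - 1)) x) * fps_X * Gx j m"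
  using assms
proof (induction m)
  case 0
  have "Dx x = Dx (ch j) - fps_const (x - ch j) * fps_X"
    by (simp add: Dx_def algebra_simps flip: fps_const_sub)
  moreover have "poly (N (Suc 0) (- j - 1)) x = x - ch j"
    by (simp add: N_Suc nd_def ch_minus)
  ultimately show ?case using Gx_0[of j] by (simp add: left_diff_distrib mult.assoc)
next
  case (Suc m)
  define c where "c = ch (j - 2 * int (Suc m))"
  define p where "p = poly (N (Suc m) (- j - 1)) x"
  have D: "Dx x = Dx c - fps_const (x - c) * fps_X"
    by (simp add: Dx_def algebra_simps flip: fps_const_sub)
  have "ch (- j - 1 + 1 + 2 * int (Suc m)) = c"
    unfolding c_def using ch_minus[of "j - 2 * int (Suc m)"] by simp
  then have 1: "poly (N (Suc (Suc m)) (- j - 1)) x = p * (x - c)"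
    unfolding p_def by (subst N_Suc) (simp add: nd_def algebra_simps)
  have "Dx c * Gx j (Suc m) = fps_X * Gx j m"
    unfolding c_def using Gx_step[of "Suc m" j] Suc.prems by simp
  then have 2: "Dx x * Gx j (Suc m) = fps_X * Gx j m - fps_const (x - c) * fps_X * Gx j (Suc m)"
    unfolding D by (simp add: left_diff_distrib mult.assoc)
  have 3: "Dx x * (\<Sum>n<Suc (Suc m). fps_const (poly (N n (- j - 1)) x) * Gx j n) =
      fps_X - fps_const p * fps_X * Gx j m + fps_const p * (Dx x * Gx j (Suc m))"
    using Suc unfolding p_def by (simp add: algebra_simps del: sum.lessThan_Suc add: sum.lessThan_Suc[of _ "Suc m"])
  show ?case unfolding 3 2 1 fps_const_mult[symmetric] by (simp add: algebra_simps)
qed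

lemma poly_chebU_newton_fps:
  assumes "r \<le> l"
  shows "poly (chebU r) x = (\<Sum>n<l. poly (N n (- j - 1)) x * fps_nth (Gx j n) r)"
proof -
  define Ux where "Ux = Abs_fps (\<lambda>r. poly (chebU r) x)"
  have Ux: "Dx x * Ux = fps_X"
  proof (rule fps_ext)
    fix n
    have x2: "Dx x * Ux = Ux - fps_const x * (fps_X * Ux) + fps_X * (fps_X * Ux)"
      by (simp add: Dx_def algebra_simps power2_eq_square)
    show "fps_nth (Dx x * Ux) n = fps_nth fps_X n"
      unfolding x2 by (cases n rule: chebU.cases) (simp_all add: Ux_def)
  qed
  define A where "A = (\<Sum>n<l. fps_const (poly (N n (- j - 1)) x) * Gx j n)"
  have "Dx x * A = fps_X - fps_const (poly (N l (- j - 1)) x) * fps_X * Gx j (l - 1)"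
    using Gx_telescope[of "l - 1" x j] by (simp add: A_def)
  then have "Dx x * (Ux - A) = fps_const (poly (N l (- j - 1)) x) * fps_X * Gx j (l - 1)"
    by (simp add: right_diff_distrib Ux)
  \<comment> \<open>The remainder begins in degree l + 1, so the coefficients are exact up to r = l;
    the bound on r comes from here.\<close>
  also have "\<dots> = fps_X ^ (l + 1) * (fps_const (poly (N l (- j - 1)) x) * (Fa j (l - 1) * Fb j (l - 1)))"
    by (simp add: Gx_def mult_ac)
  finally have "fps_nth (Ux - A) r = 0"
    by (rule fps_nth_eq_0_of_mult) (use assms in \<open>auto simp: Dx_def power2_eq_square\<close>)
  then show ?thesis by (simp add: Ux_def A_def fps_sum_nth)
qed

section \<open>Newton coefficients as sums over the weights of \<open>V_r\<close>\<close>

definition ca :: "nat \<Rightarrow> complex" where "ca n = qp (int n * (int n - 1)) / (bf n)\<^sup>2"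

definition wt :: "nat \<Rightarrow> nat \<Rightarrow> int" where "wt r i = int r - 1 - 2 * int i"

text \<open>The shape in which the Drinfeld map delivers the coefficient: a sum over the weights of
  \<open>V_r\<close> of the eigenvalues of F^n E^n, with powers of q from the Cartan part of R and
  from K^(-1) in the quantum trace. Compare \<open>drinfeld_qCh_mod\<close>.\<close>

definition Bc :: "nat \<Rightarrow> nat \<Rightarrow> int \<Rightarrow> complex"
  where "Bc n r k = ca n * (\<Sum>i<r. qp (wt r i * k + int n * (k - wt r i) - 2 * (int n)\<^sup>2 - wt r i) *
    poly (N n (wt r i)) (ch (int r)))"

text \<open>By \<open>ch_diff\<close> every factor is a product of two brackets, one growing and one
  shrinking. The shrinking one passes through 0 when i < n, in accordance with E^n killing
  v_i.\<close>

lemma poly_N_weight: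
  assumes "i < r" "n < l"
  shows "poly (N n (wt r i)) (ch (int r)) =
    (if i < n then 0 else gb n (r - 1 - i) * gb n (i - n) * (bf n)\<^sup>2)"
proof -
  have "poly (N n (wt r i)) (ch (int r)) = (\<Prod>s<n. br (int r - int i + int s) * br (int i - int s))"
    unfolding N_def poly_prod
  proof (rule prod.cong)
    fix s
    have "ch (wt r i + 1 + 2 * int s) = ch ((int r - int i + int s) - (int i - int s))"
      by (simp add: wt_def algebra_simps)
    then show "poly (nd (wt r i + 1 + 2 * int s)) (ch (int r)) =
        br (int r - int i + int s) * br (int i - int s)"
      using ch_diff[of "int r - int i + int s" "int i - int s"] by (simp add: nd_def)
  qed simp
  also have "\<dots> = (if i < n then 0 else gb n (r - 1 - i) * gb n (i - n) * (bf n)\<^sup>2)"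
  proof (cases "i < n")
    case True
    then show ?thesis by (auto intro!: prod_zero bexI[of _ i])
  next
    case False
    have g: "(\<Prod>s=1..n. br (int a + int s)) = gb n a * bf n" for a
      using bf_nonzero[OF assms(2)] unfolding gb_def bf_def by (simp add: prod_dividef)
    have 1: "(\<Prod>s<n. br (int r - int i + int s)) = (\<Prod>s=1..n. br (int (r - 1 - i) + int s))"
      using assms by (intro prod.reindex_bij_witness[of _ "\<lambda>s. s - 1" Suc])
        (auto simp: of_nat_diff algebra_simps)
    have 2: "(\<Prod>s<n. br (int i - int s)) = (\<Prod>s=1..n. br (int (i - n) + int s))"
      using False by (intro prod.reindex_bij_witness[of _ "\<lambda>s. n - s" "\<lambda>s. n - s"])
        (auto simp: of_nat_diff algebra_simps)
    show ?thesis using False unfolding prod.distrib 1 2 g by (simp add: power2_eq_square)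
  qed
  finally show ?thesis .
qed

text \<open>The weight with index r - 1 - a contributes the a-th term of the Cauchy product of
  \<open>Fa\<close> and \<open>Fb\<close>. The weights killed by E^n are the terms cut off by the
  factor X^(n+1).\<close>

lemma Gx_nth:
  assumes "n < l"
  shows "fps_nth (Gx j n) r = Bc n r (j + 1)"
proof -
  define t where "t i = qp (wt r i * (j + 1) + int n * ((j + 1) - wt r i) - 2 * (int n)\<^sup>2 - wt r i) *
    poly (N n (wt r i)) (ch (int r))" for i
  have t: "ca n * t (r - 1 - a) = (if a < r - n then fps_nth (Fa j n) a * fps_nth (Fb j n) (r - n - 1 - a) else 0)"
    if a: "a < r" for a
  proof (cases "a < r - n")
    case False
    then have "r - 1 - a < n" using a by simp
    then show ?thesis using False a by (simp add: t_def poly_N_weight assms)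
  next
    case True
    define b where "b = r - n - 1 - a"
    have r: "r = n + 1 + a + b" using True by (simp add: b_def)
    have e: "int n * (int n - 1) + (wt r (r - 1 - a) * (j + 1) + int n * ((j + 1) - wt r (r - 1 - a)) - 2 * (int n)\<^sup>2 - wt r (r - 1 - a))
        = int a * (j - int n) + - int b * (j - int n)"
      by (simp add: r wt_def of_nat_diff algebra_simps power2_eq_square)
    have i: "\<not> r - 1 - a < n" "r - 1 - (r - 1 - a) = a" "r - 1 - a - n = b"
      using r by auto
    have "ca n * t (r - 1 - a) =
        qp (int n * (int n - 1) + (wt r (r - 1 - a) * (j + 1) + int n * ((j + 1) - wt r (r - 1 - a)) - 2 * (int n)\<^sup>2 - wt r (r - 1 - a)))
        * (gb n a * gb n b)"
      unfolding t_def using a bf_nonzero[OF assms] i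
      by (simp add: poly_N_weight assms ca_def qp_add[of "int n * (int n - 1)"])
    also have "\<dots> = fps_nth (Fa j n) a * fps_nth (Fb j n) b"
      unfolding e qp_add by (simp add: Fa_def Fb_def)
    finally show ?thesis using True by (simp add: b_def)
  qed
  have "Bc n r (j + 1) = (\<Sum>i<r. ca n * t i)"
    by (simp add: Bc_def t_def sum_distrib_left)
  also have "\<dots> = (\<Sum>a<r. ca n * t (r - 1 - a))"
    by (subst sum.nat_diff_reindex[symmetric]) simp
  also have "\<dots> = (\<Sum>a<r. if a < r - n then fps_nth (Fa j n) a * fps_nth (Fb j n) (r - n - 1 - a) else 0)"
    by (rule sum.cong) (use t in auto)
  also have "\<dots> = (\<Sum>a<r - n. fps_nth (Fa j n) a * fps_nth (Fb j n) (r - n - 1 - a))"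
    by (rule sum.mono_neutral_cong_right) auto
  also have "\<dots> = fps_nth (Gx j n) r"
  proof (cases "r < n + 1")
    case True
    then show ?thesis unfolding Gx_def fps_X_power_mult_nth by simp
  next
    case False
    then have "{..<r - n} = {0..r - (n + 1)}" by auto
    moreover have "fps_nth (Gx j n) r = fps_nth (Fa j n * Fb j n) (r - (n + 1))"
      unfolding Gx_def fps_X_power_mult_nth using False by (simp only: if_False)
    ultimately show ?thesis by (simp add: fps_mult_nth)
  qed
  finally show ?thesis ..
qed

text \<open>The left side is free of k. This is why the Drinfeld image of the character of
  \<open>V_r\<close> acts by one and the same polynomial on all eigenspaces of K.\<close>

lemma chebU_newton:
  assumes "r \<le> l"
  shows "chebU r = (\<Sum>n<l. smult (Bc n r k) (N n (- k)))"
proof -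
  have "poly (chebU r) x = poly (\<Sum>n<l. smult (Bc n r k) (N n (- k))) x" for x
    using poly_chebU_newton_fps[OF assms, of x "k - 1"] Gx_nth[of _ "k - 1" r]
    by (simp add: poly_sum mult.commute)
  then show ?thesis by (simp add: poly_eq_poly_eq_iff[symmetric] fun_eq_iff)
qed

end

lemma smult_sum_right: "smult c (\<Sum>i\<in>A. f i) = (\<Sum>i\<in>A. smult c (f i))"
  by (induction A rule: infinite_finite_induct) (simp_all add: smult_add_right)

context odd_root
begin

section \<open>Weights of \<open>V_r\<close> modulo l\<close>

definition inwt :: "nat \<Rightarrow> int \<Rightarrow> bool"
  where "inwt r k \<longleftrightarrow> (\<exists>i<r. int l dvd k - wt r i)"

lemma inwt_cong: "int l dvd a - b \<Longrightarrow> inwt r a = inwt r b"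
proof -
  assume "int l dvd a - b"
  moreover have "a - w = (a - b) + (b - w)" for w by simp
  ultimately have "int l dvd a - w \<longleftrightarrow> int l dvd b - w" for w by (metis dvd_add_right_iff)
  then show ?thesis by (simp add: inwt_def)
qed

lemma inwt_minus: "inwt r (- k) = inwt r k"
proof -
  have imp: "inwt r k \<Longrightarrow> inwt r (- k)" for k
  proof -
    assume "inwt r k"
    then obtain i where i: "i < r" "int l dvd k - wt r i" by (auto simp: inwt_def)
    have "- k - wt r (r - 1 - i) = - (k - wt r i)" using i(1) by (simp add: wt_def of_nat_diff)
    then have "int l dvd - k - wt r (r - 1 - i)" using i(2) by (simp only: dvd_minus_iff)
    then show "inwt r (- k)" using i(1) unfolding inwt_def by (intro exI[of _ "r - 1 - i"]) simp
  qed
  from imp[of k] imp[of "- k"] show ?thesis by auto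
qed

lemma inwt_0 [simp]: "\<not> inwt 0 k"
  by (simp add: inwt_def)

lemma weight_index:
  obtains i where "i < l" "int l dvd k - wt r i"
proof -
  define x where "x = int (h + 1) * (int r - 1 - k)"
  define i where "i = nat (x mod int l)"
  have "i < l" by (simp add: i_def nat_less_iff)
  moreover have "int i = x - int l * (x div int l)"
    by (simp add: i_def minus_mult_div_eq_mod)
  then have "k - wt r i = int l * (int r - 1 - k - 2 * (x div int l))"
    by (simp add: wt_def x_def l_eq algebra_simps)
  then have "int l dvd k - wt r i" by simp
  ultimately show thesis by (rule that)
qed

lemma weight_index_unique:
  assumes "i < l" "j < l" "int l dvd k - wt r i" "int l dvd k - wt r j"
  shows "i = j"
proof -
  have "int l dvd (k - wt r i) - (k - wt r j)" using assms(3,4) by (rule dvd_diff)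
  also have "(k - wt r i) - (k - wt r j) = 2 * (int i - int j)" by (simp add: wt_def)
  finally have "int l dvd int i - int j" by (simp only: coprime_l_2)
  then show ?thesis using assms(1,2) Zl_eqI[of "int i" "int j"] by (simp add: Zl_def)
qed

lemma inwt_index: "r \<le> l \<Longrightarrow> i < l \<Longrightarrow> int l dvd k - wt r i \<Longrightarrow> inwt r k \<longleftrightarrow> i < r"
  unfolding inwt_def using weight_index_unique[of i _ k r] by (metis order_less_le_trans)

text \<open>Modulo l the weights of \<open>V_(l-r)\<close> continue the progression of those of
  \<open>V_r\<close>: they have the indices r, ..., l - 1 in the same string.\<close>

lemma inwt_complement:
  assumes "r \<le> l"
  shows "inwt (l - r) k \<longleftrightarrow> \<not> inwt r k"
proof -
  obtain i where i: "i < l" "int l dvd k - wt r i" by (rule weight_index)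
  have eq: "int l dvd k - wt (l - r) i' \<longleftrightarrow> int l dvd k - wt r (i' + r)" for i'
  proof -
    have "k - wt (l - r) i' = k - wt r (i' + r) - int l"
      using assms by (simp add: wt_def of_nat_diff)
    moreover have "int l dvd x - int l \<longleftrightarrow> int l dvd x" for x
      by (metis diff_add_cancel dvd_add_left_iff dvd_refl)
    ultimately show ?thesis by (simp only:)
  qed
  have "inwt (l - r) k \<longleftrightarrow> r \<le> i"
  proof
    assume "inwt (l - r) k"
    then obtain i' where "i' < l - r" "int l dvd k - wt r (i' + r)" by (auto simp: inwt_def eq)
    then have "i = i' + r" using i by (intro weight_index_unique[of _ _ k r]) auto
    then show "r \<le> i" by simp
  next
    assume "r \<le> i"
    then show "inwt (l - r) k" unfolding inwt_def eq using i
      by (intro exI[of _ "i - r"]) auto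
  qed
  then show ?thesis using inwt_index[OF assms i] by auto
qed

lemma inwt_l [simp]: "inwt l k"
  using inwt_complement[of 0 k] by simp

lemma sum_inwt:
  fixes g :: "int \<Rightarrow> 'b::comm_monoid_add"
  assumes "periodic g" "r \<le> l"
  shows "(\<Sum>k\<in>Zl. if inwt r k then g k else 0) = (\<Sum>i<r. g (wt r i))"
proof -
  have "(\<Sum>i<r. g (wt r i)) = (\<Sum>i<r. \<Sum>k\<in>Zl. if int l dvd k - wt r i then g k else 0)"
    by (simp add: sum_Zl_single[OF assms(1)])
  also have "\<dots> = (\<Sum>k\<in>Zl. \<Sum>i<r. if int l dvd k - wt r i then g k else 0)"
    by (rule sum.swap)
  also have "\<dots> = (\<Sum>k\<in>Zl. if inwt r k then g k else 0)"
  proof (rule sum.cong)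
    fix k
    obtain i where i: "i < l" "int l dvd k - wt r i" by (rule weight_index)
    have "(\<Sum>i'<r. if int l dvd k - wt r i' then g k else 0) = (\<Sum>i'<r. if i' = i then g k else 0)"
    proof (rule sum.cong)
      fix i' assume "i' \<in> {..<r}"
      then have "i' < l" using assms(2) by simp
      then have "int l dvd k - wt r i' \<longleftrightarrow> i' = i"
        using i weight_index_unique[of i' i k r] by metis
      then show "(if int l dvd k - wt r i' then g k else 0) = (if i' = i then g k else 0)"
        by simp
    qed simp
    then show "(\<Sum>i'<r. if int l dvd k - wt r i' then g k else 0) = (if inwt r k then g k else 0)"
      by (simp add: inwt_index[OF assms(2) i])
  qed simp
  finally show ?thesis ..
qed

text \<open>A step of 2 along the string changes membership only at its two ends, where k + 1 is r
  or -r.\<close>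

lemma inwt_step:
  assumes "\<not> int l dvd k + 1 - int r" "\<not> int l dvd k + 1 + int r"
  shows "inwt r (k + 2) = inwt r k"
proof
  assume "inwt r (k + 2)"
  then obtain i where i: "i < r" "int l dvd k + 2 - wt r i" by (auto simp: inwt_def)
  have "i \<noteq> r - 1"
  proof
    assume "i = r - 1"
    then have "k + 2 - wt r i = k + 1 + int r" using i(1) by (simp add: wt_def of_nat_diff)
    with i(2) assms(2) show False by simp
  qed
  moreover have "k + 2 - wt r i = k - wt r (Suc i)" by (simp add: wt_def)
  with i(2) have "int l dvd k - wt r (Suc i)" by (simp only:)
  ultimately show "inwt r k" using i(1) unfolding inwt_def by (intro exI[of _ "Suc i"]) auto
next
  assume "inwt r k"
  then obtain i where i: "i < r" "int l dvd k - wt r i" by (auto simp: inwt_def)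
  have "i \<noteq> 0"
  proof
    assume "i = 0"
    then have "k - wt r i = k + 1 - int r" by (simp add: wt_def)
    with i(2) assms(1) show False by simp
  qed
  then obtain i' where i': "i = Suc i'" by (cases i) auto
  then have "k - wt r i = k + 2 - wt r i'" by (simp add: wt_def)
  with i(2) have "int l dvd k + 2 - wt r i'" by (simp only:)
  with i(1) i' show "inwt r (k + 2)" unfolding inwt_def by (intro exI[of _ i']) auto
qed

lemma inwt_top: "0 < r \<Longrightarrow> inwt r (int r - 1)"
  unfolding inwt_def wt_def by (intro exI[of _ 0]) auto

lemma not_inwt_top:
  assumes "r < l"
  shows "\<not> inwt r (int r + 1)"
proof
  assume "inwt r (int r + 1)"
  then obtain i where "i < r" "int l dvd 2 * (int i + 1)"
    by (auto simp: inwt_def wt_def algebra_simps)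
  then have "int l dvd int (i + 1)" by (simp only: coprime_l_2) (simp add: add.commute)
  then have "l dvd i + 1" by presburger
  with \<open>i < r\<close> assms show False by (auto dest: dvd_imp_le)
qed

text \<open>The weights of \<open>V_(r+1)\<close> are those of \<open>V_r\<close> lowered by 1
  together with the new highest weight r. This is the induction step of
  \<open>ff_deriv\<close>.\<close>

lemma inwt_Suc: "inwt (Suc r) k \<longleftrightarrow> inwt r (k + 1) \<or> int l dvd k - int r"
proof -
  have "{..<Suc r} = insert 0 (Suc ` {..<r})" by (auto simp: image_iff less_Suc_eq_0_disj)
  then have "inwt (Suc r) k \<longleftrightarrow> int l dvd k - wt (Suc r) 0 \<or> (\<exists>i<r. int l dvd k - wt (Suc r) (Suc i))"
    unfolding inwt_def by (metis less_Suc_eq_0_disj)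
  moreover have "k - wt (Suc r) (Suc i) = k + 1 - wt r i" for i by (simp add: wt_def)
  moreover have "k - wt (Suc r) 0 = k - int r" by (simp add: wt_def)
  ultimately show ?thesis by (simp only: inwt_def[of r] disj_commute)
qed

text \<open>The sum is the divided difference of \<open>N m k\<close> between x and a.\<close>

lemma bezout_telescope:
  "[:- a, 1:] * (\<Sum>n<m. smult (poly (N (m - 1 - n) (k + 2 * int n + 2)) a) (N n k)) =
    N m k - [:poly (N m k) a:]"
proof (induction m)
  case (Suc m)
  define S where "S m = (\<Sum>n<m. smult (poly (N (m - 1 - n) (k + 2 * int n + 2)) a) (N n k))" for m
  define c where "c = ch (k + 1 + 2 * int m)"
  have "S (Suc m) = smult (a - c) (S m) + N m k"
  proof -
    have "(\<Sum>n<m. smult (poly (N (Suc m - 1 - n) (k + 2 * int n + 2)) a) (N n k)) = smult (a - c) (S m)"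
      unfolding S_def smult_sum_right smult_smult
    proof (rule sum.cong)
      fix n assume "n \<in> {..<m}"
      then have n: "Suc m - 1 - n = Suc (m - 1 - n)"
        "k + 2 * int n + 2 + 1 + 2 * int (m - 1 - n) = k + 1 + 2 * int m"
        by (auto simp: of_nat_diff)
      show "smult (poly (N (Suc m - 1 - n) (k + 2 * int n + 2)) a) (N n k) =
          smult ((a - c) * poly (N (m - 1 - n) (k + 2 * int n + 2)) a) (N n k)"
        unfolding n(1) N_Suc n(2) c_def by (simp add: nd_def algebra_simps)
    qed simp
    then show ?thesis by (simp add: S_def)
  qed
  then have "[:- a, 1:] * S (Suc m) = smult (a - c) ([:- a, 1:] * S m) + [:- a, 1:] * N m k"
    by (simp add: algebra_simps)
  also have "[:- a, 1:] * S m = N m k - [:poly (N m k) a:]" using Suc by (simp add: S_def)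
  also have "smult (a - c) (N m k - [:poly (N m k) a:]) + [:- a, 1:] * N m k =
      N (Suc m) k - [:poly (N (Suc m) k) a:]"
    unfolding N_Suc nd_def c_def[symmetric]
    by (rule poly_eq_poly_eq_iff[THEN iffD1]) (auto simp: algebra_simps)
  finally show ?case by (simp add: S_def)
qed simp

text \<open>As ch r is a root of \<open>PSI\<close>, the divided difference of \<open>PSI\<close>
  there is \<open>PSI\<close> divided by x - ch r. The starting node k is free, which lets the
  Radford image be recognized on every eigenspace of K.\<close>

lemma Psi_newton:
  "Psi r = (\<Sum>n<l. smult (poly (N (l - 1 - n) (k + 2 * int n + 2)) (ch r)) (N n k))"
proof -
  have "poly PSI (ch r) = 0"
    unfolding nd_Psi[of r, symmetric] by (simp add: nd_def)
  then have "nd r * (\<Sum>n<l. smult (poly (N (l - 1 - n) (k + 2 * int n + 2)) (ch r)) (N n k)) = nd r * Psi r"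
    using bezout_telescope[of "ch r" l k] by (simp add: nd_def[symmetric] N_full nd_Psi)
  then show ?thesis by (simp only: mult_cancel_left nd_nonzero if_False) simp
qed

text \<open>
  If none of the last nodes is \<open>\<plusminus>r\<close>, then no boundary of the string of weights of \<open>V\<^sub>r\<close> is crossed.
\<close>

lemma inwt_arc:
  assumes "poly (N m k) (ch (int r)) \<noteq> 0"
  shows "inwt r (k + 2 * int m) = inwt r k"
  using assms
proof (induction m)
  case (Suc m)
  have "inwt r (k + 2 * int m + 2) = inwt r (k + 2 * int m)"
  proof (rule inwt_step)
    have "ch (int r) \<noteq> ch (k + 1 + 2 * int m)" using Suc.prems by (simp add: N_Suc nd_def)
    then have "\<not> int l dvd int r - (k + 1 + 2 * int m)" "\<not> int l dvd int r + (k + 1 + 2 * int m)"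
      by (simp_all add: ch_eq_iff)
    moreover have "k + 2 * int m + 1 - int r = - (int r - (k + 1 + 2 * int m))"
      "k + 2 * int m + 1 + int r = int r + (k + 1 + 2 * int m)"
      by simp_all
    ultimately show "\<not> int l dvd k + 2 * int m + 1 - int r" "\<not> int l dvd k + 2 * int m + 1 + int r"
      by (simp_all only: dvd_minus_iff not_False_eq_True)
  qed
  then show ?case using Suc by (simp add: N_Suc algebra_simps)
qed simp

section \<open>Chebyshev polynomials rearranged into families on Z/l, and their Fourier
  transforms\<close>

definition XX :: "int \<Rightarrow> complex poly"
  where "XX k = (let s = nat (k mod int l) in chebU s + chebU (l - s))"

text \<open>The coefficients l - s and -s make the family odd and let its recursion hold at s = 0 as
  well (see \<open>nd_Mh\<close>). Moreover s \<open>XX\<close> + \<open>uu\<close> is l times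
  \<open>chebU s\<close>, so both families together span the Chebyshev polynomials.\<close>

definition uu :: "int \<Rightarrow> complex poly"
  where "uu k = (let s = nat (k mod int l) in
    smult (of_nat (l - s)) (chebU s) - smult (of_nat s) (chebU (l - s)))"

lemma periodic_XX: "periodic XX" and periodic_uu: "periodic uu"
  by (simp_all add: periodic_def XX_def uu_def)

lemma XX_nat: "s \<le> l \<Longrightarrow> XX (int s) = chebU s + chebU (l - s)"
  by (cases "s = l") (simp_all add: XX_def Let_def)

lemma uu_nat: "s \<le> l \<Longrightarrow> uu (int s) = smult (of_nat (l - s)) (chebU s) - smult (of_nat s) (chebU (l - s))"
  by (cases "s = l") (simp_all add: uu_def Let_def)

lemma residue_cases:
  obtains s where "s < l" "int l dvd k - int s"
proof -
  have "int l dvd k - int (nat (k mod int l))" by (simp add: minus_mod_eq_mult_div)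
  then show thesis using that[of "nat (k mod int l)"] by (simp add: nat_less_iff)
qed

lemma XX_minus: "XX (- k) = XX k" and uu_minus: "uu (- k) = - uu k"
proof -
  obtain s where s: "s < l" "int l dvd k - int s" by (rule residue_cases)
  have "- k - int (l - s) = - (k - int s) - int l" using s(1) by (simp add: of_nat_diff)
  then have "int l dvd - k - int (l - s)" using s(2) by (metis dvd_diff dvd_minus_iff dvd_refl)
  then have "XX (- k) = XX (int (l - s))" "uu (- k) = uu (int (l - s))"
    by (auto intro: periodic_cong periodic_XX periodic_uu)
  moreover have "XX k = XX (int s)" "uu k = uu (int s)"
    using s(2) by (auto intro: periodic_cong periodic_XX periodic_uu)
  ultimately show "XX (- k) = XX k" "uu (- k) = - uu k"
    using s(1) by (simp_all only: XX_nat uu_nat less_imp_le diff_le_self diff_diff_cancel) auto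
qed

lemma chebU_rec: "0 < r \<Longrightarrow> [:0, 1:] * chebU r = chebU (r + 1) + chebU (r - 1)"
  by (cases r) auto

lemma XX_rec:
  assumes "\<not> int l dvd k"
  shows "[:0, 1:] * XX k = XX (k + 1) + XX (k - 1)"
    and "[:0, 1:] * uu k = uu (k + 1) + uu (k - 1) + XX (k + 1) - XX (k - 1)"
proof -
  obtain s where s: "s < l" "int l dvd k - int s" by (rule residue_cases)
  with assms have s0: "0 < s" by (metis gr0I of_nat_0 diff_zero)
  have d: "int l dvd (k + 1) - int (s + 1)" "int l dvd (k - 1) - int (s - 1)"
    using s s0 by (simp_all add: of_nat_diff)
  have X: "XX k = XX (int s)" "XX (k + 1) = XX (int (s + 1))" "XX (k - 1) = XX (int (s - 1))"
    and u: "uu k = uu (int s)" "uu (k + 1) = uu (int (s + 1))" "uu (k - 1) = uu (int (s - 1))"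
    using s d by (auto intro!: periodic_cong periodic_XX periodic_uu simp del: of_nat_add)
  define t where "t = l - s"
  have t: "l - (s + 1) = t - 1" "l - (s - 1) = t + 1" "l - s = t" "0 < t" "s + t = l"
    using s s0 by (auto simp: t_def)
  have c: "(of_nat (t - 1) :: complex) = of_nat t - 1" "(of_nat (s - 1) :: complex) = of_nat s - 1"
    using t s0 by (simp_all add: of_nat_diff)
  have val: "XX (int s) = chebU s + chebU t" "XX (int (s + 1)) = chebU (s + 1) + chebU (t - 1)"
    "XX (int (s - 1)) = chebU (s - 1) + chebU (t + 1)"
    "uu (int s) = smult (of_nat t) (chebU s) - smult (of_nat s) (chebU t)"
    "uu (int (s + 1)) = smult (of_nat t - 1) (chebU (s + 1)) - smult (of_nat s + 1) (chebU (t - 1))"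
    "uu (int (s - 1)) = smult (of_nat t + 1) (chebU (s - 1)) - smult (of_nat s - 1) (chebU (t + 1))"
    using XX_nat[of s] XX_nat[of "s + 1"] XX_nat[of "s - 1"]
      uu_nat[of s] uu_nat[of "s + 1"] uu_nat[of "s - 1"] s(1)
    unfolding t c of_nat_add of_nat_1 by (simp_all only: less_imp_le Suc_leI Suc_eq_plus1[symmetric] less_imp_diff_less)
  show "[:0, 1:] * XX k = XX (k + 1) + XX (k - 1)"
    unfolding X val distrib_left chebU_rec[OF s0] chebU_rec[OF t(4)] by simp
  show "[:0, 1:] * uu k = uu (k + 1) + uu (k - 1) + XX (k + 1) - XX (k - 1)"
    unfolding u X val right_diff_distrib mult_smult_right chebU_rec[OF s0] chebU_rec[OF t(4)]
    by (simp add: smult_add_left smult_diff_left smult_add_right)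
qed

text \<open>In the variable y both sides are y^l + y^(-l) - 2.\<close>

lemma PSI_chebU: "PSI = [:0, 1:] * chebU l - 2 * chebU (l - 1) - 2"
proof (rule poly_eq_by_joukowski)
  fix y :: complex assume y: "y \<noteq> 0" "y - inverse y \<noteq> 0"
  let ?x = "y + inverse y"
  have p: "y ^ l = y ^ (l - 1) * y" "inverse y ^ l = inverse y ^ (l - 1) * inverse y"
    by (simp_all add: power_eq_if)
  have "(?x * poly (chebU l) ?x - 2 * poly (chebU (l - 1)) ?x - 2) * (y - inverse y) =
      ?x * (y ^ l - inverse y ^ l) - 2 * (y ^ (l - 1) - inverse y ^ (l - 1)) - 2 * (y - inverse y)"
    unfolding poly_chebU[OF y(1), symmetric] by (simp add: algebra_simps)
  also have "\<dots> = (y ^ l + inverse y ^ l - 2) * (y - inverse y)"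
  proof -
    have "(y + z) * (a * y - b * z) - 2 * (a - b) - 2 * (y - z) -
        (a * y + b * z - 2) * (y - z) = 2 * (y * z - 1) * (a - b)" for z a b
      by (simp add: algebra_simps)
    from this[of "inverse y" "y ^ (l - 1)" "inverse y ^ (l - 1)"] show ?thesis
      using y(1) unfolding p by simp
  qed
  also have "y ^ l + inverse y ^ l - 2 = inverse y ^ l * (y ^ l - 1)\<^sup>2"
    using y(1) by (simp add: power2_eq_square algebra_simps power_inverse)
  finally have "?x * poly (chebU l) ?x - 2 * poly (chebU (l - 1)) ?x - 2 = poly PSI ?x"
    using y by (simp add: poly_PSI)
  then show "poly PSI ?x = poly ([:0, 1:] * chebU l - 2 * chebU (l - 1) - 2) ?x"
    by simp
qed

lemma dft_shift:
  fixes Y :: "int \<Rightarrow> complex poly"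
  assumes "periodic Y"
  shows "(\<Sum>s\<in>Zl. smult (qp (j * s)) (Y (s + a))) = smult (qp (- (j * a))) (\<Sum>s\<in>Zl. smult (qp (j * s)) (Y s))"
proof -
  have "periodic (\<lambda>s. smult (qp (j * (s - a))) (Y s))"
    using assms unfolding periodic_def
    by (auto intro!: arg_cong2[where f = smult] qp_cong simp: algebra_simps)
  from sum_periodic_shift[OF this, of a]
  have "(\<Sum>s\<in>Zl. smult (qp (j * s)) (Y (s + a))) = (\<Sum>s\<in>Zl. smult (qp (j * (s - a))) (Y s))"
    by simp
  moreover have "qp (j * (s - a)) = qp (- (j * a)) * qp (j * s)" for s
    by (simp add: right_diff_distrib flip: qp_add)
  ultimately show ?thesis by (simp add: smult_sum_right)
qed

text \<open>On Z/l the recursion of \<open>XX\<close> fails only at 0, and there by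
  \<open>PSI\<close>. The Fourier transform turns the shifts into multiplication by ch j, so the
  transform times x - ch j equals \<open>PSI\<close>.\<close>

lemma Psi_dft: "Psi j = (\<Sum>s\<in>Zl. smult (qp (j * s)) (XX s))"
proof -
  let ?S = "\<Sum>s\<in>Zl. smult (qp (j * s)) (XX s)"
  have x: "[:0, 1:] * XX s = XX (s + 1) + XX (s - 1) + (if int l dvd s - 0 then PSI else 0)" for s
  proof (cases "int l dvd s")
    case True
    have s: "XX s = XX 0" "XX (s + 1) = XX 1" "XX (s - 1) = XX (- 1)"
      using True by (auto intro!: periodic_cong periodic_XX)
    have "XX 0 = chebU l" "XX 1 = 1 + chebU (l - 1)"
      using XX_nat[of 0] XX_nat[of 1] l_ge by simp_all
    then show ?thesis using True unfolding s XX_minus PSI_chebU by simp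
  next
    case False
    then show ?thesis using XX_rec(1)[of s] by simp
  qed
  have "[:0, 1:] * ?S = (\<Sum>s\<in>Zl. smult (qp (j * s)) (XX (s + 1))) + (\<Sum>s\<in>Zl. smult (qp (j * s)) (XX (s + - 1)))
      + (\<Sum>s\<in>Zl. if int l dvd s - 0 then smult (qp (j * s)) PSI else 0)"
    unfolding sum_distrib_left mult_smult_right x smult_add_right sum.distrib
    by (simp add: if_distrib[of "smult _"] cong: if_cong)
  also have "(\<Sum>s\<in>Zl. if int l dvd s - 0 then smult (qp (j * s)) PSI else 0) = PSI"
    by (subst sum_Zl_single) (auto simp: periodic_def distrib_left intro!: arg_cong2[where f = smult] qp_cong)
  finally have "[:0, 1:] * ?S = smult (ch j) ?S + PSI"
    unfolding dft_shift[OF periodic_XX] by (simp add: ch_def smult_add_left)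
  then have "nd j * ?S = PSI" by (simp add: nd_def)
  then have "nd j * Psi j = nd j * ?S" by (simp add: nd_Psi)
  then show ?thesis by simp
qed

definition Mh :: "int \<Rightarrow> complex poly"
  where "Mh j = (\<Sum>s\<in>Zl. smult (qp (j * s)) (uu s))"

text \<open>Consequently (x - ch j)^2 \<open>Mh j\<close> is a multiple of \<open>PSI\<close>: for j
  nonzero modulo l, \<open>Mh j\<close> is a generalized eigenvector of the Casimir element above
  the eigenvector \<open>Psi j\<close>.\<close>

lemma nd_Mh: "nd j * Mh j = smult (- br j) (Psi j)"
proof -
  have x: "[:0, 1:] * uu s = uu (s + 1) + uu (s - 1) + XX (s + 1) - XX (s - 1)" for s
  proof (cases "int l dvd s")
    case True
    have s: "uu s = uu 0" "XX (s + 1) = XX 1" "XX (s - 1) = XX (- 1)"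
      "uu (s + 1) = uu 1" "uu (s - 1) = uu (- 1)"
      using True by (auto intro!: periodic_cong periodic_XX periodic_uu)
    have "uu 0 = 0" using uu_nat[of 0] by simp
    then show ?thesis unfolding s XX_minus uu_minus by simp
  next
    case False
    then show ?thesis by (rule XX_rec(2))
  qed
  have "[:0, 1:] * Mh j = (\<Sum>s\<in>Zl. smult (qp (j * s)) (uu (s + 1))) + (\<Sum>s\<in>Zl. smult (qp (j * s)) (uu (s + - 1)))
      + (\<Sum>s\<in>Zl. smult (qp (j * s)) (XX (s + 1))) - (\<Sum>s\<in>Zl. smult (qp (j * s)) (XX (s + - 1)))"
    unfolding Mh_def sum_distrib_left mult_smult_right x smult_add_right smult_diff_right
      sum.distrib sum_subtractf by simp
  then have "[:0, 1:] * Mh j = smult (ch j) (Mh j) - smult (br j) (Psi j)"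
    unfolding dft_shift[OF periodic_uu] dft_shift[OF periodic_XX] Psi_dft[symmetric] Mh_def[symmetric]
    by (simp add: ch_def br_def smult_add_left smult_diff_left algebra_simps)
  then show ?thesis by (simp add: nd_def algebra_simps)
qed

end

context odd_root
begin

text \<open>
  \<open>zc m k\<close> is the coefficient of \<open>d\<^sup>m F\<^sup>m E\<^sup>m e\<^sub>k\<close> in the inverse ribbon element, so \<open>ff k\<close> is the
  polynomial in the Casimir by which that element acts on the \<open>q\<^sup>k\<close>-eigenspace of \<open>K\<close>.
\<close>

definition zc :: "nat \<Rightarrow> int \<Rightarrow> complex"
  where "zc m k = hp (k\<^sup>2 + 2 * k + int m * (int m - 1) + 2 * int m * k + 4 * int m) / bf m"

definition ff :: "int \<Rightarrow> complex poly"
  where "ff k = (\<Sum>m<l. smult (zc m k) (N m k))"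

section \<open>A truncated basic hypergeometric series\<close>

definition Qp :: "nat \<Rightarrow> complex" where "Qp m = qp (2 * int m)"

definition poch :: "complex \<Rightarrow> nat \<Rightarrow> complex"
  where "poch u m = (\<Prod>s<m. 1 - u * Qp s)"

text \<open>The terms of the series 2phi1(u, v; 0) with base and argument q^2. They are meaningful
  for m < l, where the denominator is nonzero.\<close>

definition tq :: "complex \<Rightarrow> complex \<Rightarrow> nat \<Rightarrow> complex"
  where "tq u v m = Qp m * poch u m * poch v m / (\<Prod>s=1..m. 1 - Qp s)"

lemma ch_inverse: "ch k = qp k + inverse (qp k)" and br_inverse: "br k = qp k - inverse (qp k)"
  by (simp_all add: ch_def br_def qp_minus)

lemma qp_2: "qp 2 = q * q"
  using qp_add[of 1 1] by simp

lemma Qp_0 [simp]: "Qp 0 = 1" and Qp_Suc: "Qp (Suc m) = qp 2 * Qp m" and Qp_nonzero [simp]: "Qp m \<noteq> 0"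
  by (simp_all add: Qp_def distrib_left flip: qp_add)

lemma Qp_neq_1: "0 < m \<Longrightarrow> m < l \<Longrightarrow> 1 - Qp m \<noteq> 0"
proof -
  assume m: "0 < m" "m < l"
  have "1 - Qp m = - qp (int m) * br (int m)"
    by (simp add: Qp_def br_def algebra_simps flip: qp_add)
  then show ?thesis using br_nonzero[OF m] by simp
qed

lemma tq_0 [simp]: "tq u v 0 = 1"
  by (simp add: tq_def poch_def)

lemma tq_Suc:
  assumes "Suc m < l"
  shows "tq u v (Suc m) * (1 - Qp (Suc m)) = qp 2 * (1 - u * Qp m) * (1 - v * Qp m) * tq u v m"
proof -
  have "1 - Qp (Suc m) \<noteq> 0" using Qp_neq_1[of "Suc m"] assms by simp
  then show ?thesis by (simp add: tq_def poch_def Qp_Suc[of m])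
qed

text \<open>By \<open>tq_shift\<close> the summand is (1 - v) \<open>tq u v n\<close> plus the
  change of \<open>tq u v (n + 1)\<close> when u is divided by q^2. The closed form is therefore the
  shift equation of \<open>Gq\<close> up to its last term.\<close>

lemma tq_telescope:
  assumes "m < l"
  shows "(\<Sum>n<m. ((1 - v) - u * (1 - v * Qp n)) * tq u v n) = (1 - Qp m) / Qp m * tq u v m"
  using assms
proof (induction m)
  case (Suc m)
  have "(1 - Qp (Suc m)) / Qp (Suc m) * tq u v (Suc m) =
      (tq u v (Suc m) * (1 - Qp (Suc m))) / Qp (Suc m)"
    by simp
  also have "\<dots> = (1 - u * Qp m) * (1 - v * Qp m) * tq u v m / Qp m"
    unfolding tq_Suc[OF Suc.prems] by (simp add: Qp_Suc[of m])
  finally have 1: "(1 - Qp (Suc m)) / Qp (Suc m) * tq u v (Suc m) =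
      (1 - u * Qp m) * (1 - v * Qp m) * tq u v m / Qp m" .
  have "(1 - Q) / Q * t + ((1 - v) - u * (1 - v * Q)) * t = (1 - u * Q) * (1 - v * Q) * t / Q"
    if "Q \<noteq> 0" for Q t
    using that by (simp add: field_simps)
  then show ?case using Suc unfolding 1 by simp
qed simp

lemma poch_shift: "poch (u / qp 2) (Suc m) = (1 - u / qp 2) * poch u m"
proof (induction m)
  case (Suc m)
  have "u / qp 2 * Qp (Suc m) = u * Qp m" by (simp add: Qp_Suc)
  then show ?case using Suc by (simp add: poch_def)
qed (simp add: poch_def)

lemma tq_shift:
  assumes "Suc m < l"
  shows "tq (u / qp 2) v (Suc m) - tq u v (Suc m) = - u * (1 - v * Qp m) * tq u v m"
proof -
  have 1: "1 - Qp (Suc m) \<noteq> 0" using Qp_neq_1[of "Suc m"] assms by simp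
  have "tq (u / qp 2) v (Suc m) - tq u v (Suc m) =
      Qp (Suc m) * ((1 - u / qp 2) - (1 - u * Qp m)) * poch u m * poch v (Suc m) / (\<Prod>s=1..Suc m. 1 - Qp s)"
  proof -
    have "tq (u / qp 2) v (Suc m) =
        Qp (Suc m) * (1 - u / qp 2) * poch u m * poch v (Suc m) / (\<Prod>s=1..Suc m. 1 - Qp s)"
      unfolding tq_def poch_shift by (simp only: mult.assoc)
    moreover have "tq u v (Suc m) =
        Qp (Suc m) * (1 - u * Qp m) * poch u m * poch v (Suc m) / (\<Prod>s=1..Suc m. 1 - Qp s)"
      unfolding tq_def poch_def[of u] prod.lessThan_Suc by (simp only: mult_ac)
    ultimately show ?thesis by (simp only: diff_divide_distrib right_diff_distrib left_diff_distrib)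
  qed
  also have "Qp (Suc m) * ((1 - u / qp 2) - (1 - u * Qp m)) = - u * Qp m * (1 - Qp (Suc m))"
    unfolding Qp_Suc[of m] by (simp add: field_simps)
  also have "- u * Qp m * (1 - Qp (Suc m)) * poch u m * poch v (Suc m) / (\<Prod>s=1..Suc m. 1 - Qp s) =
      - u * (1 - v * Qp m) * tq u v m"
    using 1 by (simp add: tq_def poch_def)
  finally show ?thesis .
qed

lemma poch_full: "v \<noteq> 0 \<Longrightarrow> poch v l = 1 - v ^ l"
proof -
  assume v: "v \<noteq> 0"
  have "(\<Prod>s<l. [:- Qp s, 1:]) = monom 1 l - 1"
    using prod_roots[of "\<lambda>s. qp (0 + 2 * int s)"] inj_qp_even[of 0] qp_pow_l by (simp add: Qp_def)
  from arg_cong[OF this, of "\<lambda>p. poly p (inverse v)"]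
  have "(\<Prod>s<l. inverse v - Qp s) = inverse v ^ l - 1"
    by (simp add: poly_prod poly_monom)
  then have "v ^ l * (\<Prod>s<l. inverse v - Qp s) = v ^ l * (inverse v ^ l - 1)" by simp
  also have "v ^ l * (\<Prod>s<l. inverse v - Qp s) = (\<Prod>s<l. v * (inverse v - Qp s))"
    by (simp add: prod.distrib)
  also have "\<dots> = poch v l" unfolding poch_def using v by (intro prod.cong) (simp_all add: right_diff_distrib)
  also have "v ^ l * (inverse v ^ l - 1) = 1 - v ^ l" using v by (simp add: right_diff_distrib power_inverse)
  finally show ?thesis .
qed

definition Gq :: "complex \<Rightarrow> complex \<Rightarrow> complex" where "Gq u v = (\<Sum>m<l. tq u v m)"

text \<open>
  Without truncation at \<open>l\<close>, \<open>Gq (q\<^sup>a) (q\<^sup>b)\<close> would be \<open>q\<^sup>-\<^sup>a\<^sup>b\<^sup>/\<^sup>2\<close>, which is multiplied by \<open>q\<^sup>b\<close> when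
  \<open>a\<close> is lowered by 2; the second summand comes from the truncation.
\<close>

lemma Gq_shift:
  assumes "v \<noteq> 0"
  shows "Gq (u / qp 2) v = v * Gq u v + poch u (l - 1) * (1 - v ^ l) / of_nat l"
proof -
  let ?t = "tq u v (l - 1)"
  have l1: "l = Suc (l - 1)" using l_ge by simp
  have split: "(\<Sum>m<l. g m) = g 0 + (\<Sum>m<l-1. g (Suc m))" for g :: "nat \<Rightarrow> complex"
    by (subst l1) (rule sum.lessThan_Suc_shift)
  have "Gq (u / qp 2) v - Gq u v = (\<Sum>m<l-1. tq (u / qp 2) v (Suc m) - tq u v (Suc m))"
    unfolding Gq_def split by (simp add: sum_subtractf)
  also have "\<dots> = (\<Sum>m<l-1. ((1 - v) - u * (1 - v * Qp m)) * tq u v m - (1 - v) * tq u v m)"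
  proof (rule sum.cong)
    fix m assume "m \<in> {..<l-1}"
    then have "Suc m < l" by auto
    then show "tq (u / qp 2) v (Suc m) - tq u v (Suc m) =
        ((1 - v) - u * (1 - v * Qp m)) * tq u v m - (1 - v) * tq u v m"
      by (simp add: tq_shift left_diff_distrib)
  qed simp
  also have "\<dots> = (1 - Qp (l - 1)) / Qp (l - 1) * ?t - (1 - v) * (\<Sum>m<l-1. tq u v m)"
    using tq_telescope[of "l - 1" v u] by (simp add: sum_subtractf sum_distrib_left)
  also have "(\<Sum>m<l-1. tq u v m) = Gq u v - ?t"
    unfolding Gq_def using sum.lessThan_Suc[of "tq u v" "l - 1"] l1 by (simp only: add_diff_cancel)
  also have Q: "Qp (l - 1) = inverse (qp 2)"
  proof -
    have "Qp (l - 1) * qp 2 = qp (2 * int l)"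
      unfolding Qp_def using l_ge by (simp add: of_nat_diff algebra_simps flip: qp_add)
    also have "\<dots> = 1" by (simp add: qp_eq_1_iff)
    finally show ?thesis by (simp add: field_simps)
  qed
  finally have "Gq (u / qp 2) v = v * Gq u v + (qp 2 - v) * ?t"
    by (simp add: field_simps)
  also have "(qp 2 - v) * ?t = poch u (l - 1) * ((1 - v * Qp (l - 1)) * poch v (l - 1)) / of_nat l"
    using prod_one_minus_qp unfolding tq_def Q by (simp add: Qp_def field_simps)
  also have "(1 - v * Qp (l - 1)) * poch v (l - 1) = poch v l"
    unfolding poch_def using prod.lessThan_Suc[of "\<lambda>s. 1 - v * Qp s" "l - 1"] l1
    by (simp only: mult.commute)
  finally show ?thesis by (simp add: poch_full[OF assms])
qed

text \<open>With a = q^(k+1+2m) the two new Pochhammer factors multiply to (1 - a/y)(1 - a y) = -a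
  (x - ch (k + 1 + 2m)). The exponent in \<open>zc\<close> is what compensates the factors -a and
  the denominators.\<close>

lemma zc_term:
  assumes "y \<noteq> 0" "m < l"
  shows "zc m k * poly (N m k) (y + inverse y) = hp (k\<^sup>2 + 2 * k) * tq (qp (k + 1) / y) (qp (k + 1) * y) m"
  using assms(2)
proof (induction m)
  case 0
  then show ?case by (simp add: zc_def)
next
  case (Suc m)
  let ?x = "y + inverse y" and ?w = "qp (k + 1)"
  define a where "a = ?w * Qp m"
  have a: "a = qp (k + 1 + 2 * int m)" by (simp add: a_def Qp_def qp_add)
  have brn: "br (int (Suc m)) \<noteq> 0" using br_nonzero[of "Suc m"] Suc.prems by simp
  have 1: "1 - Qp (Suc m) \<noteq> 0" using Qp_neq_1[of "Suc m"] Suc.prems by simp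
  have Q1: "1 - Qp (Suc m) = - qp (int (Suc m)) * br (int (Suc m))"
    by (simp add: Qp_def br_def algebra_simps flip: qp_add)
  have z: "zc (Suc m) k = zc m k * (qp (k + int m + 2) / br (int (Suc m)))"
  proof -
    have e: "k\<^sup>2 + 2 * k + int (Suc m) * (int (Suc m) - 1) + 2 * int (Suc m) * k + 4 * int (Suc m) =
        (k\<^sup>2 + 2 * k + int m * (int m - 1) + 2 * int m * k + 4 * int m) + 2 * (k + int m + 2)"
      by (simp add: algebra_simps)
    show ?thesis unfolding zc_def e hp_add hp_double bf_Suc by simp
  qed
  have x: "(1 - a / y) * (1 - a * y) = - a * (?x - ch (k + 1 + 2 * int m))"
    using assms(1) unfolding a ch_inverse by (simp add: field_simps)
  have "zc (Suc m) k * poly (N (Suc m) k) ?x * (1 - Qp (Suc m)) =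
      (zc m k * poly (N m k) ?x) * (- qp (k + int m + 2) * qp (int (Suc m)) * (?x - ch (k + 1 + 2 * int m)))"
    unfolding z Q1 using brn by (simp add: N_Suc nd_def field_simps del: of_nat_Suc)
  also have "qp (k + int m + 2) * qp (int (Suc m)) = qp 2 * a"
    by (simp add: Qp_def a algebra_simps flip: qp_add)
  then have "- qp (k + int m + 2) * qp (int (Suc m)) * (?x - ch (k + 1 + 2 * int m)) =
      qp 2 * (1 - ?w / y * Qp m) * (1 - ?w * y * Qp m)"
  proof -
    have "qp 2 * (1 - ?w / y * Qp m) * (1 - ?w * y * Qp m) = qp 2 * ((1 - a / y) * (1 - a * y))"
      by (simp add: a_def mult_ac)
    then show ?thesis
      using \<open>qp (k + int m + 2) * qp (int (Suc m)) = qp 2 * a\<close> unfolding x by (simp add: mult_ac)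
  qed
  also have "(zc m k * poly (N m k) ?x) * \<dots> = hp (k\<^sup>2 + 2 * k) * (tq (?w / y) (?w * y) (Suc m) * (1 - Qp (Suc m)))"
    using Suc unfolding tq_Suc[OF Suc.prems] by (simp add: mult_ac)
  finally show ?case using 1 by simp
qed

lemma ff_Gq:
  "y \<noteq> 0 \<Longrightarrow> poly (ff k) (y + inverse y) = hp (k\<^sup>2 + 2 * k) * Gq (qp (k + 1) / y) (qp (k + 1) * y)"
  unfolding ff_def Gq_def poly_sum sum_distrib_left
  by (rule sum.cong) (simp_all add: zc_term)

text \<open>Passing from (k, y) to (k - 1, q y) keeps v = q^(k+1) y and divides u = q^(k+1) / y by
  q^2, so \<open>Gq_shift\<close> applies.\<close>

lemma ff_shift:
  assumes "y \<noteq> 0"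
  shows "poly (ff (k - 1)) (q * y + inverse (q * y)) = hp 1 * (y * poly (ff k) (y + inverse y)) +
    hp (k\<^sup>2 - 1) * (poch (qp (k + 1) * inverse y) (l - 1) * (1 - (qp (k + 1) * y) ^ l) / of_nat l)"
proof -
  have q: "qp k / (q * y) = qp (k + 1) / y / qp 2" "qp k * (q * y) = qp (k + 1) * y"
    using assms by (simp_all add: qp_2 qp_add)
  have e1: "(k - 1)\<^sup>2 + 2 * (k - 1) = k\<^sup>2 - 1" by (simp add: power2_eq_square algebra_simps)
  have e2: "hp (k\<^sup>2 - 1) * qp (k + 1) = hp 1 * hp (k\<^sup>2 + 2 * k)"
    unfolding hp_double[symmetric] hp_add[symmetric] by (simp add: algebra_simps)
  have "poly (ff (k - 1)) (q * y + inverse (q * y)) =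
      hp (k\<^sup>2 - 1) * Gq (qp (k + 1) / y / qp 2) (qp (k + 1) * y)"
    using ff_Gq[of "q * y" "k - 1"] assms unfolding e1 by (simp add: q)
  also have "\<dots> = (hp (k\<^sup>2 - 1) * qp (k + 1)) * y * Gq (qp (k + 1) / y) (qp (k + 1) * y) +
     hp (k\<^sup>2 - 1) * (poch (qp (k + 1) / y) (l - 1) * (1 - (qp (k + 1) * y) ^ l) / of_nat l)"
    using assms by (subst Gq_shift) (simp_all add: algebra_simps)
  finally show ?thesis unfolding e2 using ff_Gq[OF assms, of k] by (simp add: divide_inverse mult_ac)
qed

text \<open>At y = q^j the truncation term contains 1 - 1, so each shift only multiplies the value
  by q^(j + 1/2).\<close>

lemma ff_value_aux: "poly (ff k) (ch j) * hp (- (j\<^sup>2)) = poly (ff (k - int n)) (ch (j + int n)) * hp (- ((j + int n)\<^sup>2))"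
proof (induction n)
  case (Suc n)
  define k' j' where "k' = k - int n" and "j' = j + int n"
  have "(qp (k' + 1) * qp j') ^ l = 1" by (simp add: qp_pow_l flip: qp_add)
  moreover have "q * qp j' = qp (j' + 1)" by (simp add: qp_add)
  ultimately have "poly (ff (k' - 1)) (ch (j' + 1)) = hp 1 * (qp j' * poly (ff k') (ch j'))"
    using ff_shift[of "qp j'" k'] unfolding ch_inverse by (simp del: inverse_mult_distrib)
  moreover have "hp 1 * qp j' * hp (- ((j' + 1)\<^sup>2)) = hp (- (j'\<^sup>2))"
    unfolding hp_double[symmetric] hp_add[symmetric] by (simp add: power2_eq_square algebra_simps)
  ultimately have "poly (ff (k' - 1)) (ch (j' + 1)) * hp (- ((j' + 1)\<^sup>2)) = poly (ff k') (ch j') * hp (- (j'\<^sup>2))"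
    by (simp add: mult_ac)
  moreover have "k - int (Suc n) = k' - 1" "j + int (Suc n) = j' + 1" by (simp_all add: k'_def j'_def)
  ultimately show ?case using Suc by (simp only: k'_def j'_def)
qed simp

text \<open>Here u = 1, and only the term m = 0 survives.\<close>

lemma ff_value_node: "poly (ff k) (ch (k + 1)) = hp (k\<^sup>2 + 2 * k)"
proof -
  have "Gq 1 v = 1" for v
  proof -
    have "tq 1 v m = 0" if "m > 0" for m
      using that by (auto simp: tq_def poch_def intro!: bexI[of _ 0])
    then have "Gq 1 v = (\<Sum>m<l. if m = 0 then 1 else 0)"
      unfolding Gq_def by (intro sum.cong) auto
    then show ?thesis by simp
  qed
  then show ?thesis using ff_Gq[of "qp (k + 1)" k] unfolding ch_inverse by simp
qed

text \<open>On the diagonal through (k, j) some pair (k - n, j + n) satisfies j + n = k - n + 1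
  modulo l, where the value is known. That the result is free of k reflects that the inverse ribbon
  element acts on \<open>V_j\<close> by a scalar.\<close>

lemma ff_value: "poly (ff k) (ch j) = hp (j\<^sup>2 - 1)"
proof -
  define x where "x = int (h + 1) * (k + 1 - j)"
  define n where "n = nat (x mod int l)"
  define k' j' where "k' = k - int n" and "j' = j + int n"
  have "int n = x - int l * (x div int l)" by (simp add: n_def minus_mult_div_eq_mod)
  then have "j' - (k' + 1) = int l * (k + 1 - j - 2 * (x div int l))"
    by (simp add: k'_def j'_def x_def l_eq algebra_simps)
  then have d: "int l dvd j' - (k' + 1)" by simp
  then have "int l dvd - (j'\<^sup>2) - - ((k' + 1)\<^sup>2)"
  proof -
    have "- (j'\<^sup>2) - - ((k' + 1)\<^sup>2) = (j' - (k' + 1)) * - (j' + (k' + 1))"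
      by (simp add: power2_eq_square algebra_simps)
    then show ?thesis using d by (metis dvd_mult2)
  qed
  then have "poly (ff k) (ch j) * hp (- (j\<^sup>2)) = poly (ff k') (ch (k' + 1)) * hp (- ((k' + 1)\<^sup>2))"
    using ff_value_aux[of k j n] ch_cong[OF d] hp_cong unfolding k'_def j'_def by metis
  also have "\<dots> = hp (- 1)"
    unfolding ff_value_node hp_add[symmetric] by (simp add: power2_eq_square algebra_simps)
  finally have "poly (ff k) (ch j) * hp (- (j\<^sup>2)) * hp (j\<^sup>2) = hp (- 1) * hp (j\<^sup>2)" by simp
  then show ?thesis by (simp add: mult.assoc flip: hp_add)
qed

text \<open>Among the factors 1 - q^(a+2s), s in Z/l, exactly one is zero, and the product omits s =
  l - 1. It is nonzero only if the omitted factor is the vanishing one.\<close>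

lemma poch_unity: "poch (qp a) (l - 1) = (if int l dvd a - 2 then of_nat l else 0)"
proof (cases "int l dvd a - 2")
  case True
  then have "qp a = qp 2" by (rule qp_cong)
  then have "poch (qp a) (l - 1) = (\<Prod>s<l-1. 1 - qp (2 * int (Suc s)))"
    unfolding poch_def Qp_def by (intro prod.cong) (simp_all add: distrib_left flip: qp_add)
  also have "\<dots> = (\<Prod>s=1..l-1. 1 - qp (2 * int s))"
    by (rule prod.reindex_bij_witness[of _ "\<lambda>s. s - 1" Suc]) auto
  finally show ?thesis using True prod_one_minus_qp by simp
next
  case False
  obtain i where i: "i < l" "int l dvd a - wt 1 i" by (rule weight_index)
  have "i \<noteq> l - 1"
  proof
    assume "i = l - 1"
    then have "a - wt 1 i = (a - 2) + int l * 2" using l_ge by (simp add: wt_def of_nat_diff)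
    then have "int l dvd (a - 2) + int l * 2" using i(2) by (simp only:)
    then have "int l dvd a - 2" by (metis dvd_add_left_iff dvd_triv_left)
    with False show False ..
  qed
  then have "i < l - 1" using i(1) by simp
  moreover have "qp a * Qp i = 1"
    using i(2) by (simp add: Qp_def wt_def qp_eq_1_iff flip: qp_add)
  ultimately have "poch (qp a) (l - 1) = 0" unfolding poch_def by (intro prod_zero) auto
  then show ?thesis using False by simp
qed

section \<open>Derivatives of the inverse ribbon polynomials at the Casimir eigenvalues\<close>

definition dff :: "int \<Rightarrow> int \<Rightarrow> complex"
  where "dff k j = poly (pderiv (ff k)) (ch j) * br j"

lemma poly_joukowski_deriv:
  assumes "y \<noteq> 0"
  shows "((\<lambda>y. poly p (y + inverse y)) has_field_derivative
    poly (pderiv p) (y + inverse y) * (1 - inverse y * inverse y)) (at y)"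
  using assms
  by (auto intro!: derivative_eq_intros DERIV_chain2[OF poly_DERIV] simp: power2_eq_square)

text \<open>This is \<open>ff_shift\<close> differentiated by y d/dy at y = q^j; \<open>dff\<close>
  appears because y d/dy (y + 1/y) = y - 1/y is \<open>br j\<close>. In the truncation term only the
  derivative of 1 - (q^(k+1) y)^l survives, and \<open>poch_unity\<close> evaluates its
  cofactor.\<close>

lemma dff_step:
  "dff (k - 1) (j + 1) = hp (1 + 2 * j) * (hp (j\<^sup>2 - 1) + dff k j) -
    hp (k\<^sup>2 - 1) * (if int l dvd k - 1 - j then of_nat l else 0)"
proof -
  define y where "y = qp j"
  define w where "w = qp (k + 1)"
  \<comment> \<open>\<open>poch\<close> as a polynomial in u, so that it can be
    differentiated.\<close>
  define A :: "complex poly" where "A = (\<Prod>s<l-1. [:1, - Qp s:])"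
  have A: "poly A u = poch u (l - 1)" for u
    unfolding A_def poch_def poly_prod by (simp add: mult.commute)
  have y [simp]: "y \<noteq> 0" by (simp add: y_def)
  define f where "f y = poly (ff (k - 1)) (q * y + inverse (q * y))" for y
  define g where "g y = hp 1 * (y * poly (ff k) (y + inverse y)) +
    hp (k\<^sup>2 - 1) * (poly A (w * inverse y) * (1 - (w * y) ^ l) / of_nat l)" for y
  have fg: "f z = g z" if "z \<noteq> 0" for z
    unfolding f_def g_def A w_def by (rule ff_shift[OF that])
  have qy: "q * y = qp (j + 1)"
    by (simp add: y_def qp_add)
  define D where "D = poly (pderiv (ff (k - 1))) (ch (j + 1))"
  have f': "(f has_field_derivative D * (1 - inverse (q * y) * inverse (q * y)) * q) (at y)"
  proof -
    have "((\<lambda>y. poly (ff (k - 1)) (y + inverse y)) has_field_derivative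
        D * (1 - inverse (q * y) * inverse (q * y))) (at (q * y))"
      using poly_joukowski_deriv[of "q * y" "ff (k - 1)"] unfolding qy D_def ch_inverse by simp
    moreover have "((\<lambda>y. q * y) has_field_derivative q) (at y)"
      by (auto intro!: derivative_eq_intros)
    ultimately show ?thesis unfolding f_def by (rule DERIV_chain2)
  qed
  define D' where "D' = poly (pderiv (ff k)) (ch j)"
  have p: "((\<lambda>y. poly (ff k) (y + inverse y)) has_field_derivative
      D' * (1 - inverse y * inverse y)) (at y)"
    using poly_joukowski_deriv[of y "ff k"] unfolding D'_def ch_inverse y_def by simp
  obtain B where B: "((\<lambda>y. poly A (w * inverse y)) has_field_derivative B) (at y)"
  proof
    show "((\<lambda>y. poly A (w * inverse y)) has_field_derivative
        poly (pderiv A) (w * inverse y) * (w * - (inverse y * inverse y))) (at y)"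
      by (rule DERIV_chain2[OF poly_DERIV]) (auto intro!: derivative_eq_intros simp: power2_eq_square)
  qed
  have wl: "(w * y) ^ l = 1" by (simp add: w_def y_def qp_pow_l flip: qp_add)
  have wl1: "(w * y) ^ (l - Suc 0) * w * y = 1"
    using wl by (metis One_nat_def Suc_pred l_pos(1) mult.assoc power_Suc2)
  have g': "(g has_field_derivative
      hp 1 * (poly (ff k) (ch j) + y * (D' * (1 - inverse y * inverse y))) +
      hp (k\<^sup>2 - 1) * (poly A (w * inverse y) * - ((w * y) ^ (l - Suc 0) * w))) (at y)"
  proof -
    have C: "((\<lambda>y. 1 - (w * y) ^ l) has_field_derivative - (of_nat l * (w * y) ^ (l - Suc 0) * w)) (at y)"
      by (auto intro!: derivative_eq_intros)
    have ch: "poly (ff k) (y + inverse y) = poly (ff k) (ch j)" by (simp add: ch_inverse y_def)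
    show ?thesis unfolding g_def
      using DERIV_add[OF DERIV_cmult[OF DERIV_mult[OF DERIV_ident p], of "hp 1"]
        DERIV_cmult[OF DERIV_cdivide[OF DERIV_mult[OF B C], of "of_nat l"], of "hp (k\<^sup>2 - 1)"]]
      by (rule DERIV_cong) (simp add: ch wl mult_ac add_ac)
  qed
  have "(f has_field_derivative D * (1 - inverse (q * y) * inverse (q * y)) * q) (at y) \<longleftrightarrow>
      (g has_field_derivative D * (1 - inverse (q * y) * inverse (q * y)) * q) (at y)"
  \<comment> \<open>The identity \<open>fg\<close> holds for nonzero arguments, hence near
    y.\<close>
  proof (rule DERIV_cong_ev)
    have "\<forall>\<^sub>F z in nhds y. z \<noteq> 0"
      by (rule tendsto_imp_eventually_ne[where c = y]) (simp_all add: filterlim_ident)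
    then show "\<forall>\<^sub>F z in nhds y. f z = g z" by eventually_elim (rule fg)
  qed simp_all
  with f' have "(g has_field_derivative D * (1 - inverse (q * y) * inverse (q * y)) * q) (at y)" by simp
  from DERIV_unique[OF this g']
  have "y * (D * (1 - inverse (q * y) * inverse (q * y)) * q) =
      y * (hp 1 * (poly (ff k) (ch j) + y * (D' * (1 - inverse y * inverse y))) +
      hp (k\<^sup>2 - 1) * (poly A (w * inverse y) * - ((w * y) ^ (l - Suc 0) * w)))"
    by simp
  moreover have "y * (D * (1 - inverse (q * y) * inverse (q * y)) * q) = dff (k - 1) (j + 1)"
  proof -
    have "y * (D * (1 - i * i) * q) = D * (q * y - (q * y) * i * i)" for i
      by (simp add: algebra_simps)
    then have "y * (D * (1 - inverse (q * y) * inverse (q * y)) * q) =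
        D * (q * y - (q * y) * inverse (q * y) * inverse (q * y))" .
    also have "(q * y) * inverse (q * y) = 1" by (rule right_inverse) simp
    also have "D * (q * y - 1 * inverse (q * y)) = D * (q * y - inverse (q * y))" by (simp only: mult_1)
    finally show ?thesis unfolding qy dff_def D_def br_inverse .
  qed
  moreover have "y * (hp 1 * (poly (ff k) (ch j) + y * (D' * (1 - inverse y * inverse y))) +
      hp (k\<^sup>2 - 1) * (poly A (w * inverse y) * - ((w * y) ^ (l - Suc 0) * w))) =
      hp 1 * y * (hp (j\<^sup>2 - 1) + dff k j) - hp (k\<^sup>2 - 1) * poly A (w * inverse y)"
  proof -
    have "y * (hp 1 * (poly (ff k) (ch j) + y * (D' * (1 - inverse y * inverse y))) +
      hp (k\<^sup>2 - 1) * (poly A (w * inverse y) * - ((w * y) ^ (l - Suc 0) * w))) =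
      hp 1 * y * (poly (ff k) (ch j) + D' * (y - y * inverse y * inverse y)) -
      hp (k\<^sup>2 - 1) * poly A (w * inverse y) * ((w * y) ^ (l - Suc 0) * w * y)"
      by (simp add: algebra_simps)
    also have "D' * (y - y * inverse y * inverse y) = dff k j"
      unfolding dff_def D'_def br_inverse y_def by simp
    finally show ?thesis unfolding wl1 ff_value by simp
  qed
  moreover have "poly A (w * inverse y) = (if int l dvd k - 1 - j then of_nat l else 0)"
  proof -
    have "w * inverse y = qp (k + 1 - j)" by (simp add: w_def y_def qp_diff divide_inverse)
    then show ?thesis using poch_unity[of "k + 1 - j"] by (simp add: A algebra_simps)
  qed
  moreover have "hp 1 * y = hp (1 + 2 * j)" by (simp add: y_def hp_add hp_double)
  ultimately show ?thesis by simp
qed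

text \<open>Induction on j along \<open>dff_step\<close>, starting from \<open>br 0\<close> = 0.
  Each step raises the first summand by 1, and the truncation term subtracts l when k is j modulo l,
  which is the highest weight that \<open>V_(j+1)\<close> adds to the lowered weights of
  \<open>V_j\<close>.\<close>

lemma ff_deriv:
  assumes "j < l"
  shows "poly (pderiv (ff k)) (ch (int j)) * br (int j) =
    hp ((int j)\<^sup>2 - 1) * (of_nat j - (if inwt j k then of_nat l else 0))"
proof -
  have "dff k (int j) = hp ((int j)\<^sup>2 - 1) * (of_nat j - (if inwt j k then of_nat l else 0))"
    using assms
  proof (induction j arbitrary: k)
    case 0
    then show ?case by (simp add: dff_def)
  next
    case (Suc j)
    have h: "hp (1 + 2 * int j) * hp ((int j)\<^sup>2 - 1) = hp ((int (Suc j))\<^sup>2 - 1)"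
      unfolding hp_add[symmetric] by (simp add: power2_eq_square algebra_simps)
    have s: "(k + 1) - 1 - int j = k - int j" "k + 1 - 1 = k" "int j + 1 = int (Suc j)"
      by simp_all
    have m: "hp ((k + 1)\<^sup>2 - 1) = hp ((int (Suc j))\<^sup>2 - 1)" if "int l dvd k - int j"
    proof (rule hp_cong)
      have "((k + 1)\<^sup>2 - 1) - ((int (Suc j))\<^sup>2 - 1) = (k - int j) * (k + int j + 2)"
        by (simp add: power2_eq_square algebra_simps)
      then show "int l dvd ((k + 1)\<^sup>2 - 1) - ((int (Suc j))\<^sup>2 - 1)" using that by (metis dvd_mult2)
    qed
    \<comment> \<open>The two cases of \<open>inwt_Suc\<close> exclude each other; otherwise l would
      be subtracted twice.\<close>
    have excl: "\<not> (inwt j (k + 1) \<and> int l dvd k - int j)"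
    proof
      assume a: "inwt j (k + 1) \<and> int l dvd k - int j"
      then have "inwt j (k + 1) = inwt j (int j + 1)" by (intro inwt_cong) simp
      then show False using a not_inwt_top[of j] Suc.prems by simp
    qed
    have "dff k (int (Suc j)) = hp (1 + 2 * int j) * (hp ((int j)\<^sup>2 - 1) + dff (k + 1) (int j)) -
        hp ((k + 1)\<^sup>2 - 1) * (if int l dvd k - int j then of_nat l else 0)"
      using dff_step[of "k + 1" "int j"] unfolding s .
    also have "\<dots> = hp ((int (Suc j))\<^sup>2 - 1) * (of_nat (Suc j) - (if inwt j (k + 1) then of_nat l else 0))
        - hp ((k + 1)\<^sup>2 - 1) * (if int l dvd k - int j then of_nat l else 0)"
    proof -
      define b :: complex where "b = (if inwt j (k + 1) then of_nat l else 0)"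
      have IH: "dff (k + 1) (int j) = hp ((int j)\<^sup>2 - 1) * (of_nat j - b)"
        using Suc.IH[of "k + 1"] Suc.prems by (simp add: b_def)
      show ?thesis unfolding h[symmetric] b_def[symmetric] IH by (simp add: algebra_simps)
    qed
    also have "\<dots> = hp ((int (Suc j))\<^sup>2 - 1) * (of_nat (Suc j) - (if inwt (Suc j) k then of_nat l else 0))"
      using m excl unfolding inwt_Suc by (auto simp: algebra_simps simp del: of_nat_Suc)
    finally show ?case .
  qed
  then show ?thesis by (simp add: dff_def)
qed

end

section \<open>Evaluation of polynomials in a complex algebra\<close>

definition aev :: "'a::complex_algebra_1 \<Rightarrow> complex poly \<Rightarrow> 'a"
  where "aev x p = fold_coeffs (\<lambda>a b. a *\<^sub>C 1 + x * b) p 0"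

lemma aev_0 [simp]: "aev x 0 = 0"
  by (simp add: aev_def)

lemma aev_pCons: "aev x (pCons a p) = a *\<^sub>C 1 + x * aev x p"
  by (cases "p = 0 \<and> a = 0") (auto simp: aev_def)

lemma aev_1 [simp]: "aev x 1 = 1"
  by (simp add: one_pCons aev_pCons scaleC_one)

lemma aev_add: "aev x (p + r) = aev x p + aev x r"
  by (induction p r rule: poly_induct2) (simp_all add: aev_pCons scaleC_add_left algebra_simps)

lemma aev_smult: "aev x (smult c p) = c *\<^sub>C aev x p"
  by (induction p) (simp_all add: aev_pCons scaleC_add_right scaleC_scaleC mult_scaleC_right)

lemma aev_minus: "aev x (- p) = - aev x p"
  using aev_smult[of x "-1" p] by (simp add: scaleC_one)

lemma aev_diff: "aev x (p - r) = aev x p - aev x r"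
  using aev_add[of x p "- r"] by (simp add: aev_minus)

lemma aev_sum: "aev x (\<Sum>i\<in>A. f i) = (\<Sum>i\<in>A. aev x (f i))"
  by (induction A rule: infinite_finite_induct) (simp_all add: aev_add)

lemma aev_mult: "aev x (p * r) = aev x p * aev x r"
  by (induction p) (simp_all add: aev_pCons aev_add aev_smult distrib_right mult_scaleC_left mult.assoc)

lemma aev_commute:
  assumes "x * y = y * x"
  shows "aev x p * y = y * aev x p"
proof (induction p)
  case (pCons a p)
  have "x * aev x p * y = y * (x * aev x p)"
    by (simp only: mult.assoc pCons) (simp only: assms mult.assoc[symmetric])
  then show ?case
    by (simp only: aev_pCons distrib_right distrib_left mult_scaleC_left mult_scaleC_right mult_1_left mult_1_right)
qed simp

lemma aev_nd: "aev x [:- c, 1:] = x - c *\<^sub>C 1"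
  by (simp add: aev_pCons scaleC_one)

section \<open>The PBW basis\<close>

locale uqsl2_odd = odd_root l h q + uqsl2 l q E F K \<Delta> \<epsilon> S
  for l h :: nat and q :: complex and E F K :: "'a::complex_algebra_1"
    and \<Delta> :: "'a \<Rightarrow> ('a, 'a) tensor" and \<epsilon> :: "'a \<Rightarrow> complex" and S :: "'a \<Rightarrow> 'a"
begin

lemmas sc = scaleC_scaleC mult_scaleC_left mult_scaleC_right

definition Km :: 'a where "Km = K ^ (l - 1)"

lemma K_Km [simp]: "K * Km = 1" "Km * K = 1"
proof -
  have "l = Suc (l - 1)" using l_ge by simp
  then show "K * Km = 1" "Km * K = 1"
    unfolding Km_def using K_order by (metis power_Suc, metis power_Suc2)
qed

lemma K_pow_l [simp]: "K ^ l = 1"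
  by (rule K_order)

lemma q2: "q\<^sup>2 = qp 2" "inverse (q\<^sup>2) = qp (- 2)"
  by (simp_all add: qp_def power_int_minus)

lemma KE: "K * E = qp 2 *\<^sub>C (E * K)" and KF: "K * F = qp (- 2) *\<^sub>C (F * K)"
  by (simp_all only: K_E K_F q2(2)) (simp only: q2(1))

lemma K_pow_E: "K ^ n * E = qp (2 * int n) *\<^sub>C (E * K ^ n)"
proof (induction n)
  case (Suc n)
  have "K ^ Suc n * E = qp (2 * int n) *\<^sub>C (K * E * K ^ n)"
    by (simp add: mult.assoc Suc sc)
  also have "\<dots> = qp (2 * int (Suc n)) *\<^sub>C (E * K ^ Suc n)"
    by (simp add: KE sc mult.assoc algebra_simps flip: qp_add)
  finally show ?case .
qed (simp add: scaleC_one)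

lemma K_pow_F: "K ^ n * F = qp (- 2 * int n) *\<^sub>C (F * K ^ n)"
proof (induction n)
  case (Suc n)
  have "K ^ Suc n * F = qp (- 2 * int n) *\<^sub>C (K * F * K ^ n)"
    by (simp add: mult.assoc Suc sc)
  also have "\<dots> = qp (- 2 * int (Suc n)) *\<^sub>C (F * K ^ Suc n)"
    by (simp add: KF sc mult.assoc algebra_simps flip: qp_add)
  finally show ?case .
qed (simp add: scaleC_one)

lemma scaleC_cancel: "a * b = 1 \<Longrightarrow> x = a *\<^sub>C y \<Longrightarrow> y = b *\<^sub>C (x :: 'b::complex_vector)"
  by (simp add: scaleC_scaleC mult.commute scaleC_one)

lemma E_K_pow: "E * K ^ n = qp (- 2 * int n) *\<^sub>C (K ^ n * E)"
  by (rule scaleC_cancel[OF _ K_pow_E]) (simp flip: qp_add)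

lemma F_K_pow: "F * K ^ n = qp (2 * int n) *\<^sub>C (K ^ n * F)"
  by (rule scaleC_cancel[OF _ K_pow_F]) (simp flip: qp_add)

lemma Km_E: "Km * E = qp (- 2) *\<^sub>C (E * Km)" and Km_F: "Km * F = qp 2 *\<^sub>C (F * Km)"
proof -
  have "qp (2 * int (l - 1)) = qp (- 2)" "qp (- 2 * int (l - 1)) = qp 2"
    using l_ge by (auto intro!: qp_cong simp: of_nat_diff)
  then show "Km * E = qp (- 2) *\<^sub>C (E * Km)" "Km * F = qp 2 *\<^sub>C (F * Km)"
    unfolding Km_def K_pow_E K_pow_F by simp_all
qed

lemma EF: "E * F = F * E + (1 / br 1) *\<^sub>C (K - Km)"
  using E_F by (simp add: Km_def br_1 algebra_simps)

section \<open>Idempotents of K and the Casimir element\<close>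

definition eK :: "int \<Rightarrow> 'a"
  where "eK k = (1 / of_nat l) *\<^sub>C (\<Sum>j<l. qp (- (k * int j)) *\<^sub>C K ^ j)"

lemma eK_cong: "int l dvd a - b \<Longrightarrow> eK a = eK b"
proof -
  assume "int l dvd a - b"
  then have "qp (- (a * int j)) = qp (- (b * int j))" for j
    using qp_cong[of "a * int j" "b * int j"] by (simp add: qp_minus flip: left_diff_distrib)
  then show ?thesis by (simp add: eK_def)
qed

lemma periodic_eK: "periodic eK"
  unfolding periodic_def by (auto intro: eK_cong)

lemma K_eK: "K * eK k = qp k *\<^sub>C eK k"
proof -
  define g where "g j = qp (- (k * int j)) *\<^sub>C K ^ j" for j
  have "qp (k * int l) = 1" by (simp add: qp_eq_1_iff)
  then have gl: "g l = g 0" by (simp add: g_def qp_minus scaleC_one)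
  have "(\<Sum>j<l. g (Suc j)) = (\<Sum>j<l. g j)"
    using sum.lessThan_Suc_shift[of g l] gl by (simp add: add.commute)
  moreover have "K * g j = qp k *\<^sub>C g (Suc j)" for j
    by (simp add: g_def sc distrib_left flip: qp_add)
  ultimately show ?thesis
    by (simp add: eK_def sc sum_distrib_left complex_vector.scale_sum_right[symmetric] g_def[symmetric] mult.commute)
qed

lemma K_pow_eK: "K ^ n * eK k = qp (k * int n) *\<^sub>C eK k"
  by (induction n) (simp_all add: mult.assoc K_eK sc scaleC_one distrib_left qp_add mult.commute)

lemma Km_eK: "Km * eK k = qp (- k) *\<^sub>C eK k"
proof -
  have "qp (k * int (l - 1)) = qp (- k)" using l_ge by (intro qp_cong) (simp add: of_nat_diff algebra_simps)
  then show ?thesis unfolding Km_def K_pow_eK by simp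
qed

lemma eK_commute:
  assumes "x * K = K * x"
  shows "eK k * x = x * eK k"
proof -
  have "K ^ j * x = x * K ^ j" for j using assms by (metis power_commuting_commutes)
  then show ?thesis by (simp add: eK_def sc sum_distrib_left sum_distrib_right)
qed

lemma eK_K: "eK k * K = qp k *\<^sub>C eK k"
  using eK_commute[of K k] K_eK by simp

lemma eK_Km: "eK k * Km = qp (- k) *\<^sub>C eK k"
  using eK_commute[of Km k] Km_eK by (simp)

lemma eK_mult: "eK k * eK j = (if int l dvd k - j then eK j else 0)"
proof -
  have "eK k * eK j = (1 / of_nat l) *\<^sub>C (\<Sum>i<l. qp ((j - k) * int i)) *\<^sub>C eK j"
    unfolding eK_def[of k] mult_scaleC_left sum_distrib_right K_pow_eK scaleC_scaleC
      complex_vector.scale_sum_left by (simp add: algebra_simps flip: qp_add)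
  also have "(\<Sum>i<l. qp ((j - k) * int i)) = (if int l dvd j - k then of_nat l else 0)"
    using sum_qp[of "j - k"] by (simp add: sum_Zl_nat)
  also have "int l dvd j - k \<longleftrightarrow> int l dvd k - j" by (rule dvd_diff_commute)
  finally show ?thesis by (simp add: sc scaleC_one)
qed

lemma eK_idem [simp]: "eK k * eK k = eK k"
  by (simp add: eK_mult)

lemma sum_eK: "(\<Sum>k\<in>Zl. eK k) = 1"
proof -
  have "(\<Sum>k\<in>Zl. eK k) = (1 / of_nat l) *\<^sub>C (\<Sum>j<l. (\<Sum>k\<in>Zl. qp (- int j * k)) *\<^sub>C K ^ j)"
    unfolding eK_def complex_vector.scale_sum_right[symmetric] complex_vector.scale_sum_left
    by (subst sum.swap) (simp add: mult.commute)
  also have "(\<Sum>j<l. (\<Sum>k\<in>Zl. qp (- int j * k)) *\<^sub>C K ^ j) = (\<Sum>j<l. if j = 0 then of_nat l *\<^sub>C K ^ j else 0)"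
  proof (rule sum.cong)
    fix j assume "j \<in> {..<l}"
    then have "int l dvd - int j \<longleftrightarrow> j = 0" by (auto dest: dvd_imp_le)
    then show "(\<Sum>k\<in>Zl. qp (- int j * k)) *\<^sub>C K ^ j = (if j = 0 then of_nat l *\<^sub>C K ^ j else 0)"
      unfolding sum_qp by simp
  qed simp
  finally show ?thesis by (simp add: sc scaleC_one)
qed

lemma K_pow_sum: "K ^ n = (\<Sum>k\<in>Zl. qp (k * int n) *\<^sub>C eK k)"
  using arg_cong[OF sum_eK, of "\<lambda>x. K ^ n * x"] by (simp add: sum_distrib_left K_pow_eK)

lemma E_eK: "E * eK k = eK (k + 2) * E"
  by (simp add: eK_def sc sum_distrib_left sum_distrib_right E_K_pow algebra_simps flip: qp_add)

lemma F_eK: "F * eK k = eK (k - 2) * F"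
  by (simp add: eK_def sc sum_distrib_left sum_distrib_right F_K_pow algebra_simps flip: qp_add)

lemma E_pow_eK: "E ^ n * eK k = eK (k + 2 * int n) * E ^ n"
proof (induction n arbitrary: k)
  case (Suc n)
  have "E ^ Suc n * eK k = E ^ n * eK (k + 2) * E" by (simp add: power_Suc2 mult.assoc E_eK del: power_Suc)
  then show ?case unfolding Suc by (simp add: power_Suc2 mult.assoc algebra_simps del: power_Suc)
qed simp

lemma F_pow_eK: "F ^ n * eK k = eK (k - 2 * int n) * F ^ n"
proof (induction n arbitrary: k)
  case (Suc n)
  have "F ^ Suc n * eK k = F ^ n * eK (k - 2) * F" by (simp add: power_Suc2 mult.assoc F_eK del: power_Suc)
  then show ?case unfolding Suc by (simp add: power_Suc2 mult.assoc algebra_simps del: power_Suc)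
qed simp

text \<open>Normalized to have the eigenvalue ch r = q^r + q^(-r) on \<open>V_r\<close>; see
  \<open>rep_Cas\<close>.\<close>

definition Cas :: 'a
  where "Cas = (br 1)\<^sup>2 *\<^sub>C (F * E) + q *\<^sub>C K + inverse q *\<^sub>C Km"

lemma Cas_K: "Cas * K = K * Cas"
proof -
  have "K * (F * E) = F * E * K"
    by (simp add: mult.assoc[symmetric] KF sc) (simp add: mult.assoc KE sc scaleC_one flip: qp_add)
  moreover have "K * Km = Km * K" by simp
  ultimately show ?thesis by (simp add: Cas_def distrib_left distrib_right sc mult.assoc)
qed

lemma Cas_alt: "Cas = (br 1)\<^sup>2 *\<^sub>C (E * F) + inverse q *\<^sub>C K + q *\<^sub>C Km"
proof -
  have b: "(br 1)\<^sup>2 * (1 / br 1) = q - inverse q" by (simp add: power2_eq_square br_1)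
  show ?thesis unfolding EF Cas_def scaleC_add_right scaleC_scaleC b
    by (simp add: scaleC_add_right complex_vector.scale_right_diff_distrib
        complex_vector.scale_left_diff_distrib algebra_simps)
qed

lemma Cas_E: "Cas * E = E * Cas"
proof -
  have e: "q * qp 2 = q ^ 3" "qp 2 = q\<^sup>2" "qp (- 2) = inverse q ^ 2"
    by (simp_all add: qp_def power_int_minus power_inverse power3_eq_cube power2_eq_square)
  have "E * Cas = (br 1)\<^sup>2 *\<^sub>C (E * F * E) + q *\<^sub>C (E * K) + inverse q *\<^sub>C (E * Km)"
    by (simp add: Cas_def distrib_left sc mult.assoc)
  moreover have "Cas * E = (br 1)\<^sup>2 *\<^sub>C (E * F * E) + inverse q *\<^sub>C (K * E) + q *\<^sub>C (Km * E)"
    unfolding Cas_alt by (simp add: distrib_right sc mult.assoc)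
  moreover have "inverse q *\<^sub>C (K * E) = q *\<^sub>C (E * K)" "q *\<^sub>C (Km * E) = inverse q *\<^sub>C (E * Km)"
    unfolding KE Km_E sc e by (simp_all add: power2_eq_square)
  ultimately show ?thesis by simp
qed

lemma Cas_F: "Cas * F = F * Cas"
proof -
  have e: "qp 2 = q\<^sup>2" "qp (- 2) = inverse q ^ 2"
    by (simp_all add: qp_def power_int_minus power_inverse power2_eq_square)
  have "F * Cas = (br 1)\<^sup>2 *\<^sub>C (F * E * F) + inverse q *\<^sub>C (F * K) + q *\<^sub>C (F * Km)"
    unfolding Cas_alt by (simp add: distrib_left sc mult.assoc)
  moreover have "Cas * F = (br 1)\<^sup>2 *\<^sub>C (F * E * F) + q *\<^sub>C (K * F) + inverse q *\<^sub>C (Km * F)"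
    by (simp add: Cas_def distrib_right sc mult.assoc)
  moreover have "q *\<^sub>C (K * F) = inverse q *\<^sub>C (F * K)" "inverse q *\<^sub>C (Km * F) = q *\<^sub>C (F * Km)"
    unfolding KF Km_F sc e by (simp_all add: power2_eq_square)
  ultimately show ?thesis by simp
qed

lemma generated_induct:
  assumes "P E" "P F" "P K" "P 1" "\<And>x y. P x \<Longrightarrow> P y \<Longrightarrow> P (x + y)"
    "\<And>c x. P x \<Longrightarrow> P (c *\<^sub>C x)" "\<And>x y. P x \<Longrightarrow> P y \<Longrightarrow> P (x * y)"
  shows "P x"
proof -
  have "P 0" using assms(6)[OF assms(4), of 0] by simp
  then have "complex_vector.subspace {x. P x}"
    using assms(5,6) by (auto simp: complex_vector.subspace_def)
  then have "{x. P x} = UNIV"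
    using assms by (intro generated) (auto simp: subalgebra_def)
  then show ?thesis by blast
qed

lemma commute_generated:
  assumes "z * E = E * z" "z * F = F * z" "z * K = K * z"
  shows "z * x = x * z"
proof (induction x rule: generated_induct)
  case (7 x y)
  then show ?case by (metis mult.assoc)
qed (use assms in \<open>simp_all add: distrib_left distrib_right sc\<close>)

lemma Cas_central: "Cas * x = x * Cas"
  by (rule commute_generated) (rule Cas_E Cas_F Cas_K)+

abbreviation pev :: "complex poly \<Rightarrow> 'a" where "pev \<equiv> aev Cas"

lemma pev_central: "pev p * x = x * pev p"
  by (rule aev_commute) (rule Cas_central)

lemma pev_nd: "pev (nd k) = Cas - ch k *\<^sub>C 1"
  by (simp add: nd_def aev_nd)

lemma FE_eK: "(br 1)\<^sup>2 *\<^sub>C (F * E * eK k) = pev (nd (k + 1)) * eK k"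
proof -
  have "Cas * eK k = (br 1)\<^sup>2 *\<^sub>C (F * E * eK k) + ch (k + 1) *\<^sub>C eK k"
    by (simp add: Cas_def distrib_right sc K_eK Km_eK ch_def qp_add qp_diff qp_minus divide_inverse
        mult.commute scaleC_add_left add.assoc)
  then show ?thesis by (simp add: pev_nd left_diff_distrib sc)
qed

lemma EF_eK: "(br 1)\<^sup>2 *\<^sub>C (E * F * eK k) = pev (nd (k - 1)) * eK k"
proof -
  have "Cas * eK k = (br 1)\<^sup>2 *\<^sub>C (E * F * eK k) + ch (k - 1) *\<^sub>C eK k"
    unfolding Cas_alt by (simp add: distrib_right sc K_eK Km_eK ch_def qp_add qp_diff qp_minus divide_inverse
        mult.commute scaleC_add_left add.assoc)
  then show ?thesis by (simp add: pev_nd left_diff_distrib sc)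
qed

text \<open>Peeling off the outer F and E moves the idempotent from k to k + 2, and the pair itself
  contributes x - ch (k + 1) by \<open>FE_eK\<close>. Hence the step 2 between the nodes of
  \<open>N\<close>.\<close>

lemma FE_pow_eK: "(br 1 ^ (2 * m)) *\<^sub>C (F ^ m * E ^ m * eK k) = pev (N m k) * eK k"
proof (induction m arbitrary: k)
  case (Suc m)
  have "F ^ Suc m * E ^ Suc m * eK k = F * (F ^ m * E ^ m * eK (k + 2)) * E"
    by (simp only: power_Suc[of F] power_Suc2[of E] mult.assoc E_eK)
  then have "br 1 ^ (2 * Suc m) *\<^sub>C (F ^ Suc m * E ^ Suc m * eK k) =
      (br 1)\<^sup>2 *\<^sub>C (F * (br 1 ^ (2 * m) *\<^sub>C (F ^ m * E ^ m * eK (k + 2))) * E)"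
    by (simp add: sc power2_eq_square mult_ac)
  also have "\<dots> = (br 1)\<^sup>2 *\<^sub>C (F * pev (N m (k + 2)) * (eK (k + 2) * E))"
    unfolding Suc by (simp only: mult.assoc)
  also have "\<dots> = pev (N m (k + 2)) * ((br 1)\<^sup>2 *\<^sub>C (F * E * eK k))"
    by (simp only: pev_central[symmetric, of F] E_eK[symmetric] sc mult.assoc)
  also have "\<dots> = pev (N (Suc m) k) * eK k"
    unfolding FE_eK N_Suc' aev_mult by (simp only: pev_central[of "nd (k + 1)" "pev (N m (k + 2))"] mult.assoc)
  finally show ?case .
qed (simp add: scaleC_one)

lemma EF_pow_eK: "(br 1 ^ (2 * m)) *\<^sub>C (E ^ m * F ^ m * eK k) = pev (N m (- k)) * eK k"
proof (induction m arbitrary: k)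
  case (Suc m)
  have "E ^ Suc m * F ^ Suc m * eK k = E * (E ^ m * F ^ m * eK (k - 2)) * F"
    by (simp only: power_Suc[of E] power_Suc2[of F] mult.assoc F_eK)
  then have "br 1 ^ (2 * Suc m) *\<^sub>C (E ^ Suc m * F ^ Suc m * eK k) =
      (br 1)\<^sup>2 *\<^sub>C (E * (br 1 ^ (2 * m) *\<^sub>C (E ^ m * F ^ m * eK (k - 2))) * F)"
    by (simp add: sc power2_eq_square mult_ac)
  also have "\<dots> = (br 1)\<^sup>2 *\<^sub>C (E * pev (N m (- (k - 2))) * (eK (k - 2) * F))"
    unfolding Suc by (simp only: mult.assoc)
  also have "\<dots> = pev (N m (- (k - 2))) * ((br 1)\<^sup>2 *\<^sub>C (E * F * eK k))"
    by (simp only: pev_central[symmetric, of E] F_eK[symmetric] sc mult.assoc)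
  also have "\<dots> = pev (N (Suc m) (- k)) * eK k"
  proof -
    have "nd (- k + 1) = nd (k - 1)" "- k + 2 = - (k - 2)" using nd_minus[of "k - 1"] by simp_all
    then show ?thesis
      unfolding EF_eK N_Suc' aev_mult by (simp only: pev_central[of "nd (k - 1)" "pev (N m (- (k - 2)))"] mult.assoc)
  qed
  finally show ?case .
qed (simp add: scaleC_one)

text \<open>F^l E^l vanishes on each eigenspace of K, and by \<open>N_full\<close> all eigenspaces
  give the same polynomial.\<close>

lemma pev_PSI: "pev PSI = 0"
proof -
  have "pev PSI * eK k = 0" for k
    using FE_pow_eK[of l k] by (simp add: N_full F_nilpotent)
  then have "pev PSI * (\<Sum>k\<in>Zl. eK k) = 0" unfolding sum_distrib_left by simp
  then show ?thesis by (simp add: sum_eK)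
qed

section \<open>The basis vectors, their independence and coordinate functionals\<close>

definition bas :: "int \<Rightarrow> nat \<Rightarrow> nat \<Rightarrow> 'a" where "bas k m n = eK k * F ^ m * E ^ n"

definition bindex :: "(int \<times> nat \<times> nat) set" where "bindex = Zl \<times> {..<l} \<times> {..<l}"

definition basf :: "int \<times> nat \<times> nat \<Rightarrow> 'a" where "basf = (\<lambda>(k, m, n). bas k m n)"

lemma bas_cong: "int l dvd a - b \<Longrightarrow> bas a m n = bas b m n"
  using eK_cong by (simp add: bas_def)

lemma pow_zero_ge: "x ^ l = (0 :: 'a) \<Longrightarrow> l \<le> m \<Longrightarrow> x ^ m = 0"
  by (metis le_add_diff_inverse mult_zero_left power_add)

lemma bas_in_span: "bas k m n \<in> complex_vector.span (basf ` bindex)"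
proof (cases "m < l \<and> n < l")
  case True
  have "bas k m n = basf (k mod int l, m, n)"
    unfolding basf_def by (auto intro!: bas_cong simp: minus_mod_eq_mult_div)
  moreover have "(k mod int l, m, n) \<in> bindex" using True by (simp add: bindex_def)
  ultimately show ?thesis by (simp add: complex_vector.span_base)
next
  case False
  then have "bas k m n = 0"
    using pow_zero_ge[OF F_nilpotent] pow_zero_ge[OF E_nilpotent] by (auto simp: bas_def not_less)
  then show ?thesis by (simp add: complex_vector.span_zero)
qed

lemma span_mult_left:
  assumes "\<And>k m n. x * bas k m n \<in> complex_vector.span (basf ` bindex)"
    and "y \<in> complex_vector.span (basf ` bindex)"
  shows "x * y \<in> complex_vector.span (basf ` bindex)"
  using assms(2)
proof (induction rule: complex_vector.span_induct_alt)
  case (step c b y)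
  then have "x * b \<in> complex_vector.span (basf ` bindex)" using assms(1) by (auto simp: basf_def)
  then show ?case using step
    by (simp add: distrib_left sc complex_vector.span_add complex_vector.span_scale)
qed (simp add: complex_vector.span_zero)

lemma F_bas: "F * bas k m n = bas (k - 2) (Suc m) n"
  by (simp add: bas_def mult.assoc[symmetric] F_eK)

lemma E_bas_in_span: "E * bas k m n \<in> complex_vector.span (basf ` bindex)"
proof (induction m arbitrary: k)
  case 0
  have "E * bas k 0 n = bas (k + 2) 0 (Suc n)"
    by (simp add: bas_def mult.assoc[symmetric] E_eK)
  then show ?case by (simp add: bas_in_span)
next
  case (Suc m)
  have "bas k (Suc m) n = F * bas (k + 2) m n" using F_bas[of "k + 2" m n] by simp
  then have "E * bas k (Suc m) n = F * (E * bas (k + 2) m n) + (1 / br 1) *\<^sub>C ((K - Km) * bas (k + 2) m n)"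
    by (simp add: mult.assoc[symmetric] EF distrib_right sc)
  moreover have "F * (E * bas (k + 2) m n) \<in> complex_vector.span (basf ` bindex)"
    by (rule span_mult_left[OF _ Suc]) (simp add: F_bas bas_in_span)
  moreover have "(K - Km) * bas (k + 2) m n = (qp (k + 2) - qp (- (k + 2))) *\<^sub>C bas (k + 2) m n"
    by (simp only: bas_def mult.assoc[symmetric] left_diff_distrib K_eK Km_eK mult_scaleC_left
        complex_vector.scale_left_diff_distrib)
  ultimately show ?case
    by (simp add: complex_vector.span_add complex_vector.span_scale bas_in_span)
qed

lemma span_bas: "complex_vector.span (basf ` bindex) = UNIV"
proof -
  let ?Sp = "complex_vector.span (basf ` bindex)"
  have K: "K * bas k m n = qp k *\<^sub>C bas k m n" for k m n
    by (simp add: bas_def mult.assoc[symmetric] K_eK sc)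
  have closed: "\<forall>y\<in>?Sp. x * y \<in> ?Sp" for x
  proof (induction x rule: generated_induct)
    case 1 show ?case using span_mult_left[OF E_bas_in_span] by blast
  next
    case 2 show ?case using span_mult_left[of F] by (auto simp: F_bas bas_in_span)
  next
    case 3 show ?case using span_mult_left[of K] by (auto simp: K bas_in_span complex_vector.span_scale)
  qed (auto simp: distrib_right mult.assoc sc complex_vector.span_add complex_vector.span_scale)
  have "1 \<in> ?Sp"
  proof -
    have "1 = (\<Sum>k\<in>Zl. bas k 0 0)" by (simp add: bas_def sum_eK)
    then show ?thesis by (metis complex_vector.span_sum bas_in_span)
  qed
  then have "x \<in> ?Sp" for x using closed[of x] by (metis mult_1_right)
  then show ?thesis by blast
qed

lemma card_bindex: "card bindex = l ^ 3" and finite_bindex [simp]: "finite bindex"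
  by (simp_all add: bindex_def card_cartesian_product power3_eq_cube)

text \<open>A spanning family with at most l^3 members in a space of dimension l^3 is a
  basis.\<close>

lemma independent_bas: "\<not> complex_vector.dependent (basf ` bindex)"
  and inj_basf: "inj_on basf bindex"
proof -
  obtain B where B: "B \<subseteq> basf ` bindex" "\<not> complex_vector.dependent B"
    "basf ` bindex \<subseteq> complex_vector.span B"
    by (rule complex_vector.maximal_independent_subset)
  then have "complex_vector.span B = UNIV"
    using span_bas complex_vector.span_mono complex_vector.span_span by (metis top.extremum_uniqueI)
  then have "card B = l ^ 3"
    using complex_vector.dim_eq_card[of B UNIV] B(2) dimension by simp
  moreover have le: "card (basf ` bindex) \<le> l ^ 3"
    using card_image_le[OF finite_bindex, of basf] by (simp only: card_bindex)
  ultimately have eq: "B = basf ` bindex"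
    using B(1) by (intro card_seteq) simp_all
  then have card: "card (basf ` bindex) = card bindex"
    using \<open>card B = l ^ 3\<close> by (simp only: card_bindex)
  show "\<not> complex_vector.dependent (basf ` bindex)" using B(2) eq by simp
  show "inj_on basf bindex" using card by (intro eq_card_imp_inj_on) simp_all
qed

lemma functional_exists:
  fixes c :: "int \<Rightarrow> nat \<Rightarrow> nat \<Rightarrow> complex"
  obtains \<phi> :: "'a \<Rightarrow> complex" where "clinear \<phi>"
    "\<And>k m n. k \<in> Zl \<Longrightarrow> m < l \<Longrightarrow> n < l \<Longrightarrow> \<phi> (bas k m n) = c k m n"
proof -
  obtain \<phi> :: "'a \<Rightarrow> complex" where \<phi>: "clinear \<phi>"
    "\<forall>x\<in>basf ` bindex. \<phi> x = (\<lambda>(k, m, n). c k m n) (the_inv_into bindex basf x)"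
    using complex_vector.linear_independent_extend[OF independent_bas,
        of "\<lambda>x. (\<lambda>(k, m, n). c k m n) (the_inv_into bindex basf x)"] by blast
  have "\<phi> (bas k m n) = c k m n" if "k \<in> Zl" "m < l" "n < l" for k m n
  proof -
    have "(k, m, n) \<in> bindex" using that by (simp add: bindex_def)
    then have "the_inv_into bindex basf (basf (k, m, n)) = (k, m, n)"
      by (rule the_inv_into_f_f[OF inj_basf])
    with \<phi>(2) \<open>(k, m, n) \<in> bindex\<close> show ?thesis by (force simp: basf_def)
  qed
  with \<phi>(1) show thesis by (rule that)
qed

lemma bas_coordinates:
  obtains c :: "int \<Rightarrow> nat \<Rightarrow> nat \<Rightarrow> complex"
  where "x = (\<Sum>k\<in>Zl. \<Sum>m<l. \<Sum>n<l. c k m n *\<^sub>C bas k m n)"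
proof -
  have "x \<in> complex_vector.span (basf ` bindex)" by (simp add: span_bas)
  then obtain u where "x = (\<Sum>v\<in>basf ` bindex. u v *\<^sub>C v)"
    by (auto simp: complex_vector.span_finite)
  also have "\<dots> = (\<Sum>i\<in>bindex. u (basf i) *\<^sub>C basf i)"
    by (rule sum.reindex[OF inj_basf, unfolded o_def])
  also have "\<dots> = (\<Sum>k\<in>Zl. \<Sum>m<l. \<Sum>n<l. u (bas k m n) *\<^sub>C bas k m n)"
    by (simp add: bindex_def basf_def sum.cartesian_product split_def)
  finally show thesis by (rule that)
qed

end

context odd_root
begin

section \<open>Jumps of weight indicators and linear relations between the polynomials\<close>

definition ind :: "nat \<Rightarrow> int \<Rightarrow> complex" where "ind r k = (if inwt r k then 1 else 0)"

lemma periodic_ind: "periodic (ind r)"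
  using inwt_cong[of "k + int l" k r for k] by (simp add: periodic_def ind_def)

lemma ind_complement: "r \<le> l \<Longrightarrow> ind (l - r) k = 1 - ind r k"
  by (simp add: ind_def inwt_complement)

text \<open>In steps of 2 the string of weights is entered at its lowest weight 1 - j and left after
  its highest weight j - 1.\<close>

lemma ind_jump:
  assumes "0 < j" "j < l"
  shows "ind j (k + 1) - ind j (k - 1) =
    (if int l dvd k + int j then 1 else 0) - (if int l dvd k - int j then 1 else 0)"
proof -
  have excl: "\<not> (int l dvd k + int j \<and> int l dvd k - int j)"
  proof
    assume "int l dvd k + int j \<and> int l dvd k - int j"
    then have "int l dvd (k + int j) - (k - int j)" by (blast intro: dvd_diff)
    then have "int l dvd 2 * int j" by simp
    then show False using assms by (simp only: coprime_l_2) (auto dest: zdvd_imp_le)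
  qed
  consider "int l dvd k + int j" | "int l dvd k - int j" | "\<not> int l dvd k + int j" "\<not> int l dvd k - int j"
    by blast
  then show ?thesis
  proof cases
    case 1
    have d: "int l dvd (k + 1) - - (int j - 1)" "int l dvd (k - 1) - - (int j + 1)"
      using 1 by simp_all
    show ?thesis using 1 excl assms unfolding ind_def inwt_cong[OF d(1)] inwt_cong[OF d(2)] inwt_minus
      by (simp add: inwt_top not_inwt_top)
  next
    case 2
    have d: "int l dvd (k + 1) - (int j + 1)" "int l dvd (k - 1) - (int j - 1)"
      using 2 by simp_all
    show ?thesis using 2 excl assms unfolding ind_def inwt_cong[OF d(1)] inwt_cong[OF d(2)]
      by (simp add: inwt_top not_inwt_top)
  next
    case 3
    then have "inwt j (k - 1 + 2) = inwt j (k - 1)" by (intro inwt_step) simp_all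
    moreover have "k - 1 + 2 = k + 1" by simp
    ultimately have "inwt j (k + 1) = inwt j (k - 1)" by (simp only:)
    then show ?thesis using 3 by (simp add: ind_def)
  qed
qed

lemma chebU_independent:
  assumes "(\<Sum>r=1..n. smult (b r) (chebU r)) = 0" "1 \<le> r" "r \<le> n"
  shows "b r = 0"
  using assms
proof (induction n)
  case (Suc n)
  have "coeff (\<Sum>r=1..n. smult (b r) (chebU r)) n = 0"
    unfolding coeff_sum
  proof (rule sum.neutral, rule ballI)
    fix r assume "r \<in> {1..n}"
    then have "degree (chebU r) < n" "0 < r" using degree_chebU_less[of r] by auto
    then show "coeff (smult (b r) (chebU r)) n = 0" by (simp add: coeff_eq_0)
  qed
  moreover have "coeff (\<Sum>r=1..Suc n. smult (b r) (chebU r)) n = 0" using Suc.prems(1) by simp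
  ultimately have "b (Suc n) = 0" using degree_chebU_less[of "Suc n"] by simp
  moreover from this have "(\<Sum>r=1..n. smult (b r) (chebU r)) = 0" using Suc.prems(1) by simp
  ultimately show ?case using Suc by (metis le_Suc_eq)
qed simp

lemma chebU_span:
  assumes "degree f < n"
  obtains b where "f = (\<Sum>r=1..n. smult (b r) (chebU r))"
proof -
  have "\<exists>b. f = (\<Sum>r=1..n. smult (b r) (chebU r))"
    using assms
  proof (induction n arbitrary: f)
    case (Suc n)
    define c where "c = coeff f n"
    define g where "g = f - smult c (chebU (Suc n))"
    have U: "degree (chebU (Suc n)) \<le> n" "coeff (chebU (Suc n)) n = 1"
      using degree_chebU_less[of "Suc n"] by auto
    have g: "degree g \<le> n" "coeff g n = 0"
      unfolding g_def using Suc.prems U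
      by (auto simp: c_def intro!: degree_diff_le order_trans[OF degree_smult_le])
    show ?case
    proof (cases "n = 0")
      case True
      with g have "g = 0" by (metis le_zero_eq leading_coeff_0_iff)
      then show ?thesis using True by (intro exI[of _ "\<lambda>_. c"]) (simp add: g_def)
    next
      case False
      with g have "degree g < n"
        by (metis degree_0 gr0I le_neq_implies_less leading_coeff_0_iff)
      then obtain b where b: "g = (\<Sum>r=1..n. smult (b r) (chebU r))" using Suc.IH by blast
      have "(\<Sum>r=1..n. smult ((b(Suc n := c)) r) (chebU r)) = g"
        unfolding b by (rule sum.cong) auto
      then have "f = (\<Sum>r=1..Suc n. smult ((b(Suc n := c)) r) (chebU r))"
        by (simp add: g_def)
      then show ?thesis by blast
    qed
  qed simp
  then show thesis using that by blast
qed

text \<open>The terms s and l - s together contribute b_s + (l - s) c_s to the coefficient of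
  \<open>chebU s\<close>. The same equation at l - s reads b_s - s c_s = 0 by parity, and the
  difference is l c_s = 0. Only s = l is met once, hence the factor 2 elsewhere.\<close>

lemma XX_uu_independent:
  assumes per: "periodic b" "periodic c" and sym: "\<And>k. b (- k) = b k" "\<And>k. c (- k) = - c k"
    and eq: "(\<Sum>s\<in>Zl. smult (b s) (XX s) + smult (c s) (uu s)) = 0"
  shows "b k = 0 \<and> c k = 0"
proof -
  define b' c' where "b' s = b (int s)" and "c' s = c (int s)" for s :: nat
  have refl: "b' (l - s) = b' s" "c' (l - s) = - c' s" if "s \<le> l" for s
  proof -
    have "b (int (l - s)) = b (- int s)" "c (int (l - s)) = c (- int s)"
      using that by (auto intro!: periodic_cong per simp: of_nat_diff)
    then show "b' (l - s) = b' s" "c' (l - s) = - c' s" by (simp_all add: b'_def c'_def sym)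
  qed
  define g where "g s = smult (b' s + of_nat (l - s) * c' s) (chebU s)" for s
  have "(\<Sum>s<l. smult (b' s) (XX (int s)) + smult (c' s) (uu (int s))) = (\<Sum>s<l. g s + g (l - s))"
  proof (rule sum.cong)
    fix s assume "s \<in> {..<l}"
    then have s: "s \<le> l" by simp
    show "smult (b' s) (XX (int s)) + smult (c' s) (uu (int s)) = g s + g (l - s)"
      using s by (simp add: g_def XX_nat uu_nat refl smult_add_right smult_add_left smult_diff_right
          smult_diff_left mult.commute)
        (simp add: right_diff_distrib smult_diff_left mult.commute)
  qed simp
  also have "\<dots> = (\<Sum>s<l. g s) + (\<Sum>s<l. g (l - s))" by (rule sum.distrib)
  also have "(\<Sum>s<l. g s) = (\<Sum>s=1..l. if s < l then g s else 0)"
    by (rule sum.mono_neutral_cong) (auto simp: g_def not_less_eq_eq)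
  also have "(\<Sum>s<l. g (l - s)) = (\<Sum>s=1..l. g s)"
    by (rule sum.reindex_bij_witness[of _ "\<lambda>s. l - s" "\<lambda>s. l - s"]) auto
  also have "(\<Sum>s=1..l. if s < l then g s else 0) + (\<Sum>s=1..l. g s) =
      (\<Sum>s=1..l. smult ((if s < l then 2 else 1) * (b' s + of_nat (l - s) * c' s)) (chebU s))"
    unfolding sum.distrib[symmetric] g_def
    by (rule sum.cong) (auto simp: mult.commute simp flip: smult_add_left)
  finally have "(\<Sum>s=1..l. smult ((if s < l then 2 else 1) * (b' s + of_nat (l - s) * c' s)) (chebU s)) = 0"
    using eq by (simp add: sum_Zl_nat b'_def c'_def)
  note zero = chebU_independent[OF this]
  have main: "b' s + of_nat (l - s) * c' s = 0" if "1 \<le> s" "s \<le> l" for s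
    using zero[OF that] by (simp split: if_splits)
  have c0: "c' s = 0" if "s < l" for s
  proof (cases "s = 0")
    case True
    have "c 0 = - c 0" using sym(2)[of 0] by simp
    then show ?thesis using True by (simp add: c'_def)
  next
    case False
    then have "b' s + of_nat (l - s) * c' s = 0" "b' s - of_nat s * c' s = 0"
      using main[of s] main[of "l - s"] refl[of s] that by simp_all
    then have "of_nat (l - s + s) * c' s = 0" by (simp add: algebra_simps)
    then show ?thesis using that by simp
  qed
  have b0: "b' s = 0" if "s < l" for s
  proof (cases "s = 0")
    case True
    then show ?thesis using main[of l] refl(1)[of 0] l_ge by simp
  next
    case False
    then show ?thesis using main[of s] c0[OF that] that by simp
  qed
  obtain s where s: "s < l" "int l dvd k - int s" by (rule residue_cases)
  then have "b k = b' s" "c k = c' s"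
    unfolding b'_def c'_def by (auto intro: periodic_cong per)
  then show ?thesis using b0 c0 s by simp
qed

text \<open>\<open>Psi\<close> is even in its index, so a relation involves only the even part of a.
  This part vanishes because \<open>Psi\<close> is the Fourier transform of \<open>XX\<close>, whose
  members are independent up to parity.\<close>

lemma Psi_relation:
  assumes "periodic a" "(\<Sum>j\<in>Zl. smult (a j) (Psi j)) = 0"
  shows "a (- k) = - a k"
proof -
  define A where "A s = (\<Sum>j\<in>Zl. qp (j * s) * a j)" for s
  have perA: "periodic A"
    unfolding periodic_def A_def by (auto intro!: sum.cong arg_cong2[where f = "(*)"] qp_cong simp: algebra_simps)
  have "(\<Sum>s\<in>Zl. smult (A s) (XX s)) = 0"
  proof -
    have "(\<Sum>j\<in>Zl. smult (a j) (Psi j)) = (\<Sum>s\<in>Zl. \<Sum>j\<in>Zl. smult (a j * qp (j * s)) (XX s))"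
      unfolding Psi_dft smult_sum_right smult_smult by (rule sum.swap)
    then show ?thesis using assms(2) by (simp add: A_def smult_sum mult.commute)
  qed
  moreover from this have "(\<Sum>s\<in>Zl. smult (A (- s)) (XX s)) = 0"
    using sum_periodic_minus[of "\<lambda>s. smult (A s) (XX s)"] perA periodic_XX
    by (simp add: periodic_def XX_minus)
  ultimately have "(\<Sum>s\<in>Zl. smult (A s + A (- s)) (XX s) + smult 0 (uu s)) = 0"
    by (simp add: smult_add_left sum.distrib)
  moreover have perA': "periodic (\<lambda>s. A s + A (- s))"
    unfolding periodic_def using periodic_cong[OF perA] by (auto intro!: arg_cong2[where f = "(+)"])
  ultimately have A0: "A s + A (- s) = 0" for s
    using XX_uu_independent[of "\<lambda>s. A s + A (- s)" "\<lambda>_. 0" s] by (simp add: periodic_def add.commute)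
  have inv: "of_nat l * a k = (\<Sum>s\<in>Zl. qp (- (k * s)) * A s)" for k
    using dft_inversion[OF assms(1), of k] by (simp add: A_def)
  have "(\<Sum>s\<in>Zl. qp (- (- k * s)) * A s) = (\<Sum>s\<in>Zl. qp (- (- k * - s)) * A (- s))"
    by (rule sum_periodic_minus[symmetric, of "\<lambda>s. qp (- (- k * s)) * A s"])
      (use perA in \<open>auto simp: periodic_def intro!: arg_cong2[where f = "(*)"] qp_cong simp: algebra_simps\<close>)
  then have "of_nat l * (a k + a (- k)) = (\<Sum>s\<in>Zl. qp (- (k * s)) * (A s + A (- s)))"
    unfolding distrib_left inv by (simp add: sum.distrib distrib_left)
  then have "a k + a (- k) = 0" by (simp add: A0)
  then show ?thesis by (simp add: eq_neg_iff_add_eq_0 add.commute)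
qed

end

section \<open>The center\<close>

context uqsl2_odd
begin

definition el :: "(int \<Rightarrow> complex poly) \<Rightarrow> 'a" where "el g = (\<Sum>k\<in>Zl. eK k * pev (g k))"

lemma el_add: "el (\<lambda>k. f k + g k) = el f + el g"
  by (simp add: el_def aev_add distrib_left sum.distrib)

lemma el_smult: "el (\<lambda>k. smult c (f k)) = c *\<^sub>C el f"
  by (simp add: el_def aev_smult sc complex_vector.scale_sum_right)

lemma el_const: "el (\<lambda>k. f) = pev f"
  by (simp add: el_def sum_eK flip: sum_distrib_right)

lemma el_sum: "el (\<lambda>k. \<Sum>i\<in>A. f i k) = (\<Sum>i\<in>A. el (f i))"
  by (induction A rule: infinite_finite_induct) (simp_all add: el_add el_def)

lemma periodic_eK_pev: "periodic g \<Longrightarrow> periodic (\<lambda>k. eK k * pev (g k))"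
  using periodic_eK by (simp add: periodic_def)

lemma eK_el:
  assumes "periodic g"
  shows "eK j * el g = eK j * pev (g j)"
proof -
  have "eK j * el g = (\<Sum>k\<in>Zl. if int l dvd k - j then eK k * pev (g k) else 0)"
    unfolding el_def sum_distrib_left mult.assoc[symmetric]
    by (rule sum.cong) (auto simp: eK_mult dvd_diff_commute)
  also have "\<dots> = eK j * pev (g j)"
    by (rule sum_Zl_single) (rule periodic_eK_pev[OF assms])
  finally show ?thesis .
qed

lemma pev_left_commute: "x * (pev p * y) = pev p * (x * y)"
  by (metis mult.assoc pev_central)

lemma functional_ex:
  "\<exists>\<phi>::'a \<Rightarrow> complex. clinear \<phi> \<and> (\<forall>k\<in>Zl. \<forall>m<l. \<forall>n<l. \<phi> (bas k m n) = c k m n)"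
  by (rule functional_exists[of c]) blast

lemma el_mult:
  assumes "periodic g"
  shows "el f * el g = el (\<lambda>k. f k * g k)"
proof -
  have "el f * el g = (\<Sum>k\<in>Zl. pev (f k) * (eK k * el g))"
    unfolding el_def[of f] sum_distrib_right by (simp only: mult.assoc pev_left_commute)
  also have "\<dots> = el (\<lambda>k. f k * g k)"
    unfolding eK_el[OF assms] by (simp only: el_def aev_mult pev_left_commute mult.assoc)
  finally show ?thesis .
qed

lemma eK_pow: "eK k * F ^ m * E ^ m = F ^ m * E ^ m * eK k"
  by (simp add: mult.assoc E_pow_eK) (simp add: mult.assoc[symmetric] F_pow_eK)

lemma pev_N_bas: "eK k * pev (N m k) = br 1 ^ (2 * m) *\<^sub>C bas k m m"
  using FE_pow_eK[of m k] by (simp add: bas_def eK_pow pev_central)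

text \<open>In the Newton basis that starts at k the element becomes a combination of the basis
  vectors \<open>bas k n n\<close>. Hence the remainder modulo \<open>PSI\<close>, of degree below
  l, can vanish on \<open>eK k\<close> only by being 0.\<close>

lemma eK_pev_eq_0_iff: "eK k * pev f = 0 \<longleftrightarrow> PSI dvd f"
proof
  assume "PSI dvd f"
  then show "eK k * pev f = 0" by (auto simp: dvd_def aev_mult pev_PSI)
next
  assume 0: "eK k * pev f = 0"
  define g where "g = f mod PSI"
  have "f = PSI * (f div PSI) + g" by (simp add: g_def)
  then have "pev f = pev g" by (metis aev_add aev_mult pev_PSI mult_zero_left add_0)
  with 0 have g0: "eK (k mod int l) * pev g = 0"
    using eK_cong[of "k mod int l" k] by (metis dvd_minus_mod dvd_diff_commute)
  have "degree g < l" using degree_mod_less[of PSI f] by (auto simp: g_def)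
  then obtain a where a: "g = (\<Sum>n<l. smult (a n) (N n (k mod int l)))"
    by (rule newton_expansion)
  have "a i = 0" if "i < l" for i
  proof -
    obtain \<phi> :: "'a \<Rightarrow> complex" where \<phi>: "clinear \<phi>"
      "\<forall>k\<in>Zl. \<forall>m<l. \<forall>n<l. \<phi> (bas k m n) = (if m = i then 1 else 0)"
      using functional_ex[of "\<lambda>_ m _. if m = i then 1 else 0"] by blast
    have "eK (k mod int l) * pev g = (\<Sum>n<l. (a n * br 1 ^ (2 * n)) *\<^sub>C bas (k mod int l) n n)"
      unfolding a aev_sum aev_smult sum_distrib_left mult_scaleC_right pev_N_bas scaleC_scaleC ..
    then have "0 = \<phi> (\<Sum>n<l. (a n * br 1 ^ (2 * n)) *\<^sub>C bas (k mod int l) n n)"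
      using g0 complex_vector.linear_0[OF \<phi>(1)] by simp
    also have "\<dots> = (\<Sum>n<l. (a n * br 1 ^ (2 * n)) * (if n = i then 1 else 0))"
      unfolding complex_vector.linear_sum[OF \<phi>(1)] complex_vector.linear_scale[OF \<phi>(1)]
      by (rule sum.cong) (simp_all add: \<phi>(2))
    also have "\<dots> = a i * br 1 ^ (2 * i)"
      using that by (simp add: if_distrib[of "\<lambda>x. _ * x"] cong: if_cong)
    finally show ?thesis by simp
  qed
  then have "g = 0" using a by simp
  then show "PSI dvd f" by (simp add: g_def dvd_eq_mod_eq_0)
qed

lemma el_eq_0_imp: "periodic g \<Longrightarrow> el g = 0 \<Longrightarrow> PSI dvd g k"
  using eK_el[of g k] by (simp add: eK_pev_eq_0_iff)

lemma el_cong_PSI: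
  assumes "\<And>k. PSI dvd f k - g k"
  shows "el f = el g"
  unfolding el_def
proof (rule sum.cong)
  fix k
  have "eK k * pev (f k - g k) = 0" using assms by (simp add: eK_pev_eq_0_iff)
  then show "eK k * pev (f k) = eK k * pev (g k)" by (simp add: aev_diff right_diff_distrib)
qed simp

text \<open>On \<open>eK k\<close> the polynomial \<open>Psi (k - 1)\<close> is a multiple of
  F^(l-1) E^(l-1), so one more E gives 0. For F the idempotent is first moved across, and one more F
  on the left gives 0.\<close>

lemma Psi_E: "pev (Psi (k - 1)) * (eK k * E) = 0" and Psi_F: "pev (Psi (k + 1)) * (eK k * F) = 0"
proof -
  have "pev (Psi (k - 1)) * (eK k * E) = br 1 ^ (2 * (l - 1)) *\<^sub>C (F ^ (l - 1) * E ^ (l - 1) * eK k * E)"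
    unfolding Psi_def mult.assoc[symmetric] by (simp add: FE_pow_eK[symmetric] sc)
  also have "F ^ (l - 1) * E ^ (l - 1) * eK k * E = eK k * F ^ (l - 1) * (E ^ (l - 1) * E)"
    by (simp only: eK_pow mult.assoc[symmetric])
  also have "E ^ (l - 1) * E = 0"
    using E_nilpotent power_Suc2[of E "l - 1"] by simp
  finally show "pev (Psi (k - 1)) * (eK k * E) = 0" by simp
  have "pev (Psi (k + 1)) * (eK k * F) = F * (pev (N (l - 1) (k + 2)) * eK (k + 2))"
  proof -
    have "eK k * F = F * eK (k + 2)" "k + 1 + 1 = k + 2" using F_eK[of "k + 2"] by simp_all
    then show ?thesis unfolding Psi_def by (simp only: pev_left_commute)
  qed
  also have "\<dots> = br 1 ^ (2 * (l - 1)) *\<^sub>C (F * F ^ (l - 1) * E ^ (l - 1) * eK (k + 2))"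
    using FE_pow_eK[of "l - 1" "k + 2"] by (simp add: mult.assoc flip: sc(3))
  also have "F * F ^ (l - 1) = 0"
    using F_nilpotent power_Suc[of F "l - 1"] by simp
  finally show "pev (Psi (k + 1)) * (eK k * F) = 0" by simp
qed

text \<open>Moving E or F across the idempotents replaces g k by its neighbour at distance 2. The
  difference is a multiple of a \<open>Psi\<close> that annihilates \<open>eK k\<close> E or
  \<open>eK k\<close> F.\<close>

lemma el_central:
  assumes per: "periodic g" and jump: "\<And>k. \<exists>a. g (k + 2) - g k = smult a (Psi (k + 1))"
  shows "el g \<in> center"
proof -
  have shift: "(\<Sum>k\<in>Zl. eK (k + a) * pev (g k) * x) = (\<Sum>k\<in>Zl. eK k * pev (g (k - a)) * x)" for a x
  proof -
    have "periodic (\<lambda>k. eK k * pev (g (k - a)) * x)"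
      unfolding periodic_def using periodic_cong[OF per] periodic_cong[OF periodic_eK]
      by (auto intro!: arg_cong2[where f = "(*)"] arg_cong[where f = pev])
    from sum_periodic_shift[OF this, of a] show ?thesis by simp
  qed
  have "el g * E = E * el g"
  proof -
    have "E * el g = (\<Sum>k\<in>Zl. eK (k + 2) * pev (g k) * E)"
      unfolding el_def sum_distrib_left mult.assoc[symmetric] E_eK by (simp only: mult.assoc pev_central)
    also have "\<dots> = (\<Sum>k\<in>Zl. eK k * pev (g (k - 2)) * E)" by (rule shift)
    also have "\<dots> = el g * E"
      unfolding el_def sum_distrib_right
    proof (rule sum.cong)
      fix k
      obtain a where "g k = g (k - 2) + smult a (Psi (k - 1))"
        using jump[of "k - 2"] by (auto simp: algebra_simps)
      then have "eK k * pev (g k) * E = eK k * pev (g (k - 2)) * E + a *\<^sub>C (pev (Psi (k - 1)) * (eK k * E))"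
        by (simp only: aev_add aev_smult distrib_left distrib_right sc mult.assoc pev_left_commute)
      then show "eK k * pev (g (k - 2)) * E = eK k * pev (g k) * E" by (simp add: Psi_E)
    qed simp
    finally show ?thesis ..
  qed
  moreover have "el g * F = F * el g"
  proof -
    have "F * el g = (\<Sum>k\<in>Zl. eK (k + - 2) * pev (g k) * F)"
      unfolding el_def sum_distrib_left mult.assoc[symmetric] F_eK
      by (simp only: mult.assoc pev_central diff_conv_add_uminus)
    also have "\<dots> = (\<Sum>k\<in>Zl. eK k * pev (g (k - - 2)) * F)" by (rule shift)
    also have "\<dots> = el g * F"
      unfolding el_def sum_distrib_right
    proof (rule sum.cong)
      fix k
      obtain a where "g (k - - 2) = g k + smult a (Psi (k + 1))"
        using jump[of k] by (auto simp: algebra_simps)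
      then have "eK k * pev (g (k - - 2)) * F = eK k * pev (g k) * F + a *\<^sub>C (pev (Psi (k + 1)) * (eK k * F))"
        by (simp only: aev_add aev_smult distrib_left distrib_right sc mult.assoc pev_left_commute)
      then show "eK k * pev (g (k - - 2)) * F = eK k * pev (g k) * F" by (simp add: Psi_F)
    qed simp
    finally show ?thesis ..
  qed
  moreover have "el g * K = K * el g"
    unfolding el_def sum_distrib_left sum_distrib_right
    by (simp only: mult.assoc pev_central[of _ K]) (simp only: mult.assoc[symmetric] eK_K K_eK)
  ultimately have "el g * x = x * el g" for x by (rule commute_generated)
  then show ?thesis by (simp add: center_def)
qed

lemma K_bas: "K * bas k m n = qp k *\<^sub>C bas k m n"
  by (simp add: bas_def mult.assoc[symmetric] K_eK sc)

lemma bas_K: "bas k m n * K = qp (k + 2 * (int m - int n)) *\<^sub>C bas k m n"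
proof -
  have E: "E ^ n * K = qp (- 2 * int n) *\<^sub>C (K * E ^ n)" for n
  proof (induction n)
    case (Suc n)
    have "E ^ Suc n * K = E ^ n * (E * K)" by (simp only: power_Suc2 mult.assoc)
    also have "E * K = qp (- 2) *\<^sub>C (K * E)" using E_K_pow[of 1] by simp
    finally have "E ^ Suc n * K = qp (- 2) *\<^sub>C ((E ^ n * K) * E)" by (simp add: sc mult.assoc)
    then show ?case unfolding Suc
      by (simp add: sc mult.assoc power_Suc2 algebra_simps del: power_Suc flip: qp_add)
  qed (simp add: scaleC_one)
  have F: "F ^ n * K = qp (2 * int n) *\<^sub>C (K * F ^ n)" for n
  proof (induction n)
    case (Suc n)
    have "F ^ Suc n * K = F ^ n * (F * K)" by (simp only: power_Suc2 mult.assoc)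
    also have "F * K = qp 2 *\<^sub>C (K * F)" using F_K_pow[of 1] by simp
    finally have "F ^ Suc n * K = qp 2 *\<^sub>C ((F ^ n * K) * F)" by (simp add: sc mult.assoc)
    then show ?case unfolding Suc
      by (simp add: sc mult.assoc power_Suc2 algebra_simps del: power_Suc flip: qp_add)
  qed (simp add: scaleC_one)
  have "bas k m n * K = qp (- 2 * int n) *\<^sub>C (eK k * (F ^ m * K) * E ^ n)"
    by (simp add: bas_def mult.assoc E sc)
  also have "\<dots> = (qp (- 2 * int n) * qp (2 * int m)) *\<^sub>C ((eK k * K) * F ^ m * E ^ n)"
    by (simp add: F sc mult.assoc)
  also have "\<dots> = qp (k + 2 * (int m - int n)) *\<^sub>C bas k m n"
    by (simp add: eK_K sc bas_def algebra_simps flip: qp_add)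
  finally show ?thesis .
qed

lemma qp_weight_neq: "m < l \<Longrightarrow> n < l \<Longrightarrow> m \<noteq> n \<Longrightarrow> qp k \<noteq> qp (k + 2 * (int m - int n))"
proof
  assume mn: "m < l" "n < l" "m \<noteq> n" "qp k = qp (k + 2 * (int m - int n))"
  then have "int l dvd - (2 * (int m - int n))" by (simp add: qp_eq_iff)
  then have "int l dvd int m - int n" by (simp only: dvd_minus_iff coprime_l_2)
  then have "int m = int n" using mn by (intro Zl_eqI) (simp_all add: Zl_def)
  with mn show False by simp
qed

text \<open>Commuting with K forces equal exponents of F and E. The coefficients are made periodic
  in k so that any representative of a residue may be used.\<close>

lemma center_el:
  assumes z: "z \<in> center"
  obtains c where "z = el (\<lambda>k. \<Sum>m<l. smult (c k m / br 1 ^ (2 * m)) (N m k))"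
    "z = (\<Sum>k\<in>Zl. \<Sum>m<l. c k m *\<^sub>C bas k m m)" "\<forall>m. periodic (\<lambda>k. c k m)"
proof -
  obtain c where c: "z = (\<Sum>k\<in>Zl. \<Sum>m<l. \<Sum>n<l. c k m n *\<^sub>C bas k m n)" by (rule bas_coordinates)
  have c0: "c k m n = 0" if "k \<in> Zl" "m < l" "n < l" "m \<noteq> n" for k m n
  proof -
    obtain \<phi> :: "'a \<Rightarrow> complex" where \<phi>: "clinear \<phi>"
      "\<forall>k'\<in>Zl. \<forall>m'<l. \<forall>n'<l.
        \<phi> (bas k' m' n') = (if n' = n then if m' = m then if k' = k then 1 else 0 else 0 else 0)"
      using functional_ex[of "\<lambda>k' m' n'. if n' = n then if m' = m then if k' = k then 1 else 0 else 0 else 0"]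
      by blast
    have val: "\<phi> (\<Sum>k\<in>Zl. \<Sum>m<l. \<Sum>n<l. b k m n *\<^sub>C bas k m n) = b k m n" for b
    proof -
      have "\<phi> (\<Sum>k\<in>Zl. \<Sum>m<l. \<Sum>n<l. b k m n *\<^sub>C bas k m n) =
          (\<Sum>k'\<in>Zl. \<Sum>m'<l. \<Sum>n'<l. b k' m' n' *
            (if n' = n then if m' = m then if k' = k then 1 else 0 else 0 else 0))"
        unfolding complex_vector.linear_sum[OF \<phi>(1)] complex_vector.linear_scale[OF \<phi>(1)]
        by (intro sum.cong refl) (simp add: \<phi>(2))
      also have "\<dots> = b k m n"
        using that by (simp add: if_distrib[of "\<lambda>x. _ * x"] cong: if_cong)
      finally show ?thesis .
    qed
    have 1: "K * z = (\<Sum>k\<in>Zl. \<Sum>m<l. \<Sum>n<l. (c k m n * qp k) *\<^sub>C bas k m n)"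
      unfolding c sum_distrib_left mult_scaleC_right K_bas scaleC_scaleC ..
    have 2: "z * K = (\<Sum>k\<in>Zl. \<Sum>m<l. \<Sum>n<l. (c k m n * qp (k + 2 * (int m - int n))) *\<^sub>C bas k m n)"
      unfolding c sum_distrib_right mult_scaleC_left bas_K scaleC_scaleC ..
    have "\<phi> (K * z) = \<phi> (z * K)" using z by (simp add: center_def)
    then have "c k m n * qp k = c k m n * qp (k + 2 * (int m - int n))"
      unfolding 1 2 val .
    moreover have "qp k \<noteq> qp (k + 2 * (int m - int n))" using that by (intro qp_weight_neq)
    ultimately show ?thesis by simp
  qed
  define c' where "c' k m = c (k mod int l) m m" for k m
  have per: "periodic (\<lambda>k. c' k m)" for m by (simp add: periodic_def c'_def)
  have "z = (\<Sum>k\<in>Zl. \<Sum>m<l. \<Sum>n<l. if n = m then c' k m *\<^sub>C bas k m m else 0)"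
    unfolding c
  proof (intro sum.cong refl)
    fix k m n assume "k \<in> Zl" "m \<in> {..<l}" "n \<in> {..<l}"
    then show "c k m n *\<^sub>C bas k m n = (if n = m then c' k m *\<^sub>C bas k m m else 0)"
      using c0[of k m n] by (auto simp: c'_def Zl_def)
  qed
  then have z': "z = (\<Sum>k\<in>Zl. \<Sum>m<l. c' k m *\<^sub>C bas k m m)" by simp
  moreover have "(\<Sum>k\<in>Zl. \<Sum>m<l. c' k m *\<^sub>C bas k m m) =
      el (\<lambda>k. \<Sum>m<l. smult (c' k m / br 1 ^ (2 * m)) (N m k))"
    unfolding el_def aev_sum aev_smult sum_distrib_left mult_scaleC_right pev_N_bas scaleC_scaleC
    by simp
  ultimately show thesis using per that[of c'] by simp
qed

end

section \<open>The shape of the central elements\<close>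

context uqsl2_odd
begin

text \<open>Comparing E z with z E shows that the jump annihilates \<open>eK (k + 2)\<close> E.
  Multiplication by F turns E F into x - ch (k + 1), so \<open>PSI\<close> divides (x - ch (k + 1))
  times the jump, and the degree bound leaves only a scalar multiple of
  \<open>Psi (k + 1)\<close>.\<close>

lemma center_jump:
  assumes per: "periodic g" and deg: "\<And>k. degree (g k) < l" and z: "el g \<in> center"
  obtains a where "g (k + 2) - g k = smult a (Psi (k + 1))"
proof -
  define \<delta> where "\<delta> = g (k + 2) - g k"
  have "eK (k + 2) * E * el g = E * (eK k * el g)" by (simp only: mult.assoc E_eK[symmetric])
  also have "\<dots> = E * eK k * pev (g k)" by (simp only: eK_el[OF per] mult.assoc)
  also have "\<dots> = pev (g k) * (eK (k + 2) * E)" by (simp only: E_eK pev_central)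
  finally have 1: "eK (k + 2) * E * el g = pev (g k) * (eK (k + 2) * E)" .
  have "eK (k + 2) * E * el g = eK (k + 2) * el g * E"
    using z by (simp add: center_def mult.assoc)
  also have "\<dots> = pev (g (k + 2)) * (eK (k + 2) * E)"
    by (simp only: eK_el[OF per] pev_central[symmetric] mult.assoc)
  finally have "pev \<delta> * (eK (k + 2) * E) = 0"
    using 1 by (simp add: \<delta>_def aev_diff left_diff_distrib)
  then have "0 = (br 1)\<^sup>2 *\<^sub>C (pev \<delta> * (eK (k + 2) * E) * F)" by simp
  also have "pev \<delta> * (eK (k + 2) * E) * F = pev \<delta> * (E * F * eK (k + 2))"
  proof -
    have "eK (k + 2) * E * F = E * (eK k * F)" by (simp only: E_eK[symmetric] mult.assoc)
    also have "eK k * F = F * eK (k + 2)" using F_eK[of "k + 2"] by simp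
    finally show ?thesis by (simp only: mult.assoc)
  qed
  also have "(br 1)\<^sup>2 *\<^sub>C (pev \<delta> * (E * F * eK (k + 2))) = pev \<delta> * (pev (nd (k + 1)) * eK (k + 2))"
  proof -
    have "k + 2 - 1 = k + 1" by simp
    then have "pev (nd (k + 1)) * eK (k + 2) = (br 1)\<^sup>2 *\<^sub>C (E * F * eK (k + 2))"
      using EF_eK[of "k + 2"] by (simp only:)
    then show ?thesis by (simp only: sc)
  qed
  also have "\<dots> = eK (k + 2) * pev (nd (k + 1) * \<delta>)"
  proof -
    have "pev \<delta> * (pev (nd (k + 1)) * eK (k + 2)) = pev (nd (k + 1) * \<delta>) * eK (k + 2)"
      by (simp only: mult.commute[of _ \<delta>] aev_mult mult.assoc)
    then show ?thesis by (simp only: pev_central)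
  qed
  finally have "PSI dvd nd (k + 1) * \<delta>" by (simp add: eK_pev_eq_0_iff)
  then have "Psi (k + 1) dvd \<delta>" by (simp flip: nd_Psi[of "k + 1"])
  then obtain r where r: "\<delta> = Psi (k + 1) * r" by (auto simp: dvd_def)
  have "degree \<delta> < l" unfolding \<delta>_def using deg by (intro degree_diff_less)
  have "degree r = 0"
  proof (cases "r = 0")
    case False
    then have "degree \<delta> = (l - 1) + degree r" unfolding r by (subst degree_mult_eq) simp_all
    with \<open>degree \<delta> < l\<close> show ?thesis by simp
  qed simp
  then obtain a where "r = [:a:]" by (rule degree_eq_zeroE)
  then have "\<delta> = smult a (Psi (k + 1))" using r by simp
  then show thesis using that by (simp add: \<delta>_def)
qed

text \<open>Nilpotent for 0 < r < l, since \<open>Psi r\<close> still vanishes at the double root ch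
  r. Up to a scalar it is the Radford image of the quantum character of \<open>V_r\<close>.\<close>

definition nn :: "nat \<Rightarrow> 'a" where "nn r = el (\<lambda>k. smult (ind r k) (Psi (int r)))"

lemma periodic_ind_smult: "periodic (\<lambda>k. smult (ind r k) f)"
  using periodic_ind by (simp add: periodic_def)

lemma nn_complement: "r \<le> l \<Longrightarrow> nn (l - r) = pev (Psi (int r)) - nn r"
proof -
  assume r: "r \<le> l"
  have "Psi (int (l - r)) = Psi (- int r)" using r by (intro Psi_cong) (simp add: of_nat_diff)
  then have "nn (l - r) = el (\<lambda>k. Psi (int r) + smult (- 1) (smult (ind r k) (Psi (int r))))"
    using r by (simp add: nn_def Psi_minus ind_complement smult_diff_left)
  then show ?thesis unfolding el_add el_const el_smult by (simp add: nn_def scaleC_one)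
qed

lemma ind_Psi_jump:
  assumes "0 < j" "j < l"
  shows "smult (ind j (k + 2)) (Psi (int j)) - smult (ind j k) (Psi (int j)) =
    smult ((if int l dvd k + 1 + int j then 1 else 0) - (if int l dvd k + 1 - int j then 1 else 0)) (Psi (k + 1))"
proof -
  have "ind j (k + 2) - ind j k =
      (if int l dvd k + 1 + int j then 1 else 0) - (if int l dvd k + 1 - int j then 1 else 0)"
    using ind_jump[OF assms, of "k + 1"] by (simp add: add.assoc)
  moreover have "Psi (int j) = Psi (k + 1)" if "int l dvd k + 1 - int j"
    using Psi_cong[OF that] by simp
  moreover have "Psi (int j) = Psi (k + 1)" if "int l dvd k + 1 + int j"
    using Psi_cong[of "k + 1" "- int j"] that by (simp add: Psi_minus)
  ultimately show ?thesis unfolding smult_diff_left[symmetric] by auto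
qed

lemma nn_central: "r \<le> l \<Longrightarrow> nn r \<in> center"
proof -
  assume r: "r \<le> l"
  consider "r = 0" | "r = l" | "0 < r" "r < l" using r by linarith
  then show ?thesis
  proof cases
    case 1
    then show ?thesis by (simp add: nn_def ind_def el_def center_def)
  next
    case 2
    then show ?thesis by (simp add: nn_def ind_def el_const center_def pev_central)
  next
    case 3
    then show ?thesis unfolding nn_def
      using ind_Psi_jump[OF 3] by (intro el_central periodic_ind_smult) blast
  qed
qed

lemma pev_center: "pev f \<in> center"
  by (simp add: center_def pev_central)

lemma center_subspace: "complex_vector.subspace (center :: 'a set)"
  by (auto simp: complex_vector.subspace_def center_def distrib_left distrib_right sc)

text \<open>2 generates Z/l.\<close>

lemma periodic_step2_const:
  assumes "periodic g" "\<And>k. g (k + 2) = g k"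
  shows "g k = g 0"
proof -
  have "g (k + 2 * int n) = g k" for k n
  proof (induction n)
    case (Suc n)
    then show ?case using assms(2)[of "k + 2 * int n"] by (simp add: algebra_simps)
  qed simp
  moreover obtain i where "int l dvd 0 - (k + 2 * int i)"
  proof -
    obtain i where "int l dvd k - wt 1 i" by (rule weight_index)
    then have "int l dvd k + 2 * int i" by (simp add: wt_def)
    then show thesis using that[of i] by (metis diff_0 dvd_minus_iff)
  qed
  ultimately show ?thesis using periodic_cong[OF assms(1)] by metis
qed

text \<open>Summing the jumps of g around the cycle gives a relation between the \<open>Psi\<close>,
  so their coefficients are odd in k by \<open>Psi_relation\<close>. Odd jumps are those of
  combinations of the \<open>nn j\<close>, and removing these leaves a family that is constant in
  steps of 2, hence constant.\<close>

lemma center_form: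
  assumes "z \<in> center"
  obtains f c where "degree f < l" "z = pev f + (\<Sum>j=1..l-1. c j *\<^sub>C nn j)"
proof -
  obtain c0 where z: "z = el (\<lambda>k. \<Sum>m<l. smult (c0 k m / br 1 ^ (2 * m)) (N m k))"
    and "z = (\<Sum>k\<in>Zl. \<Sum>m<l. c0 k m *\<^sub>C bas k m m)"
    and per0: "\<forall>m. periodic (\<lambda>k. c0 k m)"
    by (rule center_el[OF assms])
  define g where "g k = (\<Sum>m<l. smult (c0 k m / br 1 ^ (2 * m)) (N m k))" for k
  have zg: "z = el g" unfolding z g_def ..
  have N_per: "N m (k + int l) = N m k" for m k by (rule N_cong) simp
  have per: "periodic g" using per0 by (simp add: periodic_def g_def N_per)
  have deg: "degree (g k) < l" for k
  proof -
    have "degree (g k) \<le> l - 1"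
      unfolding g_def by (rule degree_sum_le) (auto intro: order_trans[OF degree_smult_le])
    then show ?thesis using l_ge by simp
  qed
  define a where "a k = coeff (g (k + 1) - g (k - 1)) (l - 1)" for k
  have jump: "g (k + 2) - g k = smult (a (k + 1)) (Psi (k + 1))" for k
  proof -
    obtain b where b: "g (k + 2) - g k = smult b (Psi (k + 1))"
      using center_jump[OF per deg] assms unfolding zg by metis
    have "k + 1 + 1 = k + 2" by simp
    then have "a (k + 1) = coeff (g (k + 2) - g k) (l - 1)" unfolding a_def by (simp only: add_diff_cancel_right')
    also have "\<dots> = b" unfolding b by (simp add: Psi_def lead_coeff_N)
    finally show ?thesis using b by simp
  qed
  have pera: "periodic a"
  proof -
    have "g (k + int l + 1) = g (k + 1)" "g (k + int l - 1) = g (k - 1)" for k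
      by (rule periodic_cong[OF per], simp)+
    then show ?thesis by (simp add: periodic_def a_def)
  qed
  have "(\<Sum>k\<in>Zl. smult (a (k + 1)) (Psi (k + 1))) = (\<Sum>k\<in>Zl. g (k + 2)) - (\<Sum>k\<in>Zl. g k)"
    by (simp add: jump flip: sum_subtractf)
  also have "\<dots> = 0" using sum_periodic_shift[OF per, of 2] by simp
  finally have sum0: "(\<Sum>k\<in>Zl. smult (a (k + 1)) (Psi (k + 1))) = 0" .
  have "(\<Sum>j\<in>Zl. smult (a j) (Psi j)) = 0"
  proof -
    have "Psi (k + int l) = Psi k" for k by (rule Psi_cong) simp
    then have "periodic (\<lambda>j. smult (a j) (Psi j))" using pera by (simp add: periodic_def)
    then show ?thesis
      using sum_periodic_shift[of "\<lambda>j. smult (a j) (Psi j)" 1] sum0 by (simp only:)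
  qed
  then have odd: "a (- k) = - a k" for k by (rule Psi_relation[OF pera])
  \<comment> \<open>The coefficient is half of a_j because, as j runs through 1, ..., l - 1, the
    jump at a given place is met both as j and as -j modulo l.\<close>
  define G where "G k = g k + (\<Sum>j=1..l-1. smult (a (int j) / 2) (smult (ind j k) (Psi (int j))))" for k
  have "G (k + 2) = G k" for k
  proof -
    let ?k = "k + 1"
    define w where "w j = (if int l dvd ?k + int j then 1 else 0) - (if int l dvd ?k - int j then 1 else (0::complex))" for j
    have "G (k + 2) - G k = smult (a ?k) (Psi ?k) + (\<Sum>j=1..l-1. smult (a (int j) / 2) (smult (w j) (Psi ?k)))"
    proof -
      have step: "smult (a (int j) / 2) (smult (ind j (k + 2)) (Psi (int j))) - smult (a (int j) / 2) (smult (ind j k) (Psi (int j)))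
          = smult (a (int j) / 2) (smult (w j) (Psi ?k))" if "j \<in> {1..l-1}" for j
      proof -
        have "0 < j" "j < l" using that by auto
        then show ?thesis unfolding w_def smult_diff_right[symmetric] by (simp only: ind_Psi_jump)
      qed
      have "G (k + 2) - G k = (g (k + 2) - g k) + (\<Sum>j=1..l-1.
          smult (a (int j) / 2) (smult (ind j (k + 2)) (Psi (int j))) - smult (a (int j) / 2) (smult (ind j k) (Psi (int j))))"
        unfolding G_def sum_subtractf by simp
      also have "\<dots> = smult (a ?k) (Psi ?k) + (\<Sum>j=1..l-1. smult (a (int j) / 2) (smult (w j) (Psi ?k)))"
        unfolding jump by (rule arg_cong2[where f = "(+)"], rule refl, rule sum.cong, rule refl, rule step)
      finally show ?thesis .
    qed
    also have "\<dots> = smult (a ?k + (\<Sum>j=1..l-1. a (int j) * w j) / 2) (Psi ?k)"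
      by (simp add: smult_add_left smult_sum sum_divide_distrib)
    also have "(\<Sum>j=1..l-1. a (int j) * w j) = (\<Sum>j<l. a (int j) * w j)"
    proof -
      have "a 0 = 0" using odd[of 0] by simp
      then show ?thesis by (intro sum.mono_neutral_cong) (auto simp: not_less_eq_eq)
    qed
    also have "\<dots> = (\<Sum>j<l. if int l dvd int j - - ?k then a (int j) else 0) - (\<Sum>j<l. if int l dvd int j - ?k then a (int j) else 0)"
    proof -
      have "int l dvd ?k + int j \<longleftrightarrow> int l dvd int j - - ?k" for j by (simp add: algebra_simps)
      moreover have "int l dvd ?k - int j \<longleftrightarrow> int l dvd int j - ?k" for j by (rule dvd_diff_commute)
      ultimately have "a (int j) * w j = (if int l dvd int j - - ?k then a (int j) else 0) -
          (if int l dvd int j - ?k then a (int j) else 0)" for j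
        unfolding w_def by (simp only: right_diff_distrib) simp
      then show ?thesis by (simp only: sum_subtractf)
    qed
    also have "\<dots> = a (- ?k) - a ?k"
      using sum_Zl_single[OF pera, of "- ?k"] sum_Zl_single[OF pera, of "?k"] by (simp only: sum_Zl_nat)
    finally show ?thesis by (simp only: odd) simp
  qed
  moreover have perG: "periodic G"
    using per periodic_ind unfolding periodic_def G_def by simp
  ultimately have "G k = G 0" for k by (intro periodic_step2_const)
  moreover define f where "f = G 0"
  ultimately have G: "G k = f" for k by simp
  have "el g = el (\<lambda>k. G k + smult (-1) (\<Sum>j=1..l-1. smult (a (int j) / 2) (smult (ind j k) (Psi (int j)))))"
    by (simp add: G_def)
  also have "\<dots> = pev f + (\<Sum>j=1..l-1. (- (a (int j) / 2)) *\<^sub>C nn j)"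
    unfolding el_add el_smult el_sum G el_const nn_def
    by (simp add: complex_vector.scale_sum_right sc)
  finally have "z = pev f + (\<Sum>j=1..l-1. (- (a (int j) / 2)) *\<^sub>C nn j)" by (simp add: zg)
  moreover have "degree f < l"
  proof -
    have "degree (\<Sum>j=1..l-1. smult (a (int j) / 2) (smult (ind j 0) (Psi (int j)))) \<le> l - 1"
      by (rule degree_sum_le) (auto intro!: order_trans[OF degree_smult_le])
    then show ?thesis unfolding f_def G_def using deg[of 0] l_ge by (intro degree_add_less) auto
  qed
  ultimately show thesis by (intro that[of f "\<lambda>j. - (a (int j) / 2)"])
qed

end

section \<open>Tensors and the antipode\<close>

lemma clinear_add: "clinear T \<Longrightarrow> T (x + y) = T x + T y"
  and clinear_scale: "clinear T \<Longrightarrow> T (c *\<^sub>C x) = c *\<^sub>C T x"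
  by (auto simp: clinear_iff)

lemma clinear_0: "clinear T \<Longrightarrow> T 0 = 0"
  by (rule complex_vector.linear_0)

lemma clinear_compose: "clinear T \<Longrightarrow> clinear g \<Longrightarrow> clinear (\<lambda>x. T (g x))"
  by (simp add: clinear_iff)

lemma cbilinear_compose: "clinear T \<Longrightarrow> cbilinear f \<Longrightarrow> cbilinear (\<lambda>a b. T (f a b))"
  by (rule cbilinearI) (simp_all add: cbilinear_simps clinear_add clinear_scale)

lemma cbilinear_mult: "clinear f \<Longrightarrow> clinear g \<Longrightarrow> cbilinear (\<lambda>a b. f a * g b :: 'c::complex_algebra_1)"
  by (rule cbilinearI) (simp_all add: clinear_add clinear_scale algebra_simps mult_scaleC_left mult_scaleC_right)

lemma clinear_id: "clinear (\<lambda>x. x)"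
  by (simp add: clinear_iff)

lemma clinear_mult_left: "clinear (\<lambda>x. c * x :: 'c::complex_algebra_1)"
  and clinear_mult_right: "clinear (\<lambda>x. x * c :: 'c::complex_algebra_1)"
  by (simp_all add: clinear_iff algebra_simps mult_scaleC_left mult_scaleC_right)

lemma tensor_lift_compose:
  assumes "cbilinear f" "clinear T"
  shows "T (tensor_lift f t) = tensor_lift (\<lambda>a b. T (f a b)) t"
  by (induction t) (simp_all add: tensor_lift_0 tensor_lift_pure tensor_lift_add assms cbilinear_compose
      clinear_0 clinear_add)

lemma tensor_lift_cong:
  assumes "\<And>a b. f a b = g a b"
  shows "tensor_lift f t = tensor_lift g t"
proof -
  have "f = g" using assms by (simp add: fun_eq_iff)
  then show ?thesis by simp
qed

lemma clinear_tensor_lift_param: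
  assumes "\<And>c. cbilinear (G c)" "\<And>a b. clinear (\<lambda>c. G c a b)"
  shows "clinear (\<lambda>c. tensor_lift (G c) t)"
proof (induction t)
  case zero
  show ?case using assms(1) by (simp add: tensor_lift_0 clinear_iff)
next
  case (add s t)
  then show ?case using assms(1) by (simp add: tensor_lift_add clinear_iff scaleC_add_right add_ac)
qed (use assms in \<open>simp_all add: tensor_lift_pure\<close>)

lemma tensor_lift_times_pure:
  assumes "cbilinear f"
  shows "tensor_lift f (t * (c \<boxtimes> d)) = tensor_lift (\<lambda>a b. f (a * c) (b * d)) t"
proof -
  have "cbilinear (\<lambda>a b. f (a * c) (b * d))"
    by (rule cbilinearI) (simp_all add: algebra_simps mult_scaleC_left cbilinear_simps[OF assms])
  then show ?thesis
    by (induction t) (simp_all add: tensor_lift_0 tensor_lift_add tensor_lift_pure assms times_pure_tensor distrib_right)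
qed

context hopf_algebra
begin

lemma comult_clinear: "clinear \<Delta>" and comult_1: "\<Delta> 1 = 1" and comult_mult: "\<Delta> (x * y) = \<Delta> x * \<Delta> y"
  and counit_clinear: "clinear \<epsilon>" and counit_1: "\<epsilon> 1 = 1" and counit_mult: "\<epsilon> (x * y) = \<epsilon> x * \<epsilon> y"
  using comult_hom counit_hom by (auto simp: calgebra_hom_def)

text \<open>In the convolution algebra g is g times the unit id * S, hence (g * id) * S. The map T
  evaluates g(x') x'' S(x''') on the two bracketings supplied by coassociativity.\<close>

lemma convolution_unique:
  assumes g: "clinear g" and conv: "\<And>x. tensor_lift (\<lambda>a b. g a * b) (\<Delta> x) = \<epsilon> x *\<^sub>C c"
  shows "g x = c * S x"
proof -
  define T1 where "T1 = tensor_lift (\<lambda>y z. y * S z)"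
  have b1: "cbilinear (\<lambda>y z. y * S z)"
    by (rule cbilinear_mult[OF clinear_id antipode_linear])
  have T1: "clinear T1" unfolding T1_def by (rule clinear_tensor_lift[OF b1])
  have b2: "cbilinear (\<lambda>a t. g a * T1 t)" by (rule cbilinear_mult[OF g T1])
  define T where "T = tensor_lift (\<lambda>a t. g a * T1 t)"
  have T: "clinear T" unfolding T_def by (rule clinear_tensor_lift[OF b2])
  have Tp: "T (a \<boxtimes> t) = g a * T1 t" for a t unfolding T_def by (rule tensor_lift_pure[OF b2])
  have T1p: "T1 (a \<boxtimes> b) = a * S b" for a b unfolding T1_def by (rule tensor_lift_pure[OF b1])
  have b3: "cbilinear (\<lambda>(a'::'a) (a''::'a). a' \<boxtimes> (a'' \<boxtimes> b))" for b :: 'a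
    by (rule cbilinearI) (simp_all add: pure_tensor_simps)
  have b4: "cbilinear (\<lambda>a (b::'a). tensor_lift (\<lambda>a' a''. a' \<boxtimes> (a'' \<boxtimes> b)) (\<Delta> a))"
    unfolding cbilinear_def
  proof (intro conjI allI)
    show "clinear (\<lambda>b::'a. tensor_lift (\<lambda>a' a''. a' \<boxtimes> (a'' \<boxtimes> b)) (\<Delta> a))" for a
      by (rule clinear_tensor_lift_param[where G = "\<lambda>(b::'a) (a'::'a) (a''::'a). a' \<boxtimes> (a'' \<boxtimes> b)"])
        (simp_all add: b3 clinear_iff pure_tensor_simps)
    show "clinear (\<lambda>a. tensor_lift (\<lambda>a' a''. a' \<boxtimes> (a'' \<boxtimes> b)) (\<Delta> a))" for b :: 'a
      by (rule clinear_compose[OF clinear_tensor_lift[OF b3] comult_clinear])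
  qed
  have b5: "cbilinear (\<lambda>a b. a \<boxtimes> \<Delta> b)"
    by (rule cbilinearI) (simp_all add: pure_tensor_simps clinear_add[OF comult_clinear] clinear_scale[OF comult_clinear])
  have bg: "cbilinear (\<lambda>a b. g a * b)" by (rule cbilinear_mult[OF g clinear_id])
  have be: "cbilinear (\<lambda>a b. \<epsilon> b *\<^sub>C a)" "cbilinear (\<lambda>a b. \<epsilon> a *\<^sub>C b)"
    by (rule cbilinearI; simp add: clinear_add[OF counit_clinear] clinear_scale[OF counit_clinear]
        scaleC_add_left scaleC_add_right scaleC_scaleC mult.commute)+
  have "T (tensor_lift (\<lambda>a b. a \<boxtimes> \<Delta> b) (\<Delta> x)) = tensor_lift (\<lambda>a b. T (a \<boxtimes> \<Delta> b)) (\<Delta> x)"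
    by (rule tensor_lift_compose[OF b5 T])
  also have "\<dots> = tensor_lift (\<lambda>a b. g (\<epsilon> b *\<^sub>C a)) (\<Delta> x)"
    by (rule tensor_lift_cong)
      (simp add: Tp T1_def antipode_right mult_scaleC_right clinear_scale[OF g])
  also have "\<dots> = g (tensor_lift (\<lambda>a b. \<epsilon> b *\<^sub>C a) (\<Delta> x))"
    by (rule tensor_lift_compose[OF be(1) g, symmetric])
  also have "\<dots> = g x" by (simp add: counit_right)
  finally have 1: "T (tensor_lift (\<lambda>a b. a \<boxtimes> \<Delta> b) (\<Delta> x)) = g x" .
  have "T (tensor_lift (\<lambda>a b. tensor_lift (\<lambda>a' a''. a' \<boxtimes> (a'' \<boxtimes> b)) (\<Delta> a)) (\<Delta> x)) =
      tensor_lift (\<lambda>a b. T (tensor_lift (\<lambda>a' a''. a' \<boxtimes> (a'' \<boxtimes> b)) (\<Delta> a))) (\<Delta> x)"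
    by (rule tensor_lift_compose[OF b4 T])
  also have "\<dots> = tensor_lift (\<lambda>a b. c * S (\<epsilon> a *\<^sub>C b)) (\<Delta> x)"
  proof (rule tensor_lift_cong)
    fix a b
    have "T (tensor_lift (\<lambda>a' a''. a' \<boxtimes> (a'' \<boxtimes> b)) (\<Delta> a)) = tensor_lift (\<lambda>a' a''. T (a' \<boxtimes> (a'' \<boxtimes> b))) (\<Delta> a)"
      by (rule tensor_lift_compose[OF b3 T])
    also have "\<dots> = tensor_lift (\<lambda>a' a''. (g a' * a'') * S b) (\<Delta> a)"
      by (rule tensor_lift_cong) (simp add: Tp T1p mult.assoc)
    also have "\<dots> = tensor_lift (\<lambda>a' a''. g a' * a'') (\<Delta> a) * S b"
      by (rule tensor_lift_compose[OF bg clinear_mult_right, symmetric])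
    finally show "T (tensor_lift (\<lambda>a' a''. a' \<boxtimes> (a'' \<boxtimes> b)) (\<Delta> a)) = c * S (\<epsilon> a *\<^sub>C b)"
      by (simp add: conv mult_scaleC_left mult_scaleC_right clinear_scale[OF antipode_linear])
  qed
  also have "\<dots> = c * S (tensor_lift (\<lambda>a b. \<epsilon> a *\<^sub>C b) (\<Delta> x))"
    by (rule tensor_lift_compose[OF be(2) clinear_compose[OF clinear_mult_left antipode_linear], symmetric])
  also have "\<dots> = c * S x" by (simp add: counit_left)
  finally show ?thesis using 1 coassoc[of x] by simp
qed

lemma antipode_1: "S 1 = 1"
proof -
  have "tensor_lift (\<lambda>a b. S a * b) (1 \<boxtimes> 1) = S 1 * 1"
    by (rule tensor_lift_pure[OF cbilinear_mult[OF antipode_linear clinear_id]])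
  then show ?thesis using antipode_left[of 1] by (simp add: comult_1 one_tensor_def counit_1 scaleC_one)
qed

end

context uqsl2_odd
begin

lemma S_E: "S E = - (E * Km)" and S_F: "S F = - (K * F)" and S_K: "S K = Km"
  by (simp_all add: antipode_E antipode_F antipode_K Km_def)

text \<open>For a generator c the antipode axiom at x c, with the known coproduct of c, can be
  solved for the convolution of x to S (x c) with the identity. The result is \<epsilon> x times S
  c, and \<open>convolution_unique\<close> applies.\<close>

lemma antipode_mult_gen:
  shows "S (x * K) = S K * S x" "S (x * E) = S E * S x" "S (x * F) = S F * S x"
proof -
  note lS = antipode_linear
  have bS: "cbilinear (\<lambda>a b. S a * b)" by (rule cbilinear_mult[OF lS clinear_id])
  have lin: "clinear (\<lambda>a. S (a * c))" for c by (rule clinear_compose[OF lS clinear_mult_right])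
  have bc: "cbilinear (\<lambda>a b. S (a * c) * b)" for c by (rule cbilinear_mult[OF lin clinear_id])
  have pure: "tensor_lift (\<lambda>a b. S a * b) (\<Delta> x * (c \<boxtimes> d)) = tensor_lift (\<lambda>a b. S (a * c) * b) (\<Delta> x) * d" for x c d
  proof -
    have "tensor_lift (\<lambda>a b. S a * b) (\<Delta> x * (c \<boxtimes> d)) = tensor_lift (\<lambda>a b. S (a * c) * (b * d)) (\<Delta> x)"
      by (rule tensor_lift_times_pure[OF bS])
    also have "\<dots> = tensor_lift (\<lambda>a b. (S (a * c) * b) * d) (\<Delta> x)" by (simp add: mult.assoc)
    also have "\<dots> = tensor_lift (\<lambda>a b. S (a * c) * b) (\<Delta> x) * d"
      by (rule tensor_lift_compose[OF bc clinear_mult_right, symmetric])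
    finally show ?thesis .
  qed
  have K: "tensor_lift (\<lambda>a b. S (a * K) * b) (\<Delta> x) = \<epsilon> x *\<^sub>C Km" for x
  proof -
    have "tensor_lift (\<lambda>a b. S (a * K) * b) (\<Delta> x) * K = \<epsilon> x *\<^sub>C 1"
      using antipode_left[of "x * K"] pure[of x K K] by (simp add: comult_mult comult_K counit_mult counit_K)
    then have "tensor_lift (\<lambda>a b. S (a * K) * b) (\<Delta> x) * K * Km = \<epsilon> x *\<^sub>C Km"
      by (simp add: sc)
    then show ?thesis by (simp only: mult.assoc K_Km mult_1_right)
  qed
  from convolution_unique[OF lin K] show xK: "S (x * K) = S K * S x" for x by (simp add: S_K)
  have xKm: "S (x * Km) = K * S x" for x
  proof -
    have "S x = Km * S (x * Km)" using xK[of "x * Km"] by (simp add: mult.assoc S_K)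
    then have "K * S x = (K * Km) * S (x * Km)" by (simp only: mult.assoc)
    then show ?thesis by simp
  qed
  have E: "tensor_lift (\<lambda>a b. S (a * E) * b) (\<Delta> x) = \<epsilon> x *\<^sub>C S E" for x
  proof -
    have "0 = tensor_lift (\<lambda>a b. S a * b) (\<Delta> x * (1 \<boxtimes> E)) + tensor_lift (\<lambda>a b. S a * b) (\<Delta> x * (E \<boxtimes> K))"
      using antipode_left[of "x * E"]
      by (simp add: comult_mult comult_E counit_mult counit_E distrib_left tensor_lift_add[OF bS])
    also have "\<dots> = \<epsilon> x *\<^sub>C E + tensor_lift (\<lambda>a b. S (a * E) * b) (\<Delta> x) * K"
      unfolding pure by (simp add: antipode_left sc)
    finally have "tensor_lift (\<lambda>a b. S (a * E) * b) (\<Delta> x) * K = - (\<epsilon> x *\<^sub>C E)"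
      by (simp add: eq_neg_iff_add_eq_0 add.commute)
    then have "tensor_lift (\<lambda>a b. S (a * E) * b) (\<Delta> x) * K * Km = - (\<epsilon> x *\<^sub>C (E * Km))"
      by (simp add: sc)
    then show ?thesis by (simp add: S_E mult.assoc)
  qed
  from convolution_unique[OF lin E] show "S (x * E) = S E * S x" .
  have F: "tensor_lift (\<lambda>a b. S (a * F) * b) (\<Delta> x) = \<epsilon> x *\<^sub>C S F" for x
  proof -
    have "0 = tensor_lift (\<lambda>a b. S a * b) (\<Delta> x * (Km \<boxtimes> F)) + tensor_lift (\<lambda>a b. S a * b) (\<Delta> x * (F \<boxtimes> 1))"
      using antipode_left[of "x * F"]
      by (simp add: comult_mult comult_F counit_mult counit_F distrib_left tensor_lift_add[OF bS] Km_def)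
    also have "\<dots> = K * tensor_lift (\<lambda>a b. S a * b) (\<Delta> x) * F + tensor_lift (\<lambda>a b. S (a * F) * b) (\<Delta> x)"
    proof -
      have "tensor_lift (\<lambda>a b. K * S a * b) (\<Delta> x) = K * tensor_lift (\<lambda>a b. S a * b) (\<Delta> x)"
        using tensor_lift_compose[OF bS clinear_mult_left, of K "\<Delta> x"] by (simp add: mult.assoc)
      then show ?thesis unfolding pure xKm by simp
    qed
    finally have "tensor_lift (\<lambda>a b. S (a * F) * b) (\<Delta> x) = - (K * tensor_lift (\<lambda>a b. S a * b) (\<Delta> x) * F)"
      by (simp add: eq_neg_iff_add_eq_0 add.commute)
    then show ?thesis by (simp add: antipode_left S_F sc)
  qed
  from convolution_unique[OF lin F] show "S (x * F) = S F * S x" .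
qed

lemma antipode_mult: "S (x * y) = S y * S x"
proof -
  have "\<forall>x. S (x * y) = S y * S x"
  proof (induction y rule: generated_induct)
    case (7 y z)
    show ?case
    proof
      fix x
      have "S (x * (y * z)) = S z * (S y * S x)" using 7 by (simp add: mult.assoc[symmetric])
      also have "\<dots> = S (y * z) * S x" using 7 by (simp add: mult.assoc)
      finally show "S (x * (y * z)) = S (y * z) * S x" .
    qed
  qed (simp_all add: antipode_mult_gen antipode_1 distrib_left distrib_right sc
      clinear_add[OF antipode_linear] clinear_scale[OF antipode_linear])
  then show ?thesis by blast
qed

text \<open>As a consequence the quantum characters are exactly the traces on H composed with
  multiplication by K^(-1).\<close>

lemma antipode_squared: "S (S x) = K * x * Km"
proof (induction x rule: generated_induct)
  have "S Km * Km = S 1" using antipode_mult[of K Km] by (simp add: S_K)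
  then have "S Km * Km * K = K" by (simp add: antipode_1)
  then have S_Km: "S Km = K" by (simp add: mult.assoc)
  have neg: "S (- x) = - S x" for x by (rule complex_vector.linear_neg[OF antipode_linear])
  case 1
  show ?case by (simp add: S_E neg antipode_mult S_Km mult.assoc)
  case 2
  show ?case by (simp add: S_F neg antipode_mult S_K mult.assoc)
  case 3
  show ?case by (simp add: S_K S_Km mult.assoc)
next
  case (7 x y)
  have "K * x * Km * (K * y * Km) = K * x * (Km * K) * y * Km" by (simp only: mult.assoc)
  then show ?case using 7 by (simp add: antipode_mult mult.assoc)
qed (simp_all add: antipode_1 clinear_add[OF antipode_linear] clinear_scale[OF antipode_linear] distrib_left distrib_right sc)

end

section \<open>Quantum characters, the Drinfeld map and the Radford map\<close>

fun gbin :: "complex \<Rightarrow> nat \<Rightarrow> nat \<Rightarrow> complex" where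
  "gbin Q n 0 = 1"
| "gbin Q 0 (Suc i) = 0"
| "gbin Q (Suc n) (Suc i) = gbin Q n i + Q ^ Suc i * gbin Q n (Suc i)"

lemma gbin_eq_0: "n < i \<Longrightarrow> gbin Q n i = 0"
  by (induction Q n i rule: gbin.induct) auto

lemma gbin_closed:
  "gbin Q n i * (\<Prod>s=1..i. 1 - Q ^ s) = (\<Prod>s<i. 1 - Q ^ (n - s))"
proof (induction Q n i rule: gbin.induct)
  case (2 Q i)
  have "(\<Prod>s<Suc i. 1 - Q ^ (0 - s)) = (0 :: complex)" by (intro prod_zero) auto
  then show ?case by simp
next
  case (3 Q n i)
  let ?T = "\<lambda>n i. \<Prod>s<i. 1 - Q ^ (n - s) :: complex"
  have "gbin Q (Suc n) (Suc i) * (\<Prod>s=1..Suc i. 1 - Q ^ s) =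
      (gbin Q n i * (\<Prod>s=1..i. 1 - Q ^ s)) * (1 - Q ^ Suc i) +
      Q ^ Suc i * (gbin Q n (Suc i) * (\<Prod>s=1..Suc i. 1 - Q ^ s))"
    by (simp add: algebra_simps)
  also have "\<dots> = ?T n i * (1 - Q ^ Suc i) + Q ^ Suc i * (?T n i * (1 - Q ^ (n - i)))"
    using 3 by (simp del: gbin.simps prod.cl_ivl_Suc)
  also have "\<dots> = ?T n i * (1 - Q ^ Suc n)"
  proof (cases "i \<le> n")
    case True
    then have "Q ^ Suc i * Q ^ (n - i) = Q ^ Suc n" by (simp flip: power_add power_Suc)
    moreover have "t * (1 - x) + x * (t * (1 - y)) = t * (1 - x * y)" for t x y :: complex
      by (simp add: algebra_simps)
    ultimately show ?thesis by (simp only:)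
  next
    case False
    then have T0: "?T n i = 0" by (intro prod_zero) (auto intro!: bexI[of _ n])
    show ?thesis unfolding T0 by simp
  qed
  also have "\<dots> = ?T (Suc n) (Suc i)"
    by (subst prod.lessThan_Suc_shift) simp
  finally show ?case .
qed simp

lemma q_binomial:
  fixes A B :: "'b::complex_algebra_1"
  assumes "B * A = Q *\<^sub>C (A * B)"
  shows "(A + B) ^ n = (\<Sum>i\<le>n. gbin Q n i *\<^sub>C (A ^ i * B ^ (n - i)))"
proof (induction n)
  case (Suc n)
  have BA: "B * A ^ i = (Q ^ i) *\<^sub>C (A ^ i * B)" for i
  proof (induction i)
    case (Suc i)
    have "B * A ^ Suc i = Q *\<^sub>C (A * (B * A ^ i))"
      by (simp add: assms mult_scaleC_left flip: mult.assoc)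
    then show ?case unfolding Suc by (simp add: mult_scaleC_right scaleC_scaleC mult.assoc)
  qed (simp add: scaleC_one)
  let ?t = "\<lambda>i. A ^ i * B ^ (Suc n - i)"
  have "(A + B) ^ Suc n = (\<Sum>i\<le>n. gbin Q n i *\<^sub>C (A ^ Suc i * B ^ (n - i))) +
      (\<Sum>i\<le>n. (Q ^ i * gbin Q n i) *\<^sub>C (A ^ i * (B * B ^ (n - i))))"
  proof -
    have B: "B * (A ^ i * X) = (Q ^ i) *\<^sub>C (A ^ i * (B * X))" for i X
      using arg_cong[OF BA[of i], of "\<lambda>y. y * X"] by (simp add: mult.assoc mult_scaleC_left)
    have "(A + B) * (c *\<^sub>C (A ^ i * X)) = c *\<^sub>C (A ^ Suc i * X) + (Q ^ i * c) *\<^sub>C (A ^ i * (B * X))" for c i X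
      by (simp add: distrib_right mult_scaleC_right B scaleC_scaleC scaleC_add_right mult.assoc mult.commute)
    then show ?thesis by (simp only: power_Suc[of "A + B"] Suc sum_distrib_left sum.distrib)
  qed
  also have "(\<Sum>i\<le>n. (Q ^ i * gbin Q n i) *\<^sub>C (A ^ i * (B * B ^ (n - i)))) =
      (\<Sum>i\<le>Suc n. (Q ^ i * gbin Q n i) *\<^sub>C ?t i)"
    by (simp add: gbin_eq_0) (rule sum.cong, simp_all add: Suc_diff_le)
  also have "\<dots> = ?t 0 + (\<Sum>i\<le>n. (Q ^ Suc i * gbin Q n (Suc i)) *\<^sub>C ?t (Suc i))"
    by (subst sum.atMost_Suc_shift) (simp add: scaleC_one)
  also have "(\<Sum>i\<le>n. gbin Q n i *\<^sub>C (A ^ Suc i * B ^ (n - i))) = (\<Sum>i\<le>n. gbin Q n i *\<^sub>C ?t (Suc i))"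
    by simp
  finally have "(A + B) ^ Suc n = ?t 0 + (\<Sum>i\<le>n. gbin Q (Suc n) (Suc i) *\<^sub>C ?t (Suc i))"
    by (simp add: scaleC_add_left sum.distrib add_ac)
  also have "\<dots> = (\<Sum>i\<le>Suc n. gbin Q (Suc n) i *\<^sub>C ?t i)"
    by (subst sum.atMost_Suc_shift) (simp add: scaleC_one)
  finally show ?case .
qed (simp add: scaleC_one)

lemma sum_swap4:
  "(\<Sum>i\<in>A. \<Sum>j\<in>B. \<Sum>k\<in>C. \<Sum>k'\<in>D. f i j k k') = (\<Sum>k\<in>C. \<Sum>k'\<in>D. \<Sum>i\<in>A. \<Sum>j\<in>B. f i j k k')"
proof -
  have "(\<Sum>i\<in>A. \<Sum>j\<in>B. \<Sum>k\<in>C. \<Sum>k'\<in>D. f i j k k') = (\<Sum>i\<in>A. \<Sum>k\<in>C. \<Sum>j\<in>B. \<Sum>k'\<in>D. f i j k k')"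
    by (intro sum.cong refl sum.swap)
  also have "\<dots> = (\<Sum>k\<in>C. \<Sum>i\<in>A. \<Sum>k'\<in>D. \<Sum>j\<in>B. f i j k k')"
    by (subst sum.swap) (intro sum.cong refl sum.swap)
  also have "\<dots> = (\<Sum>k\<in>C. \<Sum>k'\<in>D. \<Sum>i\<in>A. \<Sum>j\<in>B. f i j k k')"
    by (intro sum.cong refl sum.swap)
  finally show ?thesis .
qed

lemma sum_pure_left: "(\<Sum>i\<in>A. f i) \<boxtimes> b = (\<Sum>i\<in>A. f i \<boxtimes> b)"
  and sum_pure_right: "a \<boxtimes> (\<Sum>i\<in>A. g i) = (\<Sum>i\<in>A. a \<boxtimes> g i)"
  by (induction A rule: infinite_finite_induct) (simp_all add: pure_tensor_simps)

lemma pure_tensor_power: "(a \<boxtimes> b) ^ n = (a ^ n) \<boxtimes> (b ^ n)"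
  by (induction n) (simp_all add: one_tensor_def times_pure_tensor)

lemma cbilinear_flip: "cbilinear (\<lambda>a b. b \<boxtimes> a)"
  by (rule cbilinearI) (simp_all add: pure_tensor_simps)

lemma tensor_flip_pure: "tensor_flip (a \<boxtimes> b) = b \<boxtimes> a"
  unfolding tensor_flip_def by (rule tensor_lift_pure[OF cbilinear_flip])

lemma clinear_flip: "clinear tensor_flip"
  unfolding tensor_flip_def by (rule clinear_tensor_lift[OF cbilinear_flip])

lemma cbilinear_slice: "clinear \<beta> \<Longrightarrow> cbilinear (\<lambda>a b. \<beta> a *\<^sub>C b)"
  by (rule cbilinearI)
    (simp_all add: clinear_add clinear_scale scaleC_add_left scaleC_add_right scaleC_scaleC mult.commute)

lemma tensor_slice_pure: "clinear \<beta> \<Longrightarrow> tensor_slice \<beta> (a \<boxtimes> b) = \<beta> a *\<^sub>C b"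
  unfolding tensor_slice_def by (rule tensor_lift_pure[OF cbilinear_slice])

lemma clinear_slice: "clinear \<beta> \<Longrightarrow> clinear (tensor_slice \<beta>)"
  unfolding tensor_slice_def by (rule clinear_tensor_lift[OF cbilinear_slice])

section \<open>Scalar sums occurring in R and in the coproduct of the integral\<close>

context odd_root
begin

text \<open>The sum over i vanishes unless 2j = 2m + k modulo l, that is j = (h + 1)(2m + k).
  Inserting this j leaves a half power of q, the origin of \<open>hp\<close>.\<close>

lemma R_coefficient:
  "(\<Sum>i<l. \<Sum>j<l. qp (2 * m * (int i - int j) - 2 * int i * int j) * (qp (k * int i) * qp (k' * int j))) =
    of_nat l * hp ((k + 2 * m) * (k' - 2 * m))"
proof -
  have "(\<Sum>i<l. \<Sum>j<l. qp (2 * m * (int i - int j) - 2 * int i * int j) * (qp (k * int i) * qp (k' * int j))) =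
      (\<Sum>j\<in>Zl. \<Sum>i\<in>Zl. qp ((2 * m - 2 * j + k) * i) * qp ((k' - 2 * m) * j))"
    unfolding sum_Zl_nat by (subst sum.swap) (simp add: algebra_simps flip: qp_add)
  also have "\<dots> = (\<Sum>j\<in>Zl. if int l dvd j - int (h + 1) * (2 * m + k) then of_nat l * qp ((k' - 2 * m) * j) else 0)"
  proof (rule sum.cong)
    fix j
    have e1: "2 * m - 2 * j + k = - 2 * (j - int (h + 1) * (2 * m + k)) - int l * (2 * m + k)"
      by (simp add: l_eq algebra_simps)
    have "int l dvd 2 * m - 2 * j + k \<longleftrightarrow> int l dvd - 2 * (j - int (h + 1) * (2 * m + k))"
      unfolding e1 by (metis dvd_diff_left_iff dvd_triv_left)
    also have "- 2 * (j - int (h + 1) * (2 * m + k)) = - (2 * (j - int (h + 1) * (2 * m + k)))" by simp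
    also have "int l dvd \<dots> \<longleftrightarrow> int l dvd j - int (h + 1) * (2 * m + k)"
      by (simp only: dvd_minus_iff coprime_l_2)
    finally have "int l dvd 2 * m - 2 * j + k \<longleftrightarrow> int l dvd j - int (h + 1) * (2 * m + k)" .
    then show "(\<Sum>i\<in>Zl. qp ((2 * m - 2 * j + k) * i) * qp ((k' - 2 * m) * j)) =
        (if int l dvd j - int (h + 1) * (2 * m + k) then of_nat l * qp ((k' - 2 * m) * j) else 0)"
      by (simp only: sum_distrib_right[symmetric] sum_qp) simp
  qed simp
  also have "\<dots> = of_nat l * qp ((k' - 2 * m) * (int (h + 1) * (2 * m + k)))"
    by (rule sum_Zl_single) (auto simp: periodic_def algebra_simps intro!: qp_cong)
  also have "(k' - 2 * m) * (int (h + 1) * (2 * m + k)) = int (h + 1) * ((k + 2 * m) * (k' - 2 * m))"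
    by (simp add: algebra_simps)
  finally show ?thesis by (simp add: hp_def)
qed

text \<open>Modulo l the numerator of either binomial is the denominator of the other, so they are
  inverse to each other. They meet in the coproduct of F^(l-1) E^(l-1).\<close>

lemma gbin_last:
  assumes "i \<le> l - 1"
  shows "gbin (qp (- 2)) (l - 1) i * gbin (qp 2) (l - 1) i = 1"
proof -
  define P P' where "P = (\<Prod>s=1..i. 1 - qp 2 ^ s)" and "P' = (\<Prod>s=1..i. 1 - qp (- 2) ^ s)"
  have pow: "qp a ^ n = qp (a * int n)" for a n by (simp add: qp_mult_nat)
  have nz: "1 - qp (2 * int s) \<noteq> 0" "1 - qp (- 2 * int s) \<noteq> 0" if "s \<in> {1..i}" for s
  proof -
    have "\<not> int l dvd int s" using that assms l_ge by (auto dest: dvd_imp_le)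
    then have "\<not> int l dvd 2 * int s" "\<not> int l dvd - (2 * int s)" by (simp_all only: dvd_minus_iff coprime_l_2 not_False_eq_True)
    then have "qp (2 * int s) \<noteq> 1" "qp (- 2 * int s) \<noteq> 1" by (simp_all add: qp_eq_1_iff)
    then show "1 - qp (2 * int s) \<noteq> 0" "1 - qp (- 2 * int s) \<noteq> 0" by simp_all
  qed
  then have P: "P \<noteq> 0" "P' \<noteq> 0" unfolding P_def P'_def pow by simp_all
  have shift: "(\<Prod>s<i. 1 - qp a ^ (l - 1 - s)) = (\<Prod>s=1..i. 1 - qp (- a) ^ s)" for a
  proof (rule prod.reindex_bij_witness[of _ "\<lambda>s. s - 1" Suc])
    fix s assume "s \<in> {..<i}"
    then have "s \<le> l - 1" using assms by simp
    then have "int l dvd a * int (l - 1 - s) - (- a * int (Suc s))"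
      using l_ge by (simp add: of_nat_diff algebra_simps)
    then show "1 - qp (- a) ^ Suc s = 1 - qp a ^ (l - 1 - s)"
      unfolding pow using qp_cong by metis
  qed auto
  have "gbin (qp 2) (l - 1) i * P = P'" "gbin (qp (- 2)) (l - 1) i * P' = P"
    unfolding P_def P'_def gbin_closed shift by simp_all
  then have "gbin (qp 2) (l - 1) i = P' / P" "gbin (qp (- 2)) (l - 1) i = P / P'"
    using P by (simp_all add: field_simps)
  then show ?thesis using P by simp
qed

text \<open>The coefficient of E^m \<otimes> F^m in R with the Cartan part split off; see
  \<open>am_eq\<close>.\<close>

definition am :: "nat \<Rightarrow> complex" where "am m = br 1 ^ (2 * m) * hp (int m * (int m - 1)) / bf m"

lemma qfact_bf: "qfact q n = bf n / br 1 ^ n"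
  unfolding qfact_def bf_def qint_br by (simp add: prod_dividef)

lemma am_eq:
  "(q - inverse q) ^ m / qfact q m * q powi (int (m * (m - 1) div 2) + x) = am m * qp x"
proof -
  have "2 * int (m * (m - 1) div 2) = int m * (int m - 1)"
  proof -
    have "2 * (m * (m - 1) div 2) = m * (m - 1)" by (cases m) simp_all
    then have "2 * int (m * (m - 1) div 2) = int (m * (m - 1))" by (metis of_nat_mult of_nat_numeral)
    then show ?thesis by (cases m) (simp_all add: algebra_simps)
  qed
  then have "qp (int (m * (m - 1) div 2)) = hp (int m * (int m - 1))" by (simp flip: hp_double)
  then show ?thesis
    unfolding qp_def[symmetric] qp_add am_def qfact_bf br_1[symmetric]
    by (simp add: mult_2 power_add)
qed

lemma am_ca: "(am n)\<^sup>2 = ca n * br 1 ^ (2 * n) * br 1 ^ (2 * n)"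
  by (simp add: am_def ca_def power_mult_distrib power_divide power2_eq_square flip: hp_double hp_add)

end

context uqsl2_odd
begin

lemma K_Km_left [simp]: "K * (Km * x) = x" "Km * (K * x) = x"
  by (simp_all flip: mult.assoc)

lemma qCh_linear: "\<beta> \<in> qCh S \<Longrightarrow> clinear \<beta>"
  by (simp add: qCh_def)

text \<open>S^2 fixes K, so \<beta> (x K) = \<beta> (K x), which forces \<beta> to vanish on
  elements of nonzero weight.\<close>

lemma qCh_weight: "\<beta> \<in> qCh S \<Longrightarrow> m < l \<Longrightarrow> n < l \<Longrightarrow> m \<noteq> n \<Longrightarrow> \<beta> (bas k m n) = 0"
proof -
  assume b: "\<beta> \<in> qCh S" and mn: "m < l" "n < l" "m \<noteq> n"
  have "\<beta> (bas k m n * K) = \<beta> (K * K * Km * bas k m n)"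
    using b by (simp only: qCh_def antipode_squared mem_Collect_eq)
  then have "\<beta> (bas k m n * K) = \<beta> (K * bas k m n)" by (simp add: mult.assoc)
  then have "qp (k + 2 * (int m - int n)) * \<beta> (bas k m n) = qp k * \<beta> (bas k m n)"
    unfolding K_bas bas_K clinear_scale[OF qCh_linear[OF b]] by simp
  then show ?thesis using qp_weight_neq[OF mn, of k] by auto
qed

definition Rm :: "('a, 'a) tensor" where "Rm = uqsl2_R l q E F K"

text \<open>Expanding K^i and K^j in idempotents turns the sums over i and j into
  \<open>R_coefficient\<close>. Moving the idempotents to the left of E^m and F^m shifts k and k' by
  2m and -2m, and the coefficient becomes q^(k k' / 2) without m.\<close>

lemma R_eq: "Rm = (\<Sum>m<l. am m *\<^sub>C (\<Sum>k\<in>Zl. \<Sum>k'\<in>Zl. hp (k * k') *\<^sub>C ((eK k * E ^ m) \<boxtimes> (eK k' * F ^ m))))"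
proof -
  have inner: "(\<Sum>i<l. \<Sum>j<l. qp (2 * int m * (int i - int j) - 2 * int i * int j) *\<^sub>C ((E ^ m * K ^ i) \<boxtimes> (F ^ m * K ^ j))) =
      of_nat l *\<^sub>C (\<Sum>k\<in>Zl. \<Sum>k'\<in>Zl. hp (k * k') *\<^sub>C ((eK k * E ^ m) \<boxtimes> (eK k' * F ^ m)))" for m
  proof -
    let ?m = "int m"
    define T where "T k k' = (E ^ m * eK k) \<boxtimes> (F ^ m * eK k')" for k k'
    have T: "T k k' = (eK (k + 2 * ?m) * E ^ m) \<boxtimes> (eK (k' - 2 * ?m) * F ^ m)" for k k'
      by (simp add: T_def E_pow_eK F_pow_eK)
    have "(E ^ m * K ^ i) \<boxtimes> (F ^ m * K ^ j) = (\<Sum>k\<in>Zl. \<Sum>k'\<in>Zl. (qp (k * int i) * qp (k' * int j)) *\<^sub>C T k k')" for i j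
    proof -
      have "(E ^ m * K ^ i) \<boxtimes> (F ^ m * K ^ j) = (\<Sum>k\<in>Zl. (E ^ m * (qp (k * int i) *\<^sub>C eK k)) \<boxtimes> (F ^ m * K ^ j))"
        unfolding K_pow_sum[of i] sum_distrib_left sum_pure_left ..
      also have "\<dots> = (\<Sum>k\<in>Zl. \<Sum>k'\<in>Zl. (E ^ m * (qp (k * int i) *\<^sub>C eK k)) \<boxtimes> (F ^ m * (qp (k' * int j) *\<^sub>C eK k')))"
        unfolding K_pow_sum[of j] sum_distrib_left sum_pure_right ..
      finally show ?thesis by (simp add: T_def sc pure_tensor_simps mult.commute)
    qed
    then have "(\<Sum>i<l. \<Sum>j<l. qp (2 * ?m * (int i - int j) - 2 * int i * int j) *\<^sub>C ((E ^ m * K ^ i) \<boxtimes> (F ^ m * K ^ j))) =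
        (\<Sum>i<l. \<Sum>j<l. \<Sum>k\<in>Zl. \<Sum>k'\<in>Zl. (qp (2 * ?m * (int i - int j) - 2 * int i * int j) * (qp (k * int i) * qp (k' * int j))) *\<^sub>C T k k')"
      by (simp add: complex_vector.scale_sum_right sc)
    also have "\<dots> = (\<Sum>k\<in>Zl. \<Sum>k'\<in>Zl. \<Sum>i<l. \<Sum>j<l. (qp (2 * ?m * (int i - int j) - 2 * int i * int j) * (qp (k * int i) * qp (k' * int j))) *\<^sub>C T k k')"
      by (rule sum_swap4)
    also have "\<dots> = (\<Sum>k\<in>Zl. \<Sum>k'\<in>Zl. (of_nat l * hp ((k + 2 * ?m) * (k' - 2 * ?m))) *\<^sub>C T k k')"
      by (simp only: complex_vector.scale_sum_left[symmetric] R_coefficient)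
    also have "\<dots> = (\<Sum>k\<in>Zl. \<Sum>k'\<in>Zl. (of_nat l * hp ((k + 2 * ?m) * k')) *\<^sub>C ((eK (k + 2 * ?m) * E ^ m) \<boxtimes> (eK k' * F ^ m)))"
    proof (rule sum.cong)
      fix k
      let ?g = "\<lambda>k'. (of_nat l * hp ((k + 2 * ?m) * k')) *\<^sub>C ((eK (k + 2 * ?m) * E ^ m) \<boxtimes> (eK k' * F ^ m))"
      have "hp ((k + 2 * ?m) * (k' + int l)) = hp ((k + 2 * ?m) * k')" for k'
        by (rule hp_cong) (simp add: algebra_simps)
      then have "periodic ?g" using periodic_eK by (simp add: periodic_def)
      from sum_periodic_shift[OF this, of "- 2 * ?m"]
      show "(\<Sum>k'\<in>Zl. (of_nat l * hp ((k + 2 * ?m) * (k' - 2 * ?m))) *\<^sub>C T k k') = sum ?g Zl"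
        by (simp add: T)
    qed simp
    also have "\<dots> = (\<Sum>k\<in>Zl. \<Sum>k'\<in>Zl. (of_nat l * hp (k * k')) *\<^sub>C ((eK k * E ^ m) \<boxtimes> (eK k' * F ^ m)))"
    proof -
      let ?g = "\<lambda>k. \<Sum>k'\<in>Zl. (of_nat l * hp (k * k')) *\<^sub>C ((eK k * E ^ m) \<boxtimes> (eK k' * F ^ m))"
      have "hp ((k + int l) * k') = hp (k * k')" for k k'
        by (rule hp_cong) (simp add: algebra_simps)
      then have "periodic ?g" using periodic_eK by (simp add: periodic_def)
      from sum_periodic_shift[OF this, of "2 * ?m"] show ?thesis .
    qed
    finally show ?thesis by (simp add: complex_vector.scale_sum_right sc)
  qed
  have "Rm = (1 / of_nat l) *\<^sub>C (\<Sum>m<l. am m *\<^sub>C (\<Sum>i<l. \<Sum>j<l. qp (2 * int m * (int i - int j) - 2 * int i * int j) *\<^sub>C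
      ((E ^ m * K ^ i) \<boxtimes> (F ^ m * K ^ j))))"
    unfolding Rm_def uqsl2_R_def complex_vector.scale_sum_right[of "am _"] sc
    by (simp only: am_eq[symmetric] add_diff_eq)
  then show ?thesis
    unfolding inner by (simp add: complex_vector.scale_sum_right[of "1 / of_nat l"] sc)
qed

end

text \<open>\<open>ring_inv\<close> is a definite description, so its equations become available
  only from an exhibited two-sided inverse.\<close>

definition two_sided_unit :: "'a::ring_1 \<Rightarrow> bool"
  where "two_sided_unit x \<longleftrightarrow> (\<exists>y. x * y = 1 \<and> y * x = 1)"

lemma ring_inv_eq:
  assumes "x * y = 1" "y * x = 1"
  shows "ring_inv x = y"
  unfolding ring_inv_def
proof (rule the_equality)
  fix z assume z: "x * z = 1 \<and> z * x = 1"
  have "z = (y * x) * z" by (simp add: assms)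
  also have "\<dots> = y" using z by (simp add: mult.assoc)
  finally show "z = y" .
qed (use assms in simp)

lemma ring_inv_unit: "two_sided_unit x \<Longrightarrow> x * ring_inv x = 1 \<and> ring_inv x * x = 1"
  by (auto simp: two_sided_unit_def ring_inv_eq)

lemma two_sided_unit_mult:
  assumes "two_sided_unit x" "two_sided_unit y"
  shows "two_sided_unit (x * y)"
proof -
  obtain x' y' where "x * x' = 1" "x' * x = 1" "y * y' = 1" "y' * y = 1"
    using assms by (auto simp: two_sided_unit_def)
  then have "(x * y) * (y' * x') = 1" "(y' * x') * (x * y) = 1"
    by (metis mult.assoc mult_1_right)+
  then show ?thesis by (auto simp: two_sided_unit_def)
qed

lemma two_sided_unit_nilpotent:
  fixes w :: "'a::ring_1"
  assumes "w ^ n = 0"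
  shows "two_sided_unit (1 + w)"
proof -
  define v where "v = - w"
  have "(1 - v) * (\<Sum>i<m. v ^ i) = 1 - v ^ m" for m
    by (induction m) (simp_all add: distrib_left left_diff_distrib)
  moreover have "(\<Sum>i<m. v ^ i) * (1 - v) = 1 - v ^ m" for m
    by (induction m) (simp_all add: distrib_right, simp add: right_diff_distrib power_commutes)
  moreover have "v ^ n = 0"
    unfolding v_def using assms by (metis mult_zero_right power_minus)
  moreover have "1 - v = 1 + w" by (simp add: v_def)
  ultimately show ?thesis unfolding two_sided_unit_def by (metis diff_zero)
qed

lemma commuting_power_mult:
  fixes x y :: "'a::monoid_mult"
  assumes "x * y = y * x"
  shows "(x * y) ^ n = x ^ n * y ^ n"
proof (induction n)
  case (Suc n)
  have "y * x ^ n = x ^ n * y" using assms by (metis power_commuting_commutes)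
  then have "x * y * (x ^ n * y ^ n) = x * x ^ n * (y * y ^ n)"
    by (metis mult.assoc)
  then show ?case by (simp add: Suc)
qed simp

lemma sum_product3:
  fixes u v w :: "_ \<Rightarrow> 'a::semiring_0"
  shows "(\<Sum>i\<in>A. u i) * (\<Sum>j\<in>B. v j) * (\<Sum>k\<in>C. w k) = (\<Sum>i\<in>A. \<Sum>j\<in>B. \<Sum>k\<in>C. u i * v j * w k)"
  unfolding sum_product[of u A v B] by (simp only: sum_distrib_right) (simp only: sum_distrib_left)

lemma tensor_flip_mult: "tensor_flip (s * t) = tensor_flip s * tensor_flip t"
proof (induction s)
  case (pure a b)
  show ?case
    by (induction t) (simp_all add: clinear_0[OF clinear_flip] clinear_add[OF clinear_flip] distrib_left
        tensor_flip_pure times_pure_tensor)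
qed (simp_all add: clinear_0[OF clinear_flip] clinear_add[OF clinear_flip] distrib_right)

lemma tensor_flip_1: "tensor_flip 1 = 1"
  by (simp add: one_tensor_def tensor_flip_pure)

lemma two_sided_unit_flip: "two_sided_unit t \<Longrightarrow> two_sided_unit (tensor_flip t)"
  unfolding two_sided_unit_def by (metis tensor_flip_mult tensor_flip_1)

section \<open>The monodromy element and the Drinfeld map\<close>

context uqsl2_odd
begin

definition Dm :: "(int \<Rightarrow> int \<Rightarrow> complex) \<Rightarrow> ('a, 'a) tensor"
  where "Dm f = (\<Sum>a\<in>Zl. \<Sum>b\<in>Zl. f a b *\<^sub>C (eK a \<boxtimes> eK b))"

lemma eK_Dm:
  assumes "\<And>b. periodic (\<lambda>a. g a b)" "\<And>a. periodic (g a)"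
  shows "(eK a \<boxtimes> eK b) * Dm g = g a b *\<^sub>C (eK a \<boxtimes> eK b)"
proof -
  have p: "periodic (\<lambda>d. g c d *\<^sub>C (eK a \<boxtimes> eK d))" "periodic (\<lambda>c. g c d *\<^sub>C (eK c \<boxtimes> eK b))" for c d
    using assms periodic_eK by (simp_all add: periodic_def)
  have "(eK a \<boxtimes> eK b) * Dm g = (\<Sum>c\<in>Zl. \<Sum>d\<in>Zl. if int l dvd c - a then if int l dvd d - b
      then g c d *\<^sub>C (eK c \<boxtimes> eK d) else 0 else 0)"
    unfolding Dm_def sum_distrib_left mult_scaleC_right times_pure_tensor eK_mult
    by (intro sum.cong refl) (simp add: dvd_diff_commute pure_tensor_simps)
  also have "\<dots> = (\<Sum>c\<in>Zl. if int l dvd c - a then \<Sum>d\<in>Zl. if int l dvd d - b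
      then g c d *\<^sub>C (eK c \<boxtimes> eK d) else 0 else 0)"
    by (intro sum.cong refl) simp
  also have "\<dots> = (\<Sum>c\<in>Zl. if int l dvd c - a then g c b *\<^sub>C (eK c \<boxtimes> eK b) else 0)"
    using assms(2) periodic_eK by (intro sum.cong refl if_cong sum_Zl_single) (simp_all add: periodic_def)
  also have "\<dots> = g a b *\<^sub>C (eK a \<boxtimes> eK b)"
    by (rule sum_Zl_single[OF p(2)])
  finally show ?thesis .
qed

lemma Dm_mult:
  assumes "\<And>b. periodic (\<lambda>a. g a b)" "\<And>a. periodic (g a)"
  shows "Dm f * Dm g = Dm (\<lambda>a b. f a b * g a b)"
  unfolding Dm_def[of f] sum_distrib_right mult_scaleC_left eK_Dm[OF assms]
  by (simp add: Dm_def scaleC_scaleC)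

lemma Dm_1: "Dm (\<lambda>a b. 1) = 1"
  by (simp add: Dm_def scaleC_one one_tensor_def sum_eK flip: sum_pure_left sum_pure_right)

lemma periodic_hp: "periodic (\<lambda>a. hp (a * b))" "periodic (\<lambda>a. hp (b * a))"
  "periodic (\<lambda>a. hp (- (a * b)))" "periodic (\<lambda>a. hp (- (b * a)))"
  unfolding periodic_def by (auto intro!: hp_cong simp: algebra_simps)

definition Th :: "'a \<Rightarrow> 'a \<Rightarrow> ('a, 'a) tensor"
  where "Th X Y = (\<Sum>m<l. am m *\<^sub>C (X ^ m \<boxtimes> Y ^ m))"

lemma am_0: "am 0 = 1"
  by (simp add: am_def)

text \<open>The sum is 1 plus a multiple of the nilpotent element X \<otimes> Y commuting with
  it.\<close>

lemma Th_unit: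
  assumes "X ^ l = 0"
  shows "two_sided_unit (Th X Y)"
proof -
  define Z where "Z = X \<boxtimes> Y"
  define G where "G = (\<Sum>m<l-1. am (Suc m) *\<^sub>C Z ^ m)"
  have l1: "l = Suc (l - 1)" using l_ge by simp
  have "Th X Y = (\<Sum>m<Suc (l-1). am m *\<^sub>C Z ^ m)"
    using l1 by (simp add: Th_def Z_def pure_tensor_power)
  also have "\<dots> = 1 + Z * G"
    by (subst sum.lessThan_Suc_shift) (simp add: am_0 scaleC_one G_def sum_distrib_left mult_scaleC_right)
  finally have "Th X Y = 1 + Z * G" .
  moreover have "Z * G = G * Z"
    by (simp add: G_def sum_distrib_left sum_distrib_right mult_scaleC_left mult_scaleC_right power_commutes)
  then have "(Z * G) ^ l = Z ^ l * G ^ l" by (rule commuting_power_mult)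
  moreover have "Z ^ l = 0" using assms by (simp add: Z_def pure_tensor_power pure_tensor_simps)
  ultimately show ?thesis using two_sided_unit_nilpotent[of "Z * G" l] by simp
qed

lemma R_factor: "Rm = Dm (\<lambda>a b. hp (a * b)) * Th E F"
  unfolding R_eq Th_def Dm_def sum_distrib_right sum_distrib_left mult_scaleC_left mult_scaleC_right times_pure_tensor
  by (simp add: complex_vector.scale_sum_right scaleC_scaleC mult.commute sum.swap[of _ Zl "{..<l}"])

lemma flip_R: "tensor_flip Rm = Dm (\<lambda>a b. hp (a * b)) * Th F E"
proof -
  have 1: "tensor_flip (Dm (\<lambda>a b. hp (a * b))) = Dm (\<lambda>a b. hp (a * b))"
    unfolding Dm_def complex_vector.linear_sum[OF clinear_flip] clinear_scale[OF clinear_flip] tensor_flip_pure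
    by (subst sum.swap) (simp add: mult.commute)
  have 2: "tensor_flip (Th E F) = Th F E"
    unfolding Th_def complex_vector.linear_sum[OF clinear_flip] clinear_scale[OF clinear_flip] tensor_flip_pure ..
  show ?thesis unfolding R_factor tensor_flip_mult 1 2 ..
qed

definition Mm :: "('a, 'a) tensor" where "Mm = tensor_flip Rm * Rm"

lemma Mm_unit: "two_sided_unit Mm"
proof -
  have "Dm (\<lambda>a b. hp (a * b)) * Dm (\<lambda>a b. hp (- (a * b))) = 1"
    "Dm (\<lambda>a b. hp (- (a * b))) * Dm (\<lambda>a b. hp (a * b)) = 1"
    by (simp_all add: Dm_mult periodic_hp hp_minus Dm_1 flip: hp_minus) (simp_all add: hp_minus Dm_1)
  then have "two_sided_unit (Dm (\<lambda>a b. hp (a * b)))" by (auto simp: two_sided_unit_def)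
  then have "two_sided_unit Rm"
    unfolding R_factor by (intro two_sided_unit_mult Th_unit E_nilpotent)
  then show ?thesis unfolding Mm_def by (intro two_sided_unit_mult two_sided_unit_flip)
qed

text \<open>Moving the second Cartan part to the left through F^n \<otimes> E^n shifts its arguments
  by 2n and -2n. The half powers of both Cartan parts then combine to whole powers of q.\<close>

lemma Mm_eq:
  "Mm = (\<Sum>n<l. \<Sum>m<l. \<Sum>a\<in>Zl. \<Sum>b\<in>Zl. (am n * am m * qp (a * b + int n * (b - a) - 2 * (int n)\<^sup>2)) *\<^sub>C
    (bas a n m \<boxtimes> (eK b * E ^ n * F ^ m)))"
proof -
  let ?D = "Dm (\<lambda>a b. hp (a * b))"
  have 1: "(eK a \<boxtimes> eK b) * (F ^ n \<boxtimes> E ^ n) * ?D =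
      hp ((a + 2 * int n) * (b - 2 * int n)) *\<^sub>C ((eK a \<boxtimes> eK b) * (F ^ n \<boxtimes> E ^ n))" for a b n
  proof -
    have c: "(eK a \<boxtimes> eK b) * (F ^ n \<boxtimes> E ^ n) = (F ^ n \<boxtimes> E ^ n) * (eK (a + 2 * int n) \<boxtimes> eK (b - 2 * int n))"
      by (simp add: times_pure_tensor F_pow_eK E_pow_eK)
    show ?thesis unfolding c mult.assoc eK_Dm[OF periodic_hp(1,2)] mult_scaleC_right ..
  qed
  have h: "hp (a * b) * hp ((a + 2 * int n) * (b - 2 * int n)) = qp (a * b + int n * (b - a) - 2 * (int n)\<^sup>2)" for a b n
    by (simp add: algebra_simps power2_eq_square flip: hp_double hp_add)
  have 2: "?D * (F ^ n \<boxtimes> E ^ n) * ?D = (\<Sum>a\<in>Zl. \<Sum>b\<in>Zl. qp (a * b + int n * (b - a) - 2 * (int n)\<^sup>2) *\<^sub>C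
      ((eK a \<boxtimes> eK b) * (F ^ n \<boxtimes> E ^ n)))" for n
  proof -
    have "?D * (F ^ n \<boxtimes> E ^ n) * ?D = (\<Sum>a\<in>Zl. \<Sum>b\<in>Zl. hp (a * b) *\<^sub>C (eK a \<boxtimes> eK b)) * (F ^ n \<boxtimes> E ^ n) * ?D"
      by (subst (1) Dm_def) (rule refl)
    then show ?thesis
      by (simp only: sum_distrib_right mult_scaleC_left 1 scaleC_scaleC h)
  qed
  have "Mm = (?D * Th F E * ?D) * Th E F"
    unfolding Mm_def flip_R unfolding R_factor by (simp only: mult.assoc)
  also have "?D * Th F E * ?D = (\<Sum>n<l. am n *\<^sub>C (?D * (F ^ n \<boxtimes> E ^ n) * ?D))"
    unfolding Th_def by (simp only: sum_distrib_left sum_distrib_right mult_scaleC_left mult_scaleC_right)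
  also have "\<dots> * Th E F = (\<Sum>n<l. \<Sum>m<l. (am n * am m) *\<^sub>C (?D * (F ^ n \<boxtimes> E ^ n) * ?D * (E ^ m \<boxtimes> F ^ m)))"
    unfolding Th_def sum_product by (simp add: mult_scaleC_left mult_scaleC_right scaleC_scaleC mult.commute)
  also have "\<dots> = (\<Sum>n<l. \<Sum>m<l. \<Sum>a\<in>Zl. \<Sum>b\<in>Zl. (am n * am m * qp (a * b + int n * (b - a) - 2 * (int n)\<^sup>2)) *\<^sub>C
    (bas a n m \<boxtimes> (eK b * E ^ n * F ^ m)))"
    unfolding 2 by (simp add: sum_distrib_right complex_vector.scale_sum_right mult_scaleC_left scaleC_scaleC
        times_pure_tensor bas_def)
  finally show ?thesis .
qed

lemma eK_EF_pow: "eK k * E ^ m * F ^ m = E ^ m * F ^ m * eK k"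
  by (simp add: mult.assoc F_pow_eK) (simp add: mult.assoc[symmetric] E_pow_eK)

lemma pev_N_EF: "eK k * pev (N m (- k)) = br 1 ^ (2 * m) *\<^sub>C (eK k * E ^ m * F ^ m)"
  using EF_pow_eK[of m k] by (simp add: eK_EF_pow pev_central)

text \<open>A quantum character sees only weight zero, so n = m remains in \<open>Mm_eq\<close>.
  Both tensor factors are then polynomials in the Casimir element on their idempotents.\<close>

lemma drinfeld_formula:
  assumes "\<beta> \<in> qCh S"
  shows "drinfeld Rm \<beta> = el (\<lambda>b. \<Sum>n<l. smult (ca n *
    (\<Sum>a\<in>Zl. qp (a * b + int n * (b - a) - 2 * (int n)\<^sup>2) * \<beta> (eK a * pev (N n a)))) (N n (- b)))"
proof -
  have lin: "clinear \<beta>" using assms by (rule qCh_linear)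
  let ?c = "\<lambda>n a b. qp (a * b + int n * (b - a) - 2 * (int n)\<^sup>2)"
  have "drinfeld Rm \<beta> = tensor_slice \<beta> Mm" by (simp add: drinfeld_def Mm_def)
  also have "\<dots> = (\<Sum>n<l. \<Sum>m<l. \<Sum>a\<in>Zl. \<Sum>b\<in>Zl. (am n * am m * ?c n a b * \<beta> (bas a n m)) *\<^sub>C (eK b * E ^ n * F ^ m))"
    unfolding Mm_eq complex_vector.linear_sum[OF clinear_slice[OF lin]] clinear_scale[OF clinear_slice[OF lin]]
      tensor_slice_pure[OF lin] scaleC_scaleC ..
  also have "\<dots> = (\<Sum>n<l. \<Sum>m<l. if m = n then \<Sum>a\<in>Zl. \<Sum>b\<in>Zl. (am n * am m * ?c n a b * \<beta> (bas a n m)) *\<^sub>C (eK b * E ^ n * F ^ m) else 0)"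
    by (intro sum.cong refl) (auto simp: qCh_weight[OF assms])
  also have "\<dots> = (\<Sum>n<l. \<Sum>a\<in>Zl. \<Sum>b\<in>Zl. ((am n)\<^sup>2 * ?c n a b * \<beta> (bas a n n)) *\<^sub>C (eK b * E ^ n * F ^ n))"
    by (simp add: power2_eq_square)
  also have "\<dots> = (\<Sum>n<l. \<Sum>b\<in>Zl. \<Sum>a\<in>Zl. ((am n)\<^sup>2 * ?c n a b * \<beta> (bas a n n)) *\<^sub>C (eK b * E ^ n * F ^ n))"
    by (intro sum.cong refl sum.swap)
  also have "\<dots> = (\<Sum>b\<in>Zl. \<Sum>n<l. \<Sum>a\<in>Zl. ((am n)\<^sup>2 * ?c n a b * \<beta> (bas a n n)) *\<^sub>C (eK b * E ^ n * F ^ n))"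
    by (rule sum.swap)
  also have "\<dots> = el (\<lambda>b. \<Sum>n<l. smult (ca n * (\<Sum>a\<in>Zl. ?c n a b * \<beta> (eK a * pev (N n a)))) (N n (- b)))"
    unfolding el_def aev_sum aev_smult sum_distrib_left mult_scaleC_right pev_N_EF pev_N_bas clinear_scale[OF lin]
      scaleC_scaleC complex_vector.scale_sum_left am_ca sum_distrib_right
    by (simp add: mult_ac)
  finally show ?thesis .
qed

section \<open>The coproduct of the integral and the Radford map\<close>

lemma comult_power: "\<Delta> (x ^ n) = \<Delta> x ^ n"
  by (induction n) (simp_all add: comult_1 comult_mult)

lemma comult_F_pow:
  "\<Delta> (F ^ n) = (\<Sum>i\<le>n. gbin (qp (- 2)) n i *\<^sub>C ((Km ^ i * F ^ (n - i)) \<boxtimes> F ^ i))"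
proof -
  have e: "F * Km = qp (- 2) *\<^sub>C (Km * F)" by (simp add: Km_F scaleC_scaleC scaleC_one flip: qp_add)
  have "\<Delta> (F ^ n) = ((Km \<boxtimes> F) + (F \<boxtimes> 1)) ^ n" by (simp add: comult_power comult_F Km_def)
  also have "\<dots> = (\<Sum>i\<le>n. gbin (qp (- 2)) n i *\<^sub>C ((Km \<boxtimes> F) ^ i * (F \<boxtimes> 1) ^ (n - i)))"
    by (rule q_binomial) (simp add: times_pure_tensor e pure_tensor_simps)
  finally show ?thesis by (simp add: pure_tensor_power times_pure_tensor)
qed

lemma comult_E_pow:
  "\<Delta> (E ^ n) = (\<Sum>i\<le>n. gbin (qp 2) n i *\<^sub>C (E ^ (n - i) \<boxtimes> (E ^ i * K ^ (n - i))))"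
proof -
  have "\<Delta> (E ^ n) = ((1 \<boxtimes> E) + (E \<boxtimes> K)) ^ n" by (simp add: comult_power comult_E)
  also have "\<dots> = (\<Sum>i\<le>n. gbin (qp 2) n i *\<^sub>C ((1 \<boxtimes> E) ^ i * (E \<boxtimes> K) ^ (n - i)))"
    by (rule q_binomial) (simp add: times_pure_tensor KE pure_tensor_simps)
  finally show ?thesis by (simp add: pure_tensor_power times_pure_tensor)
qed

lemma comult_eK: "\<Delta> (eK k) = (\<Sum>a\<in>Zl. eK (k - a) \<boxtimes> eK a)"
proof -
  have K: "\<Delta> (K ^ j) = (\<Sum>a\<in>Zl. \<Sum>b\<in>Zl. (qp (b * int j) * qp (a * int j)) *\<^sub>C (eK b \<boxtimes> eK a))" for j
  proof -
    have "\<Delta> (K ^ j) = K ^ j \<boxtimes> K ^ j" by (simp add: comult_power comult_K pure_tensor_power)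
    also have "\<dots> = (\<Sum>a\<in>Zl. K ^ j \<boxtimes> (qp (a * int j) *\<^sub>C eK a))"
      by (subst (2) K_pow_sum) (rule sum_pure_right)
    also have "\<dots> = (\<Sum>a\<in>Zl. \<Sum>b\<in>Zl. (qp (b * int j) *\<^sub>C eK b) \<boxtimes> (qp (a * int j) *\<^sub>C eK a))"
      unfolding K_pow_sum[of j] by (simp only: sum_pure_left)
    finally show ?thesis by (simp add: pure_tensor_simps scaleC_scaleC mult.commute)
  qed
  have "\<Delta> (eK k) = (1 / of_nat l) *\<^sub>C (\<Sum>j<l. qp (- (k * int j)) *\<^sub>C \<Delta> (K ^ j))"
    unfolding eK_def complex_vector.linear_sum[OF comult_clinear] clinear_scale[OF comult_clinear] ..
  also have "\<dots> = (1 / of_nat l) *\<^sub>C (\<Sum>j<l. \<Sum>a\<in>Zl. \<Sum>b\<in>Zl. qp ((b - (k - a)) * int j) *\<^sub>C (eK b \<boxtimes> eK a))"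
    unfolding K complex_vector.scale_sum_right scaleC_scaleC qp_add[symmetric]
    by (simp add: algebra_simps)
  also have "(\<Sum>j<l. \<Sum>a\<in>Zl. \<Sum>b\<in>Zl. qp ((b - (k - a)) * int j) *\<^sub>C (eK b \<boxtimes> eK a)) =
      (\<Sum>a\<in>Zl. \<Sum>b\<in>Zl. \<Sum>j<l. qp ((b - (k - a)) * int j) *\<^sub>C (eK b \<boxtimes> eK a))"
    by (subst sum.swap) (intro sum.cong refl sum.swap)
  also have "\<dots> = (\<Sum>a\<in>Zl. \<Sum>b\<in>Zl. if int l dvd b - (k - a) then of_nat l *\<^sub>C (eK b \<boxtimes> eK a) else 0)"
    unfolding complex_vector.scale_sum_left[symmetric] sum_Zl_nat[of "\<lambda>j. qp (_ * j)", symmetric] sum_qp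
    by (intro sum.cong refl) simp
  also have "\<dots> = (\<Sum>a\<in>Zl. of_nat l *\<^sub>C (eK (k - a) \<boxtimes> eK a))"
    using periodic_eK by (intro sum.cong refl sum_Zl_single) (simp add: periodic_def)
  finally show ?thesis by (simp add: complex_vector.scale_sum_right scaleC_scaleC scaleC_one)
qed

definition rl :: complex where "rl = of_real (sqrt (of_nat l))"

lemma rl_square: "rl * rl = of_nat l" and rl_nonzero [simp]: "rl \<noteq> 0"
proof -
  have "rl * rl = of_real (sqrt (real l) * sqrt (real l))" unfolding rl_def of_real_mult ..
  then show "rl * rl = of_nat l" by simp
  then show "rl \<noteq> 0" by auto
qed

definition Lam :: 'a where "Lam = uqsl2_integral l q E F K"

text \<open>The sum over the powers of K is l \<open>eK 0\<close>, and \<open>bf_last\<close>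
  evaluates [l-1]! as l / (q - 1/q)^(l-1).\<close>

lemma Lam_eq: "Lam = (rl * br 1 ^ (2 * (l - 1)) / of_nat l) *\<^sub>C (F ^ (l - 1) * E ^ (l - 1) * eK 0)"
proof -
  have "(\<Sum>j<l. K ^ j) = of_nat l *\<^sub>C eK 0" by (simp add: eK_def scaleC_scaleC scaleC_one)
  moreover have "rl / (qfact q (l - 1))\<^sup>2 * of_nat l = rl * br 1 ^ (2 * (l - 1)) / of_nat l"
    unfolding qfact_bf bf_last by (simp add: power2_eq_square mult_2 power_add)
  ultimately show ?thesis
    unfolding Lam_def uqsl2_integral_def rl_def[symmetric] by (simp add: sc)
qed

text \<open>Weight zero leaves i = i', where the two Gaussian binomials cancel by
  \<open>gbin_last\<close>. The powers of q from K^(-i) and K^(l-1-i) combine to q^(a(l-1)) =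
  q^(-a), which no longer depends on i.\<close>

lemma radford_formula:
  assumes "\<beta> \<in> qCh S"
  shows "radford \<Delta> Lam \<beta> = el (\<lambda>a. \<Sum>i<l. smult (rl / of_nat l * qp (- a) *
    \<beta> (eK (- a) * pev (N (l - 1 - i) (- a)))) (N i a))"
proof -
  have lin: "clinear \<beta>" using assms by (rule qCh_linear)
  define M where "M = l - 1"
  have M: "{..M} = {..<l}" "M < l" using l_ge by (auto simp: M_def)
  define c where "c = rl * br 1 ^ (2 * M) / of_nat l"
  define f g where "f i = gbin (qp (- 2)) M i" and "g i = gbin (qp 2) M i" for i
  have fg: "f i * g i = 1" if "i < l" for i using gbin_last[of i] that by (simp add: f_def g_def M_def)
  define X where "X i i' a = Km ^ i * F ^ (M - i) * E ^ (M - i') * eK (- a)" for i i' a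
  define Y where "Y i i' a = F ^ i * E ^ i' * K ^ (M - i') * eK a" for i i' a
  have X: "\<beta> (X i i' a) = (if i' = i then qp (a * int i) * \<beta> (bas (- a) (M - i) (M - i)) else 0)"
    if "i < l" "i' < l" for i i' a
  proof -
    define b where "b = - a + 2 * int (M - i') - 2 * int (M - i)"
    have Kp: "Km ^ i * eK b = qp (- b * int i) *\<^sub>C eK b" for b i
      by (induction i) (simp_all add: mult.assoc Km_eK sc scaleC_one algebra_simps flip: qp_add)
    have "X i i' a = Km ^ i * eK b * F ^ (M - i) * E ^ (M - i')"
      unfolding X_def by (simp add: mult.assoc E_pow_eK b_def) (simp add: mult.assoc[symmetric] F_pow_eK)
    then have "\<beta> (X i i' a) = qp (- b * int i) * \<beta> (bas b (M - i) (M - i'))"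
      unfolding Kp by (simp add: sc bas_def clinear_scale[OF lin])
    moreover have "M - i \<noteq> M - i'" if "i' \<noteq> i"
      using that \<open>i < l\<close> \<open>i' < l\<close> by (auto simp: M_def)
    ultimately show ?thesis using M(2)
      by (auto simp: b_def qCh_weight[OF assms] less_imp_diff_less)
  qed
  have Y: "Y i i a = qp (a * int (M - i)) *\<^sub>C (F ^ i * E ^ i * eK a)" for i a
    by (simp add: Y_def mult.assoc K_pow_eK sc)
  have "\<Delta> Lam = c *\<^sub>C (\<Delta> (F ^ M) * \<Delta> (E ^ M) * \<Delta> (eK 0))"
    unfolding Lam_eq clinear_scale[OF comult_clinear] comult_mult c_def M_def ..
  also have "\<Delta> (F ^ M) * \<Delta> (E ^ M) * \<Delta> (eK 0) = (\<Sum>i<l. \<Sum>i'<l. \<Sum>a\<in>Zl. (f i * g i') *\<^sub>C (X i i' a \<boxtimes> Y i i' a))"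
    unfolding comult_F_pow comult_E_pow comult_eK M sum_product3
    by (simp add: f_def g_def mult_scaleC_left mult_scaleC_right scaleC_scaleC times_pure_tensor X_def Y_def mult.assoc mult.commute)
  finally have "\<Delta> Lam = c *\<^sub>C (\<Sum>i<l. \<Sum>i'<l. \<Sum>a\<in>Zl. (f i * g i') *\<^sub>C (X i i' a \<boxtimes> Y i i' a))" .
  then have "radford \<Delta> Lam \<beta> = c *\<^sub>C (\<Sum>i<l. \<Sum>i'<l. \<Sum>a\<in>Zl. (f i * g i') *\<^sub>C (\<beta> (X i i' a) *\<^sub>C Y i i' a))"
    by (simp only: radford_def complex_vector.linear_sum[OF clinear_slice[OF lin]] clinear_scale[OF clinear_slice[OF lin]]
      tensor_slice_pure[OF lin])
  also have "\<dots> = c *\<^sub>C (\<Sum>i<l. \<Sum>i'<l. if i' = i then \<Sum>a\<in>Zl. (f i * g i * qp (a * int i) * \<beta> (bas (- a) (M - i) (M - i))) *\<^sub>C Y i i a else 0)"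
    by (rule arg_cong[where f = "(*\<^sub>C) c"], intro sum.cong refl) (auto simp: X scaleC_scaleC mult.assoc)
  also have "\<dots> = c *\<^sub>C (\<Sum>i<l. \<Sum>a\<in>Zl. (f i * g i * qp (a * int i) * \<beta> (bas (- a) (M - i) (M - i))) *\<^sub>C Y i i a)"
    by simp
  also have "\<dots> = (\<Sum>i<l. \<Sum>a\<in>Zl. (c * qp (- a) * \<beta> (bas (- a) (M - i) (M - i))) *\<^sub>C (F ^ i * E ^ i * eK a))"
    unfolding complex_vector.scale_sum_right
  proof (intro sum.cong refl)
    fix i a assume i: "i \<in> {..<l}"
    have "qp (a * int i) * qp (a * int (M - i)) = qp (- a)"
    proof -
      have "a * int i + a * int (M - i) = int l * a - a"
        using i l_ge by (simp add: M_def of_nat_diff algebra_simps)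
      then show ?thesis unfolding qp_add[symmetric] by (metis qp_cong diff_minus_eq_add diff_add_cancel dvd_triv_left add_uminus_conv_diff)
    qed
    then show "c *\<^sub>C (f i * g i * qp (a * int i) * \<beta> (bas (- a) (M - i) (M - i))) *\<^sub>C Y i i a =
        (c * qp (- a) * \<beta> (bas (- a) (M - i) (M - i))) *\<^sub>C (F ^ i * E ^ i * eK a)"
      using i by (simp add: Y scaleC_scaleC fg mult_ac)
  qed
  also have "\<dots> = (\<Sum>a\<in>Zl. \<Sum>i<l. (c * qp (- a) * \<beta> (bas (- a) (M - i) (M - i))) *\<^sub>C (F ^ i * E ^ i * eK a))"
    by (rule sum.swap)
  also have "\<dots> = el (\<lambda>a. \<Sum>i<l. smult (rl / of_nat l * qp (- a) * \<beta> (eK (- a) * pev (N (l - 1 - i) (- a)))) (N i a))"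
    unfolding el_def aev_sum aev_smult sum_distrib_left mult_scaleC_right pev_N_bas clinear_scale[OF lin] scaleC_scaleC
      scaleC_complex_def
  proof (intro sum.cong refl)
    fix a i assume "i \<in> {..<l}"
    then have "2 * M = 2 * (M - i) + 2 * i" by (auto simp: M_def)
    then have "c = rl / of_nat l * (br 1 ^ (2 * (M - i)) * br 1 ^ (2 * i))"
      unfolding c_def by (simp flip: power_add)
    then show "(c * qp (- a) * \<beta> (bas (- a) (M - i) (M - i))) *\<^sub>C (F ^ i * E ^ i * eK a) =
        (rl / of_nat l * qp (- a) * (br 1 ^ (2 * (l - 1 - i)) * \<beta> (bas (- a) (l - 1 - i) (l - 1 - i))) * br 1 ^ (2 * i)) *\<^sub>C bas a i i"
      using eK_pow[of a i] by (simp add: bas_def[of a i i] M_def mult_ac)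
  qed
  finally show ?thesis .
qed

end

section \<open>Irreducible modules and the Lyubashenko--Majid operator\<close>

lemma trace_commute:
  assumes "A \<in> carrier_mat n n" "B \<in> carrier_mat n n"
  shows "(\<Sum>i<n. (A * B) $$ (i, i)) = (\<Sum>i<n. (B * A) $$ (i, i :: nat) :: complex)"
proof -
  have "(\<Sum>i<n. (A * B) $$ (i, i)) = (\<Sum>i<n. \<Sum>j<n. A $$ (i, j) * B $$ (j, i))"
    using assms by (intro sum.cong refl) (auto simp: scalar_prod_def lessThan_atLeast0)
  also have "\<dots> = (\<Sum>j<n. \<Sum>i<n. A $$ (i, j) * B $$ (j, i))" by (rule sum.swap)
  also have "\<dots> = (\<Sum>i<n. (B * A) $$ (i, i))"
    using assms by (intro sum.cong refl) (auto simp: scalar_prod_def lessThan_atLeast0 mult.commute)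
  finally show ?thesis .
qed

lemma diag_mat_mult:
  assumes "A \<in> carrier_mat r r" "i < r" "j < r"
  shows "(mat r r (\<lambda>(m, n). if m = n then d m else 0) * A) $$ (i, j) = d i * A $$ (i, j)"
proof -
  show ?thesis
    using assms by (simp add: scalar_prod_def if_distrib[of "\<lambda>x. x * _"] cong: if_cong)
qed

context odd_root
begin

lemma sum_weight: "r \<le> l \<Longrightarrow> (\<Sum>i<r. if int l dvd k - wt r i then 1 else 0) = ind r k"
proof -
  assume r: "r \<le> l"
  obtain i where i: "i < l" "int l dvd k - wt r i" by (rule weight_index)
  have "(\<Sum>i'<r. if int l dvd k - wt r i' then 1 else 0) = (\<Sum>i'<r. if i' = i then 1 else (0::complex))"
  proof (rule sum.cong)
    fix i' assume "i' \<in> {..<r}"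
    then have "i' < l" using r by simp
    then have "int l dvd k - wt r i' \<longleftrightarrow> i' = i" using i weight_index_unique[of i' i k r] by metis
    then show "(if int l dvd k - wt r i' then 1 else 0) = (if i' = i then 1 else (0::complex))" by simp
  qed simp
  then show ?thesis by (simp add: ind_def inwt_index[OF r i])
qed

lemma N_PSI_dvd: "l \<le> n \<Longrightarrow> PSI dvd N n k"
  using N_add[of l "n - l" k] by (simp add: N_full)

lemma newton_independent: "(\<Sum>n<M. smult (c n) (N n k)) = 0 \<Longrightarrow> n < M \<Longrightarrow> c n = 0"
proof (induction M)
  case (Suc M)
  have "coeff (\<Sum>n<M. smult (c n) (N n k)) M = 0"
    unfolding coeff_sum by (rule sum.neutral) (auto intro!: coeff_eq_0)
  then have "coeff (\<Sum>n<Suc M. smult (c n) (N n k)) M = c M" by (simp add: lead_coeff_N)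
  then have "c M = 0" by (simp only: Suc.prems(1) coeff_0)
  then show ?case using Suc by (cases "n = M") auto
qed simp

end

context uqsl2_odd
begin

context
  fixes r :: nat and \<rho> :: "'a \<Rightarrow> complex mat"
  assumes irrep: "uqsl2_irrep q E F K r \<rho>" and r: "1 \<le> r" "r \<le> l"
begin

lemma rep_carrier: "\<rho> x \<in> carrier_mat r r" and rep_1: "\<rho> 1 = 1\<^sub>m r"
  and rep_add: "\<rho> (x + y) = \<rho> x + \<rho> y" and rep_mult: "\<rho> (x * y) = \<rho> x * \<rho> y"
  and rep_scale: "\<rho> (c *\<^sub>C x) = c \<cdot>\<^sub>m \<rho> x"
  using irrep unfolding uqsl2_irrep_def by blast+

lemma rep_K: "\<rho> K = mat r r (\<lambda>(m, n). if m = n then qp (wt r m) else 0)"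
proof -
  have "\<rho> K = mat r r (\<lambda>(m, n). if m = n then q powi (int r - 1 - 2 * int n) else 0)"
    using irrep unfolding uqsl2_irrep_def by blast
  also have "\<dots> = mat r r (\<lambda>(m, n). if m = n then qp (wt r m) else 0)"
    by (rule cong_mat) (auto simp: qp_def wt_def)
  finally show ?thesis .
qed

lemma rep_dim: "dim_row (\<rho> x) = r" "dim_col (\<rho> x) = r"
  using rep_carrier[of x] by auto

lemma rep_entry_linear: "i < r \<Longrightarrow> j < r \<Longrightarrow> clinear (\<lambda>x. \<rho> x $$ (i, j))"
  by (intro clinearI) (auto simp: rep_add rep_scale rep_dim)

lemma rep_K_entry: "i < r \<Longrightarrow> j < r \<Longrightarrow> \<rho> (K * x) $$ (i, j) = qp (wt r i) * \<rho> x $$ (i, j)"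
  unfolding rep_mult rep_K by (rule diag_mat_mult[OF rep_carrier])

lemma rep_Km_entry: "i < r \<Longrightarrow> j < r \<Longrightarrow> \<rho> (Km * x) $$ (i, j) = qp (- wt r i) * \<rho> x $$ (i, j)"
  using rep_K_entry[of i j "Km * x"] by (simp add: qp_minus)

lemma rep_FE_entry:
  assumes "i < r" "j < r"
  shows "\<rho> (F * E) $$ (i, j) = (if i = j then qint q i * qint q (r - i) else 0)"
proof -
  have F: "\<rho> F = mat r r (\<lambda>(m, n). if m = Suc n then 1 else 0)"
    and E: "\<rho> E = mat r r (\<lambda>(m, n). if Suc m = n then qint q n * qint q (r - n) else 0)"
    using irrep unfolding uqsl2_irrep_def by blast+
  have "\<rho> (F * E) $$ (i, j) = (\<Sum>k<r. if i = Suc k \<and> Suc k = j then qint q i * qint q (r - i) else 0)"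
    unfolding rep_mult F E using assms by (auto simp: scalar_prod_def lessThan_atLeast0 intro!: sum.cong)
  also have "\<dots> = (if i = j then qint q i * qint q (r - i) else 0)"
  proof (cases i)
    case 0
    then show ?thesis by (simp add: qint_def)
  next
    case (Suc k)
    then have "(\<Sum>k<r. if i = Suc k \<and> Suc k = j then qint q i * qint q (r - i) else 0) =
        (\<Sum>k'<r. if k' = k then (if i = j then qint q i * qint q (r - i) else 0) else 0)"
      by (intro sum.cong) auto
    then show ?thesis using Suc assms by simp
  qed
  finally show ?thesis .
qed

lemma rep_Cas: "\<rho> Cas = ch (int r) \<cdot>\<^sub>m 1\<^sub>m r"
proof (rule eq_matI)
  fix i j assume "i < dim_row (ch (int r) \<cdot>\<^sub>m 1\<^sub>m r)" "j < dim_col (ch (int r) \<cdot>\<^sub>m 1\<^sub>m r)"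
  then have ij: "i < r" "j < r" by auto
  have one: "\<rho> 1 $$ (i, j) = (if i = j then 1 else 0)" using ij by (simp add: rep_1)
  have "\<rho> Cas $$ (i, j) = (br 1)\<^sup>2 * \<rho> (F * E) $$ (i, j) + q * \<rho> (K * 1) $$ (i, j) + inverse q * \<rho> (Km * 1) $$ (i, j)"
    unfolding Cas_def using clinear_add[OF rep_entry_linear[OF ij]] clinear_scale[OF rep_entry_linear[OF ij]] by simp
  also have "\<dots> = (if i = j then ch (int r) else 0)"
  proof (cases "i = j")
    case True
    have "br (int (r - i)) * br (int i) + qp (wt r i + 1) + qp (- (wt r i + 1)) = ch (int r)"
      using ch_diff[of "int r - int i" "int i"] ij by (simp add: ch_def wt_def of_nat_diff algebra_simps)
    moreover have "(br 1)\<^sup>2 * (qint q i * qint q (r - i)) = br (int (r - i)) * br (int i)"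
      by (simp add: qint_br power2_eq_square)
    moreover have "q * qp (wt r i) = qp (wt r i + 1)" "inverse q * qp (- wt r i) = qp (- (wt r i + 1))"
      by (simp_all add: qp_add qp_diff divide_inverse)
    ultimately show ?thesis
      using True ij unfolding rep_FE_entry[OF ij] rep_K_entry[OF ij] rep_Km_entry[OF ij] one by simp
  next
    case False
    then show ?thesis unfolding rep_FE_entry[OF ij] rep_K_entry[OF ij] rep_Km_entry[OF ij] one by simp
  qed
  finally show "\<rho> Cas $$ (i, j) = (ch (int r) \<cdot>\<^sub>m 1\<^sub>m r) $$ (i, j)" using ij by simp
qed (use rep_carrier[of Cas] in auto)

lemma rep_pev_entry:
  assumes "i < r" "j < r"
  shows "\<rho> (pev f * x) $$ (i, j) = poly f (ch (int r)) * \<rho> x $$ (i, j)"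
proof (induction f)
  case 0
  then show ?case using complex_vector.linear_0[OF rep_entry_linear[OF assms]] by simp
next
  case (pCons a p)
  have "\<rho> (Cas * y) = ch (int r) \<cdot>\<^sub>m \<rho> y" for y
    unfolding rep_mult rep_Cas using rep_carrier[of y]
    by (simp add: mult_smult_assoc_mat[of "1\<^sub>m r" r r "\<rho> y" r])
  then have "\<rho> (Cas * y) $$ (i, j) = ch (int r) * \<rho> y $$ (i, j)" for y
    using assms rep_carrier[of y] by auto
  then have "\<rho> (pev (pCons a p) * x) $$ (i, j) = a * \<rho> x $$ (i, j) + ch (int r) * \<rho> (pev p * x) $$ (i, j)"
    using clinear_add[OF rep_entry_linear[OF assms]] clinear_scale[OF rep_entry_linear[OF assms]]
    by (simp add: aev_pCons distrib_right sc mult.assoc)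
  then show ?case by (simp add: pCons algebra_simps)
qed

lemma rep_eK_entry:
  assumes "i < r"
  shows "\<rho> (eK k) $$ (i, i) = (if int l dvd k - wt r i then 1 else 0)"
proof -
  have 0: "\<rho> (eK k) $$ (i, i) = 0" if "\<not> int l dvd k - wt r i" for k
  proof -
    have "qp (wt r i) * \<rho> (eK k) $$ (i, i) = qp k * \<rho> (eK k) $$ (i, i)"
      using rep_K_entry[OF assms assms, of "eK k"] clinear_scale[OF rep_entry_linear[OF assms assms]]
      by (auto simp: K_eK)
    moreover have "qp k \<noteq> qp (wt r i)" using that by (simp add: qp_eq_iff)
    ultimately show ?thesis by auto
  qed
  have "1 = \<rho> (\<Sum>k\<in>Zl. eK k) $$ (i, i)" using assms by (simp add: sum_eK rep_1)
  also have "\<dots> = (\<Sum>k\<in>Zl. \<rho> (eK k) $$ (i, i))"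
    by (rule complex_vector.linear_sum[OF rep_entry_linear[OF assms assms]])
  also have "\<dots> = (\<Sum>k\<in>Zl. if int l dvd k - wt r i then \<rho> (eK k) $$ (i, i) else 0)"
    by (rule sum.cong) (auto simp: 0)
  also have "\<dots> = \<rho> (eK (wt r i)) $$ (i, i)"
    by (rule sum_Zl_single) (use periodic_eK in \<open>simp add: periodic_def\<close>)
  finally show ?thesis using 0[of k] eK_cong[of k "wt r i"] by auto
qed

lemma qCh_mod_eq: "qCh_mod l K \<rho> x = (\<Sum>i<r. \<rho> (Km * x) $$ (i, i))"
  using rep_carrier[of x] by (simp add: qCh_mod_def Km_def)

lemma qCh_mod_qCh: "qCh_mod l K \<rho> \<in> qCh S"
proof -
  have "clinear (qCh_mod l K \<rho>)"
  proof (rule clinearI)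
    fix x y c
    show "qCh_mod l K \<rho> (x + y) = qCh_mod l K \<rho> x + qCh_mod l K \<rho> y"
      unfolding qCh_mod_eq distrib_left sum.distrib[symmetric]
      by (intro sum.cong refl clinear_add rep_entry_linear) auto
    show "qCh_mod l K \<rho> (c *\<^sub>C x) = c *\<^sub>C qCh_mod l K \<rho> x"
      unfolding qCh_mod_eq mult_scaleC_right scaleC_complex_def sum_distrib_left
      using clinear_scale[OF rep_entry_linear] by (intro sum.cong refl) auto
  qed
  moreover have "qCh_mod l K \<rho> (x * y) = qCh_mod l K \<rho> (S (S y) * x)" for x y
  proof -
    have "qCh_mod l K \<rho> (x * y) = (\<Sum>i<r. (\<rho> (Km * x) * \<rho> y) $$ (i, i))"
      unfolding qCh_mod_eq by (simp add: mult.assoc flip: rep_mult)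
    also have "\<dots> = (\<Sum>i<r. (\<rho> y * \<rho> (Km * x)) $$ (i, i))"
      by (rule trace_commute[OF rep_carrier rep_carrier])
    also have "\<dots> = qCh_mod l K \<rho> (S (S y) * x)"
      unfolding qCh_mod_eq antipode_squared by (simp add: mult.assoc flip: rep_mult)
    finally show ?thesis .
  qed
  ultimately show ?thesis by (simp add: qCh_def)
qed

lemma qCh_mod_value: "qCh_mod l K \<rho> (eK k * pev f) = qp (- k) * ind r k * poly f (ch (int r))"
proof -
  have "qCh_mod l K \<rho> (eK k * pev f) = (\<Sum>i<r. \<rho> (pev f * (qp (- k) *\<^sub>C eK k)) $$ (i, i))"
  proof -
    have "Km * (eK k * pev f) = pev f * (Km * eK k)" by (metis pev_central mult.assoc)
    then show ?thesis unfolding qCh_mod_eq by (simp only: Km_eK)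
  qed
  also have "\<dots> = (\<Sum>i<r. poly f (ch (int r)) * (qp (- k) * (if int l dvd k - wt r i then 1 else 0)))"
    using clinear_scale[OF rep_entry_linear] by (intro sum.cong refl) (simp add: rep_pev_entry rep_eK_entry)
  also have "\<dots> = qp (- k) * (\<Sum>i<r. if int l dvd k - wt r i then 1 else 0) * poly f (ch (int r))"
    by (simp add: mult_ac flip: sum_distrib_left)
  also have "(\<Sum>i<r. if int l dvd k - wt r i then 1 else 0) = ind r k"
    by (rule sum_weight[OF r(2)])
  finally show ?thesis .
qed

text \<open>For each b the formula is the Newton expansion of \<open>chebU r\<close> at the nodes
  belonging to b. The family is therefore constant and the image is a polynomial in the Casimir
  element.\<close>

lemma drinfeld_qCh_mod: "drinfeld Rm (qCh_mod l K \<rho>) = pev (chebU r)"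
proof -
  have "(\<Sum>n<l. smult (ca n * (\<Sum>a\<in>Zl. qp (a * b + int n * (b - a) - 2 * (int n)\<^sup>2) *
      qCh_mod l K \<rho> (eK a * pev (N n a)))) (N n (- b))) = chebU r" for b
  proof -
    have "(\<Sum>a\<in>Zl. qp (a * b + int n * (b - a) - 2 * (int n)\<^sup>2) * qCh_mod l K \<rho> (eK a * pev (N n a))) =
        (\<Sum>i<r. qp (wt r i * b + int n * (b - wt r i) - 2 * (int n)\<^sup>2 - wt r i) * poly (N n (wt r i)) (ch (int r)))" for n
    proof -
      let ?g = "\<lambda>a. qp (a * b + int n * (b - a) - 2 * (int n)\<^sup>2 - a) * poly (N n a) (ch (int r))"
      have "N n (a + int l) = N n a" for a by (rule N_cong) simp
      moreover have "qp ((a + int l) * b + int n * (b - (a + int l)) - 2 * (int n)\<^sup>2 - (a + int l)) =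
          qp (a * b + int n * (b - a) - 2 * (int n)\<^sup>2 - a)" for a
      proof (rule qp_cong)
        have "((a + int l) * b + int n * (b - (a + int l)) - 2 * (int n)\<^sup>2 - (a + int l)) -
          (a * b + int n * (b - a) - 2 * (int n)\<^sup>2 - a) = int l * (b - int n - 1)"
          by (simp add: algebra_simps)
        then show "int l dvd ((a + int l) * b + int n * (b - (a + int l)) - 2 * (int n)\<^sup>2 - (a + int l)) -
          (a * b + int n * (b - a) - 2 * (int n)\<^sup>2 - a)" by (metis dvd_triv_left)
      qed
      ultimately have per: "periodic ?g" by (simp add: periodic_def)
      have "(\<Sum>a\<in>Zl. qp (a * b + int n * (b - a) - 2 * (int n)\<^sup>2) * qCh_mod l K \<rho> (eK a * pev (N n a))) =
          (\<Sum>a\<in>Zl. if inwt r a then ?g a else 0)"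
        by (intro sum.cong refl) (auto simp: qCh_mod_value ind_def qp_diff qp_minus divide_inverse)
      then show ?thesis by (simp only: sum_inwt[OF per r(2)])
    qed
    then have "(\<Sum>n<l. smult (ca n * (\<Sum>a\<in>Zl. qp (a * b + int n * (b - a) - 2 * (int n)\<^sup>2) *
      qCh_mod l K \<rho> (eK a * pev (N n a)))) (N n (- b))) = (\<Sum>n<l. smult (Bc n r b) (N n (- b)))"
      by (simp add: Bc_def)
    also have "\<dots> = chebU r" by (rule chebU_newton[OF r(2), symmetric])
    finally show ?thesis .
  qed
  then show ?thesis unfolding drinfeld_formula[OF qCh_mod_qCh] by (simp add: el_const)
qed

text \<open>After the nodes are reversed by \<open>N_minus\<close>, the coefficients are those of
  \<open>Psi_newton\<close>. The weight indicator comes out as a factor because the weights are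
  symmetric under negation.\<close>

lemma radford_qCh_mod: "radford \<Delta> Lam (qCh_mod l K \<rho>) = (rl / of_nat l) *\<^sub>C nn r"
proof -
  have H2: "(\<Sum>i<l. smult (rl / of_nat l * qp (- a) * qCh_mod l K \<rho> (eK (- a) * pev (N (l - 1 - i) (- a)))) (N i a)) =
      smult (rl / of_nat l) (smult (ind r a) (Psi (int r)))" for a
  proof -
    have H: "rl / of_nat l * qp (- a) * qCh_mod l K \<rho> (eK (- a) * pev (N (l - 1 - i) (- a))) =
        rl / of_nat l * ind r a * poly (N (l - 1 - i) (a + 2 * int i + 2)) (ch (int r))" if "i < l" for i
    proof -
      have "N (l - 1 - i) (- a) = N (l - 1 - i) (a - 2 * int (l - 1 - i))" by (rule N_minus)
      also have "\<dots> = N (l - 1 - i) (a + 2 * int i + 2)"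
        by (rule N_cong) (use that l_ge in \<open>simp add: of_nat_diff\<close>)
      finally show ?thesis by (simp add: qCh_mod_value qp_minus ind_def inwt_minus)
    qed
    have "(\<Sum>i<l. smult (rl / of_nat l * qp (- a) * qCh_mod l K \<rho> (eK (- a) * pev (N (l - 1 - i) (- a)))) (N i a)) =
        (\<Sum>i<l. smult (rl / of_nat l * ind r a * poly (N (l - 1 - i) (a + 2 * int i + 2)) (ch (int r))) (N i a))"
      by (rule sum.cong) (simp_all only: lessThan_iff H)
    also have "\<dots> = smult (rl / of_nat l * ind r a) (Psi (int r))"
      unfolding Psi_newton[of "int r" a] smult_sum_right by (simp add: mult_ac)
    finally show ?thesis by simp
  qed
  show ?thesis unfolding radford_formula[OF qCh_mod_qCh] H2 el_smult nn_def ..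
qed

end

text \<open>The form takes the coordinate at F^(l-1) E^(l-1). On \<open>eK k\<close> this is the
  coefficient of x^(l-1), in whichever Newton basis it is computed, so products with a generator in
  either order agree in weight zero; elements of nonzero weight have value 0.\<close>

lemma cointegral_exists:
  "\<exists>\<phi>::'a \<Rightarrow> complex. clinear \<phi> \<and> (\<forall>x y. \<phi> (x * y) = \<phi> (y * x)) \<and>
    (\<forall>k f. degree f < l \<longrightarrow> \<phi> (eK k * pev f) = coeff f (l - 1))"
proof -
  \<comment> \<open>Cancels the power of q - 1/q by which \<open>N (l - 1) k\<close> differs from
    F^(l-1) E^(l-1).\<close>
  define c where "c = inverse (br 1 ^ (2 * (l - 1)))"
  obtain \<phi> :: "'a \<Rightarrow> complex" where lin: "clinear \<phi>"
    and val: "\<forall>k\<in>Zl. \<forall>m<l. \<forall>n<l. \<phi> (bas k m n) = (if m = l - 1 \<and> n = l - 1 then c else 0)"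
    using functional_ex[of "\<lambda>k m n. if m = l - 1 \<and> n = l - 1 then c else 0"] by blast
  have bas: "\<phi> (bas k m n) = (if m = l - 1 \<and> n = l - 1 then c else 0)" for k m n
  proof (cases "m < l \<and> n < l")
    case True
    have "bas k m n = bas (k mod int l) m n" by (rule bas_cong) (simp add: minus_mod_eq_mult_div)
    then show ?thesis using val True by simp
  next
    case False
    then have "bas k m n = 0"
      using pow_zero_ge[OF F_nilpotent] pow_zero_ge[OF E_nilpotent] by (auto simp: bas_def not_less)
    then show ?thesis using False l_ge by (auto simp: clinear_0[OF lin])
  qed
  have poly: "\<phi> (eK k * pev f) = coeff f (l - 1)" if f: "degree f < l" for k f
  proof -
    obtain a where a: "f = (\<Sum>n<l. smult (a n) (N n k))" "a (l - 1) = coeff f (l - 1)"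
      by (rule newton_expansion[OF f])
    have "\<phi> (eK k * pev f) = (\<Sum>n<l. a n * (br 1 ^ (2 * n) * (if n = l - 1 then c else 0)))"
      unfolding a(1) aev_sum aev_smult sum_distrib_left mult_scaleC_right pev_N_bas
        complex_vector.linear_sum[OF lin] clinear_scale[OF lin] bas by simp
    also have "\<dots> = (\<Sum>n<l. if n = l - 1 then a n else 0)"
      by (intro sum.cong refl) (simp add: c_def)
    also have "\<dots> = a (l - 1)" using l_ge by simp
    finally show ?thesis using a(2) by simp
  qed
  have span: "P x" if "\<And>k m n. m < l \<Longrightarrow> n < l \<Longrightarrow> P (bas k m n)" "\<And>x y. P x \<Longrightarrow> P y \<Longrightarrow> P (x + y)"
    "\<And>c x. P x \<Longrightarrow> P (c *\<^sub>C x)" for P and x :: 'a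
  proof -
    have "P 0" using that(3)[OF that(1)[of 0 0 0], of 0] l_ge by simp
    have "x \<in> complex_vector.span (basf ` bindex)" by (simp add: span_bas)
    then show ?thesis
      by (induction rule: complex_vector.span_induct_alt)
        (use \<open>P 0\<close> that in \<open>auto simp: basf_def bindex_def\<close>)
  qed
  have K: "\<phi> (x * K) = \<phi> (K * x)" for x
    by (rule span[of "\<lambda>x. \<phi> (x * K) = \<phi> (K * x)"])
      (auto simp: K_bas bas_K clinear_scale[OF lin] clinear_add[OF lin] bas distrib_left distrib_right sc)
  have weight: "\<phi> x = 0" if "K * x = qp a *\<^sub>C (x * K)" "\<not> int l dvd a" for x a
  proof -
    have "\<phi> x = \<phi> (K * (x * Km))" using K[of "x * Km"] by (simp add: mult.assoc)
    also have "K * (x * Km) = qp a *\<^sub>C x"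
      by (simp add: mult.assoc[symmetric] that(1) sc) (simp add: mult.assoc)
    finally have "(1 - qp a) * \<phi> x = 0" by (simp add: clinear_scale[OF lin] left_diff_distrib)
    then show ?thesis using that(2) by (simp add: qp_eq_1_iff)
  qed
  have K_bas': "K * bas k m n = qp (2 * (int n - int m)) *\<^sub>C (bas k m n * K)" for k m n
    unfolding K_bas bas_K scaleC_scaleC by (simp add: algebra_simps flip: qp_add)
  have not_dvd: "\<not> int l dvd 2 * x" if "\<bar>x\<bar> < int l" "x \<noteq> 0" for x
  proof -
    have "\<not> int l dvd x" using that zdvd_imp_le[of "int l" "\<bar>x\<bar>"] by auto
    then show ?thesis by (simp only: coprime_l_2 not_False_eq_True)
  qed
  have E: "\<phi> (x * E) = \<phi> (E * x)" for x
  proof (rule span[of "\<lambda>x. \<phi> (x * E) = \<phi> (E * x)"])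
    fix k m n assume mn: "m < l" "n < l"
    have 1: "bas k m n * E = bas k m (Suc n)" by (simp add: bas_def mult.assoc power_commutes)
    show "\<phi> (bas k m n * E) = \<phi> (E * bas k m n)"
    \<comment> \<open>For m = n + 1 the product with E has weight 0 and is a polynomial in the
      Casimir element on an idempotent. Otherwise its weight is nonzero modulo l, except for m = 0
      and n = l - 1, where E^l = 0 decides.\<close>
    proof (cases "m = Suc n")
      case True
      have "E * bas k m n = eK (k + 2) * (E * F) * F ^ n * E ^ n"
        unfolding True bas_def by (simp add: mult.assoc[symmetric] E_eK)
      also have "\<dots> = E * F * (eK (k + 2) * F ^ n * E ^ n)"
        using eK_EF_pow[of "k + 2" 1] by (simp add: mult.assoc[symmetric])
      also have "eK (k + 2) * F ^ n * E ^ n = inverse (br 1 ^ (2 * n)) *\<^sub>C (eK (k + 2) * pev (N n (k + 2)))"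
        by (simp add: pev_N_bas scaleC_scaleC bas_def scaleC_one)
      finally have "E * bas k m n = inverse (br 1 ^ (2 * n)) *\<^sub>C (E * F * eK (k + 2) * pev (N n (k + 2)))"
        by (simp add: sc mult.assoc)
      also have "\<dots> = (inverse (br 1 ^ (2 * n)) * inverse ((br 1)\<^sup>2)) *\<^sub>C ((br 1)\<^sup>2 *\<^sub>C (E * F * eK (k + 2)) * pev (N n (k + 2)))"
        by (simp add: sc)
      also have "(br 1)\<^sup>2 *\<^sub>C (E * F * eK (k + 2)) = eK (k + 2) * pev (nd (k + 1))"
        unfolding EF_eK by (simp add: pev_central algebra_simps)
      also have "eK (k + 2) * pev (nd (k + 1)) * pev (N n (k + 2)) = eK (k + 2) * pev (N m k)"
        unfolding True N_Suc' aev_mult by (simp only: mult.assoc)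
      finally have "\<phi> (E * bas k m n) = inverse (br 1 ^ (2 * n)) * inverse ((br 1)\<^sup>2) * coeff (N m k) (l - 1)"
        using poly[of "N m k" "k + 2"] mn by (simp add: clinear_scale[OF lin])
      moreover have "coeff (N m k) (l - 1) = (if m = l - 1 then 1 else 0)"
        using lead_coeff_N[of m k] mn by (auto intro!: coeff_eq_0)
      moreover have "c = inverse (br 1 ^ (2 * n)) * inverse ((br 1)\<^sup>2)" if "m = l - 1"
      proof -
        have e: "2 * (l - 1) = 2 * n + 2" using that True by simp
        show ?thesis unfolding c_def e power_add by simp
      qed
      ultimately show ?thesis unfolding 1 bas using True by auto
    next
      case False
      have z: "\<phi> (bas k m n * E) = 0" unfolding 1 bas using False mn by auto
      show ?thesis
      proof (cases "m = 0 \<and> n = l - 1")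
        case True
        have "E * bas k m n = eK (k + 2) * (E * E ^ (l - 1))"
          using True by (simp add: bas_def mult.assoc[symmetric] E_eK)
        also have "E * E ^ (l - 1) = 0" using E_nilpotent power_Suc[of E "l - 1"] by simp
        finally show ?thesis using z by (simp add: clinear_0[OF lin])
      next
        case nb: False
        have "K * (E * bas k m n) = qp 2 *\<^sub>C (E * (K * bas k m n))"
          by (simp add: mult.assoc[symmetric] KE sc)
        also have "\<dots> = qp (2 * (int n + 1 - int m)) *\<^sub>C (E * bas k m n * K)"
          unfolding K_bas' by (simp add: sc mult.assoc algebra_simps flip: qp_add)
        finally have "\<phi> (E * bas k m n) = 0"
          by (rule weight) (rule not_dvd; use mn False nb in auto)
        then show ?thesis using z by simp
      qed
    qed
  qed (auto simp: clinear_scale[OF lin] clinear_add[OF lin] distrib_left distrib_right sc)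
  have Ft: "\<phi> (x * F) = \<phi> (F * x)" for x
  proof (rule span[of "\<lambda>x. \<phi> (x * F) = \<phi> (F * x)"])
    fix k m n assume mn: "m < l" "n < l"
    show "\<phi> (bas k m n * F) = \<phi> (F * bas k m n)"
    \<comment> \<open>The same division for F; the exceptional pair is now m = l - 1 and n =
      0.\<close>
    proof (cases "n = Suc m")
      case True
      have "bas k m n * F = eK k * F ^ m * E ^ m * (E * F)"
        unfolding True bas_def by (simp add: mult.assoc power_Suc2 del: power_Suc)
      also have "\<dots> = inverse (br 1 ^ (2 * m)) *\<^sub>C (eK k * pev (N m k) * (E * F))"
        by (simp add: pev_N_bas sc bas_def scaleC_one)
      also have "eK k * pev (N m k) * (E * F) = pev (N m k) * (E * F * eK k)"
        using eK_EF_pow[of k 1] by (simp add: pev_central[of "N m k", symmetric] mult.assoc)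
      also have "inverse (br 1 ^ (2 * m)) *\<^sub>C \<dots> = (inverse (br 1 ^ (2 * m)) * inverse ((br 1)\<^sup>2)) *\<^sub>C
          (pev (N m k) * ((br 1)\<^sup>2 *\<^sub>C (E * F * eK k)))"
        by (simp add: sc)
      also have "pev (N m k) * ((br 1)\<^sup>2 *\<^sub>C (E * F * eK k)) = eK k * pev (N n (k - 2))"
        unfolding EF_eK True N_Suc' by (simp add: aev_mult pev_left_commute[of "eK k"] pev_left_commute[of "pev (N m k)"]) (simp only: pev_central)
      finally have "\<phi> (bas k m n * F) = inverse (br 1 ^ (2 * m)) * inverse ((br 1)\<^sup>2) * coeff (N n (k - 2)) (l - 1)"
        using poly[of "N n (k - 2)" k] mn by (simp add: clinear_scale[OF lin])
      moreover have "coeff (N n (k - 2)) (l - 1) = (if n = l - 1 then 1 else 0)"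
        using lead_coeff_N[of n "k - 2"] mn by (auto intro!: coeff_eq_0)
      moreover have "c = inverse (br 1 ^ (2 * m)) * inverse ((br 1)\<^sup>2)" if "n = l - 1"
      proof -
        have e: "2 * (l - 1) = 2 * m + 2" using that True by simp
        show ?thesis unfolding c_def e power_add by simp
      qed
      ultimately show ?thesis unfolding F_bas bas using True by auto
    next
      case False
      have z: "\<phi> (F * bas k m n) = 0" unfolding F_bas bas using False mn by auto
      show ?thesis
      proof (cases "m = l - 1 \<and> n = 0")
        case True
        have "F ^ (l - 1) * F = 0" using F_nilpotent power_Suc2[of F "l - 1"] by simp
        then show ?thesis using z True by (simp add: bas_def mult.assoc clinear_0[OF lin])
      next
        case nb: False
        have "K * (bas k m n * F) = qp (2 * (int n - int m)) *\<^sub>C (bas k m n * (K * F))"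
          by (simp add: mult.assoc[symmetric] K_bas' sc)
        also have "\<dots> = qp (2 * (int n - int m - 1)) *\<^sub>C (bas k m n * F * K)"
          unfolding KF by (simp add: sc mult.assoc algebra_simps flip: qp_add)
        finally have "\<phi> (bas k m n * F) = 0"
          by (rule weight) (rule not_dvd; use mn False nb in auto)
        then show ?thesis using z by simp
      qed
    qed
  qed (auto simp: clinear_scale[OF lin] clinear_add[OF lin] distrib_left distrib_right sc)
  have "\<forall>x. \<phi> (x * y) = \<phi> (y * x)" for y
  proof (induction y rule: generated_induct)
    case (7 y z)
    then show ?case by (metis mult.assoc)
  qed (use E Ft K in \<open>simp_all add: clinear_scale[OF lin] clinear_add[OF lin] distrib_left distrib_right sc\<close>)
  then show ?thesis using lin poly by blast
qed

end

section \<open>Characters built from the trace, and the operator \<open>SL\<close>\<close>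

lemma tensor_slice_combination:
  assumes "clinear \<beta>" "clinear \<gamma>"
  shows "tensor_slice (\<lambda>x. c * \<beta> x + d * \<gamma> x) t = c *\<^sub>C tensor_slice \<beta> t + d *\<^sub>C tensor_slice \<gamma> t"
proof -
  have lin: "clinear (\<lambda>x. c * \<beta> x + d * \<gamma> x)"
    using assms by (simp add: clinear_iff algebra_simps)
  have "clinear (\<lambda>t. c *\<^sub>C tensor_slice \<beta> t + d *\<^sub>C tensor_slice \<gamma> t)"
    by (rule clinearI)
      (simp_all add: clinear_add[OF clinear_slice] clinear_scale[OF clinear_slice] assms scaleC_add_right scaleC_scaleC mult.commute)
  then show ?thesis
    by (rule clinear_eq_on_pure[OF clinear_slice[OF lin]])
      (simp add: tensor_slice_pure lin assms scaleC_add_left scaleC_scaleC)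
qed

lemma qCh_combination:
  assumes "\<beta> \<in> qCh S" "\<gamma> \<in> qCh S"
  shows "(\<lambda>x. c * \<beta> x + d * \<gamma> x) \<in> qCh S"
    "drinfeld R (\<lambda>x. c * \<beta> x + d * \<gamma> x) = c *\<^sub>C drinfeld R \<beta> + d *\<^sub>C drinfeld R \<gamma>"
    "radford \<Delta> \<Lambda> (\<lambda>x. c * \<beta> x + d * \<gamma> x) = c *\<^sub>C radford \<Delta> \<Lambda> \<beta> + d *\<^sub>C radford \<Delta> \<Lambda> \<gamma>"
  using assms unfolding drinfeld_def radford_def
  by (auto simp: qCh_def tensor_slice_combination) (simp add: clinear_iff algebra_simps)

context uqsl2_odd
begin

text \<open>The character is the trace twisted by K^(-1) and by \<open>chebU r\<close> of the
  Casimir element. The bases \<open>N m (- k)\<close> and \<open>N n k\<close> are dual for the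
  trace, so its values are Newton coefficients of \<open>chebU r\<close>. The Radford map
  reassembles them; in the Drinfeld map a Fourier sum selects one weight of \<open>V_r\<close> and
  leaves the coefficients of \<open>Psi r\<close>.\<close>

lemma cointegral_character:
  assumes r: "r \<le> l"
  obtains \<xi> where "\<xi> \<in> qCh S" "radford \<Delta> Lam \<xi> = pev (chebU r)" "drinfeld Rm \<xi> = (rl / of_nat l) *\<^sub>C nn r"
proof -
  obtain \<phi> :: "'a \<Rightarrow> complex" where lin: "clinear \<phi>" and tr: "\<And>x y. \<phi> (x * y) = \<phi> (y * x)"
    and val: "\<And>k f. degree f < l \<Longrightarrow> \<phi> (eK k * pev f) = coeff f (l - 1)"
    using cointegral_exists by blast
  \<comment> \<open>Reversing one progression of nodes joins it to the other, so the product is a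
    single \<open>N (m + n)\<close>. Its coefficient of x^(l-1) is 1 for m + n = l - 1 and 0 below,
    and from m + n = l on it is divisible by \<open>PSI\<close>.\<close>
  have NN: "\<phi> (eK j * pev (N m (- k) * N n k)) = (if n = l - 1 - m then 1 else 0)"
    if "m < l" "n < l" for j m n k
  proof -
    have "N m (- k) * N n k = N m (k - 2 * int m) * N n k" by (simp only: N_minus)
    also have "\<dots> = N (m + n) (k - 2 * int m)" unfolding N_add by simp
    finally have eq: "N m (- k) * N n k = N (m + n) (k - 2 * int m)" .
    show ?thesis
    proof (cases "m + n < l")
      case True
      have "coeff (N (m + n) (k - 2 * int m)) (l - 1) = (if n = l - 1 - m then 1 else 0)"
      proof (cases "m + n = l - 1")
        case True
        then show ?thesis using lead_coeff_N[of "m + n"] that by auto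
      next
        case False
        then have "m + n < l - 1" using \<open>m + n < l\<close> by simp
        then show ?thesis by (simp add: coeff_eq_0)
      qed
      then show ?thesis unfolding eq using val[of "N (m + n) (k - 2 * int m)"] True by simp
    next
      case False
      then have "eK j * pev (N (m + n) (k - 2 * int m)) = 0"
        by (simp only: eK_pev_eq_0_iff) (rule N_PSI_dvd, simp)
      then show ?thesis unfolding eq using False that clinear_0[OF lin] by auto
    qed
  qed
  define \<xi> where "\<xi> x = rl * \<phi> (Km * (pev (chebU r) * x))" for x
  have lin\<xi>: "clinear \<xi>"
    unfolding \<xi>_def
    by (rule clinearI) (simp_all add: clinear_add[OF lin] clinear_scale[OF lin] distrib_left sc)
  have "\<xi> (x * y) = \<xi> (S (S y) * x)" for x y
  proof -
    have "\<phi> (Km * (pev (chebU r) * (x * y))) = \<phi> (y * (Km * (pev (chebU r) * x)))"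
      using tr[of "Km * (pev (chebU r) * x)" y] by (simp add: mult.assoc)
    also have "y * (Km * (pev (chebU r) * x)) = Km * (pev (chebU r) * (K * y * Km * x))"
    proof -
      have "Km * (pev (chebU r) * (K * y * Km * x)) = pev (chebU r) * (Km * K * y * Km * x)"
        by (simp only: mult.assoc pev_left_commute[of Km])
      also have "\<dots> = y * (Km * (pev (chebU r) * x))"
        by (simp add: mult.assoc pev_left_commute[of Km] pev_left_commute[of y])
      finally show ?thesis ..
    qed
    finally show ?thesis by (simp add: \<xi>_def antipode_squared)
  qed
  then have q: "\<xi> \<in> qCh S" using lin\<xi> by (simp add: qCh_def)
  have \<xi>: "\<xi> (eK k * pev f) = rl * qp (- k) * \<phi> (eK k * pev (chebU r * f))" for k f
  proof -
    have "Km * (pev (chebU r) * (eK k * pev f)) = qp (- k) *\<^sub>C (eK k * pev (chebU r * f))"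
    proof -
      have "Km * (pev (chebU r) * (eK k * pev f)) = (Km * eK k) * (pev (chebU r) * pev f)"
        by (simp only: mult.assoc pev_left_commute[of "eK k"] pev_left_commute[of Km])
      then show ?thesis by (simp add: Km_eK aev_mult sc)
    qed
    then show ?thesis by (simp add: \<xi>_def clinear_scale[OF lin])
  qed
  have rad: "\<xi> (eK (- a) * pev (N (l - 1 - i) (- a))) = rl * qp a * Bc i r (- a)" if i: "i < l" for a i
  proof -
    have "chebU r * N (l - 1 - i) (- a) = (\<Sum>n<l. smult (Bc n r (- a)) (N (l - 1 - i) (- a) * N n a))"
      unfolding chebU_newton[OF r, of "- a"] sum_distrib_right by (simp add: mult.commute)
    then have "\<phi> (eK (- a) * pev (chebU r * N (l - 1 - i) (- a))) =
        (\<Sum>n<l. Bc n r (- a) * \<phi> (eK (- a) * pev (N (l - 1 - i) (- a) * N n a)))"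
      by (simp only: aev_sum aev_smult sum_distrib_left mult_scaleC_right complex_vector.linear_sum[OF lin]
          clinear_scale[OF lin] scaleC_complex_def)
    also have "\<dots> = (\<Sum>n<l. if n = i then Bc n r (- a) else 0)"
      by (intro sum.cong refl) (use i l_ge in \<open>auto simp: NN\<close>)
    also have "\<dots> = Bc i r (- a)" using i by simp
    finally show ?thesis by (simp add: \<xi>)
  qed
  have R: "radford \<Delta> Lam \<xi> = pev (chebU r)"
  proof -
    have "(\<Sum>i<l. smult (rl / of_nat l * qp (- a) * \<xi> (eK (- a) * pev (N (l - 1 - i) (- a)))) (N i a)) = chebU r" for a
    proof -
      have "rl / of_nat l * qp (- a) * (rl * qp a * x) = x" for x
        using rl_square l_ge by (simp add: qp_minus field_simps)
      then have "(\<Sum>i<l. smult (rl / of_nat l * qp (- a) * \<xi> (eK (- a) * pev (N (l - 1 - i) (- a)))) (N i a)) =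
          (\<Sum>i<l. smult (Bc i r (- a)) (N i a))"
        by (intro sum.cong refl) (simp only: lessThan_iff rad)
      then show ?thesis using chebU_newton[OF r, of "- a"] by simp
    qed
    then show ?thesis unfolding radford_formula[OF q] by (simp only: el_const)
  qed
  have dri: "\<xi> (eK a * pev (N n a)) = rl * qp (- a) * Bc (l - 1 - n) r a" if n: "n < l" for a n
  proof -
    have "chebU r * N n a = (\<Sum>m<l. smult (Bc m r a) (N m (- a) * N n a))"
      unfolding chebU_newton[OF r, of a] sum_distrib_right by simp
    then have "\<phi> (eK a * pev (chebU r * N n a)) =
        (\<Sum>m<l. Bc m r a * \<phi> (eK a * pev (N m (- a) * N n a)))"
      by (simp only: aev_sum aev_smult sum_distrib_left mult_scaleC_right complex_vector.linear_sum[OF lin]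
          clinear_scale[OF lin] scaleC_complex_def)
    also have "\<dots> = (\<Sum>m<l. if m = l - 1 - n then Bc m r a else 0)"
      by (intro sum.cong refl) (use n l_ge in \<open>auto simp: NN\<close>)
    also have "\<dots> = Bc (l - 1 - n) r a" using n by simp
    finally show ?thesis by (simp add: \<xi>)
  qed
  \<comment> \<open>The exponent is linear in a with slope \<open>wt r i\<close> - d, so the sum
    over a forces d to be that weight. The remaining phase is then 1 and the factorials give 1 / l^2
    by \<open>bf_complement\<close>.\<close>
  have coef: "ca n * (\<Sum>a\<in>Zl. qp (a * b + int n * (b - a) - 2 * (int n)\<^sup>2) * \<xi> (eK a * pev (N n a))) =
      rl / of_nat l * ind r b * poly (N (l - 1 - n) (- b + 2 * int n + 2)) (ch (int r))" if n: "n < l" for n b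
  proof -
    define M where "M = l - 1 - n"
    have M: "int M = int l - 1 - int n" using n by (simp add: M_def of_nat_diff)
    define d where "d = 2 * int n + 2 - b"
    define P where "P w = poly (N M w) (ch (int r))" for w
    have "ca n * (\<Sum>a\<in>Zl. qp (a * b + int n * (b - a) - 2 * (int n)\<^sup>2) * \<xi> (eK a * pev (N n a))) =
        (\<Sum>a\<in>Zl. \<Sum>i<r. rl * (ca n * ca M) * qp (a * b + int n * (b - a) - 2 * (int n)\<^sup>2 - a +
          (wt r i * a + int M * (a - wt r i) - 2 * (int M)\<^sup>2 - wt r i)) * P (wt r i))"
      unfolding dri[OF n] M_def[symmetric] Bc_def P_def[symmetric] sum_distrib_left
      by (intro sum.cong refl) (simp add: qp_add qp_diff qp_minus divide_inverse)
    also have "\<dots> = (\<Sum>i<r. \<Sum>a\<in>Zl. rl * (ca n * ca M) * qp (a * b + int n * (b - a) - 2 * (int n)\<^sup>2 - a +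
          (wt r i * a + int M * (a - wt r i) - 2 * (int M)\<^sup>2 - wt r i)) * P (wt r i))"
      by (rule sum.swap)
    also have "\<dots> = (\<Sum>i<r. if int l dvd d - wt r i then rl / of_nat l * P d else 0)"
    proof (rule sum.cong)
      fix i
      define w where "w = wt r i"
      define e where "e = int n * b - 2 * (int n)\<^sup>2 + int n * w - 2 * (int n + 1)\<^sup>2"
      have "qp (a * b + int n * (b - a) - 2 * (int n)\<^sup>2 - a + (w * a + int M * (a - w) - 2 * (int M)\<^sup>2 - w)) =
          qp e * qp ((w - d) * a)" for a
        unfolding qp_add[symmetric]
      proof (rule qp_cong)
        have "(a * b + int n * (b - a) - 2 * (int n)\<^sup>2 - a + (w * a + int M * (a - w) - 2 * (int M)\<^sup>2 - w)) -
            (e + (w - d) * a) = int l * (a - w - 2 * (int l - 2 * (int n + 1)))"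
          unfolding M e_def d_def by (simp add: algebra_simps power2_eq_square)
        then show "int l dvd (a * b + int n * (b - a) - 2 * (int n)\<^sup>2 - a + (w * a + int M * (a - w) - 2 * (int M)\<^sup>2 - w)) -
            (e + (w - d) * a)" by simp
      qed
      then have "(\<Sum>a\<in>Zl. rl * (ca n * ca M) * qp (a * b + int n * (b - a) - 2 * (int n)\<^sup>2 - a +
          (w * a + int M * (a - w) - 2 * (int M)\<^sup>2 - w)) * P w) =
          rl * (ca n * ca M) * qp e * P w * (\<Sum>a\<in>Zl. qp ((w - d) * a))"
        by (simp add: sum_distrib_left mult_ac)
      also have "\<dots> = (if int l dvd d - w then rl / of_nat l * P d else 0)"
      proof (cases "int l dvd d - w")
        case True
        have "P w = P d" using N_cong[of w d M] True by (simp add: P_def dvd_diff_commute)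
        have "ca n * ca M * qp e = 1 / (of_nat l)\<^sup>2"
        proof -
          have "ca n * ca M * qp e = qp (int n * (int n - 1) + int M * (int M - 1) + e) / (bf n * bf M)\<^sup>2"
            by (simp add: ca_def qp_add power_mult_distrib)
          also have "qp (int n * (int n - 1) + int M * (int M - 1) + e) = qp 0"
          proof (rule qp_cong)
            have "int n * (int n - 1) + int M * (int M - 1) + e - 0 =
                int l * (int l - 3 - 2 * int n) - int n * (d - w)"
              unfolding M e_def d_def by (simp add: algebra_simps power2_eq_square)
            then show "int l dvd int n * (int n - 1) + int M * (int M - 1) + e - 0"
              using True by simp
          qed
          finally show ?thesis unfolding M_def bf_complement[OF n] by simp
        qed
        moreover have "rl * (ca n * ca M) * qp e * P w * (\<Sum>a\<in>Zl. qp ((w - d) * a)) =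
            rl * (ca n * ca M * qp e) * P d * of_nat l"
          using True \<open>P w = P d\<close> sum_qp[of "w - d"] by (simp add: dvd_diff_commute)
        ultimately show ?thesis using True l_ge by (simp add: power2_eq_square)
      next
        case False
        then show ?thesis using sum_qp[of "w - d"] by (simp add: dvd_diff_commute)
      qed
      finally show "(\<Sum>a\<in>Zl. rl * (ca n * ca M) * qp (a * b + int n * (b - a) - 2 * (int n)\<^sup>2 - a +
          (wt r i * a + int M * (a - wt r i) - 2 * (int M)\<^sup>2 - wt r i)) * P (wt r i)) =
          (if int l dvd d - wt r i then rl / of_nat l * P d else 0)" by (simp add: w_def)
    qed simp
    also have "\<dots> = rl / of_nat l * P d * (\<Sum>i<r. if int l dvd d - wt r i then 1 else 0)"
      unfolding sum_distrib_left by (intro sum.cong) auto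
    also have "\<dots> = rl / of_nat l * P d * ind r d" by (simp only: sum_weight[OF r])
    \<comment> \<open>Passing from d to -b crosses the nodes of P d. If none of them is r or -r
      modulo l, then d and -b are both weights of \<open>V_r\<close> or both not; otherwise P d =
      0.\<close>
    also have "\<dots> = rl / of_nat l * ind r b * P d"
    proof (cases "P d = 0")
      case False
      then have "inwt r (d + 2 * int M) = inwt r d" unfolding P_def by (rule inwt_arc)
      moreover have "inwt r (d + 2 * int M) = inwt r (- b)"
        by (rule inwt_cong) (simp add: M d_def)
      ultimately show ?thesis by (simp add: ind_def inwt_minus)
    qed simp
    moreover have "d = - b + 2 * int n + 2" by (simp add: d_def)
    ultimately show ?thesis by (simp only: P_def M_def)
  qed
  have "(\<Sum>n<l. smult (ca n * (\<Sum>a\<in>Zl. qp (a * b + int n * (b - a) - 2 * (int n)\<^sup>2) * \<xi> (eK a * pev (N n a)))) (N n (- b)))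
      = smult (rl / of_nat l) (smult (ind r b) (Psi (int r)))" for b
  proof -
    have "(\<Sum>n<l. smult (ca n * (\<Sum>a\<in>Zl. qp (a * b + int n * (b - a) - 2 * (int n)\<^sup>2) * \<xi> (eK a * pev (N n a)))) (N n (- b)))
        = (\<Sum>n<l. smult (rl / of_nat l * ind r b * poly (N (l - 1 - n) (- b + 2 * int n + 2)) (ch (int r))) (N n (- b)))"
      by (intro sum.cong refl) (simp only: lessThan_iff coef)
    also have "\<dots> = smult (rl / of_nat l * ind r b) (Psi (int r))"
      unfolding Psi_newton[of "int r" "- b"] smult_sum_right by (simp add: mult_ac)
    finally show ?thesis by simp
  qed
  then have D: "drinfeld Rm \<xi> = (rl / of_nat l) *\<^sub>C nn r"
    unfolding drinfeld_formula[OF q] by (simp only: el_smult nn_def)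
  show thesis using that q R D .
qed

text \<open>By independence of the Newton basis every coefficient vanishes. As a function of b it is
  a phase times a Fourier transform, and inversion gives \<beta> = 0 in weight zero; in the other
  weights \<open>qCh_weight\<close> applies.\<close>

lemma drinfeld_eq_0:
  assumes b: "\<beta> \<in> qCh S" and 0: "drinfeld Rm \<beta> = 0"
  shows "\<beta> x = 0"
proof -
  note lin = qCh_linear[OF b]
  define s where "s n b = (\<Sum>a\<in>Zl. qp (a * b + int n * (b - a) - 2 * (int n)\<^sup>2) * \<beta> (eK a * pev (N n a)))" for n b
  define g where "g b = (\<Sum>n<l. smult (ca n * s n b) (N n (- b)))" for b
  have "periodic g"
  proof -
    have N: "N n (- (b + int l)) = N n (- b)" for n b by (rule N_cong) simp
    have "qp (a * (b + int l) + int n * (b + int l - a) - 2 * (int n)\<^sup>2) = qp (a * b + int n * (b - a) - 2 * (int n)\<^sup>2)" for a b n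
    proof (rule qp_cong)
      have "(a * (b + int l) + int n * (b + int l - a) - 2 * (int n)\<^sup>2) - (a * b + int n * (b - a) - 2 * (int n)\<^sup>2) = int l * (a + int n)"
        by (simp add: algebra_simps)
      then show "int l dvd (a * (b + int l) + int n * (b + int l - a) - 2 * (int n)\<^sup>2) - (a * b + int n * (b - a) - 2 * (int n)\<^sup>2)"
        by simp
    qed
    then have "s n (b + int l) = s n b" for n b by (simp only: s_def)
    then show ?thesis by (simp only: periodic_def g_def N) simp
  qed
  have "el g = 0" using 0 unfolding drinfeld_formula[OF b] g_def s_def .
  have "g b = 0" for b
  proof (rule ccontr)
    assume "g b \<noteq> 0"
    have "degree (g b) < l"
      unfolding g_def by (rule degree_sum_less) (use l_ge in \<open>auto intro: le_less_trans[OF degree_smult_le]\<close>)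
    moreover have "PSI dvd g b" by (rule el_eq_0_imp) fact+
    ultimately show False using dvd_imp_degree_le[of PSI "g b"] \<open>g b \<noteq> 0\<close> by simp
  qed
  then have s0: "s n b = 0" if "n < l" for n b
    using newton_independent[of "\<lambda>n. ca n * s n b" "- b" l n] that unfolding g_def
    by (auto simp: ca_def bf_nonzero)
  have diag: "\<beta> (bas k n n) = 0" if n: "n < l" for k n
  proof -
    define f where "f a = qp (- (int n * a)) * \<beta> (eK a * pev (N n a))" for a
    have "periodic f"
    proof -
      have "N n (a + int l) = N n a" "eK (a + int l) = eK a" "qp (- (int n * (a + int l))) = qp (- (int n * a))" for a
        by (auto intro!: N_cong eK_cong qp_cong simp: algebra_simps)
      then show ?thesis by (simp add: periodic_def f_def)
    qed
    have "(\<Sum>a\<in>Zl. qp (a * b) * f a) = 0" for b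
    proof -
      have "s n b = qp (int n * b - 2 * (int n)\<^sup>2) * (\<Sum>a\<in>Zl. qp (a * b) * f a)"
        unfolding s_def sum_distrib_left f_def
        by (intro sum.cong refl) (simp add: algebra_simps flip: qp_add mult.assoc)
      then show ?thesis using s0[OF n, of b] by simp
    qed
    then have "f k = 0" using dft_inversion[OF \<open>periodic f\<close>, of k] l_ge by simp
    then show ?thesis by (simp add: f_def pev_N_bas clinear_scale[OF lin])
  qed
  obtain c where x: "x = (\<Sum>k\<in>Zl. \<Sum>m<l. \<Sum>n<l. c k m n *\<^sub>C bas k m n)" by (rule bas_coordinates)
  have "\<beta> (bas k m n) = 0" if "m < l" "n < l" for k m n
    using diag[of n k] qCh_weight[OF b that] that by (cases "m = n") auto
  then show ?thesis
    unfolding x by (simp add: complex_vector.linear_sum[OF lin] clinear_scale[OF lin])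
qed

lemma inj_drinfeld: "inj_on (drinfeld Rm) (qCh S)"
proof (rule inj_onI)
  fix \<beta> \<gamma> assume bc: "\<beta> \<in> qCh S" "\<gamma> \<in> qCh S" "drinfeld Rm \<beta> = drinfeld Rm \<gamma>"
  have "1 * \<beta> x + (- 1) * \<gamma> x = 0" for x
  proof (rule drinfeld_eq_0)
    show "(\<lambda>x. 1 * \<beta> x + (- 1) * \<gamma> x) \<in> qCh S" by (rule qCh_combination(1)[OF bc(1,2)])
    show "drinfeld Rm (\<lambda>x. 1 * \<beta> x + (- 1) * \<gamma> x) = 0"
      unfolding qCh_combination(2)[OF bc(1,2)] bc(3) by (simp add: scaleC_one)
  qed
  then show "\<beta> = \<gamma>" by (auto simp: fun_eq_iff)
qed

definition SL :: "'a \<Rightarrow> 'a" where "SL = S_LM Rm \<Delta> S Lam"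

lemma SL_drinfeld: "\<beta> \<in> qCh S \<Longrightarrow> SL (drinfeld Rm \<beta>) = radford \<Delta> Lam \<beta>"
  unfolding SL_def S_LM_def by (simp add: inv_into_f_f[OF inj_drinfeld])

end

locale uqsl2_odd_irreps = uqsl2_odd l h q E F K \<Delta> \<epsilon> S
  for l h q E F K \<Delta> \<epsilon> S +
  fixes V :: "nat \<Rightarrow> 'a \<Rightarrow> complex mat"
  assumes irrep: "1 \<le> r \<Longrightarrow> r \<le> l \<Longrightarrow> uqsl2_irrep q E F K r (V r)"
begin

lemma chebU_image: "1 \<le> r \<Longrightarrow> r \<le> l \<Longrightarrow> pev (chebU r) \<in> drinfeld Rm ` qCh S"
  and SL_chebU: "1 \<le> r \<Longrightarrow> r \<le> l \<Longrightarrow> SL (pev (chebU r)) = (rl / of_nat l) *\<^sub>C nn r"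
proof -
  assume r: "1 \<le> r" "r \<le> l"
  note * = irrep[OF r] r
  show "pev (chebU r) \<in> drinfeld Rm ` qCh S"
    unfolding drinfeld_qCh_mod[OF *, symmetric] by (rule imageI) (rule qCh_mod_qCh[OF *])
  show "SL (pev (chebU r)) = (rl / of_nat l) *\<^sub>C nn r"
    unfolding drinfeld_qCh_mod[OF *, symmetric] SL_drinfeld[OF qCh_mod_qCh[OF *]] by (rule radford_qCh_mod[OF *])
qed

lemma drinfeld_image_combination:
  assumes "x \<in> drinfeld Rm ` qCh S" "y \<in> drinfeld Rm ` qCh S"
  shows "c *\<^sub>C x + d *\<^sub>C y \<in> drinfeld Rm ` qCh S"
    "SL (c *\<^sub>C x + d *\<^sub>C y) = c *\<^sub>C SL x + d *\<^sub>C SL y"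
proof -
  obtain \<beta> \<gamma> where b: "\<beta> \<in> qCh S" "x = drinfeld Rm \<beta>" "\<gamma> \<in> qCh S" "y = drinfeld Rm \<gamma>"
    using assms by blast
  note comb = qCh_combination[OF b(1,3)]
  show "c *\<^sub>C x + d *\<^sub>C y \<in> drinfeld Rm ` qCh S"
    unfolding b comb(2)[symmetric] by (rule imageI) (rule comb(1))
  show "SL (c *\<^sub>C x + d *\<^sub>C y) = c *\<^sub>C SL x + d *\<^sub>C SL y"
    unfolding b comb(2)[symmetric] SL_drinfeld[OF comb(1)] comb(3) SL_drinfeld[OF b(1)] SL_drinfeld[OF b(3)] ..
qed

lemma nn_image: "r \<le> l \<Longrightarrow> nn r \<in> drinfeld Rm ` qCh S"
  and SL_nn: "r \<le> l \<Longrightarrow> SL (nn r) = rl *\<^sub>C pev (chebU r)"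
proof -
  assume r: "r \<le> l"
  obtain \<xi> where \<xi>: "\<xi> \<in> qCh S" "radford \<Delta> Lam \<xi> = pev (chebU r)" "drinfeld Rm \<xi> = (rl / of_nat l) *\<^sub>C nn r"
    by (rule cointegral_character[OF r])
  have nn: "nn r = rl *\<^sub>C drinfeld Rm \<xi> + 0 *\<^sub>C drinfeld Rm \<xi>"
    unfolding \<xi>(3) using rl_square l_ge by (simp add: scaleC_scaleC scaleC_one)
  have mem: "drinfeld Rm \<xi> \<in> drinfeld Rm ` qCh S" using \<xi>(1) by blast
  show "nn r \<in> drinfeld Rm ` qCh S" unfolding nn by (rule drinfeld_image_combination(1)[OF mem mem])
  show "SL (nn r) = rl *\<^sub>C pev (chebU r)"
    unfolding nn drinfeld_image_combination(2)[OF mem mem] SL_drinfeld[OF \<xi>(1)] \<xi>(2) by simp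
qed

text \<open>The center is spanned by the two families that \<open>SL\<close> exchanges, so linear
  statements about \<open>SL\<close> need checking on these alone.\<close>

lemma center_induct [consumes 1, case_names chebU nn combination]:
  assumes "z \<in> center"
    and cheb: "\<And>r. 1 \<le> r \<Longrightarrow> r \<le> l \<Longrightarrow> P (pev (chebU r))" and nn: "\<And>j. 1 \<le> j \<Longrightarrow> j < l \<Longrightarrow> P (nn j)"
    and comb: "\<And>c d x y. x \<in> center \<Longrightarrow> y \<in> center \<Longrightarrow> P x \<Longrightarrow> P y \<Longrightarrow> P (c *\<^sub>C x + d *\<^sub>C y)"
  shows "P z"
proof -
  define Q where "Q x \<longleftrightarrow> x \<in> center \<and> P x" for x
  have Q: "Q (c *\<^sub>C x + d *\<^sub>C y)" if "Q x" "Q y" for c d x y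
    using that comb center_subspace by (auto simp: Q_def complex_vector.subspace_def)
  have add: "Q (x + y)" if "Q x" "Q y" for x y using Q[OF that, of 1 1] by (simp add: scaleC_one)
  have scale: "Q (c *\<^sub>C x)" if "Q x" for c x using Q[OF that that, of c 0] by simp
  have "Q (pev (chebU 1))" unfolding Q_def using cheb[of 1] l_ge by (intro conjI pev_center) simp_all
  from scale[OF this, of 0] have 0: "Q 0" by simp
  have sum: "Q (sum f A)" if "\<And>i. i \<in> A \<Longrightarrow> Q (f i)" for f :: "nat \<Rightarrow> 'a" and A
    using that by (induction A rule: infinite_finite_induct) (auto simp: 0 intro: add)
  obtain f c where f: "degree f < l" and z: "z = pev f + (\<Sum>j=1..l-1. c j *\<^sub>C nn j)"
    by (rule center_form[OF assms(1)])
  obtain b where b: "f = (\<Sum>r=1..l. smult (b r) (chebU r))" by (rule chebU_span[OF f])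
  have "Q (pev f)" unfolding b aev_sum aev_smult
    by (rule sum, rule scale) (auto simp: Q_def pev_center cheb)
  moreover have "Q (\<Sum>j=1..l-1. c j *\<^sub>C nn j)"
    by (rule sum, rule scale) (auto simp: Q_def nn_central nn)
  ultimately show ?thesis unfolding z using add by (auto simp: Q_def)
qed

lemma center_image: "center \<subseteq> drinfeld Rm ` qCh S"
proof
  fix z :: 'a assume "z \<in> center"
  then show "z \<in> drinfeld Rm ` qCh S"
  proof (induction rule: center_induct)
    case (combination c d x y)
    then show ?case using drinfeld_image_combination(1) by blast
  next
    case (chebU r)
    then show ?case by (rule chebU_image)
  next
    case (nn j)
    then show ?case by (intro nn_image) simp
  qed
qed

lemma SL_combination: "x \<in> center \<Longrightarrow> y \<in> center \<Longrightarrow> SL (c *\<^sub>C x + d *\<^sub>C y) = c *\<^sub>C SL x + d *\<^sub>C SL y"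
  by (rule drinfeld_image_combination(2)) (rule subsetD[OF center_image], assumption)+

lemma SL_scale: "x \<in> center \<Longrightarrow> SL (c *\<^sub>C x) = c *\<^sub>C SL x"
  using SL_combination[of x x c 0] by simp

lemma SL_add: "x \<in> center \<Longrightarrow> y \<in> center \<Longrightarrow> SL (x + y) = SL x + SL y"
  using SL_combination[of x y 1 1] by (simp add: scaleC_one)

lemma SL_sum: "(\<And>i. i \<in> A \<Longrightarrow> f i \<in> center) \<Longrightarrow> SL (sum f A) = (\<Sum>i\<in>A. SL (f i))"
proof (induction A rule: infinite_finite_induct)
  case (insert i A)
  then have "sum f A \<in> center" by (intro complex_vector.subspace_sum[OF center_subspace]) auto
  then show ?case using insert by (simp add: SL_add)
qed (use SL_scale[of 0 0] center_subspace in \<open>auto simp: complex_vector.subspace_def\<close>)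

lemma SL_center: "z \<in> center \<Longrightarrow> SL z \<in> center"
proof (induction z rule: center_induct)
  case (combination c d x y)
  then show ?case using center_subspace by (simp add: SL_combination complex_vector.subspace_def)
qed (use center_subspace in \<open>simp_all add: SL_chebU SL_nn nn_central pev_center complex_vector.subspace_def\<close>)

lemma SL_SL: "z \<in> center \<Longrightarrow> SL (SL z) = z"
proof (induction z rule: center_induct)
  case (combination c d x y)
  then show ?case by (simp add: SL_combination SL_center)
next
  case (chebU r)
  then show ?case using rl_square l_ge by (simp add: SL_chebU SL_scale nn_central SL_nn scaleC_scaleC scaleC_one)
next
  case (nn j)
  then show ?case using rl_square l_ge by (simp add: SL_nn SL_scale pev_center SL_chebU scaleC_scaleC scaleC_one)
qed

lemma inv_SL: "z \<in> center \<Longrightarrow> inv_into center SL z = SL z"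
proof -
  assume z: "z \<in> center"
  have "inj_on SL center" by (rule inj_on_inverseI[of _ SL]) (rule SL_SL)
  then have "inv_into center SL (SL (SL z)) = SL z" by (rule inv_into_f_f) (simp add: SL_center z)
  then show ?thesis by (simp add: SL_SL z)
qed

end

section \<open>The ribbon element\<close>

lemma gbin_self: "gbin Q n n = 1"
  by (induction n) (simp_all add: gbin_eq_0)

context uqsl2_odd
begin

lemma coordinate_functional:
  assumes "m0 < l" "n0 < l"
  shows "\<exists>\<phi>::'a \<Rightarrow> complex. clinear \<phi> \<and>
    (\<forall>k m n. \<phi> (bas k m n) = (if int l dvd k - k0 \<and> m = m0 \<and> n = n0 then 1 else 0))"
proof -
  let ?c = "\<lambda>k m n. if int l dvd k - k0 \<and> m = m0 \<and> n = n0 then 1 else (0::complex)"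
  obtain \<phi> :: "'a \<Rightarrow> complex" where lin: "clinear \<phi>"
    and val: "\<forall>k\<in>Zl. \<forall>m<l. \<forall>n<l. \<phi> (bas k m n) = ?c k m n"
    using functional_ex[of ?c] by blast
  have "\<phi> (bas k m n) = ?c k m n" for k m n
  proof (cases "m < l \<and> n < l")
    case True
    have "bas k m n = bas (k mod int l) m n" by (rule bas_cong) (simp add: minus_mod_eq_mult_div)
    moreover have "int l dvd k mod int l - k0 \<longleftrightarrow> int l dvd k - k0"
      by (simp add: mod_eq_dvd_iff[symmetric])
    ultimately show ?thesis using val True by simp
  next
    case False
    then have "bas k m n = 0"
      using pow_zero_ge[OF F_nilpotent] pow_zero_ge[OF E_nilpotent] by (auto simp: bas_def not_less)
    then show ?thesis using False assms by (auto simp: clinear_0[OF lin])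
  qed
  with lin show ?thesis by blast
qed

lemma dvd_diff_iff: "int l dvd a - b \<Longrightarrow> int l dvd a - c \<longleftrightarrow> int l dvd b - c"
  by (metis mod_eq_dvd_iff)

text \<open>Only the summand with F^n in the left and E^n in the right factor meets these
  coordinates. Its Gaussian binomials and powers of q are all 1, which is why this pair of
  coordinates is chosen.\<close>

lemma comult_bas_coordinate:
  fixes \<phi> \<psi> :: "'a \<Rightarrow> complex"
  assumes m: "m < l" and n: "n < l" and lin: "clinear \<phi>" "clinear \<psi>"
    and \<phi>: "\<And>k i j. \<phi> (bas k i j) = (if int l dvd k - k1 \<and> i = m \<and> j = 0 then 1 else 0)"
    and \<psi>: "\<And>k i j. \<psi> (bas k i j) = (if int l dvd k - k2 \<and> i = 0 \<and> j = m then 1 else 0)"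
  shows "tensor_lift (\<lambda>a b. \<phi> a * \<psi> b) (\<Delta> (bas k n n)) = (if int l dvd k - (k1 + k2) \<and> n = m then 1 else 0)"
proof -
  have bil: "cbilinear (\<lambda>a b. \<phi> a * \<psi> b)" by (rule cbilinear_mult[OF lin])
  note L = clinear_tensor_lift[OF bil]
  have KmF: "eK a * (Km ^ i * F ^ j * E ^ i') = qp (- (a * int i)) *\<^sub>C bas a j i'" for a i j i'
  proof -
    have "eK a * Km ^ i = qp (- (a * int i)) *\<^sub>C eK a"
    proof (induction i)
      case (Suc i)
      have "eK a * Km ^ Suc i = eK a * Km ^ i * Km" by (simp add: power_commutes mult.assoc)
      also have "\<dots> = qp (- (a * int (Suc i))) *\<^sub>C eK a"
        unfolding Suc by (simp add: sc eK_Km algebra_simps flip: qp_add)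
      finally show ?case .
    qed (simp add: scaleC_one)
    then show ?thesis unfolding bas_def by (simp add: sc flip: mult.assoc)
  qed
  have basK: "bas a i i' * K ^ j = qp ((a + 2 * (int i - int i')) * int j) *\<^sub>C bas a i i'" for a i i' j
  proof (induction j)
    case (Suc j)
    have "bas a i i' * K ^ Suc j = bas a i i' * K ^ j * K" by (simp add: power_commutes mult.assoc)
    also have "\<dots> = qp ((a + 2 * (int i - int i')) * int (Suc j)) *\<^sub>C bas a i i'"
      unfolding Suc by (simp add: sc bas_K algebra_simps flip: qp_add)
    finally show ?case .
  qed (simp add: scaleC_one)
  define x where "x a i (i'::nat) = qp (- ((k - a) * int i))" for a i i'
  define y where "y a i i' = qp ((a + 2 * (int i - int i')) * int (n - i'))" for a and i i' :: nat
  have "\<Delta> (bas k n n) = (\<Sum>a\<in>Zl. \<Sum>i\<le>n. \<Sum>i'\<le>n. (gbin (qp (- 2)) n i * gbin (qp 2) n i') *\<^sub>C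
      ((eK (k - a) * (Km ^ i * F ^ (n - i) * E ^ (n - i'))) \<boxtimes> (eK a * F ^ i * E ^ i' * K ^ (n - i'))))"
    unfolding bas_def comult_mult comult_eK comult_F_pow comult_E_pow sum_product3
    by (simp add: sc times_pure_tensor mult.assoc mult.commute[of "gbin (qp 2) n i" for i])
  also have "\<dots> = (\<Sum>a\<in>Zl. \<Sum>i\<le>n. \<Sum>i'\<le>n. (gbin (qp (- 2)) n i * gbin (qp 2) n i' * x a i i' * y a i i') *\<^sub>C
      (bas (k - a) (n - i) (n - i') \<boxtimes> bas a i i'))"
    unfolding KmF bas_def[symmetric] basK by (simp add: pure_tensor_simps sc x_def y_def mult_ac)
  finally have D: "\<Delta> (bas k n n) = \<dots>" .
  have "tensor_lift (\<lambda>a b. \<phi> a * \<psi> b) (\<Delta> (bas k n n)) = (\<Sum>a\<in>Zl. \<Sum>i\<le>n. \<Sum>i'\<le>n.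
      gbin (qp (- 2)) n i * gbin (qp 2) n i' * x a i i' * y a i i' * (\<phi> (bas (k - a) (n - i) (n - i')) * \<psi> (bas a i i')))"
    unfolding D complex_vector.linear_sum[OF L] clinear_scale[OF L] tensor_lift_pure[OF bil] scaleC_complex_def ..
  also have "\<dots> = (\<Sum>a\<in>Zl. \<Sum>i\<le>n. \<Sum>i'\<le>n. if i = 0 \<and> i' = n then
      (if int l dvd a - k2 then (if int l dvd k - a - k1 \<and> n = m then 1 else 0) else 0) else 0)"
    by (intro sum.cong refl) (auto simp: \<phi> \<psi> x_def y_def gbin_self)
  also have "\<dots> = (\<Sum>a\<in>Zl. if int l dvd a - k2 then (if int l dvd k - a - k1 \<and> n = m then 1 else 0) else 0)"
  proof (rule sum.cong)
    fix a
    have "(\<Sum>i\<le>n. \<Sum>i'\<le>n. if i = 0 \<and> i' = n then u else 0) = (\<Sum>i\<le>n. if i = 0 then u else (0::complex))" for u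
      by (intro sum.cong) auto
    then show "(\<Sum>i\<le>n. \<Sum>i'\<le>n. if i = 0 \<and> i' = n then
      (if int l dvd a - k2 then (if int l dvd k - a - k1 \<and> n = m then 1 else 0) else 0) else 0) =
      (if int l dvd a - k2 then (if int l dvd k - a - k1 \<and> n = m then 1 else 0) else (0::complex))" by simp
  qed simp
  also have "\<dots> = (if int l dvd k - k2 - k1 \<and> n = m then 1 else 0)"
  proof (rule sum_Zl_single)
    have "int l dvd k - (a + int l) - k1 \<longleftrightarrow> int l dvd k - a - k1" for a
      using dvd_diff_iff[of "k - (a + int l)" "k - a" k1] by simp
    then show "periodic (\<lambda>a. if int l dvd k - a - k1 \<and> n = m then 1 else (0::complex))"
      by (simp add: periodic_def)
  qed
  finally show ?thesis by (simp add: algebra_simps)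
qed

text \<open>Comparing the coefficients of \<open>e\<^sub>k\<^sub>1 F\<^sup>m \<otimes> e\<^sub>k\<^sub>2 E\<^sup>m\<close> determines a central \<open>z\<close> with
  \<open>\<Delta> z = (z \<otimes> z) R\<^sub>2\<^sub>1 R\<close> up to a character of \<open>\<int>/l\<close>, which centrality then excludes.\<close>

lemma ribbon_inverse_form:
  assumes z: "z \<in> center" "z \<noteq> 0" and D: "\<Delta> z = (z \<boxtimes> z) * Mm"
  shows "z = el ff"
proof -
  obtain c where el: "z = el (\<lambda>k. \<Sum>m<l. smult (c k m / br 1 ^ (2 * m)) (N m k))"
    and zb: "z = (\<Sum>k\<in>Zl. \<Sum>m<l. c k m *\<^sub>C bas k m m)" and per: "\<forall>m. periodic (\<lambda>k. c k m)"
    by (rule center_el[OF z(1)])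
  have comm: "x * z = z * x" for x using z(1) by (simp add: center_def)
  have eK_z: "eK a * z = (\<Sum>j<l. c a j *\<^sub>C bas a j j)" for a
  proof -
    have "eK a * z = (\<Sum>k\<in>Zl. if int l dvd k - a then \<Sum>j<l. c k j *\<^sub>C bas k j j else 0)"
      unfolding zb sum_distrib_left mult_scaleC_right
    proof (intro sum.cong refl)
      fix k
      have "eK a * bas k j j = (if int l dvd k - a then bas k j j else 0)" for j
        unfolding bas_def mult.assoc[symmetric] eK_mult by (simp add: dvd_diff_commute)
      then show "(\<Sum>n<l. c k n *\<^sub>C (eK a * bas k n n)) = (if int l dvd k - a then \<Sum>j<l. c k j *\<^sub>C bas k j j else 0)"
        by simp
    qed
    also have "\<dots> = (\<Sum>j<l. c a j *\<^sub>C bas a j j)"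
    proof (rule sum_Zl_single)
      have "bas (k + int l) j j = bas k j j" for k j by (rule bas_cong) simp
      then show "periodic (\<lambda>k. \<Sum>j<l. c k j *\<^sub>C bas k j j)" using per by (simp add: periodic_def)
    qed
    finally show ?thesis .
  qed
  have z_bas: "z * bas a n m = (\<Sum>j<l. c (a + 2 * int n) j *\<^sub>C bas a (n + j) (j + m))" for a n m
  proof -
    have "z * bas a n m = eK a * F ^ n * z * E ^ m"
      unfolding bas_def by (metis comm mult.assoc)
    also have "eK a * F ^ n = F ^ n * eK (a + 2 * int n)" by (simp add: F_pow_eK)
    also have "F ^ n * eK (a + 2 * int n) * z = (\<Sum>j<l. c (a + 2 * int n) j *\<^sub>C (F ^ n * bas (a + 2 * int n) j j))"
      by (simp add: mult.assoc eK_z sum_distrib_left sc)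
    also have "\<dots> * E ^ m = (\<Sum>j<l. c (a + 2 * int n) j *\<^sub>C (F ^ n * bas (a + 2 * int n) j j * E ^ m))"
      by (simp add: sum_distrib_right sc)
    also have "\<dots> = (\<Sum>j<l. c (a + 2 * int n) j *\<^sub>C bas a (n + j) (j + m))"
      unfolding bas_def mult.assoc[symmetric] F_pow_eK by (simp add: power_add mult.assoc)
    finally show ?thesis .
  qed
  have zE: "z * (eK b * E ^ n) = (\<Sum>j<l. c b j *\<^sub>C bas b j (j + n))" for b n
    using z_bas[of b 0 n] by (simp add: bas_def)
  have rec: "c (k1 + k2) m = am m * am 0 * qp (k1 * k2 + int m * (k2 - k1) - 2 * (int m)\<^sup>2) * (c (k1 + 2 * int m) 0 * c k2 0)"
    if m: "m < l" for k1 k2 m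
  proof -
    obtain \<phi> :: "'a \<Rightarrow> complex" where \<phi>: "clinear \<phi>"
      "\<And>k i j. \<phi> (bas k i j) = (if int l dvd k - k1 \<and> i = m \<and> j = 0 then 1 else 0)"
      using coordinate_functional[of m 0 k1] m by auto
    obtain \<psi> :: "'a \<Rightarrow> complex" where \<psi>: "clinear \<psi>"
      "\<And>k i j. \<psi> (bas k i j) = (if int l dvd k - k2 \<and> i = 0 \<and> j = m then 1 else 0)"
      using coordinate_functional[of 0 m k2] m by auto
    have bil: "cbilinear (\<lambda>a b. \<phi> a * \<psi> b)" by (rule cbilinear_mult[OF \<phi>(1) \<psi>(1)])
    note L = clinear_tensor_lift[OF bil]
    let ?L = "tensor_lift (\<lambda>a b. \<phi> a * \<psi> b)"
    have "?L (\<Delta> z) = (\<Sum>k\<in>Zl. \<Sum>n<l. c k n * ?L (\<Delta> (bas k n n)))"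
      unfolding zb complex_vector.linear_sum[OF comult_clinear] clinear_scale[OF comult_clinear]
        complex_vector.linear_sum[OF L] clinear_scale[OF L] scaleC_complex_def ..
    also have "\<dots> = (\<Sum>k\<in>Zl. \<Sum>n<l. if n = m then if int l dvd k - (k1 + k2) then c k m else 0 else 0)"
      by (intro sum.cong refl) (auto simp: comult_bas_coordinate[OF m _ \<phi>(1) \<psi>(1) \<phi>(2) \<psi>(2)])
    also have "\<dots> = (\<Sum>k\<in>Zl. if int l dvd k - (k1 + k2) then c k m else 0)" using m by simp
    also have "\<dots> = c (k1 + k2) m" by (rule sum_Zl_single) (use per in blast)
    finally have lhs: "?L (\<Delta> z) = c (k1 + k2) m" .
    have \<phi>z: "\<phi> (z * bas a n m') = (if int l dvd a - k1 \<and> n = m \<and> m' = 0 then c (a + 2 * int m) 0 else 0)" for a n m'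
    proof -
      have "\<phi> (z * bas a n m') = (\<Sum>j<l. c (a + 2 * int n) j * \<phi> (bas a (n + j) (j + m')))"
        unfolding z_bas complex_vector.linear_sum[OF \<phi>(1)] clinear_scale[OF \<phi>(1)] scaleC_complex_def ..
      also have "\<dots> = (\<Sum>j<l. if j = 0 then (if int l dvd a - k1 \<and> n = m \<and> m' = 0 then c (a + 2 * int m) 0 else 0) else 0)"
        by (intro sum.cong refl) (auto simp: \<phi>(2))
      finally show ?thesis using l_ge by simp
    qed
    have \<psi>z: "\<psi> (z * (eK b * E ^ m)) = (if int l dvd b - k2 then c b 0 else 0)" for b
    proof -
      have "\<psi> (z * (eK b * E ^ m)) = (\<Sum>j<l. c b j * \<psi> (bas b j (j + m)))"
        unfolding zE complex_vector.linear_sum[OF \<psi>(1)] clinear_scale[OF \<psi>(1)] scaleC_complex_def ..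
      also have "\<dots> = (\<Sum>j<l. if j = 0 then (if int l dvd b - k2 then c b 0 else 0) else 0)"
        by (intro sum.cong refl) (auto simp: \<psi>(2))
      finally show ?thesis using l_ge by simp
    qed
    define e where "e n a b = qp (a * b + int n * (b - a) - 2 * (int n)\<^sup>2)" for n a b
    have "?L ((z \<boxtimes> z) * Mm) = (\<Sum>n<l. \<Sum>m'<l. \<Sum>a\<in>Zl. \<Sum>b\<in>Zl. (am n * am m' * e n a b) *
        (\<phi> (z * bas a n m') * \<psi> (z * (eK b * E ^ n * F ^ m'))))"
      unfolding Mm_eq sum_distrib_left mult_scaleC_right times_pure_tensor complex_vector.linear_sum[OF L]
        clinear_scale[OF L] tensor_lift_pure[OF bil] scaleC_complex_def e_def ..
    also have "\<dots> = (\<Sum>n<l. \<Sum>m'<l. if n = m \<and> m' = 0 then \<Sum>a\<in>Zl. if int l dvd a - k1 then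
        \<Sum>b\<in>Zl. if int l dvd b - k2 then am m * am 0 * e m a b * (c (a + 2 * int m) 0 * c b 0) else 0 else 0 else 0)"
      by (intro sum.cong refl) (auto simp: \<phi>z \<psi>z intro!: sum.cong sum.neutral)
    also have "\<dots> = (\<Sum>a\<in>Zl. if int l dvd a - k1 then
        \<Sum>b\<in>Zl. if int l dvd b - k2 then am m * am 0 * e m a b * (c (a + 2 * int m) 0 * c b 0) else 0 else 0)"
    proof -
      have "(\<Sum>n<l. \<Sum>m'<l. if n = m \<and> m' = 0 then u else 0) = (u::complex)" for u
      proof -
        have "(\<Sum>n<l. \<Sum>m'<l. if n = m \<and> m' = 0 then u else 0) = (\<Sum>n<l. if n = m then u else 0)"
          using l_ge by (intro sum.cong refl) simp
        then show ?thesis using m by simp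
      qed
      then show ?thesis .
    qed
    also have "\<dots> = am m * am 0 * e m k1 k2 * (c (k1 + 2 * int m) 0 * c k2 0)"
    proof -
      have c: "c (a + int l) j = c a j" "c (a + int l + x) j = c (a + x) j" for a x j
        using per by (simp_all add: periodic_def add.commute[of "int l"] flip: add.assoc)
          (metis add.assoc add.commute)
      have e: "e m (a + int l) b = e m a b" "e m a (b + int l) = e m a b" for a b
      proof -
        show "e m (a + int l) b = e m a b" unfolding e_def
        proof (rule qp_cong)
          have "((a + int l) * b + int m * (b - (a + int l)) - 2 * (int m)\<^sup>2) - (a * b + int m * (b - a) - 2 * (int m)\<^sup>2) = int l * (b - int m)"
            by (simp add: algebra_simps)
          then show "int l dvd ((a + int l) * b + int m * (b - (a + int l)) - 2 * (int m)\<^sup>2) - (a * b + int m * (b - a) - 2 * (int m)\<^sup>2)" by simp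
        qed
        show "e m a (b + int l) = e m a b" unfolding e_def
        proof (rule qp_cong)
          have "(a * (b + int l) + int m * ((b + int l) - a) - 2 * (int m)\<^sup>2) - (a * b + int m * (b - a) - 2 * (int m)\<^sup>2) = int l * (a + int m)"
            by (simp add: algebra_simps)
          then show "int l dvd (a * (b + int l) + int m * ((b + int l) - a) - 2 * (int m)\<^sup>2) - (a * b + int m * (b - a) - 2 * (int m)\<^sup>2)" by simp
        qed
      qed
      have "(\<Sum>b\<in>Zl. if int l dvd b - k2 then am m * am 0 * e m a b * (c (a + 2 * int m) 0 * c b 0) else 0) =
          am m * am 0 * e m a k2 * (c (a + 2 * int m) 0 * c k2 0)" for a
        by (rule sum_Zl_single) (simp add: periodic_def e c)
      then show ?thesis by (simp only:) (rule sum_Zl_single, simp add: periodic_def e c)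
    qed
    finally show ?thesis using lhs D by (simp add: e_def)
  qed
  have am0: "am 0 = 1" by (simp add: am_def bf_def)
  define z0 where "z0 k = c k 0" for k
  have z0_add: "z0 (a + b) = qp (a * b) * z0 a * z0 b" for a b
    using rec[of 0 a b] l_ge by (simp add: am0 z0_def)
  have crec: "c k m = am m * hp (2 * (- int m * k - 2 * (int m)\<^sup>2)) * z0 (k + 2 * int m) * z0 0" if "m < l" for k m
    using rec[OF that, of k 0] unfolding hp_double by (simp add: am0 z0_def)
  have z00: "z0 0 = 1"
  proof -
    have "z0 0 \<noteq> 0"
    proof
      assume "z0 0 = 0"
      then have "z = 0" unfolding zb by (intro sum.neutral ballI) (simp add: crec)
      then show False using z(2) by simp
    qed
    moreover have "z0 0 = z0 0 * z0 0" using z0_add[of 0 0] by simp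
    ultimately show ?thesis by simp
  qed
  define g where "g k = (\<Sum>m<l. smult (c k m / br 1 ^ (2 * m)) (N m k))" for k
  have z_g: "z = el g" unfolding el by (rule arg_cong[of _ _ el]) (simp add: fun_eq_iff g_def)
  have g_node: "poly (g k) (ch (k + 1)) = z0 k" for k
  proof -
    have "poly (N m k) (ch (k + 1)) = (if m = 0 then 1 else 0)" for m
      by (cases m) (simp_all add: N_Suc' nd_def N_def[of 0])
    then have "poly (g k) (ch (k + 1)) = (\<Sum>m<l. if m = 0 then z0 k else 0)"
      unfolding g_def poly_sum by (intro sum.cong refl) (simp add: z0_def)
    then show ?thesis using l_ge by simp
  qed
  \<comment> \<open>The values at k = 0 and k = -2 are taken at the nodes ch 1 and ch (-1), which
    coincide. The jump between the two polynomials is a multiple of \<open>Psi 1\<close>, and this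
    vanishes there because ch 1 is a double root of \<open>PSI\<close>.\<close>
  have z0_m2: "z0 (- 2) = 1"
  proof -
    obtain a where a: "g (- 2 + 2) - g (- 2) = smult a (Psi (- 2 + 1))"
    proof (rule center_jump[of g "- 2"])
      have "N m (k + int l) = N m k" for m k by (rule N_cong) simp
      then show "periodic g" using per unfolding periodic_def g_def by simp
      show "degree (g k) < l" for k
        unfolding g_def by (rule degree_sum_less) (use l_ge in \<open>auto intro: le_less_trans[OF degree_smult_le]\<close>)
      show "el g \<in> center" using z(1) z_g by simp
    qed
    have "ch (- 1) = ch 1" by (simp add: ch_eq_iff)
    moreover have "poly (Psi 1) (ch 1) = 0"
    proof -
      have "Suc (l - 2) = l - 1" using l_ge by simp
      then have "Psi 1 = N (l - 2) 2 * nd (3 + 2 * int (l - 2))"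
        using N_Suc[of "l - 2" 2] by (simp add: Psi_def)
      moreover have "ch (3 + 2 * int (l - 2)) = ch 1"
        unfolding ch_eq_iff using l_ge by (simp add: of_nat_diff)
      ultimately show ?thesis by (simp add: nd_def)
    qed
    moreover have "Psi (- 1) = Psi 1" by (rule Psi_minus)
    ultimately have "poly (g 0) (ch 1) - poly (g (- 2)) (ch (- 1)) = 0"
      using arg_cong[OF a, of "\<lambda>p. poly p (ch 1)"] by simp
    then show ?thesis using g_node[of 0] g_node[of "- 2"] z00 by simp
  qed
  \<comment> \<open>Dividing by the expected value q^((k^2 + 2k) / 2) leaves a homomorphism. It is 1
    at -2, hence everywhere, since 2 is invertible modulo l.\<close>
  define v where "v k = z0 k * hp (- (k\<^sup>2 + 2 * k))" for k
  have v_add: "v (a + b) = v a * v b" for a b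
    unfolding v_def z0_add hp_double[symmetric]
    by (simp add: mult_ac power2_eq_square algebra_simps flip: hp_add)
  have v2: "v (- 2 * int n) = 1" for n
  proof (induction n)
    case (Suc n)
    have "v (- 2 * int (Suc n)) = v (- 2 * int n) * v (- 2)"
      unfolding v_add[symmetric] by (rule arg_cong[of _ _ v]) simp
    then show ?case using Suc by (simp add: v_def z0_m2)
  qed (simp add: v_def z00)
  have "v k = 1" for k
  proof -
    define n where "n = nat (int h * k mod int l)"
    have n: "int n = int h * k mod int l" using l_ge by (simp add: n_def)
    have dvd: "int l dvd k - (- 2 * int n)"
    proof -
      have "int l dvd int h * k - int n" unfolding n by (simp add: minus_mod_eq_mult_div)
      then have "int l dvd int l * k - 2 * (int h * k - int n)"
        by (rule dvd_diff[OF dvd_triv_left dvd_mult])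
      moreover have "int l * k - 2 * (int h * k - int n) = k - (- 2 * int n)"
        by (simp add: l_eq algebra_simps)
      ultimately show ?thesis by (simp only:)
    qed
    have "periodic z0" using per by (simp add: z0_def periodic_def)
    then have "z0 k = z0 (- 2 * int n)" using dvd by (rule periodic_cong)
    moreover have "hp (- (k\<^sup>2 + 2 * k)) = hp (- ((- 2 * int n)\<^sup>2 + 2 * (- 2 * int n)))"
    proof (rule hp_cong)
      have "- (k\<^sup>2 + 2 * k) - - ((- 2 * int n)\<^sup>2 + 2 * (- 2 * int n)) = - (k - (- 2 * int n)) * (k + (- 2 * int n) + 2)"
        by (simp add: algebra_simps power2_eq_square)
      then show "int l dvd - (k\<^sup>2 + 2 * k) - - ((- 2 * int n)\<^sup>2 + 2 * (- 2 * int n))"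
        using dvd by (simp only: dvd_mult2 dvd_minus_iff mult_minus_left)
    qed
    ultimately have "v k = v (- 2 * int n)" by (simp only: v_def)
    then show ?thesis by (simp only: v2)
  qed
  have z0: "z0 k = hp (k\<^sup>2 + 2 * k)" for k
  proof -
    have "z0 k / hp (k\<^sup>2 + 2 * k) = 1" using \<open>v k = 1\<close> unfolding v_def hp_minus divide_inverse .
    then show ?thesis by simp
  qed
  have "c k m / br 1 ^ (2 * m) = zc m k" if "m < l" for k m
  proof -
    have "c k m = am m * (hp (2 * (- int m * k - 2 * (int m)\<^sup>2)) * hp ((k + 2 * int m)\<^sup>2 + 2 * (k + 2 * int m)))"
      unfolding crec[OF that] z0 by simp
    also have "\<dots> = br 1 ^ (2 * m) * (hp (int m * (int m - 1)) * hp (2 * (- int m * k - 2 * (int m)\<^sup>2) + ((k + 2 * int m)\<^sup>2 + 2 * (k + 2 * int m)))) / bf m"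
      by (simp add: am_def hp_add)
    also have "\<dots> = br 1 ^ (2 * m) * zc m k"
      unfolding zc_def hp_add[symmetric] times_divide_eq_right[symmetric] by (simp add: algebra_simps power2_eq_square)
    finally show ?thesis by simp
  qed
  then have "g k = ff k" for k unfolding g_def ff_def by (intro sum.cong refl) simp
  then have "g = ff" by auto
  then show ?thesis using z_g by simp
qed

text \<open>The inverse comes from applying a \<otimes> b to S a b to \<Delta> \<theta>. As \<theta>
  is central and fixed by S, both factors \<theta> can be taken out, and the antipode axiom reads 1
  = \<theta> (\<theta> y), with y the image of the inverse of \<open>Mm\<close>.\<close>

lemma ribbon_inverse:
  assumes "ribbon_element Rm \<Delta> \<epsilon> S \<theta>"
  shows "ring_inv \<theta> = el ff" and "el ff \<in> center"
proof -
  have \<theta>: "\<theta> \<in> center" "\<Delta> \<theta> = ring_inv Mm * (\<theta> \<boxtimes> \<theta>)" "\<epsilon> \<theta> = 1" "S \<theta> = \<theta>"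
    using assms by (auto simp: ribbon_element_def Mm_def)
  have comm: "x * \<theta> = \<theta> * x" for x using \<theta>(1) by (simp add: center_def)
  have M: "Mm * ring_inv Mm = 1" using ring_inv_unit[OF Mm_unit] by simp
  have bil: "cbilinear (\<lambda>a b. S a * b)" by (rule cbilinear_mult[OF antipode_linear clinear_id])
  have "tensor_lift (\<lambda>a b. S a * b) (t * (\<theta> \<boxtimes> \<theta>)) = \<theta> * \<theta> * tensor_lift (\<lambda>a b. S a * b) t" for t
    unfolding tensor_lift_times_pure[OF bil]
  proof (rule clinear_eq_on_pure)
    have bil': "cbilinear (\<lambda>a b. S (a * \<theta>) * (b * \<theta>))"
      by (intro cbilinear_mult clinear_compose[OF antipode_linear] clinear_mult_right)
    show "clinear (tensor_lift (\<lambda>a b. S (a * \<theta>) * (b * \<theta>)))" by (rule clinear_tensor_lift[OF bil'])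
    show "clinear (\<lambda>t. \<theta> * \<theta> * tensor_lift (\<lambda>a b. S a * b) t)"
      by (rule clinear_compose[OF clinear_mult_left clinear_tensor_lift[OF bil]])
    show "tensor_lift (\<lambda>a b. S (a * \<theta>) * (b * \<theta>)) (a \<boxtimes> b) = \<theta> * \<theta> * tensor_lift (\<lambda>a b. S a * b) (a \<boxtimes> b)" for a b
    proof -
      have "\<theta> * S a * (b * \<theta>) = \<theta> * (\<theta> * (S a * b))"
        using comm[of "S a * b"] by (simp add: mult.assoc)
      then show ?thesis unfolding tensor_lift_pure[OF bil] tensor_lift_pure[OF bil']
        unfolding antipode_mult \<theta>(4) by (simp only: mult.assoc)
    qed
  qed
  from this[of "ring_inv Mm"] antipode_left[of \<theta>]
  have inv: "\<theta> * (\<theta> * tensor_lift (\<lambda>a b. S a * b) (ring_inv Mm)) = 1"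
    by (simp add: \<theta>(2)[symmetric] \<theta>(3) scaleC_one mult.assoc)
  define z where "z = \<theta> * tensor_lift (\<lambda>a b. S a * b) (ring_inv Mm)"
  have z1: "\<theta> * z = 1" "z * \<theta> = 1" using inv comm[of z] by (simp_all add: z_def)
  have zc: "z \<in> center"
  proof -
    have "z * x = x * z" for x
    proof -
      have "z * x = z * (x * \<theta>) * z" using z1(1) by (simp add: mult.assoc)
      also have "\<dots> = x * z" unfolding comm using z1(2) by (simp add: mult.assoc[symmetric])
      finally show ?thesis .
    qed
    then show ?thesis by (simp add: center_def)
  qed
  have "\<Delta> z = (z \<boxtimes> z) * Mm"
  proof -
    have 1: "\<Delta> \<theta> * \<Delta> z = 1" by (simp flip: comult_mult add: z1 comult_1)
    have 2: "(z \<boxtimes> z) * (\<theta> \<boxtimes> \<theta>) = 1" by (simp add: times_pure_tensor z1 one_tensor_def)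
    have 3: "Mm * \<Delta> \<theta> = \<theta> \<boxtimes> \<theta>" unfolding \<theta>(2) by (simp add: M flip: mult.assoc)
    have "(z \<boxtimes> z) * Mm = (z \<boxtimes> z) * (Mm * \<Delta> \<theta>) * \<Delta> z" by (simp add: mult.assoc 1)
    also have "\<dots> = \<Delta> z" unfolding 3 2 by simp
    finally show ?thesis ..
  qed
  then have "z = el ff" using zc z1 by (intro ribbon_inverse_form) auto
  moreover have "ring_inv \<theta> = z" by (rule ring_inv_eq) (rule z1)+
  ultimately show "ring_inv \<theta> = el ff" "el ff \<in> center" using zc by simp_all
qed

lemma nd_dvd_ff: "nd j dvd ff k - [:hp (j\<^sup>2 - 1):]"
  unfolding nd_def by (simp add: ff_value flip: poly_eq_0_iff_dvd)

text \<open>(x - ch j) \<open>Psi j\<close> = \<open>PSI\<close> is 0 on H, so only the value of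
  \<open>ff k\<close> at ch j counts, and this is the same for all k.\<close>

lemma twist_Psi:
  "el ff * el (\<lambda>k. smult (c k) (Psi j)) = hp (j\<^sup>2 - 1) *\<^sub>C el (\<lambda>k. smult (c k) (Psi j))"
  if "periodic c"
proof -
  have per: "periodic (\<lambda>k. smult (c k) (Psi j))" using that by (simp add: periodic_def)
  show ?thesis
    unfolding el_mult[OF per] el_smult[symmetric]
  proof (rule el_cong_PSI)
    fix k
    obtain p where p: "ff k - [:hp (j\<^sup>2 - 1):] = nd j * p" using nd_dvd_ff[of j k] by (auto simp: dvd_def)
    have "ff k * smult (c k) (Psi j) - smult (hp (j\<^sup>2 - 1)) (smult (c k) (Psi j)) =
        (ff k - [:hp (j\<^sup>2 - 1):]) * smult (c k) (Psi j)"
      by (simp add: algebra_simps)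
    also have "\<dots> = PSI * smult (c k) p" unfolding p nd_Psi[of j, symmetric] by (simp add: mult_ac)
    finally show "PSI dvd ff k * smult (c k) (Psi j) - smult (hp (j\<^sup>2 - 1)) (smult (c k) (Psi j))"
      by (simp only: dvd_triv_left)
  qed
qed

lemma taylor_second: "\<exists>p. f - [:poly f a:] - smult (poly (pderiv f) a) [:- a, 1:] = [:- a, 1:] ^ 2 * (p :: complex poly)"
proof -
  let ?x = "[:- a, 1:] :: complex poly"
  obtain g where g: "f - [:poly f a:] = ?x * g"
    using poly_eq_0_iff_dvd[of "f - [:poly f a:]" a] by (auto simp: dvd_def)
  have "pderiv f = ?x * pderiv g + g"
    using arg_cong[OF g, of pderiv] by (simp add: pderiv_diff pderiv_mult pderiv_pCons pderiv_smult)
  then have "poly (pderiv f) a = poly g a" by simp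
  moreover obtain p where p: "g - [:poly g a:] = ?x * p"
    using poly_eq_0_iff_dvd[of "g - [:poly g a:]" a] by (auto simp: dvd_def)
  have "?x * (g - [:poly g a:]) = ?x ^ 2 * p" by (simp only: p power2_eq_square mult.assoc)
  then have "?x * g - smult (poly g a) ?x = ?x ^ 2 * p"
    unfolding right_diff_distrib by (simp add: mult.commute)
  ultimately show ?thesis unfolding g by (intro exI[of _ p]) simp
qed

text \<open>(x - ch j)^2 annihilates \<open>Mh j\<close>, so the value and the first derivative of
  \<open>ff k\<close> count. The derivative depends on k through the weight indicator, and this is
  how a polynomial in the Casimir element acquires an \<open>nn\<close> part.\<close>

lemma twist_Mh:
  assumes "j < l"
  shows "el ff * pev (Mh (int j)) = hp ((int j)\<^sup>2 - 1) *\<^sub>C (pev (Mh (int j)) +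
    el (\<lambda>k. smult (of_nat l * ind j k - of_nat j) (Psi (int j))))"
proof -
  let ?t = "hp ((int j)\<^sup>2 - 1)"
  have "el ff * pev (Mh (int j)) = el (\<lambda>k. ff k * Mh (int j))"
    using el_mult[of "\<lambda>k. Mh (int j)" ff] by (simp add: el_const periodic_def)
  also have "\<dots> = el (\<lambda>k. smult ?t (Mh (int j) + smult (of_nat l * ind j k - of_nat j) (Psi (int j))))"
  proof (rule el_cong_PSI)
    fix k
    define D where "D = poly (pderiv (ff k)) (ch (int j))"
    have D: "D * br (int j) = ?t * (of_nat j - of_nat l * ind j k)"
      unfolding D_def ff_deriv[OF assms] by (simp add: ind_def)
    obtain p where p: "ff k - [:?t:] - smult D (nd (int j)) = nd (int j) ^ 2 * p"
      using taylor_second[of "ff k" "ch (int j)"] unfolding ff_value D_def nd_def by blast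
    have "nd (int j) * Mh (int j) = smult (- br (int j)) (Psi (int j))" by (rule nd_Mh)
    have "ff k * Mh (int j) = smult ?t (Mh (int j)) + smult D (nd (int j) * Mh (int j)) + p * (nd (int j) * (nd (int j) * Mh (int j)))"
    proof -
      have "ff k = [:?t:] + smult D (nd (int j)) + nd (int j) ^ 2 * p" using p by (simp add: algebra_simps)
      then show ?thesis by (simp add: algebra_simps power2_eq_square)
    qed
    also have "\<dots> = smult ?t (Mh (int j)) + smult (- (D * br (int j))) (Psi (int j)) + smult (- br (int j)) p * PSI"
      unfolding nd_Mh nd_Psi[of "int j", symmetric] by (simp add: mult_ac)
    also have "- (D * br (int j)) = ?t * (of_nat l * ind j k - of_nat j)" unfolding D by (simp add: algebra_simps)
    finally have "ff k * Mh (int j) - smult ?t (Mh (int j) + smult (of_nat l * ind j k - of_nat j) (Psi (int j))) =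
        smult (- br (int j)) p * PSI"
      by (simp add: smult_add_right)
    then show "PSI dvd ff k * Mh (int j) - smult ?t (Mh (int j) + smult (of_nat l * ind j k - of_nat j) (Psi (int j)))"
      by (simp only: dvd_triv_right)
  qed
  finally show ?thesis by (simp only: el_smult el_add el_const)
qed

end

section \<open>The Weil representation of SL(2,Z)\<close>

lemma det_two:
  assumes "A \<in> carrier_mat 2 2"
  shows "det A = A $$ (0, 0) * A $$ (1, 1) - A $$ (0, 1) * A $$ (1, 0)"
proof -
  have "det A = (\<Sum>j<2. A $$ (0, j) * cofactor A 0 j)"
    by (rule laplace_expansion_row[OF assms]) simp
  also have "\<dots> = A $$ (0, 0) * cofactor A 0 0 + A $$ (0, 1) * cofactor A 0 1"
    by (simp add: numeral_2_eq_2)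
  finally have "det A = A $$ (0, 0) * cofactor A 0 0 + A $$ (0, 1) * cofactor A 0 1" .
  moreover have "cofactor A 0 0 = A $$ (1, 1)" "cofactor A 0 1 = - A $$ (1, 0)"
    using assms by (simp_all add: cofactor_def mat_delete_def det_single)
  ultimately show ?thesis by simp
qed

lemma SL2Z_det: "g \<in> SL2Z \<Longrightarrow> g $$ (0, 0) * g $$ (1, 1) - g $$ (0, 1) * g $$ (1, 0) = 1"
  using det_two[of g] by (auto simp: SL2Z_def)

lemma SL2Z_entries: "a * d - b * c = 1 \<Longrightarrow> mat_of_rows_list 2 [[a, b], [c, d]] \<in> SL2Z"
proof -
  assume "a * d - b * c = 1"
  moreover have c: "mat_of_rows_list 2 [[a, b], [c, d]] \<in> carrier_mat 2 2"
    by (rule carrier_matI) (simp_all add: mat_of_rows_list_def)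
  ultimately show ?thesis using det_two[OF c] by (simp add: SL2Z_def mat_of_rows_list_def)
qed

lemma SL2Z_mult: "g \<in> SL2Z \<Longrightarrow> g' \<in> SL2Z \<Longrightarrow> g * g' \<in> SL2Z"
  by (auto simp: SL2Z_def det_mult[of _ 2])

lemma SL2Z_mult_entry:
  assumes "g \<in> SL2Z" "g' \<in> SL2Z" "i < 2" "j < 2"
  shows "(g * g') $$ (i, j) = g $$ (i, 0) * g' $$ (0, j) + g $$ (i, 1) * g' $$ (1, j)"
  using assms by (auto simp: SL2Z_def scalar_prod_def atLeast0_lessThan_Suc numeral_2_eq_2)

lemma SL2Z_one: "1\<^sub>m 2 \<in> SL2Z"
  by (simp add: SL2Z_def)

lemma SL2Z_inverse:
  assumes "g \<in> SL2Z"
  obtains g' where "g' \<in> SL2Z" "g * g' = 1\<^sub>m 2" "g' * g = 1\<^sub>m 2"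
proof
  note g = assms[unfolded SL2Z_def, simplified]
  note adj = adj_mat[of g 2]
  show 1: "g * adj_mat g = 1\<^sub>m 2" "adj_mat g * g = 1\<^sub>m 2" using adj g by auto
  have "det (g * adj_mat g) = det g * det (adj_mat g)" by (rule det_mult) (use adj g in auto)
  then show "adj_mat g \<in> SL2Z" using adj g 1 by (auto simp: SL2Z_def)
qed

lemma s_mat_SL2Z: "s_mat \<in> SL2Z" and t_mat_SL2Z: "t_mat \<in> SL2Z"
  unfolding s_mat_def t_mat_def by (rule SL2Z_entries, simp)+

context odd_root
begin

definition kmult :: "(int \<Rightarrow> int \<Rightarrow> complex) \<Rightarrow> (int \<Rightarrow> int \<Rightarrow> complex) \<Rightarrow> int \<Rightarrow> int \<Rightarrow> complex"
  where "kmult A B = (\<lambda>i j. \<Sum>k\<in>Zl. A i k * B k j)"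

definition kid :: "int \<Rightarrow> int \<Rightarrow> complex" where "kid i j = (if int l dvd i - j then 1 else 0)"

text \<open>The last condition says that the operator commutes with negation on Z/l, hence preserves
  even and odd functions.\<close>

definition kernel :: "(int \<Rightarrow> int \<Rightarrow> complex) \<Rightarrow> bool"
  where "kernel A \<longleftrightarrow> (\<forall>i j. A (i + int l) j = A i j \<and> A i (j + int l) = A i j \<and> A (- i) (- j) = A i j)"

text \<open>On functions on \<open>\<int>/l\<close> the Heisenberg operator of the vector \<open>(b, a)\<close> maps the
  basis vector \<open>e\<^sub>j\<close> to \<open>q\<^bsup>b(2j + a)/2\<^esup> e\<^bsub>j + a\<^esub>\<close>.\<close>

definition intertwines :: "(int \<Rightarrow> int \<Rightarrow> complex) \<Rightarrow> int \<Rightarrow> int \<Rightarrow> int \<Rightarrow> int \<Rightarrow> bool"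
  where "intertwines A b a b' a' \<longleftrightarrow>
    (\<forall>i j. hp (b * (2 * j + a)) * A i (j + a) = hp (b' * (2 * i - a')) * A (i - a') j)"

text \<open>The operator transforms Heisenberg vectors by the matrix with rows (a, b) and (c, d). An
  inverse is carried along so that products stay invertible and Schur's lemma can be applied to a
  quotient of two operators.\<close>

definition weil :: "int \<Rightarrow> int \<Rightarrow> int \<Rightarrow> int \<Rightarrow> (int \<Rightarrow> int \<Rightarrow> complex) \<Rightarrow> (int \<Rightarrow> int \<Rightarrow> complex) \<Rightarrow> bool"
  where "weil a b c d A A' \<longleftrightarrow> kernel A \<and> kernel A' \<and> kmult A A' = kid \<and> kmult A' A = kid \<and>
    (\<forall>x y. intertwines A x y (a * x + b * y) (c * x + d * y) \<and> intertwines A' (a * x + b * y) (c * x + d * y) x y)"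

lemma kernel_periodic: "kernel A \<Longrightarrow> periodic (A i)" "kernel A \<Longrightarrow> periodic (\<lambda>k. A k j)"
  by (simp_all add: kernel_def periodic_def)

lemma kid_kernel: "kernel kid"
proof -
  have "int l dvd - i - - j \<longleftrightarrow> int l dvd i - j" for i j by (simp add: dvd_diff_commute)
  moreover have "int l dvd i + int l - j \<longleftrightarrow> int l dvd i - j" "int l dvd i - (j + int l) \<longleftrightarrow> int l dvd i - j" for i j
    by (simp_all flip: mod_eq_dvd_iff)
  ultimately show ?thesis by (simp add: kernel_def kid_def)
qed

lemma kmult_assoc: "kmult (kmult A B) C = kmult A (kmult B C)"
proof (intro ext)
  fix i j
  have "kmult (kmult A B) C i j = (\<Sum>k\<in>Zl. \<Sum>m\<in>Zl. A i m * (B m k * C k j))"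
    by (simp add: kmult_def sum_distrib_right mult.assoc)
  also have "\<dots> = (\<Sum>m\<in>Zl. \<Sum>k\<in>Zl. A i m * (B m k * C k j))" by (rule sum.swap)
  finally show "kmult (kmult A B) C i j = kmult A (kmult B C) i j" by (simp add: kmult_def sum_distrib_left)
qed

lemma sum_kid: "periodic x \<Longrightarrow> (\<Sum>k\<in>Zl. kid i k * x k) = x i"
proof -
  assume x: "periodic x"
  have "(\<Sum>k\<in>Zl. kid i k * x k) = (\<Sum>k\<in>Zl. if int l dvd k - i then x k else 0)"
    by (intro sum.cong refl) (auto simp: kid_def dvd_diff_commute)
  then show ?thesis by (simp only: sum_Zl_single[OF x])
qed

lemma kid_commute: "kid i j = kid j i"
  by (simp add: kid_def dvd_diff_commute)

lemma kmult_kid: "kernel A \<Longrightarrow> kmult kid A = A" "kernel A \<Longrightarrow> kmult A kid = A"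
proof -
  assume A: "kernel A"
  show "kmult kid A = A" by (intro ext) (simp add: kmult_def sum_kid kernel_periodic[OF A])
  show "kmult A kid = A"
    using sum_kid[OF kernel_periodic(1)[OF A]] by (intro ext) (simp add: kmult_def kid_commute mult.commute)
qed

lemma kernel_kmult: "kernel A \<Longrightarrow> kernel B \<Longrightarrow> kernel (kmult A B)"
proof -
  assume AB: "kernel A" "kernel B"
  have "kmult A B (- i) (- j) = kmult A B i j" for i j
  proof -
    have per: "periodic (\<lambda>k. A (- i) k * B k (- j))" using AB by (simp add: kernel_def periodic_def)
    have "A (- i) (- k) * B (- k) (- j) = A i k * B k j" for k using AB by (simp add: kernel_def)
    then show ?thesis unfolding kmult_def by (simp flip: sum_periodic_minus[OF per])
  qed
  then show ?thesis using AB by (simp add: kernel_def kmult_def)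
qed

lemma intertwines_kmult:
  assumes A: "kernel A" and B: "kernel B" and iB: "intertwines B b a b' a'" and iA: "intertwines A b' a' b'' a''"
  shows "intertwines (kmult A B) b a b'' a''"
  unfolding intertwines_def
proof (intro allI)
  fix i j
  define g where "g k = hp (b' * (2 * k + a')) * A i (k + a') * B k j" for k
  have per: "periodic g"
  proof -
    have "hp (b' * (2 * (k + int l) + a')) = hp (b' * (2 * k + a'))" for k
      by (rule hp_cong) (simp add: algebra_simps flip: right_diff_distrib)
    moreover have "A i (k + int l + a') = A i (k + a')" for k
      using A by (metis add.assoc add.commute kernel_def)
    ultimately show ?thesis using B by (simp add: periodic_def g_def kernel_def)
  qed
  have "hp (b * (2 * j + a)) * kmult A B i (j + a) = (\<Sum>k\<in>Zl. A i k * (hp (b * (2 * j + a)) * B k (j + a)))"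
    by (simp add: kmult_def sum_distrib_left mult_ac)
  also have "\<dots> = (\<Sum>k\<in>Zl. A i k * (hp (b' * (2 * k - a')) * B (k - a') j))"
    using iB by (simp only: intertwines_def)
  also have "\<dots> = (\<Sum>k\<in>Zl. g (k + - a'))"
    by (intro sum.cong refl) (simp add: g_def algebra_simps)
  also have "\<dots> = (\<Sum>k\<in>Zl. g k)" by (rule sum_periodic_shift[OF per])
  also have "\<dots> = (\<Sum>k\<in>Zl. hp (b'' * (2 * i - a'')) * A (i - a'') k * B k j)"
    using iA by (simp only: g_def intertwines_def)
  also have "\<dots> = hp (b'' * (2 * i - a'')) * kmult A B (i - a'') j"
    by (simp add: kmult_def sum_distrib_left mult.assoc)
  finally show "hp (b * (2 * j + a)) * kmult A B i (j + a) = hp (b'' * (2 * i - a'')) * kmult A B (i - a'') j" .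
qed

lemma weil_mult:
  assumes A: "weil a b c d A A'" and B: "weil a' b' c' d' B B'"
  shows "weil (a * a' + b * c') (a * b' + b * d') (c * a' + d * c') (c * b' + d * d') (kmult A B) (kmult B' A')"
proof -
  have k: "kernel A" "kernel A'" "kernel B" "kernel B'" using A B by (auto simp: weil_def)
  have "kmult (kmult A B) (kmult B' A') = kmult A (kmult (kmult B B') A')"
    "kmult (kmult B' A') (kmult A B) = kmult B' (kmult (kmult A' A) B)"
    by (simp_all only: kmult_assoc)
  then have inv: "kmult (kmult A B) (kmult B' A') = kid" "kmult (kmult B' A') (kmult A B) = kid"
    using A B by (simp_all add: weil_def kmult_kid)
  have "intertwines (kmult A B) x y ((a * a' + b * c') * x + (a * b' + b * d') * y) ((c * a' + d * c') * x + (c * b' + d * d') * y)"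
    "intertwines (kmult B' A') ((a * a' + b * c') * x + (a * b' + b * d') * y) ((c * a' + d * c') * x + (c * b' + d * d') * y) x y" for x y
  proof -
    define u v where "u = a' * x + b' * y" and "v = c' * x + d' * y"
    have e: "(a * a' + b * c') * x + (a * b' + b * d') * y = a * u + b * v"
      "(c * a' + d * c') * x + (c * b' + d * d') * y = c * u + d * v"
      by (simp_all add: u_def v_def algebra_simps)
    have "intertwines B x y u v" "intertwines A u v (a * u + b * v) (c * u + d * v)"
      "intertwines B' u v x y" "intertwines A' (a * u + b * v) (c * u + d * v) u v"
      using A B by (auto simp: weil_def u_def v_def)
    then show "intertwines (kmult A B) x y ((a * a' + b * c') * x + (a * b' + b * d') * y) ((c * a' + d * c') * x + (c * b' + d * d') * y)"
      "intertwines (kmult B' A') ((a * a' + b * c') * x + (a * b' + b * d') * y) ((c * a' + d * c') * x + (c * b' + d * d') * y) x y"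
      unfolding e using k by (blast intro: intertwines_kmult)+
  qed
  then show ?thesis using k inv kernel_kmult by (simp add: weil_def)
qed

text \<open>The normalization is left free: \<open>S_LM\<close> has w = w' = 1 / \<open>rl\<close>,
  while \<open>weil_exists\<close> uses w = 1 and w' = 1 / l.\<close>

lemma weil_s:
  assumes "w * w' * of_nat l = 1"
  shows "weil 0 (- 1) 1 0 (\<lambda>i j. w * qp (- (i * j))) (\<lambda>i j. w' * qp (i * j))"
proof -
  have per: "qp (- ((i + int l) * j)) = qp (- (i * j))" "qp (- (i * (j + int l))) = qp (- (i * j))"
    "qp ((i + int l) * j) = qp (i * j)" "qp (i * (j + int l)) = qp (i * j)" for i j
    by (rule qp_cong, simp add: algebra_simps)+
  have "kernel (\<lambda>i j. w * qp (- (i * j)))" "kernel (\<lambda>i j. w' * qp (i * j))"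
    unfolding kernel_def per by simp_all
  moreover have "(\<Sum>k\<in>Zl. w * qp (- (i * k)) * (w' * qp (k * j))) = kid i j" for i j
  proof -
    have "qp (- (i * k)) * qp (k * j) = qp ((j - i) * k)" for k
      unfolding qp_add[symmetric] by (simp add: algebra_simps)
    moreover have "w * qp (- (i * k)) * (w' * qp (k * j)) = w * w' * (qp (- (i * k)) * qp (k * j))" for k
      by simp
    ultimately have T: "w * qp (- (i * k)) * (w' * qp (k * j)) = w * w' * qp ((j - i) * k)" for k
      by (simp only:)
    show ?thesis
      unfolding T sum_distrib_left[symmetric] sum_qp using assms by (simp add: kid_def dvd_diff_commute)
  qed
  moreover have "(\<Sum>k\<in>Zl. w' * qp (i * k) * (w * qp (- (k * j)))) = kid i j" for i j
  proof -
    have "qp (i * k) * qp (- (k * j)) = qp ((i - j) * k)" for k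
      unfolding qp_add[symmetric] by (simp add: algebra_simps)
    moreover have "w' * qp (i * k) * (w * qp (- (k * j))) = w * w' * (qp (i * k) * qp (- (k * j)))" for k
      by simp
    ultimately have T: "w' * qp (i * k) * (w * qp (- (k * j))) = w * w' * qp ((i - j) * k)" for k
      by (simp only:)
    show ?thesis
      unfolding T sum_distrib_left[symmetric] sum_qp using assms by (simp add: kid_def dvd_diff_commute)
  qed
  moreover have "intertwines (\<lambda>i j. w * qp (- (i * j))) x y (- y) x" for x y
    unfolding intertwines_def hp_double[symmetric] mult.left_commute[of _ w] hp_add[symmetric]
    by (auto simp: algebra_simps)
  moreover have "intertwines (\<lambda>i j. w' * qp (i * j)) (- y) x x y" for x y
    unfolding intertwines_def hp_double[symmetric] mult.left_commute[of _ w'] hp_add[symmetric]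
    by (auto simp: algebra_simps)
  ultimately show ?thesis by (simp add: weil_def kmult_def fun_eq_iff)
qed

text \<open>Multiplication by the Gaussian q^(n i^2 / 2), the operator of the n-th power of t up to
  the scalar c.\<close>

definition kdiag :: "complex \<Rightarrow> int \<Rightarrow> int \<Rightarrow> int \<Rightarrow> complex"
  where "kdiag c n = (\<lambda>i j. if int l dvd i - j then c * hp (n * i\<^sup>2) else 0)"

lemma hp_square_cong: "int l dvd i - j \<Longrightarrow> hp (n * i\<^sup>2) = hp (n * j\<^sup>2)"
proof (rule hp_cong)
  assume "int l dvd i - j"
  moreover have "n * i\<^sup>2 - n * j\<^sup>2 = (i - j) * (n * (i + j))" by (simp add: algebra_simps power2_eq_square)
  ultimately show "int l dvd n * i\<^sup>2 - n * j\<^sup>2" by simp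
qed

lemma kdiag_kid: "kdiag c n i j = c * hp (n * i\<^sup>2) * kid i j"
  by (simp add: kdiag_def kid_def)

lemma kernel_kdiag: "kernel (kdiag c n)"
proof -
  have "hp (n * (i + int l)\<^sup>2) = hp (n * i\<^sup>2)" for i by (rule hp_square_cong) simp
  then show ?thesis using kid_kernel by (simp add: kernel_def kdiag_kid)
qed

lemma intertwines_kdiag: "intertwines (kdiag c n) b a (b + n * a) a"
  unfolding intertwines_def
proof (intro allI)
  fix i j
  show "hp (b * (2 * j + a)) * kdiag c n i (j + a) = hp ((b + n * a) * (2 * i - a)) * kdiag c n (i - a) j"
  proof (cases "int l dvd i - (j + a)")
    case True
    have "hp (b * (2 * j + a) + n * i\<^sup>2) = hp ((b + n * a) * (2 * i - a) + n * (i - a)\<^sup>2)"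
    proof (rule hp_cong)
      have "b * (2 * j + a) + n * i\<^sup>2 - ((b + n * a) * (2 * i - a) + n * (i - a)\<^sup>2) = (i - (j + a)) * (- 2 * b)"
        by (simp add: algebra_simps power2_eq_square)
      then show "int l dvd b * (2 * j + a) + n * i\<^sup>2 - ((b + n * a) * (2 * i - a) + n * (i - a)\<^sup>2)"
        using True by (simp only: dvd_mult2)
    qed
    then show ?thesis using True by (simp add: kdiag_def hp_add diff_diff_eq add.commute mult_ac)
  next
    case False
    then show ?thesis by (simp add: kdiag_def diff_diff_eq add.commute)
  qed
qed

lemma kmult_kdiag: "c * c' = 1 \<Longrightarrow> kmult (kdiag c n) (kdiag c' (- n)) = kid"
proof (intro ext)
  fix i j assume c: "c * c' = 1"
  have "kmult (kdiag c n) (kdiag c' (- n)) i j = c * hp (n * i\<^sup>2) * (\<Sum>k\<in>Zl. kid i k * kdiag c' (- n) k j)"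
    by (simp add: kmult_def kdiag_kid sum_distrib_left mult_ac)
  also have "\<dots> = c * c' * (hp (n * i\<^sup>2) * hp (- (n * i\<^sup>2))) * kid i j"
  proof -
    have "(\<Sum>k\<in>Zl. kid i k * kdiag c' (- n) k j) = kdiag c' (- n) i j"
      by (rule sum_kid) (rule kernel_periodic(2)[OF kernel_kdiag])
    then show ?thesis by (simp only:) (simp add: kdiag_kid)
  qed
  finally show "kmult (kdiag c n) (kdiag c' (- n)) i j = kid i j" by (simp add: c hp_minus)
qed

lemma weil_t: "c * c' = 1 \<Longrightarrow> weil 1 n 0 1 (kdiag c n) (kdiag c' (- n))"
  using kmult_kdiag[of c c' n] kmult_kdiag[of c' c "- n"] intertwines_kdiag[of c n]
    intertwines_kdiag[of c' "- n" "x + n * y" y for x y]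
  by (simp add: weil_def kernel_kdiag mult.commute)

text \<open>Euclid's algorithm on the first column: powers of t reduce a modulo c, and s exchanges
  the rows with a sign. At c = 0 the matrix is a power of t up to sign, and the sign is the square
  of s.\<close>

lemma weil_exists: "a * d - b * c = 1 \<Longrightarrow> \<exists>A A'. weil a b c d A A'"
proof (induction "nat \<bar>c\<bar>" arbitrary: a b c d rule: less_induct)
  case less
  have s: "\<exists>A A'. weil (- c) (- d) a b A A'" if "\<exists>A A'. weil a b c d A A'" for a b c d
  proof -
    obtain A A' where "weil a b c d A A'" using \<open>\<exists>A A'. weil a b c d A A'\<close> by blast
    then show ?thesis
      using weil_mult[OF weil_s[of 1 "1 / of_nat l"], of a b c d A A'] l_ge by auto
  qed
  have t: "\<exists>A A'. weil (a + n * c) (b + n * d) c d A A'" if "\<exists>A A'. weil a b c d A A'" for a b c d n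
  proof -
    obtain A A' where "weil a b c d A A'" using \<open>\<exists>A A'. weil a b c d A A'\<close> by blast
    then show ?thesis
      using weil_mult[OF weil_t[of 1 1 n], of a b c d A A'] by auto
  qed
  have t0: "\<exists>A A'. weil 1 n 0 1 A A'" for n using weil_t[of 1 1 n] by auto
  show ?case
  proof (cases "c = 0")
    case True
    then have "a = 1 \<and> d = 1 \<or> a = - 1 \<and> d = - 1"
      using less.prems zmult_eq_1_iff[of a d] by simp
    then show ?thesis using t0[of b] s[OF s[OF t0[of "- b"]]] True by auto
  next
    case False
    define n r where "n = a div c" and "r = a mod c"
    have a: "a = r + n * c" by (simp add: n_def r_def)
    have "\<exists>A A'. weil (- c) (- d) r (b - n * d) A A'"
    proof (rule less.hyps)
      show "nat \<bar>r\<bar> < nat \<bar>c\<bar>" using abs_mod_less[OF False, of a] by (simp add: r_def)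
      show "- c * (b - n * d) - - d * r = 1" using less.prems a by (simp add: algebra_simps)
    qed
    \<comment> \<open>The cube of s is its inverse as a matrix, so three applications undo the
      exchange of rows.\<close>
    from t[OF s[OF s[OF s[OF this]]], of n] show ?thesis by (simp add: a)
  qed
qed

text \<open>Schur's lemma: a kernel commuting with all Heisenberg operators is a multiple of the identity.\<close>

lemma weil_unique:
  assumes A: "weil a b c d A A'" and B: "weil a b c d B B'"
  obtains e where "e \<noteq> 0" "A = (\<lambda>i j. e * B i j)"
proof -
  have k: "kernel A" "kernel A'" "kernel B" "kernel B'" using A B by (auto simp: weil_def)
  define C where "C = kmult B' A"
  have C: "kernel C" unfolding C_def using k by (intro kernel_kmult)
  have com: "intertwines C x y x y" for x y
  proof -
    have "intertwines A x y (a * x + b * y) (c * x + d * y)" "intertwines B' (a * x + b * y) (c * x + d * y) x y"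
      using A B by (auto simp: weil_def)
    then show ?thesis unfolding C_def using intertwines_kmult k by blast
  qed
  have off: "C i j = 0" if "\<not> int l dvd i - j" for i j
  proof -
    have "qp j * C i j = qp i * C i j"
      using com[of 1 0] unfolding intertwines_def by (simp add: hp_double)
    moreover have "qp i \<noteq> qp j" using that by (simp add: qp_eq_iff)
    ultimately show ?thesis by auto
  qed
  have shift: "C i (j + y) = C (i - y) j" for i j y
    using com[of 0 y] unfolding intertwines_def by simp
  have "C i j = C 0 0 * kid i j" for i j
  proof (cases "int l dvd i - j")
    case True
    have "C i j = C i i" by (rule periodic_cong[OF kernel_periodic(1)[OF C]]) (use True in \<open>simp add: dvd_diff_commute\<close>)
    also have "\<dots> = C 0 0" using shift[of i 0 i] by simp
    finally show ?thesis using True by (simp add: kid_def)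
  qed (simp add: off kid_def)
  then have C_eq: "C = (\<lambda>i j. C 0 0 * kid i j)" by blast
  have "A = kmult (kmult B B') A" using B by (simp add: weil_def kmult_kid k)
  also have "\<dots> = kmult B C" by (simp add: C_def kmult_assoc)
  also have "\<dots> = (\<lambda>i j. C 0 0 * kmult B kid i j)"
    by (subst C_eq) (simp add: kmult_def sum_distrib_left mult_ac)
  finally have eq: "A = (\<lambda>i j. C 0 0 * B i j)" by (simp add: kmult_kid k)
  have "C 0 0 \<noteq> 0"
  proof
    assume "C 0 0 = 0"
    then have "kmult A A' 0 0 = 0" unfolding eq kmult_def by simp
    then show False using A by (simp add: weil_def kid_def)
  qed
  then show thesis using that eq by blast
qed

definition act :: "(int \<Rightarrow> int \<Rightarrow> complex) \<Rightarrow> (int \<Rightarrow> complex) \<Rightarrow> int \<Rightarrow> complex"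
  where "act A x i = (\<Sum>j\<in>Zl. A i j * x j)"

lemma act_kmult: "act (kmult A B) x = act A (act B x)"
proof
  fix i
  have "act (kmult A B) x i = (\<Sum>k\<in>Zl. \<Sum>m\<in>Zl. A i m * (B m k * x k))"
    by (simp add: act_def kmult_def sum_distrib_right mult.assoc)
  also have "\<dots> = (\<Sum>m\<in>Zl. \<Sum>k\<in>Zl. A i m * (B m k * x k))" by (rule sum.swap)
  finally show "act (kmult A B) x i = act A (act B x) i" by (simp add: act_def sum_distrib_left)
qed

lemma act_linear: "act A (\<lambda>j. c * x j + d * y j) i = c * act A x i + d * act A y i"
  by (simp add: act_def sum_distrib_left distrib_left sum.distrib mult_ac)

lemma act_scale: "act (\<lambda>i j. e * A i j) x i = e * act A x i"
  by (simp add: act_def sum_distrib_left mult_ac)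

lemma act_kid: "periodic x \<Longrightarrow> act kid x = x"
  by (rule ext) (simp add: act_def sum_kid)

lemma act_periodic: "kernel A \<Longrightarrow> periodic (act A x)"
  by (simp add: periodic_def act_def kernel_def)

lemma act_parity:
  assumes A: "kernel A" and x: "periodic x" "\<And>j. x (- j) = e * x j" and e: "e * e = 1"
  shows "act A x (- i) = e * act A x i"
proof -
  have per: "periodic (\<lambda>j. A (- i) j * x j)" using A x(1) by (simp add: kernel_def periodic_def)
  have "A (- i) (- j) * x (- j) = e * (A i j * x j)" for j using A x(2) by (simp add: kernel_def)
  then show ?thesis unfolding act_def by (simp add: sum_distrib_left flip: sum_periodic_minus[OF per])
qed

lemma sum_Zl_half:
  fixes g :: "int \<Rightarrow> 'b::comm_monoid_add"
  assumes "periodic g"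
  shows "(\<Sum>k\<in>Zl. g k) = g 0 + (\<Sum>r<h. g (int r + 1) + g (- (int r + 1)))"
proof -
  have "(\<Sum>k\<in>Zl. g k) = (\<Sum>j<Suc (h + h). g (int j))"
    unfolding sum_Zl_nat by (simp only: l_eq mult_2 Suc_eq_plus1)
  also have "\<dots> = g 0 + (\<Sum>j<h + h. g (int j + 1))"
    unfolding sum.lessThan_Suc_shift by (simp add: add.commute[of 1 "int j" for j])
  also have "(\<Sum>j<h + h. g (int j + 1)) = (\<Sum>j<h. g (int j + 1)) + (\<Sum>j<h. g (int (h + j) + 1))"
  proof -
    have "(\<Sum>j<h + n. f j) = (\<Sum>j<h. f j) + (\<Sum>j<n. f (h + j))" for f :: "nat \<Rightarrow> 'b" and n
      by (induction n) (simp_all add: add.assoc)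
    then show ?thesis .
  qed
  also have "(\<Sum>j<h. g (int (h + j) + 1)) = (\<Sum>j<h. g (int (h + (h - Suc j)) + 1))"
    by (rule sum.nat_diff_reindex[symmetric])
  also have "\<dots> = (\<Sum>j<h. g (- (int j + 1)))"
    by (intro sum.cong refl periodic_cong[OF assms]) (simp add: l_eq of_nat_diff add.commute)
  finally show ?thesis by (simp only: sum.distrib)
qed

end

lemma independent_family:
  fixes u :: "'i \<Rightarrow> 'a::complex_vector"
  assumes fin: "finite I" and zero: "\<And>a i. (\<Sum>i\<in>I. a i *\<^sub>C u i) = 0 \<Longrightarrow> i \<in> I \<Longrightarrow> a i = 0"
  shows "inj_on u I" "\<not> complex_vector.dependent (u ` I)"
proof -
  show inj: "inj_on u I"
  proof (rule inj_onI, rule ccontr)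
    fix i j assume ij: "i \<in> I" "j \<in> I" "u i = u j" "i \<noteq> j"
    let ?a = "\<lambda>k. (if k = i then 1 else 0) - (if k = j then 1 else (0::complex))"
    have "(\<Sum>k\<in>I. (if k = m then 1 else 0) *\<^sub>C u k) = u m" if "m \<in> I" for m
    proof -
      have "(\<Sum>k\<in>I. (if k = m then 1 else 0) *\<^sub>C u k) = (\<Sum>k\<in>I. if k = m then u k else 0)"
        by (intro sum.cong) (auto simp: scaleC_one)
      then show ?thesis using that fin by simp
    qed
    then have "(\<Sum>k\<in>I. ?a k *\<^sub>C u k) = 0"
      using ij by (simp add: complex_vector.scale_left_diff_distrib sum_subtractf)
    from zero[OF this ij(1)] show False using ij(4) by simp
  qed
  show "\<not> complex_vector.dependent (u ` I)"
  proof
    assume "complex_vector.dependent (u ` I)"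
    then obtain c where c: "\<exists>x\<in>u ` I. c x \<noteq> 0" "(\<Sum>x\<in>u ` I. c x *\<^sub>C x) = 0"
      using complex_vector.dependent_finite[of "u ` I"] fin by auto
    have "(\<Sum>i\<in>I. c (u i) *\<^sub>C u i) = 0" using c(2) by (simp add: sum.reindex[OF inj])
    then have "\<forall>i\<in>I. c (u i) = 0" using zero[of "\<lambda>i. c (u i)"] by blast
    then show False using c(1) by blast
  qed
qed

section \<open>Projective representations carried by vectors indexed by Z/l\<close>

locale weil_module = odd_root l h q
  for l h :: nat and q :: complex +
  fixes A :: "int mat \<Rightarrow> int \<Rightarrow> int \<Rightarrow> complex" and v :: "nat \<Rightarrow> int \<Rightarrow> 'a::complex_vector"
  assumes weil_A: "g \<in> SL2Z \<Longrightarrow> \<exists>A'. weil (g $$ (0, 0)) (g $$ (0, 1)) (g $$ (1, 0)) (g $$ (1, 1)) (A g) A'"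
    and periodic_v: "periodic (v n)"
    and parity_v: "v n (- j) = (if n = 0 then 1 else - 1) *\<^sub>C v n j"
    and independent_v: "(\<And>n. periodic (f n)) \<Longrightarrow> (\<And>n j. f n (- j) = (if n = 0 then 1 else - 1) * f n j) \<Longrightarrow>
      (\<Sum>n<3. \<Sum>j\<in>Zl. f n j *\<^sub>C v n j) = 0 \<Longrightarrow> n < 3 \<Longrightarrow> f n j = 0"
begin

definition sg :: "nat \<Rightarrow> complex" where "sg n = (if n = 0 then 1 else - 1)"

lemma sg_square: "sg n * sg n = 1"
  by (simp add: sg_def)

text \<open>Coordinate vectors: even functions in the component 0, odd functions in the components 1 and 2,
  which carry the standard representation.\<close>

definition Co :: "nat set \<Rightarrow> (nat \<Rightarrow> int \<Rightarrow> complex) set"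
  where "Co J = {f. \<forall>n. periodic (f n) \<and> (\<forall>j. f n (- j) = sg n * f n j) \<and> (n \<notin> J \<longrightarrow> (\<forall>j. f n j = 0))}"

definition Ph :: "(nat \<Rightarrow> int \<Rightarrow> complex) \<Rightarrow> 'a" where "Ph f = (\<Sum>n<3. \<Sum>j\<in>Zl. f n j *\<^sub>C v n j)"

text \<open>Component 0 carries the Weil operator alone; components 1 and 2 carry it tensored with
  g, component n belonging to row n - 1.\<close>

definition M :: "int mat \<Rightarrow> (nat \<Rightarrow> int \<Rightarrow> complex) \<Rightarrow> nat \<Rightarrow> int \<Rightarrow> complex"
  where "M g f n i = (if n = 0 then act (A g) (f 0) i else if n < 3 then
    of_int (g $$ (n - 1, 0)) * act (A g) (f 1) i + of_int (g $$ (n - 1, 1)) * act (A g) (f 2) i else 0)"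

definition rho :: "int mat \<Rightarrow> 'a \<Rightarrow> 'a" where "rho g z = Ph (M g (inv_into (Co {..<3}) Ph z))"

lemma kernel_A: "g \<in> SL2Z \<Longrightarrow> kernel (A g)"
  using weil_A[of g] by (auto simp: weil_def)

text \<open>Both operators transform the Heisenberg vectors by the product matrix, so
  \<open>weil_unique\<close> compares them.\<close>

lemma A_mult:
  assumes "g \<in> SL2Z" "g' \<in> SL2Z"
  obtains e where "e \<noteq> 0" "A (g * g') = (\<lambda>i j. e * kmult (A g) (A g') i j)"
proof -
  obtain B where B: "weil (g $$ (0, 0)) (g $$ (0, 1)) (g $$ (1, 0)) (g $$ (1, 1)) (A g) B"
    using weil_A[OF assms(1)] by blast
  obtain B' where B': "weil (g' $$ (0, 0)) (g' $$ (0, 1)) (g' $$ (1, 0)) (g' $$ (1, 1)) (A g') B'"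
    using weil_A[OF assms(2)] by blast
  let ?k = "g * g'"
  obtain B'' where "weil (?k $$ (0, 0)) (?k $$ (0, 1)) (?k $$ (1, 0)) (?k $$ (1, 1)) (A ?k) B''"
    using weil_A[OF SL2Z_mult[OF assms]] by blast
  moreover have "weil (?k $$ (0, 0)) (?k $$ (0, 1)) (?k $$ (1, 0)) (?k $$ (1, 1)) (kmult (A g) (A g')) (kmult B' B)"
    using weil_mult[OF B B'] by (simp add: SL2Z_mult_entry[OF assms])
  ultimately obtain e where "e \<noteq> 0" "A ?k = (\<lambda>i j. e * kmult (A g) (A g') i j)"
    by (rule weil_unique)
  then show thesis by (rule that)
qed

lemma A_one: obtains e where "e \<noteq> 0" "A (1\<^sub>m 2) = (\<lambda>i j. e * kid i j)"
proof -
  let ?k = "1\<^sub>m 2 :: int mat"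
  obtain B where "weil (?k $$ (0, 0)) (?k $$ (0, 1)) (?k $$ (1, 0)) (?k $$ (1, 1)) (A ?k) B"
    using weil_A[OF SL2Z_one] by blast
  then have B: "weil 1 0 0 1 (A ?k) B" by simp
  have "kdiag 1 0 = kid" by (intro ext) (simp add: kdiag_kid)
  then have "weil 1 0 0 1 kid kid" using weil_t[of 1 1 0] by simp
  from weil_unique[OF B this] show thesis using that by blast
qed

lemma Ph_combination: "Ph (\<lambda>n j. c * f n j + d * g n j) = c *\<^sub>C Ph f + d *\<^sub>C Ph g"
  by (simp add: Ph_def scaleC_add_left sum.distrib complex_vector.scale_sum_right scaleC_add_right scaleC_scaleC)

lemma Co_combination: "f \<in> Co J \<Longrightarrow> g \<in> Co J \<Longrightarrow> (\<lambda>n j. c * f n j + d * g n j) \<in> Co J"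
  by (simp add: Co_def periodic_def algebra_simps)

lemma M_combination: "M k (\<lambda>n j. c * f n j + d * g n j) = (\<lambda>n j. c * M k f n j + d * M k g n j)"
  by (intro ext) (simp add: M_def act_linear algebra_simps)

lemma Co_mono: "J \<subseteq> J' \<Longrightarrow> Co J \<subseteq> Co J'"
  by (auto simp: Co_def)

lemma Ph_eq_0: "f \<in> Co J \<Longrightarrow> J \<subseteq> {..<3} \<Longrightarrow> Ph f = 0 \<Longrightarrow> f n j = 0"
  using independent_v[of f n j] by (cases "n < 3") (auto simp: Co_def Ph_def sg_def)

lemma inj_Ph: "inj_on Ph (Co {..<3})"
proof (rule inj_onI)
  fix f g assume fg: "f \<in> Co {..<3}" "g \<in> Co {..<3}" "Ph f = Ph g"
  have "Ph (\<lambda>n j. 1 * f n j + (- 1) * g n j) = 0" unfolding Ph_combination fg(3) by (simp add: scaleC_one)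
  from Ph_eq_0[OF Co_combination[OF fg(1,2)] order_refl this] show "f = g" by (intro ext) simp
qed

lemma rho_Ph: "f \<in> Co J \<Longrightarrow> J \<subseteq> {..<3} \<Longrightarrow> rho g (Ph f) = Ph (M g f)"
  unfolding rho_def using inv_into_f_f[OF inj_Ph] Co_mono by (metis subsetD)

lemma M_Co: "g \<in> SL2Z \<Longrightarrow> f \<in> Co J \<Longrightarrow> 1 \<in> J \<longleftrightarrow> 2 \<in> J \<Longrightarrow> M g f \<in> Co J"
proof -
  assume g: "g \<in> SL2Z" and f: "f \<in> Co J" and J: "1 \<in> J \<longleftrightarrow> 2 \<in> J"
  have f': "periodic (f n)" "f n (- j) = sg n * f n j" "n \<notin> J \<Longrightarrow> f n j = 0" for n j using f by (auto simp: Co_def)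
  have par: "act (A g) (f n) (- i) = sg n * act (A g) (f n) i" for n i
    by (rule act_parity[OF kernel_A[OF g] f'(1,2) sg_square])
  have per: "act (A g) (f n) (i + int l) = act (A g) (f n) i" for n i
    using act_periodic[OF kernel_A[OF g]] by (simp add: periodic_def)
  have z: "act (A g) (f n) i = 0" if "n \<notin> J" for n i using f'(3)[OF that] by (simp add: act_def)
  have "M g f n i = 0" if "n \<notin> J" for n i
  proof -
    consider "n = 0" | "n = 1" | "n = 2" | "n \<ge> 3" by linarith
    then show ?thesis using that z J by cases (auto simp: M_def)
  qed
  moreover have "M g f n (- i) = sg n * M g f n i" for n i
    by (simp add: M_def par) (simp add: sg_def algebra_simps)
  ultimately show ?thesis by (simp add: Co_def periodic_def M_def per)
qed

lemma M_mult:
  assumes "g \<in> SL2Z" "g' \<in> SL2Z"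
  obtains e where "e \<noteq> 0" "\<And>f. M (g * g') f = (\<lambda>n j. e * M g (M g' f) n j)"
proof -
  obtain e where e: "e \<noteq> 0" "A (g * g') = (\<lambda>i j. e * kmult (A g) (A g') i j)" by (rule A_mult[OF assms])
  have act: "act (A (g * g')) x i = e * act (A g) (act (A g') x) i" for x i
    unfolding e(2) act_scale act_kmult ..
  have "M (g * g') f n i = e * M g (M g' f) n i" for f n i
  proof -
    consider "n = 0" | "n = 1" | "n = 2" | "n \<ge> 3" by linarith
    then show ?thesis
    proof cases
      case 1
      then show ?thesis by (simp add: M_def act cong: if_cong) (simp add: M_def[abs_def])
    qed (simp_all add: M_def[abs_def] act act_linear SL2Z_mult_entry[OF assms] algebra_simps)
  qed
  then have "\<And>f. M (g * g') f = (\<lambda>n j. e * M g (M g' f) n j)" by blast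
  then show thesis using that e(1) by blast
qed

lemma M_one: obtains e where "e \<noteq> 0" "\<And>f J. f \<in> Co J \<Longrightarrow> J \<subseteq> {..<3} \<Longrightarrow> M (1\<^sub>m 2) f = (\<lambda>n j. e * f n j)"
proof -
  obtain e where e: "e \<noteq> 0" "A (1\<^sub>m 2) = (\<lambda>i j. e * kid i j)" by (rule A_one)
  have "M (1\<^sub>m 2) f n i = e * f n i" if "f \<in> Co J" "J \<subseteq> {..<3}" for f J n i
  proof -
    have act: "act (A (1\<^sub>m 2)) (f n) i = e * f n i" for n i
      unfolding e(2) act_scale using that(1) by (simp add: act_kid Co_def)
    have zero: "f n i = 0" if "n \<ge> 3"
    proof -
      have "n \<notin> J" using \<open>J \<subseteq> {..<3}\<close> \<open>n \<ge> 3\<close> by auto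
      then show ?thesis using \<open>f \<in> Co J\<close> by (simp add: Co_def)
    qed
    consider "n = 0" | "n = 1" | "n = 2" | "n \<ge> 3" by linarith
    then show ?thesis by cases (simp_all add: M_def act zero)
  qed
  then show thesis using that e(1) by blast
qed

lemma subspace_Ph: "complex_vector.subspace (Ph ` Co J)"
proof -
  have 0: "(\<lambda>n j. 0) \<in> Co J" by (simp add: Co_def periodic_def)
  have comb: "c *\<^sub>C Ph f + d *\<^sub>C Ph g \<in> Ph ` Co J" if "f \<in> Co J" "g \<in> Co J" for c d f g
    unfolding Ph_combination[symmetric] by (rule imageI) (rule Co_combination[OF that])
  show ?thesis
    unfolding complex_vector.subspace_def
  proof (intro conjI ballI allI)
    show "0 \<in> Ph ` Co J" using comb[OF 0 0, of 0 0] by simp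
    show "x + y \<in> Ph ` Co J" if "x \<in> Ph ` Co J" "y \<in> Ph ` Co J" for x y
      using that comb[of _ _ 1 1] by (auto simp: scaleC_one)
    show "c *\<^sub>C x \<in> Ph ` Co J" if "x \<in> Ph ` Co J" for c x
      using that comb[of _ _ c 0] by auto
  qed
qed

text \<open>The condition on J keeps the two components that g mixes together. It covers the whole
  center, P and the complement with the same \<open>rho\<close>.\<close>

lemma projective_rho:
  assumes J: "J \<subseteq> {..<3}" "1 \<in> J \<longleftrightarrow> 2 \<in> J"
  shows "projective_rep_on (Ph ` Co J) rho"
proof -
  let ?W = "Ph ` Co J"
  have img: "rho g x \<in> ?W" if "g \<in> SL2Z" "x \<in> ?W" for g x
    using that rho_Ph[OF _ J(1)] M_Co[OF that(1) _ J(2)] by force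
  have lin: "rho g (c *\<^sub>C x + d *\<^sub>C y) = c *\<^sub>C rho g x + d *\<^sub>C rho g y" if "x \<in> ?W" "y \<in> ?W" for g c d x y
  proof -
    obtain f f' where f: "f \<in> Co J" "x = Ph f" "f' \<in> Co J" "y = Ph f'" using \<open>x \<in> ?W\<close> \<open>y \<in> ?W\<close> by blast
    show ?thesis
      unfolding f(2,4) Ph_combination[symmetric] rho_Ph[OF Co_combination[OF f(1,3)] J(1)]
        rho_Ph[OF f(1) J(1)] rho_Ph[OF f(3) J(1)] M_combination by (simp only: Ph_combination)
  qed
  have scale: "rho g (c *\<^sub>C x) = c *\<^sub>C rho g x" if "x \<in> ?W" for g c x
    using lin[OF that that, of g c 0] by simp
  have Ph_scale: "Ph (\<lambda>n j. e * f n j) = e *\<^sub>C Ph f" for e f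
    using Ph_combination[of e f 0 f] by simp
  have mult: "\<exists>e. e \<noteq> 0 \<and> (\<forall>x\<in>?W. rho (g * g') x = e *\<^sub>C rho g (rho g' x))" if "g \<in> SL2Z" "g' \<in> SL2Z" for g g'
  proof -
    obtain e where e: "e \<noteq> 0" "\<And>f. M (g * g') f = (\<lambda>n j. e * M g (M g' f) n j)"
      by (rule M_mult[OF \<open>g \<in> SL2Z\<close> \<open>g' \<in> SL2Z\<close>]) blast
    have "rho (g * g') x = e *\<^sub>C rho g (rho g' x)" if "x \<in> ?W" for x
    proof -
      obtain f where f: "f \<in> Co J" "x = Ph f" using \<open>x \<in> ?W\<close> by blast
      show ?thesis
        unfolding f(2) rho_Ph[OF f(1) J(1)] rho_Ph[OF M_Co[OF \<open>g' \<in> SL2Z\<close> f(1) J(2)] J(1)] e(2) Ph_scale ..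
    qed
    with e(1) show ?thesis by blast
  qed
  have bij: "bij_betw (rho g) ?W ?W" if g: "g \<in> SL2Z" for g
  proof -
    obtain g' where g': "g' \<in> SL2Z" "g * g' = 1\<^sub>m 2" "g' * g = 1\<^sub>m 2" by (rule SL2Z_inverse[OF g])
    obtain e where e: "e \<noteq> 0" "\<And>f J. f \<in> Co J \<Longrightarrow> J \<subseteq> {..<3} \<Longrightarrow> M (1\<^sub>m 2) f = (\<lambda>n j. e * f n j)"
      by (rule M_one) blast
    have one: "rho (1\<^sub>m 2) x = e *\<^sub>C x" if "x \<in> ?W" for x
      using that by (auto simp: rho_Ph[OF _ J(1)] e(2)[OF _ J(1)] Ph_scale)
    obtain c where c: "c \<noteq> 0" "\<And>x. x \<in> ?W \<Longrightarrow> e *\<^sub>C x = c *\<^sub>C rho g (rho g' x)"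
      using mult[OF g g'(1)] one unfolding g'(2) by auto
    obtain d where d: "d \<noteq> 0" "\<And>x. x \<in> ?W \<Longrightarrow> e *\<^sub>C x = d *\<^sub>C rho g' (rho g x)"
      using mult[OF g'(1) g] one unfolding g'(3) by auto
    show ?thesis
    proof (rule bij_betwI')
      fix x y assume xy: "x \<in> ?W" "y \<in> ?W"
      show "rho g x = rho g y \<longleftrightarrow> x = y"
      proof
        assume "rho g x = rho g y"
        then have "e *\<^sub>C x = e *\<^sub>C y" using d(2) xy by simp
        then show "x = y" using e(1) by simp
      qed simp
      show "rho g x \<in> ?W" by (rule img[OF g xy(1)])
    next
      fix y assume y: "y \<in> ?W"
      let ?x = "(c / e) *\<^sub>C rho g' y"
      have "?x \<in> ?W" by (rule complex_vector.subspace_scale[OF subspace_Ph img[OF g'(1) y]])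
      moreover have "rho g ?x = inverse e *\<^sub>C (c *\<^sub>C rho g (rho g' y))"
        unfolding scale[OF img[OF g'(1) y]] scaleC_scaleC by (simp add: divide_inverse mult.commute)
      then have "y = rho g ?x" unfolding c(2)[OF y, symmetric] using e(1) by (simp add: scaleC_scaleC scaleC_one)
      ultimately show "\<exists>x\<in>?W. y = rho g x" by blast
    qed
  qed
  show ?thesis
    unfolding projective_rep_on_def
    using bij mult scale lin[of _ _ _ 1 1] subspace_Ph by (simp add: scaleC_one)
qed

lemma Ph_half:
  assumes "f \<in> Co J"
  shows "Ph f = f 0 0 *\<^sub>C v 0 0 + (\<Sum>n<3. \<Sum>r<h. (2 * f n (int r + 1)) *\<^sub>C v n (int r + 1))"
proof -
  have f: "periodic (f n)" "f n (- j) = sg n * f n j" for n j using assms by (auto simp: Co_def)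
  have v: "v n (- j) = sg n *\<^sub>C v n j" for n j by (simp add: parity_v sg_def)
  have "(\<Sum>j\<in>Zl. f n j *\<^sub>C v n j) = f n 0 *\<^sub>C v n 0 + (\<Sum>r<h. (2 * f n (int r + 1)) *\<^sub>C v n (int r + 1))" for n
  proof -
    have per: "periodic (\<lambda>j. f n j *\<^sub>C v n j)" using f(1) periodic_v by (simp add: periodic_def)
    have "f n (- j) *\<^sub>C v n (- j) = f n j *\<^sub>C v n j" for j
      using sg_square[of n] by (simp add: f(2) v scaleC_scaleC mult_ac)
    then have "f n j *\<^sub>C v n j + f n (- j) *\<^sub>C v n (- j) = (2 * f n j) *\<^sub>C v n j" for j
      by (simp flip: scaleC_add_left)
    then show ?thesis unfolding sum_Zl_half[OF per] by (simp only:)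
  qed
  moreover have "f (Suc n) 0 = 0" for n using f(2)[of "Suc n" 0] by (simp add: sg_def)
  ultimately show ?thesis by (simp add: Ph_def sum.distrib eval_nat_numeral)
qed

text \<open>The delta function at j, made even or odd according to the component. With the factor
  1/2 its image under \<open>Ph\<close> is the vector v n j itself.\<close>

definition ev :: "nat \<Rightarrow> int \<Rightarrow> nat \<Rightarrow> int \<Rightarrow> complex"
  where "ev n j m i = (if m = n then (kid i j + sg n * kid i (- j)) / 2 else 0)"

lemma kid_minus: "kid (- i) j = kid i (- j)"
  using kid_kernel unfolding kernel_def by (metis minus_minus)

lemma ev_Co: "ev n j \<in> Co {n}"
proof -
  have "kid (i + int l) j = kid i j" for i j using kid_kernel by (simp add: kernel_def)
  moreover have "ev n j m (- i) = sg m * ev n j m i" for m i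
    by (simp add: ev_def kid_minus sg_def)
  ultimately show ?thesis by (simp add: Co_def ev_def periodic_def)
qed

lemma Ph_ev: "n < 3 \<Longrightarrow> Ph (ev n j) = v n j"
proof -
  assume n: "n < 3"
  have k: "(\<Sum>i\<in>Zl. kid i j *\<^sub>C v n i) = v n j" for j
  proof -
    have "(\<Sum>i\<in>Zl. kid i j *\<^sub>C v n i) = (\<Sum>i\<in>Zl. if int l dvd i - j then v n i else 0)"
      by (intro sum.cong refl) (simp add: kid_def scaleC_one)
    then show ?thesis by (simp only: sum_Zl_single[OF periodic_v])
  qed
  have "Ph (ev n j) = (\<Sum>m<3. if m = n then \<Sum>i\<in>Zl. ((kid i j + sg n * kid i (- j)) / 2) *\<^sub>C v n i else 0)"
    unfolding Ph_def by (intro sum.cong refl) (simp add: ev_def)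
  also have "\<dots> = (1 / 2) *\<^sub>C ((\<Sum>i\<in>Zl. kid i j *\<^sub>C v n i) + sg n *\<^sub>C (\<Sum>i\<in>Zl. kid i (- j) *\<^sub>C v n i))"
    using n by (simp add: complex_vector.scale_sum_right sum.distrib scaleC_add_right scaleC_scaleC
        add_divide_distrib scaleC_add_left)
  also have "\<dots> = (1 / 2) *\<^sub>C (v n j + v n j)"
    unfolding k using sg_square[of n] by (simp add: parity_v scaleC_scaleC scaleC_one sg_def)
  also have "v n j + v n j = 2 *\<^sub>C v n j"
    using scaleC_add_left[of 1 1 "v n j"] by (simp add: scaleC_one)
  finally show ?thesis by (simp add: scaleC_scaleC scaleC_one)
qed

lemma v_Ph: "n < 3 \<Longrightarrow> n \<in> J \<Longrightarrow> v n j \<in> Ph ` Co J"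
  using Ph_ev[of n j] ev_Co[of n j] Co_mono[of "{n}" J] by (metis empty_subsetI image_eqI insert_subset subsetD)

lemma kid_nat: "r \<le> h \<Longrightarrow> s \<le> h \<Longrightarrow> kid (int r) (int s) = (if r = s then 1 else 0)"
  "r \<le> h \<Longrightarrow> s \<le> h \<Longrightarrow> kid (int r) (- int s) = (if r = 0 \<and> s = 0 then 1 else 0)"
proof -
  assume rs: "r \<le> h" "s \<le> h"
  have lt: "int r < int l" "int s < int l" "int (r + s) < int l" using rs l_eq by auto
  have "int r = int s" if "int l dvd int r - int s"
    by (rule Zl_eqI[OF _ _ that]) (use lt in \<open>auto simp: Zl_def\<close>)
  then show "kid (int r) (int s) = (if r = s then 1 else 0)" by (auto simp: kid_def)
  have "int (r + s) = 0" if "int l dvd int r - - int s"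
    by (rule Zl_eqI) (use lt that l_ge in \<open>auto simp: Zl_def\<close>)
  then show "kid (int r) (- int s) = (if r = 0 \<and> s = 0 then 1 else 0)" by (auto simp: kid_def)
qed

text \<open>Within the range 0, ..., h, without 0 in the odd components, the functions
  \<open>ev\<close> of different indices have no common support, so each coefficient can be read off
  at its own index.\<close>

lemma v_independent:
  assumes fin: "finite I" and idx: "\<And>i. i \<in> I \<Longrightarrow> n i < 3 \<and> r i \<le> h \<and> (n i = 0 \<or> 1 \<le> r i)"
    and inj: "inj_on (\<lambda>i. (n i, r i)) I" and zero: "(\<Sum>i\<in>I. a i *\<^sub>C v (n i) (int (r i))) = 0" and k: "k \<in> I"
  shows "a k = 0"
proof -
  have sum: "Ph (\<lambda>m j. \<Sum>i\<in>I'. a i * ev (n i) (int (r i)) m j) = (\<Sum>i\<in>I'. a i *\<^sub>C v (n i) (int (r i))) \<and>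
      (\<lambda>m j. \<Sum>i\<in>I'. a i * ev (n i) (int (r i)) m j) \<in> Co {..<3}" if "I' \<subseteq> I" for I'
    using finite_subset[OF that fin] that
  proof (induction I' rule: finite_induct)
    case empty
    then show ?case by (simp add: Ph_def Co_def periodic_def)
  next
    case (insert i I')
    have ev: "ev (n i) (int (r i)) \<in> Co {..<3}" using ev_Co[of "n i"] Co_mono[of "{n i}" "{..<3}"] idx insert.prems by blast
    have IH: "(\<lambda>m j. \<Sum>i\<in>I'. a i * ev (n i) (int (r i)) m j) \<in> Co {..<3}"
      "Ph (\<lambda>m j. \<Sum>i\<in>I'. a i * ev (n i) (int (r i)) m j) = (\<Sum>i\<in>I'. a i *\<^sub>C v (n i) (int (r i)))"
      using insert by auto
    show ?case
      using Ph_combination[of "a i" "ev (n i) (int (r i))" 1 "\<lambda>m j. \<Sum>i\<in>I'. a i * ev (n i) (int (r i)) m j"]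
        Co_combination[OF ev IH(1), of "a i" 1] insert idx[of i] IH
      by (simp add: Ph_ev scaleC_one)
  qed
  have "(\<Sum>i\<in>I. a i * ev (n i) (int (r i)) (n k) (int (r k))) = 0"
    using Ph_eq_0[of "\<lambda>m j. \<Sum>i\<in>I. a i * ev (n i) (int (r i)) m j" "{..<3}" "n k" "int (r k)"] sum[OF order_refl] zero by simp
  moreover have "(\<Sum>i\<in>I. a i * ev (n i) (int (r i)) (n k) (int (r k))) =
      (\<Sum>i\<in>I. if i = k then a k * (if r k = 0 then 1 else 1 / 2) else 0)"
  proof (intro sum.cong refl)
    fix i assume i: "i \<in> I"
    have "i = k \<longleftrightarrow> n i = n k \<and> r i = r k" using inj i k by (auto simp: inj_on_def)
    then show "a i * ev (n i) (int (r i)) (n k) (int (r k)) = (if i = k then a k * (if r k = 0 then 1 else 1 / 2) else 0)"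
      using idx[OF i] idx[OF k] by (auto simp: ev_def kid_nat sg_def)
  qed
  ultimately show ?thesis using fin k by (auto split: if_splits)
qed

lemma dim_even: "complex_vector.dim (Ph ` Co {0}) = h + 1"
proof -
  let ?I = "{..h}"
  have ind: "inj_on (\<lambda>r. v 0 (int r)) ?I" "\<not> complex_vector.dependent ((\<lambda>r. v 0 (int r)) ` ?I)"
    by (rule independent_family; use v_independent[of ?I "\<lambda>_. 0" "\<lambda>r. r"] in \<open>force simp: inj_on_def\<close>)+
  have "Ph ` Co {0} = complex_vector.span ((\<lambda>r. v 0 (int r)) ` ?I)"
  proof
    show "complex_vector.span ((\<lambda>r. v 0 (int r)) ` ?I) \<subseteq> Ph ` Co {0}"
      by (rule complex_vector.span_minimal) (auto intro: v_Ph subspace_Ph)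
    show "Ph ` Co {0} \<subseteq> complex_vector.span ((\<lambda>r. v 0 (int r)) ` ?I)"
    proof
      fix x assume "x \<in> Ph ` Co {0}"
      then obtain f where f: "f \<in> Co {0}" "x = Ph f" by blast
      have "(\<Sum>n<3. \<Sum>r<h. (2 * f n (int r + 1)) *\<^sub>C v n (int r + 1)) = (\<Sum>r<h. (2 * f 0 (int r + 1)) *\<^sub>C v 0 (int r + 1))"
        using f(1) by (simp add: eval_nat_numeral Co_def)
      then have x: "x = f 0 0 *\<^sub>C v 0 0 + (\<Sum>r<h. (2 * f 0 (int r + 1)) *\<^sub>C v 0 (int r + 1))"
        using Ph_half[OF f(1)] f(2) by simp
      have b: "v 0 (int r) \<in> complex_vector.span ((\<lambda>r. v 0 (int r)) ` ?I)" if "r \<le> h" for r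
        by (rule complex_vector.span_base) (use that in auto)
      have "v 0 0 \<in> complex_vector.span ((\<lambda>r. v 0 (int r)) ` ?I)" using b[of 0] by simp
      moreover have "v 0 (int r + 1) \<in> complex_vector.span ((\<lambda>r. v 0 (int r)) ` ?I)" if "r < h" for r
        using b[of "Suc r"] that by (simp add: add.commute)
      ultimately show "x \<in> complex_vector.span ((\<lambda>r. v 0 (int r)) ` ?I)"
        unfolding x by (intro complex_vector.span_add complex_vector.span_sum complex_vector.span_scale) auto
    qed
  qed
  then show ?thesis
    using complex_vector.dim_span_eq_card_independent[OF ind(2)] card_image[OF ind(1)] by simp
qed

definition tv :: "int mat \<Rightarrow> nat \<Rightarrow> int \<Rightarrow> 'a" where "tv g m j = (\<Sum>i\<in>Zl. A g i j *\<^sub>C v m i)"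

lemma Ph_M: "Ph (M g f) = (\<Sum>j\<in>Zl. f 0 j *\<^sub>C tv g 0 j) +
    (\<Sum>j\<in>Zl. f 1 j *\<^sub>C (of_int (g $$ (0, 0)) *\<^sub>C tv g 1 j + of_int (g $$ (1, 0)) *\<^sub>C tv g 2 j)) +
    (\<Sum>j\<in>Zl. f 2 j *\<^sub>C (of_int (g $$ (0, 1)) *\<^sub>C tv g 1 j + of_int (g $$ (1, 1)) *\<^sub>C tv g 2 j))"
proof -
  have act: "(\<Sum>i\<in>Zl. act (A g) x i *\<^sub>C v m i) = (\<Sum>j\<in>Zl. x j *\<^sub>C tv g m j)" for x m
  proof -
    have "(\<Sum>i\<in>Zl. act (A g) x i *\<^sub>C v m i) = (\<Sum>i\<in>Zl. \<Sum>j\<in>Zl. (x j * A g i j) *\<^sub>C v m i)"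
      by (simp add: act_def complex_vector.scale_sum_left mult.commute)
    also have "\<dots> = (\<Sum>j\<in>Zl. \<Sum>i\<in>Zl. (x j * A g i j) *\<^sub>C v m i)" by (rule sum.swap)
    finally show ?thesis by (simp add: tv_def complex_vector.scale_sum_right scaleC_scaleC)
  qed
  have comb: "(\<Sum>i\<in>Zl. (a * x i + b * y i) *\<^sub>C v m i) =
      a *\<^sub>C (\<Sum>i\<in>Zl. x i *\<^sub>C v m i) + b *\<^sub>C (\<Sum>i\<in>Zl. y i *\<^sub>C v m i)" for a b m and x y :: "int \<Rightarrow> complex"
    by (simp add: scaleC_add_left sum.distrib complex_vector.scale_sum_right scaleC_scaleC)
  have scale: "a *\<^sub>C (\<Sum>j\<in>Zl. x j *\<^sub>C tv g m j) = (\<Sum>j\<in>Zl. x j *\<^sub>C (a *\<^sub>C tv g m j))" for a m and x :: "int \<Rightarrow> complex"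
    by (simp add: complex_vector.scale_sum_right scaleC_scaleC mult.commute)
  have three: "(\<Sum>n<3. G n) = G 0 + G 1 + G 2" for G :: "nat \<Rightarrow> 'a" by (simp add: eval_nat_numeral)
  have "Ph (M g f) = (\<Sum>i\<in>Zl. act (A g) (f 0) i *\<^sub>C v 0 i) +
      (\<Sum>i\<in>Zl. (of_int (g $$ (0, 0)) * act (A g) (f 1) i + of_int (g $$ (0, 1)) * act (A g) (f 2) i) *\<^sub>C v 1 i) +
      (\<Sum>i\<in>Zl. (of_int (g $$ (1, 0)) * act (A g) (f 1) i + of_int (g $$ (1, 1)) * act (A g) (f 2) i) *\<^sub>C v 2 i)"
    unfolding Ph_def three by (simp add: M_def)
  then show ?thesis
    unfolding comb act scale by (simp add: scaleC_add_right sum.distrib add_ac)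
qed

text \<open>The matrix of A g on odd functions in the basis e_j - e_(-j), 1 \<le> j \<le> h.\<close>

definition sig :: "int mat \<Rightarrow> complex mat"
  where "sig g = mat h h (\<lambda>(i, j). A g (int i + 1) (int j + 1) - A g (int i + 1) (- (int j + 1)))"

lemma sig_mult:
  assumes "g \<in> SL2Z" "g' \<in> SL2Z"
  obtains e where "e \<noteq> 0" "sig (g * g') = e \<cdot>\<^sub>m (sig g * sig g')"
proof -
  obtain e where e: "e \<noteq> 0" "A (g * g') = (\<lambda>i j. e * kmult (A g) (A g') i j)" by (rule A_mult[OF assms])
  have k: "kernel (A g)" "kernel (A g')" using assms by (auto intro: kernel_A)
  have "kmult (A g) (A g') i j - kmult (A g) (A g') i (- j) =
      (\<Sum>r<h. (A g i (int r + 1) - A g i (- (int r + 1))) * (A g' (int r + 1) j - A g' (int r + 1) (- j)))" for i j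
  proof -
    let ?D = "\<lambda>k. A g' k j - A g' k (- j)"
    have D: "?D (- k) = - ?D k" for k
      using k(2) unfolding kernel_def by (metis minus_diff_eq minus_minus)
    have per: "periodic (\<lambda>k. A g i k * ?D k)" using k by (simp add: periodic_def kernel_def)
    have "kmult (A g) (A g') i j - kmult (A g) (A g') i (- j) = (\<Sum>k\<in>Zl. A g i k * ?D k)"
      by (simp add: kmult_def right_diff_distrib sum_subtractf)
    also have "\<dots> = A g i 0 * ?D 0 + (\<Sum>r<h. A g i (int r + 1) * ?D (int r + 1) + A g i (- (int r + 1)) * ?D (- (int r + 1)))"
      by (rule sum_Zl_half[OF per])
    also have "?D 0 = 0" using D[of 0] by simp
    finally show ?thesis unfolding D by (simp add: algebra_simps)
  qed
  from this[of "int i + 1" "int j + 1" for i j] have "sig (g * g') = e \<cdot>\<^sub>m (sig g * sig g')"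
    by (intro eq_matI) (simp_all add: sig_def e(2) scalar_prod_def lessThan_atLeast0 flip: right_diff_distrib)
  then show thesis using that e(1) by blast
qed

lemma projective_sig: "projective_mat_rep h sig"
proof -
  have carrier: "sig g \<in> carrier_mat h h" for g by (simp add: sig_def)
  have "invertible_mat (sig g)" if g: "g \<in> SL2Z" for g
  proof -
    obtain g' where g': "g' \<in> SL2Z" "g * g' = 1\<^sub>m 2" "g' * g = 1\<^sub>m 2" by (rule SL2Z_inverse[OF g])
    obtain e where e: "e \<noteq> 0" "A (1\<^sub>m 2) = (\<lambda>i j. e * kid i j)" by (rule A_one)
    have one: "sig (1\<^sub>m 2) = e \<cdot>\<^sub>m 1\<^sub>m h"
      using kid_nat[of "Suc i" "Suc j" for i j]
      by (intro eq_matI) (simp_all add: sig_def e(2) add.commute)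
    obtain c where c: "c \<noteq> 0" "sig (1\<^sub>m 2) = c \<cdot>\<^sub>m (sig g * sig g')" using sig_mult[OF g g'(1)] g'(2) by auto
    obtain d where d: "d \<noteq> 0" "sig (1\<^sub>m 2) = d \<cdot>\<^sub>m (sig g' * sig g)" using sig_mult[OF g'(1) g] g'(3) by auto
    have cancel: "y = (x / u) \<cdot>\<^sub>m 1\<^sub>m h" if "x \<cdot>\<^sub>m 1\<^sub>m h = u \<cdot>\<^sub>m y" "u \<noteq> 0" "y \<in> carrier_mat h h" for x u and y :: "complex mat"
    proof (rule eq_matI)
      fix i j assume ij: "i < dim_row ((x / u) \<cdot>\<^sub>m 1\<^sub>m h)" "j < dim_col ((x / u) \<cdot>\<^sub>m 1\<^sub>m h)"
      have "(x \<cdot>\<^sub>m 1\<^sub>m h) $$ (i, j) = (u \<cdot>\<^sub>m y) $$ (i, j)" using \<open>x \<cdot>\<^sub>m 1\<^sub>m h = u \<cdot>\<^sub>m y\<close> by simp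
      then show "y $$ (i, j) = ((x / u) \<cdot>\<^sub>m 1\<^sub>m h) $$ (i, j)"
        using ij \<open>y \<in> carrier_mat h h\<close> \<open>u \<noteq> 0\<close> by (auto simp: field_simps)
    qed (use \<open>y \<in> carrier_mat h h\<close> in auto)
    have gg': "sig g * sig g' = (e / c) \<cdot>\<^sub>m 1\<^sub>m h" "sig g' * sig g = (e / d) \<cdot>\<^sub>m 1\<^sub>m h"
      using cancel[OF c(2)[unfolded one] c(1) mult_carrier_mat[OF carrier carrier]]
        cancel[OF d(2)[unfolded one] d(1) mult_carrier_mat[OF carrier carrier]] .
    let ?B = "(c / e) \<cdot>\<^sub>m sig g'"
    have ss: "x \<cdot>\<^sub>m (y \<cdot>\<^sub>m 1\<^sub>m h) = 1\<^sub>m h" if "x * y = 1" for x y :: complex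
      using that by (intro eq_matI) auto
    have right: "sig g * ?B = 1\<^sub>m h"
      using gg'(1) carrier e(1) c(1) by (simp add: mult_smult_distrib[OF carrier carrier] ss)
    have left: "((d / e) \<cdot>\<^sub>m sig g') * sig g = 1\<^sub>m h"
      using gg'(2) carrier e(1) d(1) by (simp add: mult_smult_assoc_mat[OF carrier carrier] ss)
    have B: "?B \<in> carrier_mat h h" and B': "(d / e) \<cdot>\<^sub>m sig g' \<in> carrier_mat h h" using carrier by auto
    have "(d / e) \<cdot>\<^sub>m sig g' = ((d / e) \<cdot>\<^sub>m sig g') * (sig g * ?B)"
      unfolding right using right_mult_one_mat[OF B'] by simp
    also have "\<dots> = ?B" using assoc_mult_mat[OF B' carrier B, symmetric] left left_mult_one_mat[OF B] by simp
    finally have "?B * sig g = 1\<^sub>m h" using left by simp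
    then show ?thesis
      unfolding invertible_mat_def inverts_mat_def
      using right carrier[of g] B by (auto intro!: exI[of _ ?B])
  qed
  moreover have "\<exists>e. e \<noteq> 0 \<and> sig (g * g') = e \<cdot>\<^sub>m (sig g * sig g')" if "g \<in> SL2Z" "g' \<in> SL2Z" for g g'
    using sig_mult[OF that] by blast
  ultimately show ?thesis using carrier by (simp add: projective_mat_rep_def)
qed

text \<open>A vector v n j with 1 \<le> j \<le> h stands for the pair of indices j and -j. The
  factor 2 of \<open>Ph_half\<close> cancels the 1/2 in \<open>ev\<close>, so the coefficients are
  those of \<open>sig\<close> exactly and the scalar is 1.\<close>

lemma std_tensor_rho: "std_tensor_iso (Ph ` Co {1, 2}) rho h sig"
proof -
  define w where "w a i = v (Suc a) (int (Suc i))" for a i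
  let ?u = "\<lambda>(a, i). w a i"
  let ?I = "{..<2} \<times> {..<h}"
  have zero: "c p = 0" if "(\<Sum>i\<in>?I. c i *\<^sub>C ?u i) = 0" "p \<in> ?I" for c p
    using v_independent[of ?I "\<lambda>(a, i). Suc a" "\<lambda>(a, i). Suc i" c p] that
    by (auto simp: inj_on_def w_def case_prod_beta)
  have ind: "inj_on ?u ?I" "\<not> complex_vector.dependent (?u ` ?I)"
    by (rule independent_family[of ?I ?u], simp, erule zero, assumption)+
  have wb: "w a i \<in> complex_vector.span (?u ` ?I)" if "a < 2" "i < h" for a i
    by (rule complex_vector.span_base) (use that in force)
  have half: "Ph f = (\<Sum>a<2. \<Sum>i<h. (2 * f (Suc a) (int i + 1)) *\<^sub>C w a i)" if "f \<in> Co {1, 2}" for f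
  proof -
    have "f 0 j = 0" for j using that by (simp add: Co_def)
    then show ?thesis
      unfolding Ph_half[OF that] w_def by (simp add: eval_nat_numeral add.commute)
  qed
  have span: "complex_vector.span (?u ` ?I) = Ph ` Co {1, 2}"
  proof
    show "complex_vector.span (?u ` ?I) \<subseteq> Ph ` Co {1, 2}"
    proof (rule complex_vector.span_minimal)
      have "w a i \<in> Ph ` Co {1, 2}" if "a < 2" for a i unfolding w_def by (rule v_Ph) (use that in auto)
      then show "?u ` ?I \<subseteq> Ph ` Co {1, 2}" by auto
    qed (rule subspace_Ph)
    show "Ph ` Co {1, 2} \<subseteq> complex_vector.span (?u ` ?I)"
    proof
      fix x assume "x \<in> Ph ` Co {1, 2}"
      then obtain f where f: "f \<in> Co {1, 2}" "x = Ph f" by blast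
      show "x \<in> complex_vector.span (?u ` ?I)"
        unfolding f(2) half[OF f(1)]
        by (intro complex_vector.span_sum complex_vector.span_scale wb) auto
    qed
  qed
  have act: "rho g (w b j) = 1 *\<^sub>C (\<Sum>a<2. \<Sum>i<h. (of_int (g $$ (a, b)) * sig g $$ (i, j)) *\<^sub>C w a i)"
    if g: "g \<in> SL2Z" and b: "b < 2" and j: "j < h" for g b j
  proof -
    define J where "J = int (Suc j)"
    have "b = 0 \<or> b = 1" using b by auto
    then have "{Suc b} \<subseteq> {1, 2}" by auto
    from subsetD[OF Co_mono[OF this] ev_Co] have ev: "ev (Suc b) J \<in> Co {1, 2}" .
    have k: "kernel (A g)" by (rule kernel_A[OF g])
    have ev_act: "2 * act (A g) (ev (Suc b) J (Suc b')) i = (if b' = b then A g i J - A g i (- J) else 0)" for b' i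
    proof (cases "b' = b")
      case True
      have "act (A g) (\<lambda>m. kid m x) i = A g i x" for x
        using sum_kid[OF kernel_periodic(1)[OF k], of x] by (simp add: act_def kid_commute[of _ x] mult.commute)
      moreover have "ev (Suc b) J (Suc b) = (\<lambda>m. (1 / 2) * kid m J + (- 1 / 2) * kid m (- J))"
        by (rule ext) (simp add: ev_def sg_def diff_divide_distrib)
      ultimately show ?thesis using True act_linear[of "A g" "1 / 2" "\<lambda>m. kid m J" "- 1 / 2" "\<lambda>m. kid m (- J)"] by simp
    qed (simp add: ev_def act_def)
    have M: "2 * M g (ev (Suc b) J) (Suc a) (int i + 1) = of_int (g $$ (a, b)) * sig g $$ (i, j)" if "a < 2" "i < h" for a i
    proof -
      have "2 * M g (ev (Suc b) J) (Suc a) (int i + 1) =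
          of_int (g $$ (a, 0)) * (2 * act (A g) (ev (Suc b) J (Suc 0)) (int i + 1)) +
          of_int (g $$ (a, 1)) * (2 * act (A g) (ev (Suc b) J (Suc 1)) (int i + 1))"
        using \<open>a < 2\<close> by (simp add: M_def algebra_simps numeral_2_eq_2)
      also have "\<dots> = of_int (g $$ (a, b)) * (A g (int i + 1) J - A g (int i + 1) (- J))"
        unfolding ev_act using b by (auto simp: less_2_cases_iff)
      finally show ?thesis using \<open>i < h\<close> j by (simp add: sig_def J_def add.commute)
    qed
    have "rho g (w b j) = rho g (Ph (ev (Suc b) J))" using b by (simp add: w_def J_def Ph_ev)
    also have "\<dots> = Ph (M g (ev (Suc b) J))" by (rule rho_Ph[OF ev]) simp
    also have "\<dots> = (\<Sum>a<2. \<Sum>i<h. (2 * M g (ev (Suc b) J) (Suc a) (int i + 1)) *\<^sub>C w a i)"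
      by (rule half) (rule M_Co[OF g ev], simp)
    also have "\<dots> = (\<Sum>a<2. \<Sum>i<h. (of_int (g $$ (a, b)) * sig g $$ (i, j)) *\<^sub>C w a i)"
      by (intro sum.cong refl) (simp add: M)
    finally show ?thesis by (simp add: scaleC_one)
  qed
  show ?thesis
    unfolding std_tensor_iso_def
  proof (rule exI[of _ w], intro conjI ballI)
    fix g :: "int mat" assume "g \<in> SL2Z"
    then show "\<exists>c. c \<noteq> 0 \<and> (\<forall>b<2. \<forall>j<h. rho g (w b j) =
        c *\<^sub>C (\<Sum>a<2. \<Sum>i<h. (of_int (g $$ (a, b)) * sig g $$ (i, j)) *\<^sub>C w a i))"
      using act by (intro exI[of _ 1]) auto
  qed (rule ind span)+
qed

end

section \<open>The action on the center\<close>

context odd_root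
begin

lemma degree_XX: "degree (XX k) < l" and degree_uu: "degree (uu k) < l"
proof -
  have U: "degree (chebU r) < l" if "r \<le> l" for r
    using degree_chebU_less[of r] that l_ge by (cases "r = 0") auto
  have s: "nat (k mod int l) \<le> l" using l_ge by (simp add: nat_le_iff less_imp_le)
  show "degree (XX k) < l" unfolding XX_def Let_def by (intro degree_add_less U s) simp
  show "degree (uu k) < l" unfolding uu_def Let_def
    by (intro degree_diff_less le_less_trans[OF degree_smult_le] U s) simp
qed

lemma dft_vector:
  fixes s :: "int \<Rightarrow> 'b::complex_vector"
  assumes "periodic s"
  shows "(\<Sum>i\<in>Zl. qp (- (i * j)) *\<^sub>C (\<Sum>k\<in>Zl. qp (i * k) *\<^sub>C s k)) = of_nat l *\<^sub>C s j"
proof -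
  have "(\<Sum>i\<in>Zl. qp (- (i * j)) *\<^sub>C (\<Sum>k\<in>Zl. qp (i * k) *\<^sub>C s k)) = (\<Sum>i\<in>Zl. \<Sum>k\<in>Zl. qp ((k - j) * i) *\<^sub>C s k)"
    by (simp add: complex_vector.scale_sum_right scaleC_scaleC algebra_simps flip: qp_add)
  also have "\<dots> = (\<Sum>k\<in>Zl. \<Sum>i\<in>Zl. qp ((k - j) * i) *\<^sub>C s k)" by (rule sum.swap)
  also have "\<dots> = (\<Sum>k\<in>Zl. if int l dvd k - j then of_nat l *\<^sub>C s k else 0)"
    by (intro sum.cong refl) (simp add: sum_qp flip: complex_vector.scale_sum_left)
  also have "\<dots> = of_nat l *\<^sub>C s j" by (rule sum_Zl_single) (use assms in \<open>simp add: periodic_def\<close>)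
  finally show ?thesis .
qed

end

context uqsl2_odd_irreps
begin

text \<open>The \<open>lx j\<close> span \<open>P\<close>; \<open>lu j\<close> and \<open>lw j\<close> correspond to the two basis vectors of the standard
  representation tensored with \<open>e\<^sub>j - e\<^bsub>-j\<^esub>\<close>.\<close>

definition lx :: "int \<Rightarrow> 'a" where "lx j = pev (XX j)"
definition lu :: "int \<Rightarrow> 'a" where "lu j = pev (uu j)"
definition ls :: "int \<Rightarrow> 'a" where "ls j = SL (lu j)"
definition lw :: "int \<Rightarrow> 'a" where "lw i = (1 / rl) *\<^sub>C (\<Sum>j\<in>Zl. qp (i * j) *\<^sub>C ls j)"

definition vv :: "nat \<Rightarrow> int \<Rightarrow> 'a" where "vv n = (if n = 0 then lx else if n = 1 then lu else lw)"

lemma center_lx: "lx j \<in> center" and center_lu: "lu j \<in> center"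
  by (simp_all add: lx_def lu_def pev_center)

lemma center_ls: "ls j \<in> center"
  by (simp add: ls_def SL_center center_lu)

lemma center_scale: "(x :: 'a) \<in> center \<Longrightarrow> c *\<^sub>C x \<in> center"
  by (rule complex_vector.subspace_scale[OF center_subspace])

lemma center_lw: "lw j \<in> center"
  unfolding lw_def by (intro center_scale complex_vector.subspace_sum[OF center_subspace] center_ls)

lemma center_vv: "vv n j \<in> center"
  by (simp add: vv_def center_lx center_lu center_lw)

lemma periodic_lx: "periodic lx" and periodic_lu: "periodic lu" and periodic_ls: "periodic ls"
  using periodic_XX periodic_uu by (simp_all add: periodic_def lx_def lu_def ls_def)

lemma periodic_vv: "periodic (vv n)"
proof -
  have "qp ((i + int l) * j) = qp (i * j)" for i j by (rule qp_cong) (simp add: algebra_simps)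
  then have "periodic lw" by (simp add: periodic_def lw_def)
  then show ?thesis using periodic_lx periodic_lu by (simp add: vv_def)
qed

lemma lx_minus: "lx (- j) = lx j" and lu_minus: "lu (- j) = - lu j"
  by (simp_all add: lx_def lu_def XX_minus uu_minus aev_minus)

lemma ls_minus: "ls (- j) = - ls j"
  using SL_scale[OF center_lu, of "- 1" j] by (simp add: ls_def lu_minus)

lemma lw_minus: "lw (- i) = - lw i"
proof -
  have per: "periodic (\<lambda>j. qp (- i * j) *\<^sub>C ls j)"
  proof -
    have "qp (- i * (j + int l)) = qp (- i * j)" for j by (rule qp_cong) (simp add: algebra_simps)
    then show ?thesis using periodic_ls by (simp only: periodic_def) simp
  qed
  have "(\<Sum>j\<in>Zl. qp (- i * j) *\<^sub>C ls j) = (\<Sum>j\<in>Zl. qp (- i * - j) *\<^sub>C ls (- j))"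
    by (rule sum_periodic_minus[OF per, symmetric])
  also have "\<dots> = - (\<Sum>j\<in>Zl. qp (i * j) *\<^sub>C ls j)" by (simp add: ls_minus sum_negf)
  finally show ?thesis by (simp add: lw_def)
qed

lemma vv_minus: "vv n (- j) = (if n = 0 then 1 else - 1) *\<^sub>C vv n j"
  by (simp add: vv_def lx_minus lu_minus lw_minus scaleC_one)

lemma rl_over: "rl / of_nat l = 1 / rl"
  using rl_square l_ge by (simp add: field_simps)

lemma nn_0: "nn 0 = 0"
proof -
  have "ind 0 k = 0" for k by (simp add: ind_def inwt_def)
  then show ?thesis by (simp add: nn_def el_def)
qed

lemma SL_chebU': "r \<le> l \<Longrightarrow> SL (pev (chebU r)) = (1 / rl) *\<^sub>C nn r"
  using SL_chebU[of r] SL_scale[OF pev_center, of 0 0] by (cases "r = 0") (simp_all add: nn_0 rl_over)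

text \<open>The weights of \<open>V_s\<close> and \<open>V_(l-s)\<close> together fill Z/l, so
  \<open>nn s\<close> and \<open>nn (l - s)\<close> add up to a polynomial in the Casimir
  element.\<close>

lemma SL_lx_Psi: "SL (lx j) = (1 / rl) *\<^sub>C pev (Psi j)"
proof -
  obtain s where s: "s < l" "int l dvd j - int s" by (rule residue_cases)
  have "lx j = pev (chebU s) + pev (chebU (l - s))"
    using periodic_cong[OF periodic_lx s(2)] s(1) by (simp add: lx_def XX_nat aev_add)
  then have "SL (lx j) = (1 / rl) *\<^sub>C (nn s + nn (l - s))"
    using s(1) by (simp add: SL_add pev_center SL_chebU' scaleC_add_right)
  also have "nn s + nn (l - s) = pev (Psi (int s))" using nn_complement[of s] s(1) by simp
  finally show ?thesis using Psi_cong[OF s(2)] by simp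
qed

lemma SL_lx: "SL (lx j) = (\<Sum>s\<in>Zl. (1 / rl * qp (- (s * j))) *\<^sub>C lx s)"
proof -
  have per: "periodic (\<lambda>s. qp (- (s * j)) *\<^sub>C lx s)"
  proof -
    have "qp (- ((s + int l) * j)) = qp (- (s * j))" for s by (rule qp_cong) (simp add: algebra_simps)
    then show ?thesis using periodic_lx by (simp add: periodic_def)
  qed
  have "pev (Psi j) = (\<Sum>s\<in>Zl. qp (j * s) *\<^sub>C lx s)" unfolding Psi_dft[of j] aev_sum aev_smult lx_def ..
  also have "\<dots> = (\<Sum>s\<in>Zl. qp (- (- s * j)) *\<^sub>C lx (- s))" by (simp add: lx_minus mult.commute)
  also have "\<dots> = (\<Sum>s\<in>Zl. qp (- (s * j)) *\<^sub>C lx s)" by (rule sum_periodic_minus[OF per])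
  finally show ?thesis unfolding SL_lx_Psi by (simp add: complex_vector.scale_sum_right scaleC_scaleC)
qed

lemma ls_nat:
  assumes "s < l"
  shows "ls (int s) = (1 / rl) *\<^sub>C el (\<lambda>k. smult (of_nat l * ind s k - of_nat s) (Psi (int s)))"
    and "ls (int s) = (1 / rl) *\<^sub>C (of_nat l *\<^sub>C nn s - of_nat s *\<^sub>C pev (Psi (int s)))"
proof -
  have lu: "lu (int s) = of_nat (l - s) *\<^sub>C pev (chebU s) + (- of_nat s) *\<^sub>C pev (chebU (l - s))"
    using assms by (simp add: lu_def uu_nat aev_diff aev_smult)
  have "ls (int s) = of_nat (l - s) *\<^sub>C ((1 / rl) *\<^sub>C nn s) + (- of_nat s) *\<^sub>C ((1 / rl) *\<^sub>C nn (l - s))"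
    unfolding ls_def lu SL_combination[OF pev_center pev_center] using assms by (simp only: SL_chebU' less_imp_le diff_le_self)
  also have "\<dots> = (1 / rl) *\<^sub>C (of_nat (l - s) *\<^sub>C nn s + (- of_nat s) *\<^sub>C nn (l - s))"
    by (simp add: scaleC_add_right scaleC_scaleC mult.commute complex_vector.scale_right_diff_distrib)
  also have "of_nat (l - s) *\<^sub>C nn s + (- of_nat s) *\<^sub>C nn (l - s) = of_nat l *\<^sub>C nn s - of_nat s *\<^sub>C pev (Psi (int s))"
    using assms by (simp add: nn_complement of_nat_diff complex_vector.scale_right_diff_distrib complex_vector.scale_left_diff_distrib)
  finally show 2: "ls (int s) = (1 / rl) *\<^sub>C (of_nat l *\<^sub>C nn s - of_nat s *\<^sub>C pev (Psi (int s)))" .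
  have "el (\<lambda>k. smult (of_nat l * ind s k - of_nat s) (Psi (int s))) =
      el (\<lambda>k. smult (of_nat l) (smult (ind s k) (Psi (int s))) + smult (- of_nat s) (Psi (int s)))"
    by (simp add: smult_diff_left)
  also have "\<dots> = of_nat l *\<^sub>C nn s - of_nat s *\<^sub>C pev (Psi (int s))"
    unfolding el_add el_smult nn_def el_const by simp
  finally show "ls (int s) = (1 / rl) *\<^sub>C el (\<lambda>k. smult (of_nat l * ind s k - of_nat s) (Psi (int s)))"
    unfolding 2 by simp
qed

text \<open>\<open>lw\<close> is by definition the inverse Fourier transform of \<open>ls\<close>,
  so inverting it produces the kernel of s.\<close>

lemma SL_lu: "SL (lu j) = (\<Sum>i\<in>Zl. (1 / rl * qp (- (i * j))) *\<^sub>C lw i)"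
proof -
  have "(\<Sum>i\<in>Zl. (1 / rl * qp (- (i * j))) *\<^sub>C lw i) =
      (1 / rl * (1 / rl)) *\<^sub>C (\<Sum>i\<in>Zl. qp (- (i * j)) *\<^sub>C (\<Sum>k\<in>Zl. qp (i * k) *\<^sub>C ls k))"
    by (simp add: lw_def complex_vector.scale_sum_right scaleC_scaleC mult_ac)
  also have "\<dots> = ls j"
    unfolding dft_vector[OF periodic_ls] using rl_square l_ge by (simp add: scaleC_scaleC scaleC_one field_simps)
  finally show ?thesis by (simp add: ls_def)
qed

lemma SL_lw_Mh: "SL (lw i) = (1 / rl) *\<^sub>C pev (Mh i)"
proof -
  have mem: "(\<Sum>j\<in>Zl. qp (i * j) *\<^sub>C ls j) \<in> center"
    by (intro complex_vector.subspace_sum[OF center_subspace] center_scale center_ls)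
  have "SL (lw i) = (1 / rl) *\<^sub>C (\<Sum>j\<in>Zl. qp (i * j) *\<^sub>C SL (ls j))"
    unfolding lw_def SL_scale[OF mem] by (simp add: SL_sum center_scale center_ls SL_scale)
  also have "(\<Sum>j\<in>Zl. qp (i * j) *\<^sub>C SL (ls j)) = pev (Mh i)"
    unfolding Mh_def aev_sum aev_smult ls_def SL_SL[OF center_lu] unfolding lu_def ..
  finally show ?thesis .
qed

text \<open>The sign relative to \<open>SL_lu\<close> is the entry -1 of the matrix s; it arises
  from the oddness of \<open>uu\<close> when the Fourier variable is negated.\<close>

lemma SL_lw: "SL (lw j) = - (\<Sum>i\<in>Zl. (1 / rl * qp (- (i * j))) *\<^sub>C lu i)"
proof -
  have per: "periodic (\<lambda>s. qp (- (s * j)) *\<^sub>C lu s)"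
  proof -
    have "qp (- ((s + int l) * j)) = qp (- (s * j))" for s by (rule qp_cong) (simp add: algebra_simps)
    then show ?thesis using periodic_lu by (simp add: periodic_def)
  qed
  have "pev (Mh j) = (\<Sum>s\<in>Zl. qp (j * s) *\<^sub>C lu s)" unfolding Mh_def aev_sum aev_smult lu_def ..
  also have "\<dots> = - (\<Sum>s\<in>Zl. qp (- (- s * j)) *\<^sub>C lu (- s))" by (simp add: lu_minus sum_negf mult.commute)
  also have "(\<Sum>s\<in>Zl. qp (- (- s * j)) *\<^sub>C lu (- s)) = (\<Sum>s\<in>Zl. qp (- (s * j)) *\<^sub>C lu s)" by (rule sum_periodic_minus[OF per])
  finally show ?thesis unfolding SL_lw_Mh by (simp add: complex_vector.scale_sum_right scaleC_scaleC)
qed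

lemma lift_residue:
  assumes "\<And>s. s < l \<Longrightarrow> Q (int s)" and "j \<in> Zl"
  shows "Q j"
  using assms(1)[of "nat j"] assms(2) by (auto simp: Zl_def nat_less_iff)

lemma SL_twist_lx: "SL (el ff * SL (lx j)) = hp (j\<^sup>2 - 1) *\<^sub>C lx j"
proof -
  have "el ff * pev (Psi j) = hp (j\<^sup>2 - 1) *\<^sub>C pev (Psi j)"
    using twist_Psi[of "\<lambda>_. 1" j] by (simp add: periodic_def el_const)
  then have "el ff * SL (lx j) = hp (j\<^sup>2 - 1) *\<^sub>C SL (lx j)"
    unfolding SL_lx_Psi by (simp add: sc mult.commute)
  then show ?thesis by (simp add: SL_scale SL_center center_lx SL_SL)
qed

lemma twist_ls: "s < l \<Longrightarrow> el ff * ls (int s) = hp ((int s)\<^sup>2 - 1) *\<^sub>C ls (int s)"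
  unfolding ls_nat(1) mult_scaleC_right
proof -
  have "periodic (\<lambda>k. of_nat l * ind s k - of_nat s)" using periodic_ind by (simp add: periodic_def)
  from twist_Psi[OF this, of "int s"]
  show "(1 / rl) *\<^sub>C (el ff * el (\<lambda>k. smult (of_nat l * ind s k - of_nat s) (Psi (int s)))) =
      hp ((int s)\<^sup>2 - 1) *\<^sub>C (1 / rl) *\<^sub>C el (\<lambda>k. smult (of_nat l * ind s k - of_nat s) (Psi (int s)))"
    by (simp add: scaleC_scaleC mult.commute)
qed

lemma SL_twist_lu: "j \<in> Zl \<Longrightarrow> SL (el ff * SL (lu j)) = hp (j\<^sup>2 - 1) *\<^sub>C lu j"
proof (rule lift_residue[of "\<lambda>j. SL (el ff * SL (lu j)) = hp (j\<^sup>2 - 1) *\<^sub>C lu j"])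
  fix s assume "s < l"
  then have "el ff * SL (lu (int s)) = hp ((int s)\<^sup>2 - 1) *\<^sub>C SL (lu (int s))" using twist_ls[of s] by (simp add: ls_def)
  then show "SL (el ff * SL (lu (int s))) = hp ((int s)\<^sup>2 - 1) *\<^sub>C lu (int s)" by (simp add: SL_scale SL_center center_lu SL_SL)
qed

text \<open>The derivative term of \<open>twist_Mh\<close> is \<open>rl\<close> times
  \<open>ls j\<close>, and \<open>ls j\<close> is \<open>SL\<close> of \<open>lu j\<close>. The
  outer \<open>SL\<close> turns it into the summand \<open>lu j\<close>, the off-diagonal entry of
  t.\<close>

lemma SL_twist_lw: "j \<in> Zl \<Longrightarrow> SL (el ff * SL (lw j)) = hp (j\<^sup>2 - 1) *\<^sub>C (lw j + lu j)"
proof (rule lift_residue[of "\<lambda>j. SL (el ff * SL (lw j)) = hp (j\<^sup>2 - 1) *\<^sub>C (lw j + lu j)"])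
  fix s assume s: "s < l"
  have "el (\<lambda>k. smult (of_nat l * ind s k - of_nat s) (Psi (int s))) = rl *\<^sub>C ls (int s)"
    unfolding ls_nat(1)[OF s] by (simp add: scaleC_scaleC scaleC_one)
  then have "el ff * SL (lw (int s)) = hp ((int s)\<^sup>2 - 1) *\<^sub>C (SL (lw (int s)) + SL (lu (int s)))"
    unfolding SL_lw_Mh mult_scaleC_right twist_Mh[OF s]
    by (simp add: scaleC_add_right scaleC_scaleC scaleC_one ls_def mult.commute)
  then show "SL (el ff * SL (lw (int s))) = hp ((int s)\<^sup>2 - 1) *\<^sub>C (lw (int s) + lu (int s))"
    using center_subspace center_lu center_lw
    by (simp add: SL_scale SL_add SL_center SL_SL complex_vector.subspace_add)
qed

text \<open>A relation yields a periodic family G of polynomials of degree below l that must vanish.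
  Its jumps isolate F, the Fourier transform of the \<open>lw\<close> coefficients; once F = 0,
  \<open>XX_uu_independent\<close> settles the other two components.\<close>

lemma vv_independent:
  assumes per: "\<And>n. periodic (f n)" and par: "\<And>n j. f n (- j) = (if n = 0 then 1 else - 1) * f n j"
    and zero: "(\<Sum>n<3. \<Sum>j\<in>Zl. f n j *\<^sub>C vv n j) = 0" and n: "n < 3"
  shows "f n j = 0"
proof -
  define F where "F k = (\<Sum>j\<in>Zl. qp (j * k) * f 2 j)" for k
  have F_per: "F (k + int l) = F k" for k
  proof -
    have "qp (j * (k + int l)) = qp (j * k)" for j by (rule qp_cong) (simp add: algebra_simps)
    then show ?thesis by (simp add: F_def)
  qed
  have F_odd: "F (- k) = - F k" for k
  proof -
    have "periodic (\<lambda>j. qp (j * - k) * f 2 j)"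
    proof -
      have "qp ((j + int l) * - k) = qp (j * - k)" for j by (rule qp_cong) (simp add: algebra_simps)
      then show ?thesis using per[of 2] by (simp only: periodic_def) simp
    qed
    from sum_periodic_minus[OF this] show ?thesis unfolding F_def by (simp add: par sum_negf)
  qed
  have F0: "F 0 = 0" using F_odd[of 0] by simp
  define H where "H = (\<Sum>j\<in>Zl. smult (f 0 j) (XX j) + smult (f 1 j) (uu j))"
  define G where "G \<kappa> = H + (\<Sum>k<l. smult (F (int k) / of_nat l) (smult (of_nat l * ind k \<kappa> - of_nat k) (Psi (int k))))" for \<kappa>
  have "(\<Sum>j\<in>Zl. f 2 j *\<^sub>C lw j) = (1 / rl) *\<^sub>C (\<Sum>k\<in>Zl. F k *\<^sub>C ls k)"
  proof -
    have "(\<Sum>j\<in>Zl. f 2 j *\<^sub>C lw j) = (1 / rl) *\<^sub>C (\<Sum>j\<in>Zl. \<Sum>k\<in>Zl. (qp (j * k) * f 2 j) *\<^sub>C ls k)"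
      by (simp add: lw_def complex_vector.scale_sum_right scaleC_scaleC mult_ac)
    also have "(\<Sum>j\<in>Zl. \<Sum>k\<in>Zl. (qp (j * k) * f 2 j) *\<^sub>C ls k) = (\<Sum>k\<in>Zl. \<Sum>j\<in>Zl. (qp (j * k) * f 2 j) *\<^sub>C ls k)"
      by (rule sum.swap)
    finally show ?thesis by (simp add: F_def complex_vector.scale_sum_left)
  qed
  also have "(\<Sum>k\<in>Zl. F k *\<^sub>C ls k) = (\<Sum>k<l. F (int k) *\<^sub>C ls (int k))" by (rule sum_Zl_nat)
  also have "(1 / rl) *\<^sub>C \<dots> = el (\<lambda>\<kappa>. \<Sum>k<l. smult (F (int k) / of_nat l) (smult (of_nat l * ind k \<kappa> - of_nat k) (Psi (int k))))"
    unfolding el_sum el_smult[of "F k / of_nat l" for k] complex_vector.scale_sum_right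
  proof (rule sum.cong)
    fix k assume "k \<in> {..<l}"
    have "1 / rl * F (int k) * (1 / rl) = F (int k) / of_nat l" unfolding rl_square[symmetric] by simp
    then show "(1 / rl) *\<^sub>C F (int k) *\<^sub>C ls (int k) = (F (int k) / of_nat l) *\<^sub>C el (\<lambda>\<kappa>. smult (of_nat l * ind k \<kappa> - of_nat k) (Psi (int k)))"
      using \<open>k \<in> {..<l}\<close> by (simp add: ls_nat(1) scaleC_scaleC mult.assoc)
  qed simp
  finally have w: "(\<Sum>j\<in>Zl. f 2 j *\<^sub>C lw j) = \<dots>" .
  have H: "(\<Sum>j\<in>Zl. f 0 j *\<^sub>C lx j) + (\<Sum>j\<in>Zl. f 1 j *\<^sub>C lu j) = pev H"
    by (simp add: H_def aev_sum aev_add aev_smult lx_def lu_def sum.distrib)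
  have three: "(\<Sum>n<3. X n) = X 0 + X 1 + X 2" for X :: "nat \<Rightarrow> 'a" by (simp add: eval_nat_numeral)
  have "el G = 0"
    using zero unfolding three by (simp add: vv_def w G_def[abs_def] el_add el_const flip: H)
  have "periodic G" using periodic_ind by (simp add: periodic_def G_def)
  have dH: "degree H < l"
    unfolding H_def
    by (intro degree_sum_less degree_add_less le_less_trans[OF degree_smult_le] degree_XX degree_uu) (use l_ge in auto)
  have G0: "G \<kappa> = 0" for \<kappa>
  proof (rule ccontr)
    assume "G \<kappa> \<noteq> 0"
    have "degree (G \<kappa>) < l"
      unfolding G_def
      by (intro degree_add_less dH degree_sum_less le_less_trans[OF degree_smult_le]) (use l_ge in auto)
    moreover have "PSI dvd G \<kappa>" by (rule el_eq_0_imp) fact+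
    ultimately show False using dvd_imp_degree_le[of PSI "G \<kappa>"] \<open>G \<kappa> \<noteq> 0\<close> by simp
  qed
  have F: "F \<kappa> = 0" for \<kappa>
  proof -
    have per': "periodic (\<lambda>k. smult (F k) (Psi k))"
      using F_per Psi_cong[of "k + int l" k for k] by (simp add: periodic_def)
    \<comment> \<open>H does not depend on \<kappa> and drops out, so only the jumps of the weight
      indicators remain.\<close>
    have "0 = G (\<kappa> + 1) - G (\<kappa> - 1)" by (simp add: G0)
    also have "\<dots> = (\<Sum>k<l. smult (F (int k) * (ind k (\<kappa> + 1) - ind k (\<kappa> - 1))) (Psi (int k)))"
    proof -
      have "smult (F (int k) / of_nat l) (smult (of_nat l * ind k a - of_nat k) (Psi (int k))) -
          smult (F (int k) / of_nat l) (smult (of_nat l * ind k b - of_nat k) (Psi (int k))) =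
          smult (F (int k) * (ind k a - ind k b)) (Psi (int k))" for k a b
      proof -
        have "F (int k) / of_nat l * (of_nat l * ind k a - of_nat k) - F (int k) / of_nat l * (of_nat l * ind k b - of_nat k) =
            F (int k) * (ind k a - ind k b)"
          using l_ge by (simp add: field_simps)
        then show ?thesis unfolding smult_smult smult_diff_left[symmetric] by (simp only:)
      qed
      then show ?thesis by (simp add: G_def flip: sum_subtractf)
    qed
    also have "\<dots> = (\<Sum>k<l. (if int l dvd int k - - \<kappa> then smult (F (int k)) (Psi (int k)) else 0) -
        (if int l dvd int k - \<kappa> then smult (F (int k)) (Psi (int k)) else 0))"
    proof (rule sum.cong)
      fix k assume k: "k \<in> {..<l}"
      show "smult (F (int k) * (ind k (\<kappa> + 1) - ind k (\<kappa> - 1))) (Psi (int k)) =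
        (if int l dvd int k - - \<kappa> then smult (F (int k)) (Psi (int k)) else 0) -
        (if int l dvd int k - \<kappa> then smult (F (int k)) (Psi (int k)) else 0)"
      proof (cases "k = 0")
        case True
        then show ?thesis by (simp add: F0)
      next
        case False
        then show ?thesis using ind_jump[of k \<kappa>] k by (simp add: dvd_diff_commute[of _ \<kappa>] add.commute)
      qed
    qed simp
    also have "\<dots> = (\<Sum>k\<in>Zl. if int l dvd k - - \<kappa> then smult (F k) (Psi k) else 0) -
        (\<Sum>k\<in>Zl. if int l dvd k - \<kappa> then smult (F k) (Psi k) else 0)"
      unfolding sum_Zl_nat by (rule sum_subtractf)
    also have "\<dots> = smult (F (- \<kappa>)) (Psi (- \<kappa>)) - smult (F \<kappa>) (Psi \<kappa>)"
      by (simp only: sum_Zl_single[OF per'])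
    also have "\<dots> = smult (- 2 * F \<kappa>) (Psi \<kappa>)" unfolding Psi_minus F_odd
      by (simp add: smult_add_left[of "- F \<kappa>" "- F \<kappa>", simplified])
    finally show "F \<kappa> = 0" by (metis smult_eq_0_iff Psi_nonzero mult_eq_0_iff neg_equal_0_iff_equal zero_neq_numeral)
  qed
  have f2: "f 2 a = 0" for a
    using dft_inversion[OF per[of 2], of a] l_ge F unfolding F_def by simp
  have "H = 0" using G0[of 0] F by (simp add: G_def)
  have f01: "f 0 a = 0 \<and> f 1 a = 0" for a
    by (rule XX_uu_independent[OF per[of 0] per[of 1]]) (use \<open>H = 0\<close> par[of 0] par[of 1] in \<open>simp_all add: H_def\<close>)
  consider "n = 0" | "n = 1" | "n = 2" using n by linarith
  then show ?thesis using f2 f01 by cases auto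
qed

end

section \<open>Assembly of the decomposition\<close>

context uqsl2_odd_irreps
begin

lemma center_sum_linear:
  fixes T :: "'a \<Rightarrow> 'a"
  assumes add: "\<And>x y. x \<in> center \<Longrightarrow> y \<in> center \<Longrightarrow> T (x + y) = T x + T y"
    and scale: "\<And>c x. x \<in> center \<Longrightarrow> T (c *\<^sub>C x) = c *\<^sub>C T x"
    and u: "\<And>i. u i \<in> center"
  shows "T (\<Sum>i\<in>I. a i *\<^sub>C u i) = (\<Sum>i\<in>I. a i *\<^sub>C T (u i))"
proof (induction I rule: infinite_finite_induct)
  case (insert i I)
  have "(\<Sum>i\<in>I. a i *\<^sub>C u i) \<in> center" by (intro complex_vector.subspace_sum[OF center_subspace] center_scale u)
  then show ?case using insert by (simp add: add scale u center_scale)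
qed (use scale[of 0 0] center_subspace in \<open>auto simp: complex_vector.subspace_def\<close>)

lemma chebU_lx_lu: "r \<le> l \<Longrightarrow> pev (chebU r) = (1 / of_nat l) *\<^sub>C (of_nat r *\<^sub>C lx (int r) + lu (int r))"
proof -
  assume r: "r \<le> l"
  have "of_nat r *\<^sub>C lx (int r) + lu (int r) = pev (smult (of_nat r) (XX (int r)) + uu (int r))"
    by (simp add: lx_def lu_def aev_add aev_smult)
  also have "smult (of_nat r) (XX (int r)) + uu (int r) = smult (of_nat l) (chebU r)"
    using r by (simp add: XX_nat uu_nat smult_add_right of_nat_diff flip: smult_add_left smult_diff_left)
  finally show ?thesis using l_ge by (simp add: aev_smult scaleC_scaleC scaleC_one)
qed

definition chebU_span_set :: "'a set"
  where "chebU_span_set = complex_vector.span ((\<lambda>r. pev (chebU r)) ` {1..l})"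

definition nn_span_set :: "'a set"
  where "nn_span_set = complex_vector.span ((\<lambda>r. (rl / of_nat l) *\<^sub>C nn r) ` {1..l})"

lemma chebU_span_set_mem: "r \<le> l \<Longrightarrow> pev (chebU r) \<in> chebU_span_set"
  unfolding chebU_span_set_def
  by (cases "r = 0") (auto intro: complex_vector.span_base simp: complex_vector.span_zero)

lemma nn_span_set_mem: "r \<le> l \<Longrightarrow> (1 / rl) *\<^sub>C nn r \<in> nn_span_set"
  unfolding nn_span_set_def rl_over
  by (cases "r = 0") (auto intro: complex_vector.span_base simp: complex_vector.span_zero nn_0)

lemma SL_nn_span_set: "z \<in> nn_span_set \<Longrightarrow> z \<in> center \<and> SL z \<in> chebU_span_set"
proof -
  have "nn_span_set \<subseteq> {z \<in> center. SL z \<in> chebU_span_set}"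
    unfolding nn_span_set_def
  proof (rule complex_vector.span_minimal)
    show "(\<lambda>r. (rl / of_nat l) *\<^sub>C nn r) ` {1..l} \<subseteq> {z \<in> center. SL z \<in> chebU_span_set}"
      using chebU_span_set_mem
      by (auto simp: SL_scale nn_central SL_nn scaleC_scaleC rl_over scaleC_one intro!: center_scale)
    have "SL 0 = 0" using SL_scale[of 0 0] center_subspace by (simp add: complex_vector.subspace_def)
    then show "complex_vector.subspace {z \<in> center. SL z \<in> chebU_span_set}"
      using center_subspace complex_vector.subspace_span[of "(\<lambda>r. pev (chebU r)) ` {1..l}"]
      unfolding chebU_span_set_def[symmetric]
      by (simp add: complex_vector.subspace_def SL_add SL_scale)
  qed
  then show "z \<in> nn_span_set \<Longrightarrow> z \<in> center \<and> SL z \<in> chebU_span_set" by blast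
qed

text \<open>\<open>SL\<close> maps every \<open>lx j\<close> into the span of the \<open>nn\<close>.
  By \<open>SL_lx\<close> the family is stable under the involution \<open>SL\<close>, so each
  \<open>lx j\<close> is a combination of such images.\<close>

lemma lx_chebU_span_set: "lx j \<in> chebU_span_set" and lx_nn_span_set: "lx j \<in> nn_span_set"
proof -
  have sp: "complex_vector.subspace chebU_span_set" "complex_vector.subspace nn_span_set"
    by (simp_all add: chebU_span_set_def nn_span_set_def complex_vector.subspace_span)
  have lx: "lx j \<in> chebU_span_set \<and> SL (lx j) \<in> nn_span_set" for j
  proof -
    obtain s where s: "s < l" "int l dvd j - int s" by (rule residue_cases)
    have eq: "lx j = pev (chebU s) + pev (chebU (l - s))"
      using periodic_cong[OF periodic_lx s(2)] s(1) by (simp add: lx_def XX_nat aev_add)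
    then have "SL (lx j) = (1 / rl) *\<^sub>C nn s + (1 / rl) *\<^sub>C nn (l - s)"
      using s(1) by (simp add: SL_add pev_center SL_chebU')
    then show ?thesis
      using s(1) eq chebU_span_set_mem nn_span_set_mem by (simp add: complex_vector.subspace_add[OF sp(1)] complex_vector.subspace_add[OF sp(2)])
  qed
  then show "lx j \<in> chebU_span_set" by blast
  have "lx j = SL (SL (lx j))" by (simp add: SL_SL center_lx)
  also have "\<dots> = (\<Sum>s\<in>Zl. (1 / rl * qp (- (s * j))) *\<^sub>C SL (lx s))"
    unfolding SL_lx[of j] by (rule center_sum_linear[of SL, OF SL_add SL_scale center_lx])
  also have "\<dots> \<in> nn_span_set"
    by (intro complex_vector.subspace_sum[OF sp(2)] complex_vector.subspace_scale[OF sp(2)]) (use lx in blast)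
  finally show "lx j \<in> nn_span_set" .
qed

text \<open>p^(l+1) is q^(h+1) because l + 1 = 2(h + 1), and it is -p because p^l = -1.\<close>

lemma minus_hp_1:
  assumes "p\<^sup>2 = q" "p ^ l = - 1"
  shows "p = - hp 1"
proof -
  have "hp 1 = q ^ (h + 1)" by (simp add: hp_def qp_def power_int_def nat_add_distrib)
  also have "\<dots> = p ^ (2 * (h + 1))" by (simp only: assms(1)[symmetric] power_mult)
  also have "2 * (h + 1) = l + 1" by (simp add: l_eq)
  also have "p ^ (l + 1) = - p" using assms(2) by simp
  finally show ?thesis by simp
qed

text \<open>Replacing p by -\<open>hp 1\<close> produces a sign with exponent r^2 - 1. Together with
  r + 1 the exponent is r (r + 1), which is even.\<close>

lemma T_semi_entry:
  assumes "p\<^sup>2 = q" "p ^ l = - 1" and r: "1 \<le> r"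
  shows "(- 1) ^ (r + 1) * p ^ (r\<^sup>2 - 1) = hp ((int r)\<^sup>2 - 1)"
proof -
  have pow: "hp 1 ^ n = hp (int n)" for n
    by (induction n) (simp_all add: hp_add)
  have "r + 1 + (r\<^sup>2 - 1) = r * (r + 1)" using r by (simp add: power2_eq_square)
  then have "even (r + 1 + (r\<^sup>2 - 1))" by (simp only: even_mult_iff) simp
  then have sign: "(- 1 :: complex) ^ (r + 1) * (- 1) ^ (r\<^sup>2 - 1) = 1" by (simp only: power_add[symmetric] neg_one_even_power)
  have "p ^ (r\<^sup>2 - 1) = (- 1) ^ (r\<^sup>2 - 1) * hp 1 ^ (r\<^sup>2 - 1)"
    unfolding minus_hp_1[OF assms(1,2)] by (rule power_minus)
  then have "(- 1) ^ (r + 1) * p ^ (r\<^sup>2 - 1) = ((- 1) ^ (r + 1) * (- 1) ^ (r\<^sup>2 - 1)) * hp 1 ^ (r\<^sup>2 - 1)"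
    by (simp only: mult.assoc)
  also have "\<dots> = hp (int (r\<^sup>2 - 1))" unfolding sign pow by simp
  also have "int (r\<^sup>2 - 1) = (int r)\<^sup>2 - 1" using r by (simp add: of_nat_diff)
  finally show ?thesis .
qed

lemma br_1_nonzero: "br 1 \<noteq> 0"
proof -
  have "\<not> int l dvd 2" using l_ge zdvd_imp_le[of "int l" 2] by auto
  then have "qp 1 \<noteq> qp (- 1)" unfolding qp_eq_iff by simp
  then show ?thesis by (simp add: br_def)
qed

theorem decomposition:
  assumes ribbon: "ribbon_element Rm \<Delta> \<epsilon> S \<theta>" and \<kappa>: "\<kappa> \<noteq> 0" and p: "p\<^sup>2 = q" "p ^ l = - 1"
    and P: "P = complex_vector.span ((\<lambda>r. drinfeld Rm (qCh_mod l K (V r))) ` {1..l}) \<inter>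
      complex_vector.span ((\<lambda>r. radford \<Delta> Lam (qCh_mod l K (V r))) ` {1..l})"
  shows "\<exists>\<rho>. projective_rep_on center \<rho> \<and>
    (\<forall>z\<in>center. \<rho> s_mat z = S_LM Rm \<Delta> S Lam z \<and> \<rho> t_mat z = T_LM Rm \<Delta> S Lam \<theta> \<kappa> z) \<and>
    P \<subseteq> center \<and> projective_rep_on P \<rho> \<and> complex_vector.dim P = h + 1 \<and>
    (\<exists>W. W \<subseteq> center \<and> projective_rep_on W \<rho> \<and>
      P \<inter> W = {0} \<and> {x + y | x y. x \<in> P \<and> y \<in> W} = center \<and>
      (\<exists>\<sigma>. projective_mat_rep h \<sigma> \<and>
        (\<exists>c. c \<noteq> 0 \<and> \<sigma> s_mat = c \<cdot>\<^sub>m S_semi h q) \<and>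
        (\<exists>c. c \<noteq> 0 \<and> \<sigma> t_mat = c \<cdot>\<^sub>m T_semi h p) \<and>
        std_tensor_iso W \<rho> h \<sigma>))"
proof -
  let ?weil = "\<lambda>g. weil (g $$ (0, 0)) (g $$ (0, 1)) (g $$ (1, 0)) (g $$ (1, 1))"
  \<comment> \<open>Prescribed on s and t so that \<open>rho\<close> reproduces \<open>S_LM\<close>
    and \<open>T_LM\<close> with their scalars; the factor \<open>hp (- 1)\<close> supplies the -1
    in j^2 - 1. For the other matrices any operator will do.\<close>
  define A where "A g = (if g = s_mat then (\<lambda>i j. 1 / rl * qp (- (i * j)))
    else if g = t_mat then kdiag (\<kappa> * hp (- 1)) 1 else SOME A. \<exists>A'. ?weil g A A')" for g
  have st: "s_mat $$ (0, 0) = 0" "s_mat $$ (0, 1) = - 1" "s_mat $$ (1, 0) = 1" "s_mat $$ (1, 1) = 0"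
    "t_mat $$ (0, 0) = 1" "t_mat $$ (0, 1) = 1" "t_mat $$ (1, 0) = 0" "t_mat $$ (1, 1) = 1"
    by (simp_all add: s_mat_def t_mat_def mat_of_rows_list_def)
  then have ne: "s_mat \<noteq> t_mat" by force
  have A_s: "A s_mat = (\<lambda>i j. 1 / rl * qp (- (i * j)))" and A_t: "A t_mat = kdiag (\<kappa> * hp (- 1)) 1"
    using ne by (simp_all add: A_def)
  have weil_A: "\<exists>A'. ?weil g (A g) A'" if g: "g \<in> SL2Z" for g
  proof -
    consider "g = s_mat" | "g = t_mat" | "g \<noteq> s_mat" "g \<noteq> t_mat" by blast
    then show ?thesis
    proof cases
      case 1
      have "1 / rl * (1 / rl) * of_nat l = 1" unfolding rl_square[symmetric] by simp
      from weil_s[OF this] show ?thesis unfolding 1 st A_s by blast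
    next
      case 2
      have "\<kappa> * hp (- 1) * inverse (\<kappa> * hp (- 1)) = 1" using \<kappa> by (intro right_inverse) simp
      from weil_t[OF this, of 1] show ?thesis unfolding 2 st A_t by blast
    next
      case 3
      have "\<exists>A A'. ?weil g A A'" by (rule weil_exists) (rule SL2Z_det[OF g])
      from someI_ex[OF this] show ?thesis using 3 by (simp add: A_def)
    qed
  qed
  interpret wm: weil_module l h q A vv
  proof
    show "\<exists>A'. ?weil g (A g) A'" if "g \<in> SL2Z" for g by (rule weil_A[OF that])
    show "periodic (vv n)" for n by (rule periodic_vv)
    show "vv n (- j) = (if n = 0 then 1 else - 1) *\<^sub>C vv n j" for n j by (rule vv_minus)
    show "f n j = 0" if "\<And>n. periodic (f n)" "\<And>n j. f n (- j) = (if n = 0 then 1 else - 1) * f n j"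
      "(\<Sum>n<3. \<Sum>j\<in>Zl. f n j *\<^sub>C vv n j) = 0" "n < 3" for f n j
      using that by (rule vv_independent)
  qed
  let ?all = "{..<3} :: nat set"
  have three: "(\<Sum>n<3. X n) = X 0 + X 1 + X 2" for X :: "nat \<Rightarrow> 'a" by (simp add: eval_nat_numeral)
  have Ph_vv: "wm.Ph f = (\<Sum>j\<in>Zl. f 0 j *\<^sub>C lx j) + (\<Sum>j\<in>Zl. f 1 j *\<^sub>C lu j) + (\<Sum>j\<in>Zl. f 2 j *\<^sub>C lw j)" for f
    unfolding wm.Ph_def three by (simp add: vv_def)
  have Ph_center: "wm.Ph f \<in> center" for f
    unfolding wm.Ph_def
    by (intro complex_vector.subspace_sum[OF center_subspace] center_scale center_vv)
  have memv: "lx j \<in> wm.Ph ` wm.Co J" if "0 \<in> J" for j J using wm.v_Ph[of 0 J j] that by (simp add: vv_def)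
  have memu: "lu j \<in> wm.Ph ` wm.Co J" if "1 \<in> J" for j J using wm.v_Ph[of 1 J j] that by (simp add: vv_def)
  have memw: "lw j \<in> wm.Ph ` wm.Co J" if "2 \<in> J" for j J using wm.v_Ph[of 2 J j] that by (simp add: vv_def)
  note Psub = wm.subspace_Ph
  have mem_cheb: "pev (chebU r) \<in> wm.Ph ` wm.Co J" if "r \<le> l" "0 \<in> J" "1 \<in> J" for r J
    unfolding chebU_lx_lu[OF that(1)]
    by (intro complex_vector.subspace_scale[OF Psub] complex_vector.subspace_add[OF Psub] memv memu that)
  have mem_Psi: "pev (Psi j) \<in> wm.Ph ` wm.Co ?all" for j
  proof -
    have "pev (Psi j) = (\<Sum>s\<in>Zl. qp (j * s) *\<^sub>C lx s)" unfolding Psi_dft[of j] aev_sum aev_smult lx_def ..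
    then show ?thesis by (simp add: complex_vector.subspace_sum[OF Psub] complex_vector.subspace_scale[OF Psub] memv)
  qed
  have mem_ls: "ls j \<in> wm.Ph ` wm.Co ?all" for j
  proof -
    have "ls j = (\<Sum>i\<in>Zl. (1 / rl * qp (- (i * j))) *\<^sub>C lw i)" using SL_lu by (simp add: ls_def)
    then show ?thesis by (simp add: complex_vector.subspace_sum[OF Psub] complex_vector.subspace_scale[OF Psub] memw)
  qed
  have mem_nn: "nn s \<in> wm.Ph ` wm.Co ?all" if s: "s < l" for s
  proof -
    have "of_nat l *\<^sub>C nn s = rl *\<^sub>C ls (int s) + of_nat s *\<^sub>C pev (Psi (int s))"
      unfolding ls_nat(2)[OF s] by (simp add: scaleC_scaleC scaleC_one)
    then have "nn s = (1 / of_nat l) *\<^sub>C (rl *\<^sub>C ls (int s) + of_nat s *\<^sub>C pev (Psi (int s)))"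
      using l_ge by (simp add: scaleC_scaleC scaleC_one flip: \<open>of_nat l *\<^sub>C nn s = _\<close>)
    also have "\<dots> \<in> wm.Ph ` wm.Co ?all"
      by (intro complex_vector.subspace_scale[OF Psub] complex_vector.subspace_add[OF Psub] mem_ls mem_Psi)
    finally show ?thesis .
  qed
  have center: "center = wm.Ph ` wm.Co ?all"
  proof
    show "wm.Ph ` wm.Co ?all \<subseteq> center" using Ph_center by blast
    show "center \<subseteq> wm.Ph ` wm.Co ?all"
    proof
      fix z :: 'a assume "z \<in> center"
      then show "z \<in> wm.Ph ` wm.Co ?all"
      proof (induction z rule: center_induct)
        case (combination c d x y)
        then show ?case by (intro complex_vector.subspace_scale[OF Psub] complex_vector.subspace_add[OF Psub])
      qed (auto intro: mem_cheb mem_nn)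
    qed
  qed
  have rho_eq: "wm.rho g z = T z" if z: "z \<in> center"
    and T: "\<And>x y. x \<in> center \<Longrightarrow> y \<in> center \<Longrightarrow> T (x + y) = T x + T y" "\<And>c x. x \<in> center \<Longrightarrow> T (c *\<^sub>C x) = c *\<^sub>C T x"
    and Tv: "\<And>j. j \<in> Zl \<Longrightarrow> T (lx j) = wm.tv g 0 j"
      "\<And>j. j \<in> Zl \<Longrightarrow> T (lu j) = of_int (g $$ (0, 0)) *\<^sub>C wm.tv g 1 j + of_int (g $$ (1, 0)) *\<^sub>C wm.tv g 2 j"
      "\<And>j. j \<in> Zl \<Longrightarrow> T (lw j) = of_int (g $$ (0, 1)) *\<^sub>C wm.tv g 1 j + of_int (g $$ (1, 1)) *\<^sub>C wm.tv g 2 j"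
    for g z and T :: "'a \<Rightarrow> 'a"
  proof -
    obtain f where f: "f \<in> wm.Co ?all" "z = wm.Ph f" using z center by blast
    have c: "(\<Sum>j\<in>Zl. a j *\<^sub>C u j) \<in> center" if "\<And>j. u j \<in> center" for a and u :: "int \<Rightarrow> 'a"
      by (intro complex_vector.subspace_sum[OF center_subspace] center_scale that)
    have sum: "T (\<Sum>j\<in>Zl. a j *\<^sub>C u j) = (\<Sum>j\<in>Zl. a j *\<^sub>C T (u j))" if "\<And>j. u j \<in> center" for a and u :: "int \<Rightarrow> 'a"
      by (rule center_sum_linear) (simp_all add: T that)
    have "T z = T (\<Sum>j\<in>Zl. f 0 j *\<^sub>C lx j) + T (\<Sum>j\<in>Zl. f 1 j *\<^sub>C lu j) + T (\<Sum>j\<in>Zl. f 2 j *\<^sub>C lw j)"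
      unfolding f(2) Ph_vv
      by (simp only: T(1) c center_lx center_lu center_lw complex_vector.subspace_add[OF center_subspace])
    also have "\<dots> = (\<Sum>j\<in>Zl. f 0 j *\<^sub>C T (lx j)) + (\<Sum>j\<in>Zl. f 1 j *\<^sub>C T (lu j)) + (\<Sum>j\<in>Zl. f 2 j *\<^sub>C T (lw j))"
      unfolding sum[OF center_lx] sum[OF center_lu] sum[OF center_lw] ..
    also have "\<dots> = wm.Ph (wm.M g f)"
      unfolding wm.Ph_M by (intro arg_cong2[of _ _ _ _ "(+)"] sum.cong refl) (simp_all only: Tv)
    also have "\<dots> = wm.rho g z" unfolding f(2) by (rule wm.rho_Ph[OF f(1) order_refl, symmetric])
    finally show ?thesis by simp
  qed
  have vv: "vv 0 = lx" "vv 1 = lu" "vv 2 = lw" by (simp_all add: vv_def)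
  have rho_s: "wm.rho s_mat z = SL z" if "z \<in> center" for z
    by (rule rho_eq[OF that SL_add SL_scale])
      (simp_all only: wm.tv_def A_s vv st SL_lx SL_lu SL_lw of_int_0 of_int_1 of_int_minus, simp_all add: scaleC_one)
  have tv_t: "wm.tv t_mat m j = (\<kappa> * hp (j\<^sup>2 - 1)) *\<^sub>C vv m j" for m j
  proof -
    have "wm.tv t_mat m j = (\<Sum>i\<in>Zl. if int l dvd i - j then (\<kappa> * hp (- 1) * hp (1 * i\<^sup>2)) *\<^sub>C vv m i else 0)"
      unfolding wm.tv_def A_t kdiag_def by (intro sum.cong) auto
    also have "\<dots> = (\<kappa> * hp (- 1) * hp (1 * j\<^sup>2)) *\<^sub>C vv m j"
    proof (rule sum_Zl_single)
      have "hp (1 * (i + int l)\<^sup>2) = hp (1 * i\<^sup>2)" for i by (rule hp_square_cong) simp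
      then show "periodic (\<lambda>i. (\<kappa> * hp (- 1) * hp (1 * i\<^sup>2)) *\<^sub>C vv m i)"
        using periodic_vv by (simp add: periodic_def)
    qed
    also have "\<kappa> * hp (- 1) * hp (1 * j\<^sup>2) = \<kappa> * hp (j\<^sup>2 - 1)"
      by (simp add: mult.assoc flip: hp_add)
    finally show ?thesis .
  qed
  have tw: "el ff * x \<in> center" if "x \<in> center" for x
  proof -
    have 1: "el ff * y = y * el ff" and 2: "x * y = y * x" for y
      using ribbon_inverse(2)[OF ribbon] that by (auto simp: center_def)
    have "el ff * x * y = el ff * y * x" for y by (simp add: mult.assoc 2)
    then have "el ff * x * y = y * (el ff * x)" for y by (simp only: 1 mult.assoc)
    then show ?thesis by (simp add: center_def)
  qed
  have rho_t: "wm.rho t_mat z = T_LM Rm \<Delta> S Lam \<theta> \<kappa> z" if z: "z \<in> center" for z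
  proof -
    have "wm.rho t_mat z = \<kappa> *\<^sub>C SL (el ff * SL z)"
    proof (rule rho_eq[OF z])
      show "\<kappa> *\<^sub>C SL (el ff * SL (x + y)) = \<kappa> *\<^sub>C SL (el ff * SL x) + \<kappa> *\<^sub>C SL (el ff * SL y)"
        if "x \<in> center" "y \<in> center" for x y
        using that by (simp add: SL_add SL_center distrib_left tw scaleC_add_right)
      show "\<kappa> *\<^sub>C SL (el ff * SL (c *\<^sub>C x)) = c *\<^sub>C \<kappa> *\<^sub>C SL (el ff * SL x)" if "x \<in> center" for c x
        using that by (simp add: SL_scale SL_center mult_scaleC_right tw scaleC_scaleC mult.commute)
    qed (simp_all only: SL_twist_lx SL_twist_lu SL_twist_lw tv_t vv st of_int_0 of_int_1,
        simp_all add: scaleC_scaleC scaleC_one scaleC_add_right add.commute)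
    also have "\<dots> = T_LM Rm \<Delta> S Lam \<theta> \<kappa> z"
      unfolding T_LM_def SL_def[symmetric] ribbon_inverse(1)[OF ribbon] using z by (simp add: inv_SL tw SL_center)
    finally show ?thesis .
  qed
  have P': "P = chebU_span_set \<inter> nn_span_set"
  proof -
    have "(\<lambda>r. drinfeld Rm (qCh_mod l K (V r))) ` {1..l} = (\<lambda>r. pev (chebU r)) ` {1..l}"
      by (intro image_cong refl) (simp add: drinfeld_qCh_mod[OF irrep])
    moreover have "(\<lambda>r. radford \<Delta> Lam (qCh_mod l K (V r))) ` {1..l} = (\<lambda>r. (rl / of_nat l) *\<^sub>C nn r) ` {1..l}"
      by (intro image_cong refl) (simp add: radford_qCh_mod[OF irrep])
    ultimately show ?thesis unfolding P chebU_span_set_def nn_span_set_def by (simp only:)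
  qed
  \<comment> \<open>For the inclusion of P in the even part: an element of P has no
    \<open>lw\<close> component, and neither has its image under \<open>SL\<close>. Since
    \<open>SL\<close> sends the \<open>lu\<close> component to \<open>lw\<close> by a Fourier
    transform, that component is 0.\<close>
  have P_eq: "P = wm.Ph ` wm.Co {0}"
  proof
    have sp: "complex_vector.subspace (chebU_span_set \<inter> nn_span_set)"
      by (intro complex_vector.subspace_inter) (simp_all add: chebU_span_set_def nn_span_set_def complex_vector.subspace_span)
    show "wm.Ph ` wm.Co {0} \<subseteq> P"
    proof
      fix x assume "x \<in> wm.Ph ` wm.Co {0}"
      then obtain f where f: "f \<in> wm.Co {0}" "x = wm.Ph f" by blast
      have "f 1 j = 0" "f 2 j = 0" for j using f(1) by (simp_all add: wm.Co_def)
      then have "x = (\<Sum>j\<in>Zl. f 0 j *\<^sub>C lx j)" unfolding f(2) Ph_vv by simp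
      then show "x \<in> P"
        unfolding P' using lx_chebU_span_set lx_nn_span_set
        by (auto intro!: complex_vector.subspace_sum[OF sp, unfolded Int_iff] complex_vector.subspace_scale[OF sp, unfolded Int_iff])
    qed
    have cheb: "chebU_span_set \<subseteq> wm.Ph ` wm.Co {0, 1}"
      unfolding chebU_span_set_def by (rule complex_vector.span_minimal) (auto intro: mem_cheb Psub)
    show "P \<subseteq> wm.Ph ` wm.Co {0}"
    proof
      fix z assume "z \<in> P"
      then have z: "z \<in> chebU_span_set" "z \<in> center" "SL z \<in> chebU_span_set"
        using SL_nn_span_set by (auto simp: P')
      obtain f where f: "f \<in> wm.Co {0, 1}" "z = wm.Ph f" using z(1) cheb by blast
      obtain f' where f': "f' \<in> wm.Co {0, 1}" "SL z = wm.Ph f'" using z(3) cheb by blast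
      have mono: "wm.Co {0, 1} \<subseteq> wm.Co ?all" by (rule wm.Co_mono) auto
      have "wm.Ph (wm.M s_mat f) = wm.Ph f'"
        using wm.rho_Ph[OF f(1), of s_mat] rho_s[OF z(2)] f(2) f'(2) by simp
      then have "wm.M s_mat f = f'"
        using inj_onD[OF wm.inj_Ph _ wm.M_Co[OF s_mat_SL2Z subsetD[OF mono f(1)]] subsetD[OF mono f'(1)]] by simp
      then have "wm.M s_mat f 2 i = 0" for i using f'(1) by (simp add: wm.Co_def)
      then have act: "act (A s_mat) (f 1) i = 0" for i
        by (simp add: wm.M_def st[simplified])
      have "f 1 j = 0" for j
      proof -
        have per: "periodic (f 1)" using f(1) by (simp add: wm.Co_def)
        have "(\<Sum>k\<in>Zl. qp (k * i) * f 1 k) = 0" for i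
          using act[of "- i"] by (simp add: act_def A_s mult.commute flip: sum_divide_distrib)
        then show ?thesis using dft_inversion[OF per, of j] l_ge by simp
      qed
      then have "f \<in> wm.Co {0}" using f(1) by (auto simp: wm.Co_def)
      then show "z \<in> wm.Ph ` wm.Co {0}" using f(2) by blast
    qed
  qed
  define W where "W = wm.Ph ` wm.Co {1, 2}"
  have PW: "P \<inter> W = {0}"
  proof -
    have "x = 0" if "x \<in> P" "x \<in> W" for x
    proof -
      obtain f g where fg: "f \<in> wm.Co {0}" "x = wm.Ph f" "g \<in> wm.Co {1, 2}" "x = wm.Ph g"
        using \<open>x \<in> P\<close> \<open>x \<in> W\<close> unfolding P_eq W_def by blast
      have mono: "wm.Co {0} \<subseteq> wm.Co ?all" "wm.Co {1, 2} \<subseteq> wm.Co ?all" by (rule wm.Co_mono; auto)+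
      have "f = g"
        using inj_onD[OF wm.inj_Ph _ subsetD[OF mono(1) fg(1)] subsetD[OF mono(2) fg(3)]] fg(2,4) by simp
      then have "f n j = 0" for n j using fg(1,3) by (cases "n = 0") (auto simp: wm.Co_def)
      then show ?thesis unfolding fg(2) wm.Ph_def by simp
    qed
    then show ?thesis
      using complex_vector.subspace_0[OF Psub] unfolding P_eq W_def by blast
  qed
  have sum: "{x + y | x y. x \<in> P \<and> y \<in> W} = center"
  proof
    show "{x + y | x y. x \<in> P \<and> y \<in> W} \<subseteq> center"
      using Ph_center complex_vector.subspace_add[OF center_subspace] unfolding P_eq W_def by auto
    show "center \<subseteq> {x + y | x y. x \<in> P \<and> y \<in> W}"
    proof
      fix z :: 'a assume "z \<in> center"
      then obtain f where f: "f \<in> wm.Co ?all" "z = wm.Ph f" using center by blast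
      define f0 f1 where "f0 n j = (if n = 0 then f n j else 0)" and "f1 n j = (if n = 0 then 0 else f n j)" for n :: nat and j :: int
      have "f0 \<in> wm.Co {0}" "f1 \<in> wm.Co {1, 2}"
        using f(1) by (auto simp: wm.Co_def f0_def f1_def periodic_def)
      moreover have "f = (\<lambda>n j. 1 * f0 n j + 1 * f1 n j)" by (intro ext) (simp add: f0_def f1_def)
      then have "z = wm.Ph f0 + wm.Ph f1" unfolding f(2) using wm.Ph_combination[of 1 f0 1 f1] by (simp add: scaleC_one)
      ultimately show "z \<in> {x + y | x y. x \<in> P \<and> y \<in> W}" unfolding P_eq W_def by blast
    qed
  qed
  \<comment> \<open>Restricting the Fourier kernel to odd functions gives (q^(-m) - q^m) /
    \<open>rl\<close> with m = (i + 1)(j + 1), which is [m] times the constant -(q - 1/q) /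
    \<open>rl\<close>.\<close>
  have sig_s: "wm.sig s_mat = (- (br 1 / rl)) \<cdot>\<^sub>m S_semi h q"
  proof (rule eq_matI)
    fix i j assume "i < dim_row (- (br 1 / rl) \<cdot>\<^sub>m S_semi h q)" "j < dim_col (- (br 1 / rl) \<cdot>\<^sub>m S_semi h q)"
    then have ij: "i < h" "j < h" by (simp_all add: S_semi_def)
    define m where "m = (i + 1) * (j + 1)"
    have "(int i + 1) * (int j + 1) = int m" by (simp add: m_def algebra_simps)
    moreover have "(int i + 1) * - (int j + 1) = - int m" by (simp add: m_def algebra_simps)
    ultimately have "wm.sig s_mat $$ (i, j) = 1 / rl * qp (- int m) - 1 / rl * qp (- (- int m))"
      using ij by (simp only: wm.sig_def A_s index_mat split_conv)
    also have "\<dots> = - (br 1 / rl) * qint q m"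
    proof -
      have "- (br 1 / rl) * (br (int m) / br 1) = - (br (int m) / rl)" using br_1_nonzero by simp
      then show ?thesis unfolding qint_br by (simp add: br_def[of "int m"] diff_divide_distrib)
    qed
    finally show "wm.sig s_mat $$ (i, j) = (- (br 1 / rl) \<cdot>\<^sub>m S_semi h q) $$ (i, j)"
      using ij by (simp add: S_semi_def m_def)
  qed (simp_all add: wm.sig_def S_semi_def)
  have sig_t: "wm.sig t_mat = \<kappa> \<cdot>\<^sub>m T_semi h p"
  proof (rule eq_matI)
    fix i j assume "i < dim_row (\<kappa> \<cdot>\<^sub>m T_semi h p)" "j < dim_col (\<kappa> \<cdot>\<^sub>m T_semi h p)"
    then have ij: "i < h" "j < h" by (simp_all add: T_semi_def)
    have e: "int k + 1 = int (k + 1)" for k by simp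
    have "wm.sig t_mat $$ (i, j) = \<kappa> * hp (- 1) * hp (1 * (int (i + 1))\<^sup>2) * (if i = j then 1 else 0)"
      using ij wm.kid_nat[of "i + 1" "j + 1"] by (simp only: wm.sig_def A_t index_mat split_conv kdiag_kid e) simp
    also have "\<kappa> * hp (- 1) * hp (1 * (int (i + 1))\<^sup>2) = \<kappa> * hp ((int (i + 1))\<^sup>2 - 1)"
      by (simp only: mult.assoc mult_1 hp_add[symmetric]) (simp add: algebra_simps)
    finally have "wm.sig t_mat $$ (i, j) = (if i = j then \<kappa> * hp ((int (i + 1))\<^sup>2 - 1) else 0)" by simp
    moreover have "hp ((int (i + 1))\<^sup>2 - 1) = (- 1) ^ ((i + 1) + 1) * p ^ ((i + 1)\<^sup>2 - 1)"
      by (rule T_semi_entry[OF p, symmetric]) simp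
    moreover have "T_semi h p $$ (i, j) = (if i = j then (- 1) ^ ((i + 1) + 1) * p ^ ((i + 1)\<^sup>2 - 1) else 0)"
      using ij by (simp add: T_semi_def)
    moreover have "(\<kappa> \<cdot>\<^sub>m T_semi h p) $$ (i, j) = \<kappa> * T_semi h p $$ (i, j)"
      using ij by (simp add: T_semi_def)
    ultimately show "wm.sig t_mat $$ (i, j) = (\<kappa> \<cdot>\<^sub>m T_semi h p) $$ (i, j)" by (simp only: if_distrib[of "(*) \<kappa>"] mult_zero_right)
  qed (simp_all add: wm.sig_def T_semi_def)
  have rep: "projective_rep_on center wm.rho" "projective_rep_on P wm.rho" "projective_rep_on W wm.rho"
    unfolding center P_eq W_def by (rule wm.projective_rho; auto)+
  show ?thesis
  proof (rule exI[of _ wm.rho], intro conjI)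
    show "projective_rep_on center wm.rho" "projective_rep_on P wm.rho" by (rule rep)+
    show "\<forall>z\<in>center. wm.rho s_mat z = S_LM Rm \<Delta> S Lam z \<and> wm.rho t_mat z = T_LM Rm \<Delta> S Lam \<theta> \<kappa> z"
      using rho_s rho_t by (simp add: SL_def)
    show "P \<subseteq> center" unfolding P_eq using Ph_center by blast
    show "complex_vector.dim P = h + 1" unfolding P_eq by (rule wm.dim_even)
    show "\<exists>W. W \<subseteq> center \<and> projective_rep_on W wm.rho \<and>
      P \<inter> W = {0} \<and> {x + y | x y. x \<in> P \<and> y \<in> W} = center \<and>
      (\<exists>\<sigma>. projective_mat_rep h \<sigma> \<and>
        (\<exists>c. c \<noteq> 0 \<and> \<sigma> s_mat = c \<cdot>\<^sub>m S_semi h q) \<and>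
        (\<exists>c. c \<noteq> 0 \<and> \<sigma> t_mat = c \<cdot>\<^sub>m T_semi h p) \<and>
        std_tensor_iso W wm.rho h \<sigma>)"
    proof (intro exI[of _ W] exI[of _ wm.sig] conjI)
      show "W \<subseteq> center" unfolding W_def using Ph_center by blast
      show "projective_rep_on W wm.rho" by (rule rep)
      show "P \<inter> W = {0}" "{x + y | x y. x \<in> P \<and> y \<in> W} = center" by (rule PW sum)+
      show "projective_mat_rep h wm.sig" by (rule wm.projective_sig)
      show "\<exists>c. c \<noteq> 0 \<and> wm.sig s_mat = c \<cdot>\<^sub>m S_semi h q"
        using sig_s br_1_nonzero by (intro exI[of _ "- (br 1 / rl)"]) simp
      show "\<exists>c. c \<noteq> 0 \<and> wm.sig t_mat = c \<cdot>\<^sub>m T_semi h p" using sig_t \<kappa> by blast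
      show "std_tensor_iso W wm.rho h wm.sig" unfolding W_def by (rule wm.std_tensor_rho)
    qed
  qed
qed

end

theorem theorem6p3p1:
  fixes l h :: nat and q p \<kappa> :: complex
    and E F K \<theta> \<Lambda> :: "'a::complex_algebra_1"
    and \<Delta> :: "'a \<Rightarrow> ('a, 'a) tensor" and \<epsilon> :: "'a \<Rightarrow> complex" and S :: "'a \<Rightarrow> 'a"
    and R :: "('a, 'a) tensor"
    and V :: "nat \<Rightarrow> 'a \<Rightarrow> complex mat"
    and P :: "'a set"
  assumes "l = 2 * h + 1" and "l \<ge> 3"
    and "q ^ l = 1" and "\<And>k. 0 < k \<Longrightarrow> k < l \<Longrightarrow> q ^ k \<noteq> 1"
    and "p\<^sup>2 = q" and "p ^ l = - 1"
    and "uqsl2 l q E F K \<Delta> \<epsilon> S"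
    and "R = uqsl2_R l q E F K"
    and "\<Lambda> = uqsl2_integral l q E F K"
    and "ribbon_element R \<Delta> \<epsilon> S \<theta>"
    and "\<kappa> \<noteq> 0"
    and "\<And>r. 1 \<le> r \<Longrightarrow> r \<le> l \<Longrightarrow> uqsl2_irrep q E F K r (V r)"
    and "P = complex_vector.span ((\<lambda>r. drinfeld R (qCh_mod l K (V r))) ` {1..l}) \<inter>
      complex_vector.span ((\<lambda>r. radford \<Delta> \<Lambda> (qCh_mod l K (V r))) ` {1..l})"
  shows "\<exists>\<rho>. projective_rep_on center \<rho> \<and>
    (\<forall>z\<in>center. \<rho> s_mat z = S_LM R \<Delta> S \<Lambda> z \<and> \<rho> t_mat z = T_LM R \<Delta> S \<Lambda> \<theta> \<kappa> z) \<and>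
    P \<subseteq> center \<and> projective_rep_on P \<rho> \<and> complex_vector.dim P = h + 1 \<and>
    (\<exists>W. W \<subseteq> center \<and> projective_rep_on W \<rho> \<and>
      P \<inter> W = {0} \<and> {x + y | x y. x \<in> P \<and> y \<in> W} = center \<and>
      (\<exists>\<sigma>. projective_mat_rep h \<sigma> \<and>
        (\<exists>c. c \<noteq> 0 \<and> \<sigma> s_mat = c \<cdot>\<^sub>m S_semi h q) \<and>
        (\<exists>c. c \<noteq> 0 \<and> \<sigma> t_mat = c \<cdot>\<^sub>m T_semi h p) \<and>
        std_tensor_iso W \<rho> h \<sigma>))"
proof -
  interpret uqsl2_odd_irreps l h q E F K \<Delta> \<epsilon> S V
  proof (intro uqsl2_odd_irreps.intro uqsl2_odd.intro)
    show "odd_root l h q" using assms(1-4) by unfold_locales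
    show "uqsl2 l q E F K \<Delta> \<epsilon> S" by (rule assms(7))
    show "uqsl2_odd_irreps_axioms l q E F K V" using assms(12) by unfold_locales
  qed
  have R: "R = Rm" and L: "\<Lambda> = Lam" by (simp_all add: assms(8,9) Rm_def Lam_def)
  show ?thesis
    unfolding R L
    by (rule decomposition[OF assms(10)[unfolded R] assms(11) assms(5,6) assms(13)[unfolded R L]])
qed

end
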